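(* Let $F$ be a non-archimedean local field of odd residual characteristic and let $G=\mathrm{GL}_N$ over $F$. Then the notions of extra regular tame elliptic pair, regular tame elliptic pair, and admissible pair coincide. That is, for an elliptic maximal torus $S\subset G$, with $S(F)=K^\times$ for a field extension $K/F$ of degree $N$, and a character $\theta:S(F)=K^\times\to\mathbb C^\times$, the following are equivalent: $(S,\theta)$ is tame elliptic extra regular; $(S,\theta)$ is tame elliptic regular; $(K^\times,\theta)$ is admissible.
   Context: $O_E$ is the ring of integers of a finite extension $E/F$; $E_{0+}^\times=1+\mathfrak p_E$. For a torus $S$ over $F$, $S(F)_0$ is the Iwahori (connected Néron model) subgroup. Characters are smooth. $R(S,G)$, $N(S,G)$, $\Omega(S,G)$ denote the absolute roots, normalizer, and absolute Weyl group. The equation $S(F)=K^\times$ is a bijection between conjugacy classes of elliptic maximal tori of $\mathrm{GL}_N$ and isomorphism classes of (separable) degree-$N$ extensions $K/F$. **Tame elliptic (extra) regular pair.** $(S,\theta)$ is tame elliptic regular (resp. extra regular) if (1) $S$ is elliptic and splits over a tamely ramified extension; (2) the action of inertia on $R_{0+}=\{\alpha\in R(S,G):\theta(N_{E/F}(\alpha^\vee(E_{0+}^\times)))=1\}$ preserves a positive system, where $E/F$ is any tame Galois extension splitting $S$; (3) $\theta|_{S(F)_0}$ has trivial stabilizer in $N(S,G^0)(F)/S(F)$ (resp. in $\Omega(S,G^0)(F)$), where $G^0\subset G$ is the reductive subgroup with maximal torus $S$ and root system $R_{0+}$. **Admissible pair** (Howe). $(K^\times,\theta)$, with $K/F$ a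 tamely ramified extension of degree $N$ and $\theta:K^\times\to\mathbb C^\times$ a character, is admissible if for every intermediate field $F\subset L\subset K$: (i) if $\theta=\theta_L\circ N_{K/L}$ for some character $\theta_L$ of $L^\times$, then $L=K$; (ii) if $\theta|_{K_{0+}^\times}=\theta_L\circ N_{K/L}|_{K^\times_{0+}}$ for some character $\theta_L$ of $L^\times_{0+}$, then $K/L$ is unramified. *)

theory Defs
  imports
    "HOL-Analysis.Analysis"
    "HOL-Algebra.Generated_Groups"
    "HOL-Algebra.Algebraic_Closure_Type"
begin

section \<open>Non-archimedean local fields\<close>

text \<open>
  The base field \<open>F\<close> is the whole type \<open>'f\<close>; it carries a normalised discrete valuation \<open>v\<close>,
  of which only the values at nonzero elements matter.
\<close>

definition val_ge :: "('f::field \<Rightarrow> int) \<Rightarrow> int \<Rightarrow> 'f set" where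
  "val_ge v c = {x. x = 0 \<or> v x \<ge> c}"

definition nonarch_local_field :: "('f::field \<Rightarrow> int) \<Rightarrow> bool" where
  "nonarch_local_field v \<longleftrightarrow>
     (\<forall>x y. x \<noteq> 0 \<longrightarrow> y \<noteq> 0 \<longrightarrow> v (x * y) = v x + v y) \<and>
     (\<forall>x y. x \<noteq> 0 \<longrightarrow> y \<noteq> 0 \<longrightarrow> x + y \<noteq> 0 \<longrightarrow> min (v x) (v y) \<le> v (x + y)) \<and>
     (\<exists>\<pi>. \<pi> \<noteq> 0 \<and> v \<pi> = 1) \<and>
     (\<forall>x :: nat \<Rightarrow> 'f.
        (\<forall>c. \<exists>M. \<forall>m\<ge>M. \<forall>n\<ge>M. x m - x n \<in> val_ge v c) \<longrightarrow>
        (\<exists>l. \<forall>c. \<exists>M. \<forall>n\<ge>M. x n - l \<in> val_ge v c)) \<and>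
     finite (val_ge v 0 // {(x, y). x \<in> val_ge v 0 \<and> y \<in> val_ge v 0 \<and> x - y \<in> val_ge v 1})"

definition residue_char :: "('f::field \<Rightarrow> int) \<Rightarrow> nat" where
  "residue_char v = (LEAST p. 0 < p \<and> of_nat p \<in> val_ge v 1)"


section \<open>Extensions inside the algebraic closure\<close>

abbreviation base_field :: "'f::field alg_closure set" where
  "base_field \<equiv> range to_ac"

definition intermediate_field :: "'f::field alg_closure set \<Rightarrow> bool" where
  "intermediate_field L \<longleftrightarrow> base_field \<subseteq> L \<and>
     (\<forall>x\<in>L. \<forall>y\<in>L. x - y \<in> L \<and> x * y \<in> L) \<and> (\<forall>x\<in>L. inverse x \<in> L)"

definition finite_extension :: "'f::field alg_closure set \<Rightarrow> bool" where
  "finite_extension K \<longleftrightarrow> intermediate_field K \<and>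
     (\<exists>B. finite B \<and> K = module.span (\<lambda>c x. to_ac c * x) B)"

definition ext_degree :: "'f::field alg_closure set \<Rightarrow> nat" where
  "ext_degree K = vector_space.dim (\<lambda>c x. to_ac c * x) K"

definition field_auts :: "'f::field alg_closure set \<Rightarrow> ('f alg_closure \<Rightarrow> 'f alg_closure) set" where
  "field_auts L = {\<sigma>. bij \<sigma> \<and> (\<forall>x y. \<sigma> (x + y) = \<sigma> x + \<sigma> y \<and> \<sigma> (x * y) = \<sigma> x * \<sigma> y) \<and>
                      (\<forall>x\<in>L. \<sigma> x = x)}"

text \<open>Restriction to the separable closure identifies this with the absolute Galois group of \<open>F\<close>.\<close>

abbreviation abs_galois :: "('f::field alg_closure \<Rightarrow> 'f alg_closure) set" where
  "abs_galois \<equiv> field_auts base_field"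

definition restrictions :: "('f::field alg_closure \<Rightarrow> 'f alg_closure) set \<Rightarrow> 'f alg_closure set \<Rightarrow>
    ('f alg_closure \<Rightarrow> 'f alg_closure) set" where
  "restrictions H K = (\<lambda>\<sigma>. restrict \<sigma> K) ` H"

definition separable_element :: "'f::field alg_closure \<Rightarrow> bool" where
  "separable_element x \<longleftrightarrow> (\<exists>p. coprime p (pderiv p) \<and> poly (map_poly to_ac p) x = 0)"

definition galois_extension :: "'f::field alg_closure set \<Rightarrow> bool" where
  "galois_extension E \<longleftrightarrow> finite_extension E \<and> (\<forall>x\<in>E. separable_element x) \<and>
     (\<forall>\<sigma>\<in>abs_galois. \<sigma> ` E = E)"

text \<open>
  \<open>restrictions (field_auts L) K\<close> is the set of all \<open>L\<close>-embeddings of \<open>K\<close> into the algebraic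
  closure, so this is the usual field norm whenever \<open>K\<close> is separable over \<open>L\<close>. It is only used
  for \<open>K\<close> tamely ramified over \<open>F\<close>, hence separable.
\<close>

definition field_norm :: "'f::field alg_closure set \<Rightarrow> 'f alg_closure set \<Rightarrow>
    'f alg_closure \<Rightarrow> 'f alg_closure" where
  "field_norm L K x = (\<Prod>\<tau>\<in>restrictions (field_auts L) K. \<tau> x)"


section \<open>Rings of integers and ramification\<close>

text \<open>
  \<open>integers v\<close> is the integral closure of \<open>O_F\<close> in the algebraic closure; for an intermediate
  field \<open>E\<close>, \<open>O_E\<close> is its intersection with \<open>E\<close>, and likewise for \<open>O_E\<^sup>\<times>\<close> and \<open>\<pp>_E\<close>.
\<close>

definition integers :: "('f::field \<Rightarrow> int) \<Rightarrow> 'f alg_closure set" where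
  "integers v = {x. \<exists>p. Polynomial.lead_coeff p = 1 \<and> (\<forall>i. Polynomial.coeff p i \<in> val_ge v 0) \<and>
                        poly (map_poly to_ac p) x = 0}"

definition unit_integers :: "('f::field \<Rightarrow> int) \<Rightarrow> 'f alg_closure set" where
  "unit_integers v = {x \<in> integers v. x \<noteq> 0 \<and> inverse x \<in> integers v}"

definition max_ideal :: "('f::field \<Rightarrow> int) \<Rightarrow> 'f alg_closure set" where
  "max_ideal v = integers v - unit_integers v"

definition principal_units :: "('f::field \<Rightarrow> int) \<Rightarrow> 'f alg_closure set \<Rightarrow> 'f alg_closure set" where
  "principal_units v E = {x \<in> E. x - 1 \<in> max_ideal v}"

definition inertia :: "('f::field \<Rightarrow> int) \<Rightarrow> ('f alg_closure \<Rightarrow> 'f alg_closure) set" where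
  "inertia v = {\<sigma>\<in>abs_galois. \<forall>x\<in>integers v. \<sigma> x - x \<in> max_ideal v}"

text \<open>
  The ramification index of \<open>K\<close> over \<open>L\<close> as the index of the value groups
  \<open>L\<^sup>\<times> / O_L\<^sup>\<times> \<subseteq> K\<^sup>\<times> / O_K\<^sup>\<times>\<close>, i.e. the number of cosets of \<open>L\<^sup>\<times> O_K\<^sup>\<times>\<close> in \<open>K\<^sup>\<times>\<close>.
\<close>

definition ramification_index :: "('f::field \<Rightarrow> int) \<Rightarrow> 'f alg_closure set \<Rightarrow> 'f alg_closure set \<Rightarrow> nat"
  where
  "ramification_index v L K =
     card ((\<lambda>x. {x * y * u |y u. y \<in> L - {0} \<and> u \<in> K \<inter> unit_integers v}) ` (K - {0}))"

text \<open>Residue fields are finite, so there is no separability condition on residue extensions.\<close>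

definition unramified :: "('f::field \<Rightarrow> int) \<Rightarrow> 'f alg_closure set \<Rightarrow> 'f alg_closure set \<Rightarrow> bool" where
  "unramified v L K \<longleftrightarrow> ramification_index v L K = 1"

definition tamely_ramified :: "('f::field \<Rightarrow> int) \<Rightarrow> 'f alg_closure set \<Rightarrow> bool" where
  "tamely_ramified v K \<longleftrightarrow> finite_extension K \<and>
     coprime (residue_char v) (ramification_index v base_field K)"


section \<open>Smooth characters and admissible pairs\<close>

text \<open>
  For \<open>A \<subseteq> K\<^sup>\<times>\<close> the sets \<open>A \<inter> (1 + c O_K)\<close>, with \<open>c\<close> running over \<open>F\<^sup>\<times>\<close>, form a basis of
  neighbourhoods of \<open>1\<close> in \<open>A\<close>.
\<close>

definition smooth_character :: "('f::field \<Rightarrow> int) \<Rightarrow> 'f alg_closure set \<Rightarrow>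
    ('f alg_closure \<Rightarrow> complex) \<Rightarrow> bool" where
  "smooth_character v A \<eta> \<longleftrightarrow>
     (\<forall>x\<in>A. \<eta> x \<noteq> 0) \<and> (\<forall>x\<in>A. \<forall>y\<in>A. \<eta> (x * y) = \<eta> x * \<eta> y) \<and>
     (\<exists>c. c \<noteq> 0 \<and> (\<forall>x\<in>A. (x - 1) / to_ac c \<in> integers v \<longrightarrow> \<eta> x = 1))"

definition admissible_pair :: "('f::field \<Rightarrow> int) \<Rightarrow> nat \<Rightarrow> 'f alg_closure set \<Rightarrow>
    ('f alg_closure \<Rightarrow> complex) \<Rightarrow> bool" where
  "admissible_pair v N K \<theta> \<longleftrightarrow>
     tamely_ramified v K \<and> ext_degree K = N \<and> smooth_character v (K - {0}) \<theta> \<and>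
     (\<forall>L. intermediate_field L \<longrightarrow> L \<subseteq> K \<longrightarrow>
        ((\<exists>\<theta>L. smooth_character v (L - {0}) \<theta>L \<and>
            (\<forall>x\<in>K - {0}. \<theta> x = \<theta>L (field_norm L K x))) \<longrightarrow> L = K) \<and>
        ((\<exists>\<theta>L. smooth_character v (principal_units v L) \<theta>L \<and>
            (\<forall>x\<in>principal_units v K. \<theta> x = \<theta>L (field_norm L K x))) \<longrightarrow> unramified v L K))"


section \<open>Maximal tori of the general linear group\<close>

text \<open>
  \<open>GL_N\<close> and its subgroups over \<open>F\<close> are given by their groups of points over the algebraic
  closure, with the Galois action on matrix entries; \<open>N = CARD('n)\<close>.
\<close>

definition GL :: "('a::field ^'n ^'n) monoid" where
  "GL = \<lparr>carrier = {A. invertible A}, mult = (**), one = mat 1\<rparr>"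

definition rational_points :: "'f::field alg_closure set \<Rightarrow> ('f alg_closure ^'n ^'n) set \<Rightarrow>
    ('f alg_closure ^'n ^'n) set" where
  "rational_points E S = {s\<in>S. \<forall>i j. s $ i $ j \<in> E}"

text \<open>
  Tori split over the separable closure, so the maximal tori of \<open>GL_N\<close> over \<open>F\<close> are the
  Galois-stable conjugates of the diagonal torus by elements of \<open>GL_N\<close> with entries in the
  separable closure.
\<close>

definition maximal_torus :: "('f::field alg_closure ^'n ^'n) set \<Rightarrow> bool" where
  "maximal_torus S \<longleftrightarrow>
     (\<exists>g :: 'f alg_closure ^'n ^'n. invertible g \<and> (\<forall>i j. separable_element (g $ i $ j)) \<and>
          S = {g ** d ** matrix_inv g |d. invertible d \<and> (\<forall>i j. i \<noteq> j \<longrightarrow> d $ i $ j = 0)}) \<and>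
     (\<forall>\<sigma>\<in>abs_galois. map_matrix \<sigma> ` S = S)"

inductive_set regular_functions :: "('a::field ^'n ^'n \<Rightarrow> 'a) set" where
  const: "(\<lambda>_. c) \<in> regular_functions"
| entry: "(\<lambda>A. A $ i $ j) \<in> regular_functions"
| inv_det: "(\<lambda>A. inverse (det A)) \<in> regular_functions"
| add: "f \<in> regular_functions \<Longrightarrow> h \<in> regular_functions \<Longrightarrow> (\<lambda>A. f A + h A) \<in> regular_functions"
| mult: "f \<in> regular_functions \<Longrightarrow> h \<in> regular_functions \<Longrightarrow> (\<lambda>A. f A * h A) \<in> regular_functions"

text \<open>The groups \<open>X\<^sup>*(S)\<close> and \<open>X\<^sub>*(S)\<close>; as elements of \<open>\<rightarrow>\<^sub>E\<close> they are equal iff they agree pointwise.\<close>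

definition characters :: "('a::field ^'n ^'n) set \<Rightarrow> ('a ^'n ^'n \<Rightarrow> 'a) set" where
  "characters S = {\<eta> \<in> S \<rightarrow>\<^sub>E (UNIV - {0}).
     (\<forall>s\<in>S. \<forall>t\<in>S. \<eta> (s ** t) = \<eta> s * \<eta> t) \<and> (\<exists>f\<in>regular_functions. \<forall>s\<in>S. \<eta> s = f s)}"

definition cocharacters :: "('a::field ^'n ^'n) set \<Rightarrow> ('a \<Rightarrow> 'a ^'n ^'n) set" where
  "cocharacters S = {\<mu> \<in> (UNIV - {0}) \<rightarrow>\<^sub>E S.
     (\<forall>x y. x \<noteq> 0 \<longrightarrow> y \<noteq> 0 \<longrightarrow> \<mu> (x * y) = \<mu> x ** \<mu> y) \<and>
     (\<forall>i j. \<exists>p m. \<forall>x. x \<noteq> 0 \<longrightarrow> x ^ m * \<mu> x $ i $ j = poly p x)}"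

definition char_mult :: "('a::field ^'n ^'n) set \<Rightarrow> ('a ^'n ^'n \<Rightarrow> 'a) \<Rightarrow> ('a ^'n ^'n \<Rightarrow> 'a) \<Rightarrow>
    ('a ^'n ^'n \<Rightarrow> 'a)" where
  "char_mult S \<eta> \<psi> = restrict (\<lambda>s. \<eta> s * \<psi> s) S"

definition trivial_char :: "('a::field ^'n ^'n) set \<Rightarrow> ('a ^'n ^'n \<Rightarrow> 'a)" where
  "trivial_char S = restrict (\<lambda>_. 1) S"

definition galois_act :: "('f::field alg_closure ^'n ^'n) set \<Rightarrow> ('f alg_closure \<Rightarrow> 'f alg_closure) \<Rightarrow>
    ('f alg_closure ^'n ^'n \<Rightarrow> 'f alg_closure) \<Rightarrow> ('f alg_closure ^'n ^'n \<Rightarrow> 'f alg_closure)" where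
  "galois_act S \<sigma> \<eta> = restrict (\<lambda>s. \<sigma> (\<eta> (map_matrix (inv_into UNIV \<sigma>) s))) S"

definition splits_over :: "('f::field alg_closure ^'n ^'n) set \<Rightarrow> 'f alg_closure set \<Rightarrow> bool" where
  "splits_over S E \<longleftrightarrow> (\<forall>\<eta>\<in>characters S. \<forall>\<sigma>\<in>field_auts E. galois_act S \<sigma> \<eta> = \<eta>)"

text \<open>Anisotropic modulo the centre: \<open>S\<close> modulo scalars has no nontrivial character over \<open>F\<close>.\<close>

definition elliptic :: "('f::field alg_closure ^'n ^'n) set \<Rightarrow> bool" where
  "elliptic S \<longleftrightarrow>
     (\<forall>\<eta>\<in>characters S. (\<forall>\<sigma>\<in>abs_galois. galois_act S \<sigma> \<eta> = \<eta>) \<longrightarrow>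
        (\<forall>c. c \<noteq> 0 \<longrightarrow> \<eta> (mat c) = 1) \<longrightarrow> \<eta> = trivial_char S)"


section \<open>Roots and coroots\<close>

definition root_space :: "('a::field ^'n ^'n) set \<Rightarrow> ('a ^'n ^'n \<Rightarrow> 'a) \<Rightarrow> ('a ^'n ^'n) set" where
  "root_space S \<alpha> = {Y. \<forall>s\<in>S. s ** Y ** matrix_inv s = mat (\<alpha> s) ** Y}"

definition roots :: "('a::field ^'n ^'n) set \<Rightarrow> ('a ^'n ^'n \<Rightarrow> 'a) set" where
  "roots S = {\<alpha>\<in>characters S. \<alpha> \<noteq> trivial_char S \<and> root_space S \<alpha> \<noteq> {0}}"

text \<open>Elements of a root space of \<open>\<gg>\<ll>_N\<close> square to zero, so \<open>1 + Y\<close> is the exponential of \<open>Y\<close>.\<close>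

definition root_group :: "('a::field ^'n ^'n) set \<Rightarrow> ('a ^'n ^'n \<Rightarrow> 'a) \<Rightarrow> ('a ^'n ^'n) set" where
  "root_group S \<alpha> = {mat 1 + Y |Y. Y \<in> root_space S \<alpha>}"

text \<open>
  \<open>\<alpha>\<^sup>\<or>\<close> is the cocharacter with \<open>\<langle>\<alpha>, \<alpha>\<^sup>\<or>\<rangle> = 2\<close> whose image lies in the semisimple group of rank
  one generated by the root groups of \<open>\<alpha>\<close> and \<open>-\<alpha>\<close>.
\<close>

definition coroot :: "('a::field ^'n ^'n) set \<Rightarrow> ('a ^'n ^'n \<Rightarrow> 'a) \<Rightarrow> ('a \<Rightarrow> 'a ^'n ^'n)" where
  "coroot S \<alpha> = (THE \<mu>. \<mu> \<in> cocharacters S \<and>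
     (\<forall>x. x \<noteq> 0 \<longrightarrow> \<alpha> (\<mu> x) = x ^ 2 \<and>
        \<mu> x \<in> generate GL (root_group S \<alpha> \<union> root_group S (restrict (\<lambda>s. inverse (\<alpha> s)) S))))"

text \<open>Positive with respect to a linear functional on \<open>X\<^sup>*(S) \<otimes> \<real>\<close> that vanishes on no root.\<close>

definition positive_system :: "('a::field ^'n ^'n) set \<Rightarrow> ('a ^'n ^'n \<Rightarrow> 'a) set \<Rightarrow>
    ('a ^'n ^'n \<Rightarrow> 'a) set \<Rightarrow> bool" where
  "positive_system S R P \<longleftrightarrow>
     (\<exists>l :: ('a ^'n ^'n \<Rightarrow> 'a) \<Rightarrow> real.
        (\<forall>\<eta>\<in>characters S. \<forall>\<psi>\<in>characters S. l (char_mult S \<eta> \<psi>) = l \<eta> + l \<psi>) \<and>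
        (\<forall>\<alpha>\<in>R. l \<alpha> \<noteq> 0) \<and> P = {\<alpha>\<in>R. l \<alpha> > 0})"


section \<open>Tame elliptic regular pairs\<close>

definition smooth_torus_character :: "('f::field \<Rightarrow> int) \<Rightarrow> ('f alg_closure ^'n ^'n) set \<Rightarrow>
    ('f alg_closure ^'n ^'n \<Rightarrow> complex) \<Rightarrow> bool" where
  "smooth_torus_character v S \<theta> \<longleftrightarrow>
     (\<forall>s\<in>rational_points base_field S. \<theta> s \<noteq> 0) \<and>
     (\<forall>s\<in>rational_points base_field S. \<forall>t\<in>rational_points base_field S. \<theta> (s ** t) = \<theta> s * \<theta> t) \<and>
     (\<exists>c. c \<noteq> 0 \<and> (\<forall>s\<in>rational_points base_field S.
        (\<forall>i j. (s - mat 1) $ i $ j / to_ac c \<in> integers v) \<longrightarrow> \<theta> s = 1))"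

text \<open>
  The product of the conjugates of \<open>s \<in> S(E)\<close> under a set \<open>H\<close> of automorphisms of \<open>E\<close>; for
  \<open>H = restrictions abs_galois E = Gal(E/F)\<close> this is the norm map from \<open>S(E)\<close> to \<open>S(F)\<close>.
\<close>

definition torus_norm :: "('f::field alg_closure ^'n ^'n) set \<Rightarrow>
    ('f alg_closure \<Rightarrow> 'f alg_closure) set \<Rightarrow> 'f alg_closure ^'n ^'n \<Rightarrow> 'f alg_closure ^'n ^'n" where
  "torus_norm S H s = finprod (GL\<lparr>carrier := S\<rparr>) (\<lambda>\<tau>. map_matrix \<tau> s) H"

text \<open>
  The Iwahori subgroup of \<open>S(F)\<close> (the integral points of the connected Neron model) is the
  kernel of the Kottwitz homomorphism \<open>\<kappa>\<close>. Let \<open>L\<close> be the maximal unramified extension of \<open>F\<close>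
  and \<open>L' = E L\<close> with \<open>E\<close> Galois over \<open>F\<close> and splitting \<open>S\<close>. The norm from \<open>S(L')\<close> to \<open>S(L)\<close> is
  surjective, and \<open>\<kappa>\<close> sends the norm of \<open>y\<close> to the class of \<open>ord y\<close> in the coinvariants of
  \<open>X\<^sub>*(S)\<close> under \<open>Gal(L'/L)\<close>. Elements of the form \<open>\<sigma>(z) / z\<close> have trivial norm, so the kernel of
  \<open>\<kappa>\<close> on \<open>S(L)\<close> consists of the norms of those \<open>y\<close> with \<open>ord y = 0\<close>, that is, with \<open>\<eta>(y)\<close> a unit
  for all \<open>\<eta>\<close>. Each such \<open>y\<close> has entries in some finite \<open>E\<close> as above, and \<open>Gal(L'/L)\<close> maps
  isomorphically to the inertia subgroup of \<open>Gal(E/F)\<close>.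
\<close>

definition iwahori :: "('f::field \<Rightarrow> int) \<Rightarrow> ('f alg_closure ^'n ^'n) set \<Rightarrow>
    ('f alg_closure ^'n ^'n) set" where
  "iwahori v S = {s \<in> rational_points base_field S.
     \<exists>E. galois_extension E \<and> splits_over S E \<and>
       (\<exists>y\<in>rational_points E S. (\<forall>\<eta>\<in>characters S. \<eta> y \<in> unit_integers v) \<and>
          s = torus_norm S (restrictions (inertia v) E) y)}"

definition R0plus :: "('f::field \<Rightarrow> int) \<Rightarrow> ('f alg_closure ^'n ^'n) set \<Rightarrow>
    ('f alg_closure ^'n ^'n \<Rightarrow> complex) \<Rightarrow> 'f alg_closure set \<Rightarrow>
    ('f alg_closure ^'n ^'n \<Rightarrow> 'f alg_closure) set" where
  "R0plus v S \<theta> E = {\<alpha>\<in>roots S. \<forall>x\<in>principal_units v E.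
     \<theta> (torus_norm S (restrictions abs_galois E) (coroot S \<alpha> x)) = 1}"

definition subgroup_of_roots :: "('a::field ^'n ^'n) set \<Rightarrow> ('a ^'n ^'n \<Rightarrow> 'a) set \<Rightarrow>
    ('a ^'n ^'n) set" where
  "subgroup_of_roots S R = generate GL (S \<union> (\<Union>\<alpha>\<in>R. root_group S \<alpha>))"

definition normalizer_in :: "('a::field ^'n ^'n) set \<Rightarrow> ('a ^'n ^'n) set \<Rightarrow> ('a ^'n ^'n) set" where
  "normalizer_in S H = {g\<in>H. (\<lambda>s. g ** s ** matrix_inv g) ` S = S}"

definition inertia_preserves_positive_system :: "('f::field \<Rightarrow> int) \<Rightarrow>
    ('f alg_closure ^'n ^'n) set \<Rightarrow> ('f alg_closure ^'n ^'n \<Rightarrow> 'f alg_closure) set \<Rightarrow> bool" where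
  "inertia_preserves_positive_system v S R \<longleftrightarrow>
     (\<exists>P. positive_system S R P \<and> (\<forall>\<sigma>\<in>inertia v. galois_act S \<sigma> ` P = P))"

definition fixes_on_iwahori :: "('f::field \<Rightarrow> int) \<Rightarrow> ('f alg_closure ^'n ^'n) set \<Rightarrow>
    ('f alg_closure ^'n ^'n \<Rightarrow> complex) \<Rightarrow> 'f alg_closure ^'n ^'n \<Rightarrow> bool" where
  "fixes_on_iwahori v S \<theta> n \<longleftrightarrow> (\<forall>s\<in>iwahori v S. \<theta> (n ** s ** matrix_inv n) = \<theta> s)"

definition trivial_rational_stabilizer :: "('f::field \<Rightarrow> int) \<Rightarrow> ('f alg_closure ^'n ^'n) set \<Rightarrow>
    ('f alg_closure ^'n ^'n \<Rightarrow> complex) \<Rightarrow> ('f alg_closure ^'n ^'n) set \<Rightarrow> bool" where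
  "trivial_rational_stabilizer v S \<theta> G0 \<longleftrightarrow>
     (\<forall>n\<in>rational_points base_field (normalizer_in S G0). fixes_on_iwahori v S \<theta> n \<longrightarrow> n \<in> S)"

text \<open>
  The \<open>F\<close>-points of the Weyl group are the Galois-fixed cosets \<open>n S\<close>, which need not contain a
  matrix with entries in \<open>F\<close>.
\<close>

definition trivial_weyl_stabilizer :: "('f::field \<Rightarrow> int) \<Rightarrow> ('f alg_closure ^'n ^'n) set \<Rightarrow>
    ('f alg_closure ^'n ^'n \<Rightarrow> complex) \<Rightarrow> ('f alg_closure ^'n ^'n) set \<Rightarrow> bool" where
  "trivial_weyl_stabilizer v S \<theta> G0 \<longleftrightarrow>
     (\<forall>n\<in>normalizer_in S G0. (\<forall>\<sigma>\<in>abs_galois. matrix_inv n ** map_matrix \<sigma> n \<in> S) \<longrightarrow>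
        fixes_on_iwahori v S \<theta> n \<longrightarrow> n \<in> S)"

text \<open>
  \<open>R0plus v S \<theta> E\<close> does not depend on \<open>E\<close> among the tame Galois extensions splitting \<open>S\<close>, and one
  exists as soon as \<open>S\<close> splits over some tame extension (the Galois closure of which is tame).
\<close>

definition tame_elliptic_regular :: "('f::field \<Rightarrow> int) \<Rightarrow> ('f alg_closure ^'n ^'n) set \<Rightarrow>
    ('f alg_closure ^'n ^'n \<Rightarrow> complex) \<Rightarrow> bool" where
  "tame_elliptic_regular v S \<theta> \<longleftrightarrow>
     maximal_torus S \<and> smooth_torus_character v S \<theta> \<and>
     elliptic S \<and> (\<exists>E. tamely_ramified v E \<and> splits_over S E) \<and>
     (\<forall>E. tamely_ramified v E \<longrightarrow> galois_extension E \<longrightarrow> splits_over S E \<longrightarrow>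
        inertia_preserves_positive_system v S (R0plus v S \<theta> E) \<and>
        trivial_rational_stabilizer v S \<theta> (subgroup_of_roots S (R0plus v S \<theta> E)))"

definition tame_elliptic_extra_regular :: "('f::field \<Rightarrow> int) \<Rightarrow> ('f alg_closure ^'n ^'n) set \<Rightarrow>
    ('f alg_closure ^'n ^'n \<Rightarrow> complex) \<Rightarrow> bool" where
  "tame_elliptic_extra_regular v S \<theta> \<longleftrightarrow>
     maximal_torus S \<and> smooth_torus_character v S \<theta> \<and>
     elliptic S \<and> (\<exists>E. tamely_ramified v E \<and> splits_over S E) \<and>
     (\<forall>E. tamely_ramified v E \<longrightarrow> galois_extension E \<longrightarrow> splits_over S E \<longrightarrow>
        inertia_preserves_positive_system v S (R0plus v S \<theta> E) \<and>
        trivial_weyl_stabilizer v S \<theta> (subgroup_of_roots S (R0plus v S \<theta> E)))"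


section \<open>The identification of a torus with the multiplicative group of a field\<close>

text \<open>
  \<open>\<iota>\<close> is an \<open>F\<close>-algebra embedding of \<open>K\<close> into the \<open>N \<times> N\<close> matrices over \<open>F\<close> mapping \<open>K\<^sup>\<times>\<close> onto
  \<open>S(F)\<close>.
\<close>

definition identifies :: "('f::field alg_closure \<Rightarrow> 'f alg_closure ^'n ^'n) \<Rightarrow> 'f alg_closure set \<Rightarrow>
    ('f alg_closure ^'n ^'n) set \<Rightarrow> bool" where
  "identifies \<iota> K S \<longleftrightarrow>
     (\<forall>x\<in>K. \<forall>y\<in>K. \<iota> (x + y) = \<iota> x + \<iota> y \<and> \<iota> (x * y) = \<iota> x ** \<iota> y) \<and>
     (\<forall>c. \<iota> (to_ac c) = mat (to_ac c)) \<and>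
     \<iota> ` (K - {0}) = rational_points base_field S"

end

theory Submission
 imports Defs "HOL-Library.Function_Algebras" "HOL-Algebra.Sylow" "HOL-Combinatorics.Transposition"
  "HOL-Number_Theory.Number_Theory"
begin

text \<open>
  The torus is diagonalized by a frame whose columns are permuted by the Galois group; its coordinates \<open>c\<^sub>k\<close>
  correspond to the embeddings of \<open>K\<close>, and the roots are the quotients \<open>c\<^sub>k / c\<^sub>l\<close>. Such a root lies in \<open>R\<^sub>0\<^sub>+\<close> iff two
  conjugates of \<open>\<theta> \<circ> N\<^bsub>E/K\<^esub>\<close> agree on \<open>1 + \<pp>\<^sub>E\<close>. Hence \<open>R\<^sub>0\<^sub>+\<close> comes from an equivalence relation on the coordinates; the
  class of the identity embedding is its orbit under a subgroup \<open>H \<supseteq> Gal(E/K)\<close>, with fixed field \<open>L\<close>. Inertia preserves a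
  positive system iff it meets \<open>H\<close> only in \<open>Gal(E/K)\<close>, that is, iff \<open>K/L\<close> is unramified. In tame extensions a character
  of \<open>1 + \<pp>\<^sub>K\<close> with \<open>H\<close>-invariant norm pullback factors through the norm to \<open>L\<close>; this gives condition (ii) of
  admissibility. A rational Weyl element of \<open>G\<^sup>0\<close> is an automorphism \<open>\<phi>\<close> of \<open>K\<close> over \<open>L\<close>, and \<open>\<theta>\<close> is \<open>\<phi>\<close>-invariant on units iff
  it factors through the norm to \<open>K\<^sup>\<phi>\<close>, by Hilbert 90 for the unramified cyclic extension \<open>K/K\<^sup>\<phi>\<close>; this gives condition (i).
\<close>

text \<open>Every character here is smooth, hence trivial on a ball of some radius
  \<open>m < 1\<close>. Surjectivity of the norm on principal units, the description of its kernel,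
  Hilbert 90 and the comparison of the Iwahori subgroup with the units are therefore proved only up
  to an error of size \<open>m\<close>, without passing to limits in the extension fields. Tameness
  enters in two ways. Some integral element has trace 1, so the first-order term of a norm can be
  prescribed; this rests on roots of unity of order prime to the residue characteristic, which
  represent the residues and whose conjugations stay independent modulo the maximal ideal. And an
  automorphism that multiplies each nonzero element of a tame field by a factor congruent to 1 is
  trivial on that field, so that congruences become equalities. The two regularity conditions agree
  because ellipticity makes Galois transitive on the coordinates. The columns of the frame can then
  be scaled so that Galois permutes them exactly, and a Galois-equivariant permutation of the
  coordinates is given by a matrix over F.\<close>

hide_const (open) Polynomials.degree Polynomials.lead_coeff up_ring.coeff up_ring.monom module.smult

section \<open>Automorphisms of the algebraic closure\<close>

interpretation ac: vector_space "%(c::'f::field) x. to_ac c * x"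
 by unfold_locales (auto simp: algebra_simps)

abbreviation ac_poly :: "'f::field poly => 'f alg_closure poly" where
 "ac_poly \<equiv> map_poly to_ac"

lemma ac_poly_add: "ac_poly (p + q) = ac_poly p + ac_poly q"
 by (rule poly_eqI) (simp add: coeff_map_poly)

lemma ac_poly_mult: "ac_poly (p * q) = ac_poly p * ac_poly q"
 by (rule poly_eqI) (simp add: coeff_map_poly coeff_mult to_ac_sum)

lemma ac_poly_pderiv: "ac_poly (pderiv p) = pderiv (ac_poly p)"
 by (rule poly_eqI) (simp add: coeff_map_poly coeff_pderiv)

lemma degree_ac_poly [simp]: "degree (ac_poly p) = degree p"
 by (rule degree_map_poly) simp

lemma ac_poly_eq_0 [simp]: "ac_poly p = 0 \<longleftrightarrow> p = 0"
 by (metis coeff_map_poly to_ac_0 to_ac_eq_0_iff poly_eqI coeff_0)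

lemma ac_poly_1 [simp]: "ac_poly 1 = 1"
 by (simp add: map_poly_1')

lemma ifieldD:
 assumes "intermediate_field L"
 shows "to_ac c : L" "0 : L" "1 : L" "x : L ==> y : L ==> x - y : L" "x : L ==> y : L ==> x * y : L"
  "x : L ==> inverse x : L" "x : L ==> - x : L" "x : L ==> y : L ==> x + y : L"
  "x : L ==> y : L ==> x / y : L" "x : L ==> x ^ n : L"
proof -
 have *: "base_field <= L" "!!x y. x : L ==> y : L ==> x - y : L" "!!x y. x : L ==> y : L ==> x * y : L"
  "!!x. x : L ==> inverse x : L"
  using assms by (auto simp: intermediate_field_def)
 show c: "to_ac c : L" for c using *(1) by auto
 show 0: "0 : L" and 1: "1 : L" using c[of 0] c[of 1] by auto
 show m: "x : L ==> - x : L" for x using *(2)[OF 0] by fastforce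
 show "x : L ==> y : L ==> x + y : L" using *(2)[of x "- y"] m by simp
 show "x : L ==> y : L ==> x / y : L" using *(3,4) by (simp add: divide_inverse)
 show "x : L ==> x ^ n : L" by (induction n) (auto intro: *(3) 1)
qed (use assms in \<open>auto simp: intermediate_field_def\<close>)

lemma ifield_sum:
 "intermediate_field L ==> (!!i. i : A ==> f i : L) ==> sum f A : L"
 by (induction A rule: infinite_finite_induct) (auto intro: ifieldD)

lemma ifield_prod:
 "intermediate_field L ==> (!!i. i : A ==> f i : L) ==> prod f A : L"
 by (induction A rule: infinite_finite_induct) (auto intro: ifieldD)

text \<open>A nonzero polynomial of least degree vanishing at \<open>z\<close> has nonzero constant
  term, since otherwise it could be divided by the variable. Solving for that term writes the
  inverse of \<open>z\<close> as a polynomial in \<open>z\<close>, which is how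
  \<open>ifieldI\<close> uses it.\<close>

lemma algebraic_nonzero_const:
 fixes z :: "'f::field alg_closure"
 assumes "z ~= 0"
 obtains a q where "a ~= 0" "to_ac a + z * poly (ac_poly q) z = 0"
proof -
 define P where "P = (%p. p ~= 0 & poly (ac_poly p) z = 0)"
 obtain p0 :: "'f poly" where "p0 ~= 0" "poly (ac_poly p0) z = 0" by (rule alg_closure_algebraic)
 then have p0: "P p0" by (simp add: P_def)
 define p where "p = arg_min degree P"
 have p: "P p" "!!q. P q ==> degree p <= degree q"
  using arg_min_nat_lemma[of P p0 degree] p0 by (auto simp: p_def)
 obtain a q where pq: "p = pCons a q" by (cases p)
 have eq: "to_ac a + z * poly (ac_poly q) z = 0" using p(1) by (simp add: P_def pq map_poly_pCons)
 have "a ~= 0"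
 proof
  assume "a = 0"
  then have "q ~= 0" "P q" using eq assms p(1) by (auto simp: P_def pq)
  then show False using p(2)[of q] by (simp add: pq)
 qed
 then show ?thesis using eq that by blast
qed

text \<open>The closure under inverses is automatic because everything is algebraic.\<close>

lemma ifieldI:
 assumes "base_field <= L" "!!x y. x : L ==> y : L ==> x - y : L" "!!x y. x : L ==> y : L ==> x * y : L"
 shows "intermediate_field L"
proof -
 have c: "to_ac c : L" for c using assms(1) by auto
 have 0: "0 : L" using c[of 0] by simp
 have m: "x : L ==> - x : L" for x using assms(2)[OF 0] by fastforce
 have add: "x : L ==> y : L ==> x + y : L" for x y using assms(2)[of x "- y"] m by simp
 have pol: "poly (ac_poly q) x : L" if "x : L" for x q
  by (induction q) (use 0 c add assms(3) in \<open>auto simp: map_poly_pCons that\<close>)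
 have "inverse x : L" if x: "x : L" for x
 proof (cases "x = 0")
  case False
  then obtain a q where "a ~= 0" "to_ac a + x * poly (ac_poly q) x = 0"
   using algebraic_nonzero_const by blast
  then have "inverse x = - (to_ac (inverse a) * poly (ac_poly q) x)"
   using False by (simp add: field_simps add_eq_0_iff)
  then show ?thesis using assms(3)[OF c[of "inverse a"] pol[OF x, of q]] m by simp
 qed (use 0 in simp)
 then show ?thesis using assms by (auto simp: intermediate_field_def)
qed

text \<open>
  Graphs of \<open>F\<close>-homomorphisms from intermediate fields to the algebraic closure: subrings of
  the product of two copies of it that contain the diagonal of \<open>F\<close>.
\<close>

definition hom_graph :: "('f::field alg_closure \<times> 'f alg_closure) set => bool" where
 "hom_graph G \<longleftrightarrow> (ALL c. (to_ac c, to_ac c) : G) &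
  (ALL a b c d. (a, b) : G --> (c, d) : G --> (a - c, b - d) : G & (a * c, b * d) : G) &
  (ALL b. (0, b) : G --> b = 0)"

context
 fixes G :: "('f::field alg_closure \<times> 'f alg_closure) set"
 assumes G: "hom_graph G"
begin

lemma hom_graphD:
 "(to_ac e, to_ac e) : G" "(0, 0) : G" "(1, 1) : G"
 "(a, b) : G ==> (c, d) : G ==> (a - c, b - d) : G"
 "(a, b) : G ==> (c, d) : G ==> (a * c, b * d) : G"
 "(0, b) : G ==> b = 0"
 "(a, b) : G ==> (c, d) : G ==> (a + c, b + d) : G"
 "(a, b) : G ==> (a, b') : G ==> b = b'"
proof -
 have *: "!!c. (to_ac c, to_ac c) : G"
  "!!a b c d. (a, b) : G ==> (c, d) : G ==> (a - c, b - d) : G"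
  "!!a b c d. (a, b) : G ==> (c, d) : G ==> (a * c, b * d) : G"
  "!!b. (0, b) : G ==> b = 0" using G unfolding hom_graph_def by metis+
 show "(0, 0) : G" "(1, 1) : G" using *(1)[of 0] *(1)[of 1] by simp_all
 show "(to_ac e, to_ac e) : G" by (fact *(1))
 show "(a, b) : G ==> (c, d) : G ==> (a - c, b - d) : G" by (fact *(2))
 show "(a, b) : G ==> (c, d) : G ==> (a * c, b * d) : G" by (fact *(3))
 show "(0, b) : G ==> b = 0" by (fact *(4))
 show "(a, b) : G ==> (c, d) : G ==> (a + c, b + d) : G"
  using *(2)[of a b "0 - c" "0 - d"] *(2)[of 0 0 c d] *(1)[of 0] by simp
 show "(a, b) : G ==> (a, b') : G ==> b = b'" using *(2)[of a b a b'] *(4)[of "b - b'"] by simp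
qed

lemma hom_graph_sum: "(!!i. i : A ==> (f i, g i) : G) ==> (sum f A, sum g A) : G"
 by (induction A rule: infinite_finite_induct) (auto intro: hom_graphD)

lemma ifield_Domain: "intermediate_field (Domain G)"
 by (rule ifieldI) (auto intro: hom_graphD)

text \<open>Inverse pairs need not be postulated in \<open>hom_graph\<close>: the domain is a field,
  so \<open>inverse a\<close> has some partner, and multiplicativity forces this partner to be
  \<open>inverse b\<close>.\<close>

lemma hom_graph_inverse:
 assumes "(a, b) : G" "a ~= 0"
 shows "b ~= 0" "(inverse a, inverse b) : G"
proof -
 obtain c where c: "(inverse a, c) : G"
  using ifieldD(6)[OF ifield_Domain, of a] assms by blast
 have "(1, b * c) : G" using hom_graphD(5)[OF assms(1) c] assms(2) by simp
 then have "b * c = 1" using hom_graphD(3,8) by blast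
 then show "b ~= 0" "(inverse a, inverse b) : G" using c by (auto dest: inverse_unique)
qed

text \<open>Says that \<open>r\<close> arises from \<open>q\<close> by applying the homomorphism
  with graph \<open>G\<close> to the coefficients; working with pairs avoids choosing that
  homomorphism as a function.\<close>

definition poly_graph :: "'f alg_closure poly => 'f alg_closure poly => bool" where
 "poly_graph q r \<longleftrightarrow> (ALL i. (coeff q i, coeff r i) : G)"

lemma poly_graph_degree:
 assumes "poly_graph q r" shows "degree r = degree q" "q = 0 \<longleftrightarrow> r = 0"
proof -
 have "coeff q i = 0 \<longleftrightarrow> coeff r i = 0" for i
  using assms hom_graph_inverse(1) hom_graphD(6) unfolding poly_graph_def by metis
 then show "degree r = degree q" "q = 0 \<longleftrightarrow> r = 0"
  by (auto simp: Polynomial.degree_def poly_eq_iff)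
qed

lemma poly_graph_mult: "poly_graph q r ==> poly_graph q' r' ==> poly_graph (q * q') (r * r')"
 unfolding poly_graph_def coeff_mult by (auto intro!: hom_graph_sum hom_graphD)

lemma poly_graph_diff: "poly_graph q r ==> poly_graph q' r' ==> poly_graph (q - q') (r - r')"
 unfolding poly_graph_def by (auto intro!: hom_graphD)

lemma poly_graph_monom: "(a, b) : G ==> poly_graph (monom a n) (monom b n)"
 unfolding poly_graph_def by (auto intro!: hom_graphD)

text \<open>Long division by \<open>m\<close> and \<open>m'\<close> carried out on \<open>q\<close>
  and \<open>r\<close> at once. One step subtracts matching multiples, keeps the root
  \<open>x\<close> and lowers the degree, and minimality of \<open>m\<close> excludes a nonzero
  \<open>q\<close> of smaller degree.\<close>

lemma poly_graph_dvd:
 assumes m: "poly_graph m m'" "m ~= 0"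
  and min: "ALL q r. poly_graph q r --> q ~= 0 --> poly q x = 0 --> degree m <= degree q"
  and mx: "poly m x = 0"
 shows "poly_graph q r ==> poly q x = 0 ==> m' dvd r"
proof (induction "degree q" arbitrary: q r rule: less_induct)
 case less
 show ?case
 proof (cases "q = 0")
  case True
  then show ?thesis using poly_graph_degree less.prems by auto
 next
  case False
  let ?k = "degree q - degree m"
  have le: "degree m <= degree q" using min less.prems False by blast
  let ?c = "lead_coeff q * inverse (lead_coeff m)"
  let ?c' = "lead_coeff r * inverse (lead_coeff m')"
  have c: "(?c, ?c') : G"
   using hom_graph_inverse(2)[of "lead_coeff m" "lead_coeff m'"] m less.prems
    poly_graph_degree unfolding poly_graph_def by (auto intro!: hom_graphD)
  define q' where "q' = q - monom ?c ?k * m"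
  define r' where "r' = r - monom ?c' ?k * m'"
  have pg: "poly_graph q' r'" unfolding q'_def r'_def
   by (intro poly_graph_diff poly_graph_mult poly_graph_monom c less.prems m)
  have qx: "poly q' x = 0" using less.prems mx by (simp add: q'_def)
  have lc: "coeff (monom ?c ?k * m) (degree q) = lead_coeff q"
   using le m(2) by (simp add: coeff_monom_mult)
  have dle: "degree (monom ?c ?k * m) <= degree q"
   using degree_mult_le[of "monom ?c ?k" m] degree_monom_le[of ?c ?k] le by linarith
  have "q' = 0 | degree q' < degree q"
  proof (rule disjCI)
   assume "~ degree q' < degree q"
   moreover have "degree q' <= degree q"
    unfolding q'_def using dle by (simp add: degree_diff_le)
   ultimately have "lead_coeff q' = 0" using lc by (simp add: q'_def)
   then show "q' = 0" by simp
  qed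
  then have "m' dvd r'"
   using less.hyps[OF _ pg qx] poly_graph_degree(2)[OF pg] by auto
  then have "m' dvd r' + monom ?c' ?k * m'" by (rule dvd_add) simp
  then show ?thesis by (simp add: r'_def)
 qed
qed

text \<open>The new homomorphism sends \<open>q(x)\<close> to \<open>r(y)\<close>. It is well
  defined because \<open>q(x) = 0\<close> gives \<open>m' dvd r\<close> by
  \<open>poly_graph_dvd\<close>, so that \<open>r\<close> vanishes at the root \<open>y\<close> of
  \<open>m'\<close>.\<close>

lemma hom_graph_adjoin:
 assumes m: "poly_graph m m'" "m ~= 0" "poly m' y = 0"
  and min: "ALL q r. poly_graph q r --> q ~= 0 --> poly q x = 0 --> degree m <= degree q"
  and mx: "poly m x = 0"
 shows "EX H. hom_graph H & G <= H & (x, y) : H"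
proof (intro exI conjI)
 let ?H = "{(poly q x, poly r y) |q r. poly_graph q r}"
 have mem: "(poly q x, poly r y) : ?H" if "poly_graph q r" for q r using that by blast
 have G': "(a, b) : ?H" if "(a, b) : G" for a b
  using mem[OF poly_graph_monom[OF that, of 0]] by (simp add: poly_monom)
 show "hom_graph ?H" unfolding hom_graph_def
 proof (intro conjI allI impI)
  fix a b c d assume "(a, b) : ?H" "(c, d) : ?H"
  then obtain q r q' r' where *: "poly_graph q r" "poly_graph q' r'" "a = poly q x" "b = poly r y"
   "c = poly q' x" "d = poly r' y" by blast
  show "(a - c, b - d) : ?H" using mem[OF poly_graph_diff[OF *(1,2)]] * by simp
  show "(a * c, b * d) : ?H" using mem[OF poly_graph_mult[OF *(1,2)]] * by simp
 next
  fix b assume "(0, b) : ?H"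
  then obtain q r where "poly_graph q r" "poly q x = 0" "b = poly r y" by force
  then show "b = 0" using poly_graph_dvd[OF m(1,2) min mx] m(3) by (metis dvdE mult_zero_left poly_mult)
 qed (intro G' hom_graphD)
 show "G <= ?H" using G' by auto
 show "(x, y) : ?H" using mem[OF poly_graph_monom[OF hom_graphD(3), of 1]] by (simp add: poly_monom)
qed

end

lemma poly_graph_minimal:
 assumes G: "hom_graph G"
 obtains m m' where "poly_graph G m m'" "m ~= 0" "poly m x = 0"
  "ALL q r. poly_graph G q r --> q ~= 0 --> poly q x = 0 --> degree m <= degree q"
proof -
 define P where "P = (%(q, r). poly_graph G q r & q ~= 0 & poly q x = 0)"
 obtain p where p: "p ~= 0" "poly (ac_poly p) x = 0" using alg_closure_algebraic by blast
 have "P (ac_poly p, ac_poly p)"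
  using p hom_graphD(1)[OF G] by (simp add: P_def poly_graph_def[OF G] coeff_map_poly)
 then have "P (arg_min (degree o fst) P)"
  "ALL z. P z --> (degree o fst) (arg_min (degree o fst) P) <= (degree o fst) z"
  using arg_min_nat_lemma[of P _ "degree o fst"] by blast+
 moreover obtain m m' where "arg_min (degree o fst) P = (m, m')" by fastforce
 ultimately show ?thesis by (intro that[of m m']) (auto simp: P_def)
qed

section \<open>Elementary rules for automorphisms\<close>

lemma autsI:
 assumes "bij s" "!!x y. s (x + y) = s x + s y" "!!x y. s (x * y) = s x * s y" "!!x. x : L ==> s x = x"
 shows "s : field_auts L"
 unfolding field_auts_def using assms by (intro CollectI conjI allI ballI)

lemma autsD:
 assumes "s : field_auts L"
 shows "bij s" "s (x + y) = s x + s y" "s (x * y) = s x * s y" "x : L ==> s x = x"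
  "s 0 = 0" "s 1 = 1" "s (- x) = - s x" "s (x - y) = s x - s y" "s (inverse x) = inverse (s x)"
  "s (x / y) = s x / s y" "s (x ^ n) = s x ^ n" "s x = 0 \<longleftrightarrow> x = 0" "s x = s y \<longleftrightarrow> x = y"
proof -
 show b: "bij s" and a: "!!x y. s (x + y) = s x + s y" and m: "!!x y. s (x * y) = s x * s y"
  and "x : L ==> s x = x"
  using assms by (auto simp: field_auts_def)
 show inj: "s x = s y \<longleftrightarrow> x = y" for x y using b by (auto simp: bij_def dest: injD)
 show 0: "s 0 = 0" using a[of 0 0] by (metis add_cancel_right_left add_0)
 show z: "s x = 0 \<longleftrightarrow> x = 0" for x using inj[of x 0] 0 by simp
 show 1: "s 1 = 1" using m[of 1 1] z[of 1] by simp
 show n: "s (- x) = - s x" for x using a[of x "- x"] 0 by (simp add: eq_neg_iff_add_eq_0 add.commute)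
 show "s (x - y) = s x - s y" using a[of x "- y"] n by simp
 show i: "s (inverse x) = inverse (s x)" for x
  by (cases "x = 0") (use m[of x "inverse x"] 1 0 in \<open>auto dest: inverse_unique\<close>)
 show "s (x / y) = s x / s y" by (simp add: divide_inverse m i)
 show "s (x ^ n) = s x ^ n" by (induction n) (auto simp: 1 m)
qed

lemma auts_sum: "s : field_auts L ==> s (sum f A) = (SUM i:A. s (f i))"
 by (induction A rule: infinite_finite_induct) (auto simp: autsD)

lemma auts_prod: "s : field_auts L ==> s (prod f A) = (PROD i:A. s (f i))"
 by (induction A rule: infinite_finite_induct) (auto simp: autsD)

lemma auts_to_ac [simp]: "s : abs_galois ==> s (to_ac c) = to_ac c"
 by (simp add: field_auts_def)

lemma auts_poly: "s : abs_galois ==> s (poly (ac_poly p) x) = poly (ac_poly p) (s x)"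
 by (induction p) (auto simp: map_poly_pCons autsD)

lemma id_auts: "id : field_auts L"
 by (auto simp: field_auts_def)

lemma auts_comp: "s : field_auts L ==> t : field_auts L ==> s o t : field_auts L"
 by (auto simp: field_auts_def bij_comp)

abbreviation ginv :: "('a => 'b) => 'b => 'a" where
 "ginv \<equiv> inv_into UNIV"

lemma auts_inv:
 assumes "s : field_auts L" shows "ginv s : field_auts L"
proof -
 note b = autsD(1)[OF assms]
 have i: "s (ginv s x) = x" for x using b by (simp add: bij_is_surj surj_f_inv_f)
 have j: "ginv s (s x) = x" for x using b by (simp add: bij_is_inj)
 show ?thesis unfolding field_auts_def
 proof (intro CollectI conjI allI ballI)
  show "bij (ginv s)" using b by (rule bij_imp_bij_inv)
  fix x y
  show "ginv s (x + y) = ginv s x + ginv s y"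
   using j[of "ginv s x + ginv s y"] autsD(2)[OF assms] by (simp add: i)
  show "ginv s (x * y) = ginv s x * ginv s y"
   using j[of "ginv s x * ginv s y"] autsD(3)[OF assms] by (simp add: i)
 next
  fix x assume "x : L"
  then show "ginv s x = x" using j[of x] autsD(4)[OF assms] by simp
 qed
qed

lemma ginv_simps:
 assumes "s : field_auts L" shows "s (ginv s x) = x" "ginv s (s x) = x"
 using autsD(1)[OF assms] by (simp_all add: bij_is_surj surj_f_inv_f bij_is_inj)

lemma auts_mono: "L <= M ==> field_auts M <= field_auts L"
 by (auto simp: field_auts_def)

lemma auts_abs: "intermediate_field L ==> s : field_auts L ==> s : abs_galois"
 using auts_mono[of base_field L] by (auto simp: intermediate_field_def)

text \<open>A maximal graph exists by Zorn's lemma. It is total, since the image of a minimal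
  polynomial has a root and \<open>hom_graph_adjoin\<close> would otherwise enlarge the graph. The
  resulting map is onto because an injective map permutes the finite root set of each polynomial
  over F.\<close>

theorem hom_graph_extends:
 fixes G0 :: "('f::field alg_closure \<times> 'f alg_closure) set"
 assumes "hom_graph G0"
 obtains \<sigma> where "\<sigma> : abs_galois" "!!x y. (x, y) : G0 ==> \<sigma> x = y"
proof -
 define \<A> where "\<A> = {G :: ('f alg_closure \<times> 'f alg_closure) set. hom_graph G & G0 <= G}"
 have "EX M:\<A>. ALL H:\<A>. M <= H --> H = M"
 proof (rule subset_Zorn_nonempty)
  show "\<A> ~= {}" using assms by (auto simp: \<A>_def)
  fix \<C> assume \<C>: "\<C> ~= {}" "subset.chain \<A> \<C>"
  have two: "EX G:\<C>. u : G & w : G" if "u : \<Union>\<C>" "w \<in> \<Union>\<C>" for u w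
  proof -
   have "EX G H. G : \<C> & u : G & H : \<C> & w : H" using that by blast
   then obtain G H where "G : \<C>" "u : G" "H : \<C>" "w : H" by blast
   moreover from this have "G <= H | H <= G" using \<C>(2) by (auto simp: subset.chain_def)
   ultimately show ?thesis by blast
  qed
  have hg: "hom_graph G" if "G : \<C>" for G using \<C>(2) that by (auto simp: subset.chain_def \<A>_def)
  have "hom_graph (\<Union>\<C>)" unfolding hom_graph_def
  proof (intro conjI allI impI)
   fix c show "(to_ac c, to_ac c) : \<Union>\<C>" using \<C>(1) hg hom_graphD(1) by blast
  next
   fix a b c d assume "(a, b) : \<Union>\<C>" "(c, d) : \<Union>\<C>"
   then obtain G where "G : \<C>" "(a, b) : G" "(c, d) : G" using two by blast
   then show "(a - c, b - d) : \<Union>\<C>" "(a * c, b * d) : \<Union>\<C>"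
    using hg hom_graphD(4,5) by blast+
  next
   fix b assume "(0, b) : \<Union>\<C>" then show "b = 0" using hg hom_graphD(6) by blast
  qed
  moreover have "G0 <= \<Union>\<C>" using \<C> unfolding \<A>_def subset.chain_def by blast
  ultimately show "\<Union>\<C> \<in> \<A>" by (simp add: \<A>_def)
 qed
 then obtain G where "G : \<A>" and max0: "ALL H:\<A>. G <= H --> H = G" by (rule bexE)
 then have G: "hom_graph G" "G0 <= G" by (simp_all add: \<A>_def)
 then have max: "H = G" if "hom_graph H" "G <= H" for H using max0 that by (auto simp: \<A>_def)
 have tot: "EX y. (x, y) : G" for x
 proof -
  obtain m m' where m: "poly_graph G m m'" "m ~= 0" "poly m x = 0"
   "ALL q r. poly_graph G q r --> q ~= 0 --> poly q x = 0 --> degree m <= degree q"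
   using poly_graph_minimal[OF G(1)] by blast
  have "degree m > 0"
  proof (rule ccontr)
   assume "~ 0 < degree m"
   then obtain c where "m = [:c:]" using degree_eq_zeroE by blast
   then show False using m(2,3) by simp
  qed
  then obtain y where "poly m' y = 0"
   using alg_closed_imp_poly_has_root[of m'] poly_graph_degree[OF G(1) m(1)] by auto
  then obtain H where "hom_graph H" "G <= H" "(x, y) : H" using hom_graph_adjoin[OF G(1) m(1,2) _ m(4,3)] by blast
  then show ?thesis using max by blast
 qed
 define \<sigma> where "\<sigma> = (%x. THE y. (x, y) : G)"
 have s: "(x, \<sigma> x) : G" for x unfolding \<sigma>_def using tot hom_graphD(8)[OF G(1)] by (metis theI)
 have s': "\<sigma> x = y" if "(x, y) : G" for x y using s hom_graphD(8)[OF G(1)] that by blast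
 have add: "\<sigma> (x + y) = \<sigma> x + \<sigma> y" and mul: "\<sigma> (x * y) = \<sigma> x * \<sigma> y" and c: "\<sigma> (to_ac c) = to_ac c" for x y c
  by (intro s' hom_graphD[OF G(1)] s)+
 have inj: "inj \<sigma>"
 proof (rule injI)
  fix x y assume "\<sigma> x = \<sigma> y"
  then have "(x - y, 0) : G" using s[of x] s[of y] hom_graphD(4)[OF G(1)] by fastforce
  then show "x = y" using hom_graph_inverse(1)[OF G(1), of "x - y" 0] by auto
 qed
 have pol: "\<sigma> (poly (ac_poly p) x) = poly (ac_poly p) (\<sigma> x)" for p x
  by (induction p) (auto simp: map_poly_pCons add mul c c[of 0, simplified])
 have "surj \<sigma>"
  unfolding surj_def
 proof
  fix z :: "'f alg_closure"
  obtain p where p: "p ~= 0" "poly (ac_poly p) z = 0" using alg_closure_algebraic by blast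
  let ?R = "{x. poly (ac_poly p) x = 0}"
  have "finite ?R" using p(1) by (simp add: poly_roots_finite)
  moreover have "\<sigma> ` ?R <= ?R" using pol c[of 0] by (auto simp flip: pol)
  ultimately have "\<sigma> ` ?R = ?R" using inj by (meson endo_inj_surj inj_on_subset subset_UNIV)
  then show "EX x. z = \<sigma> x" using p(2) by blast
 qed
 then have "bij \<sigma>" using inj by (simp add: bij_def)
 then have "\<sigma> : abs_galois" by (rule autsI[OF _ add mul]) (use c in blast)
 then show ?thesis using that s' G(2) by blast
qed

lemma hom_graph_Id_on: "intermediate_field L ==> hom_graph (Id_on L)"
 by (auto simp: hom_graph_def ifieldD)

definition poly_over :: "'a::zero set => 'a poly => bool" where
 "poly_over L q \<longleftrightarrow> (ALL i. coeff q i : L)"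

lemma poly_graph_Id_on: "intermediate_field L ==> poly_graph (Id_on L) q r \<longleftrightarrow> q = r & poly_over L q"
 by (auto simp: poly_graph_def[OF hom_graph_Id_on] poly_eq_iff Id_on_iff poly_over_def)

text \<open>The graph lemmas applied to the identity of \<open>L\<close>, where
  \<open>poly_graph\<close> means equality of polynomials over \<open>L\<close>. The last clause,
  transitivity on the roots, comes from adjoining the pair \<open>(x, y)\<close> and extending to
  the whole closure.\<close>

lemma minimal_polynomial:
 assumes L: "intermediate_field L"
 obtains m where "poly_over L m" "m ~= 0" "poly m x = 0"
  "!!q. poly_over L q ==> poly q x = 0 ==> m dvd q"
  "!!y. poly m y = 0 ==> EX s:field_auts L. s x = y"
proof -
 note hg = hom_graph_Id_on[OF L]
 obtain m m' where m: "poly_graph (Id_on L) m m'" "m ~= 0" "poly m x = 0"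
  "ALL q r. poly_graph (Id_on L) q r --> q ~= 0 --> poly q x = 0 --> degree m <= degree q"
  using poly_graph_minimal[OF hg] by blast
 have mm: "m' = m" "poly_over L m" using m(1) poly_graph_Id_on[OF L] by auto
 show ?thesis
 proof (rule that[OF mm(2) m(2,3)])
  fix q assume "poly_over L q" "poly q x = 0"
  then show "m dvd q" using poly_graph_dvd[OF hg m(1,2,4,3)] poly_graph_Id_on[OF L] mm by blast
 next
  fix y assume "poly m y = 0"
  then obtain H where H: "hom_graph H" "Id_on L <= H" "(x, y) : H"
   using hom_graph_adjoin[OF hg m(1,2) _ m(4,3)] mm by blast
  obtain s where s: "s : abs_galois" "!!x y. (x, y) : H ==> s x = y"
   using hom_graph_extends[OF H(1)] by blast
  have "s z = z" if "z : L" for z using s(2)[of z z] H(2) that by auto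
  then have "s : field_auts L" using autsD(1-3)[OF s(1)] by (intro autsI)
  then show "EX s:field_auts L. s x = y" using s(2) H(3) by blast
 qed
qed

section \<open>Separable elements and Galois extensions\<close>

lemma poly_over_closed:
 assumes "intermediate_field L"
 shows "poly_over L q ==> poly_over L r ==> poly_over L (q + r)"
  "poly_over L q ==> poly_over L r ==> poly_over L (q - r)"
  "poly_over L q ==> poly_over L r ==> poly_over L (q * r)"
  "a : L ==> poly_over L (monom a n)" "a : L ==> poly_over L [:a:]"
  "poly_over L q ==> x : L ==> poly q x : L"
 using assms unfolding poly_over_def coeff_mult poly_altdef
 by (auto intro!: ifield_sum ifieldD simp: coeff_pCons split: nat.splits)

lemma poly_over_ac_poly: "intermediate_field L ==> poly_over L (ac_poly p)"
 by (simp add: poly_over_def coeff_map_poly ifieldD)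

text \<open>A nonzero combination of least degree divides every other combination. The identity is
  wanted because, unlike the bare word \<open>coprime\<close>, it can be carried coefficientwise
  into the closure.\<close>

lemma coprime_poly_bezout:
 fixes p q :: "'f::field poly"
 assumes "coprime p q" obtains a b where "a * p + b * q = 1"
proof -
 define P where "P = (%d. d ~= 0 & (EX a b. d = a * p + b * q))"
 have "p ~= 0 | q ~= 0" using assms by auto
 then obtain d0 where d0: "P d0" unfolding P_def by (metis add.right_neutral mult_1 mult_zero_left add_0)
 define d where "d = arg_min degree P"
 have d: "P d" "!!e. P e ==> degree d <= degree e"
  using arg_min_nat_lemma[of P d0 degree] d0 by (auto simp: d_def)
 obtain a b where ab: "d = a * p + b * q" using d(1) by (auto simp: P_def)
 have dv: "d dvd e" if "e = s * p + t * q" for e s t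
 proof (rule ccontr)
  assume "~ d dvd e"
  then have ne: "e mod d ~= 0" by (simp add: dvd_eq_mod_eq_0)
  have "e mod d = e - (e div d) * d" by (simp add: minus_div_mult_eq_mod)
  also have "... = (s - (e div d) * a) * p + (t - (e div d) * b) * q" using that ab by (simp add: algebra_simps)
  finally have "P (e mod d)" using ne by (auto simp: P_def)
  then show False using d(2)[of "e mod d"] degree_mod_less[of d e] d(1) ne by (auto simp: P_def)
 qed
 have "d dvd p" "d dvd q" using dv[of p 1 0] dv[of q 0 1] by auto
 then have "d dvd 1" using assms by (meson coprime_common_divisor)
 then obtain c where "1 = d * c" by blast
 then have "(c * a) * p + (c * b) * q = 1" using ab by (simp add: algebra_simps)
 then show ?thesis using that by blast
qed

lemma separable_elementD:
 assumes "separable_element x"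
 obtains p where "p ~= 0" "poly (ac_poly p) x = 0"
  "!!z. poly (ac_poly p) z = 0 ==> poly (pderiv (ac_poly p)) z ~= 0"
proof -
 obtain p where p: "coprime p (pderiv p)" "poly (ac_poly p) x = 0"
  using assms by (auto simp: separable_element_def)
 obtain a b where ab: "a * p + b * pderiv p = 1" using coprime_poly_bezout[OF p(1)] by blast
 have "ac_poly a * ac_poly p + ac_poly b * pderiv (ac_poly p) = 1"
  using arg_cong[OF ab, of ac_poly] by (simp add: ac_poly_add ac_poly_mult ac_poly_pderiv)
 then have eq: "poly (ac_poly a) z * poly (ac_poly p) z + poly (ac_poly b) z * poly (pderiv (ac_poly p)) z = 1" for z
  by (metis poly_add poly_mult poly_1)
 have "p ~= 0" using ab by auto
 then show ?thesis
 proof (rule that[OF _ p(2)])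
  fix z assume "poly (ac_poly p) z = 0"
  then show "poly (pderiv (ac_poly p)) z ~= 0" using eq[of z] by auto
 qed
qed

lemma separable_elementI:
 assumes "p ~= 0" "poly (ac_poly p) x = 0"
  "!!z. poly (ac_poly p) z = 0 ==> poly (pderiv (ac_poly p)) z ~= 0"
 shows "separable_element x"
 unfolding separable_element_def
proof (intro exI conjI)
 show "coprime p (pderiv p)"
 proof (rule coprimeI)
  fix d assume d: "d dvd p" "d dvd pderiv p"
  show "is_unit d"
  proof (rule ccontr)
   assume "~ is_unit d"
   moreover have "d ~= 0" using d(1) assms(1) by auto
   ultimately have "degree (ac_poly d) > 0" by (simp add: is_unit_iff_degree)
   then obtain z where "poly (ac_poly d) z = 0" using alg_closed_imp_poly_has_root by blast
   then show False using d assms(3)[of z] by (auto elim!: dvdE simp: ac_poly_mult simp flip: ac_poly_pderiv)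
  qed
 qed
qed (fact assms(2))

lemma card_simple_roots:
 fixes m :: "'a::alg_closed_field poly"
 assumes "m ~= 0" "!!z. poly m z = 0 ==> ~ [:- z, 1:] ^ 2 dvd m"
 shows "card {z. poly m z = 0} = degree m"
proof -
 obtain A where A: "size A = degree m" "m = smult (lead_coeff m) (\<Prod>x\<in>#A. [:- x, 1:])"
  using alg_closed_imp_factorization[OF assms(1)] by blast
 have rt: "poly m z = 0 \<longleftrightarrow> z \<in># A" for z
  by (subst A(2)) (use assms(1) in \<open>auto simp: poly_prod_mset prod_mset_zero_iff\<close>)
 have "count A z <= 1" for z
 proof (rule ccontr)
  assume "~ count A z <= 1"
  then have "{#z, z#} <=# A" by (auto simp: subseteq_mset_def)
  then have "(\<Prod>x\<in>#{#z, z#}. [:- x, 1:]) dvd (\<Prod>x\<in>#A. [:- x, 1:])"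
   by (intro prod_mset_subset_imp_dvd image_mset_subseteq_mono)
  then have "[:- z, 1:] ^ 2 dvd m" by (subst A(2)) (auto intro!: dvd_smult simp: power2_eq_square)
  moreover have "poly m z = 0" using rt \<open>~ count A z <= 1\<close> by (metis count_inI le_zero_eq zero_le)
  ultimately show False using assms(2) by blast
 qed
 then have "count A z = 1" if "z \<in># A" for z
  using that by (simp add: le_antisym Suc_le_eq)
 then have "size A = card (set_mset A)"
  by (simp add: size_multiset_overloaded_eq)
 moreover have "set_mset A = {z. poly m z = 0}" using rt by auto
 ultimately show ?thesis using A(1) by simp
qed

lemma simple_root_not_square_dvd:
 fixes m P :: "'a::field poly"
 assumes "m dvd P" "poly (pderiv P) z ~= 0"
 shows "~ [:- z, 1:] ^ 2 dvd m"
proof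
 assume "[:- z, 1:] ^ 2 dvd m"
 then have "[:- z, 1:] ^ 2 dvd P" using assms(1) by (rule dvd_trans)
 then obtain s where "P = [:- z, 1:] ^ 2 * s" by (rule dvdE)
 then have "P = [:- z, 1:] * ([:- z, 1:] * s)" by (simp only: power2_eq_square mult.assoc)
 then have "poly (pderiv P) z = 0"
  by (simp only: pderiv_mult poly_add poly_mult) simp
 then show False using assms(2) by simp
qed

text \<open>Polynomial values already form a field, since \<open>ifieldI\<close> supplies inverses;
  no quotients are included.\<close>

definition adjoin :: "'f::field alg_closure set => 'f alg_closure => 'f alg_closure set" where
 "adjoin L x = {poly q x |q. poly_over L q}"

context
 fixes L :: "'f::field alg_closure set"
 assumes L: "intermediate_field L"
begin

lemma adjoin_subset: "L <= adjoin L x"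
proof
 fix a assume "a : L"
 then show "a : adjoin L x" unfolding adjoin_def
  using poly_over_closed(5)[OF L] by (intro CollectI exI[of _ "[:a:]"]) simp
qed

lemma adjoin_mem: "x : adjoin L x"
 using poly_over_closed(4)[OF L ifieldD(3)[OF L], of 1]
 by (force simp: adjoin_def poly_monom)

lemma ifield_adjoin: "intermediate_field (adjoin L x)"
proof (rule ifieldI)
 show "base_field <= adjoin L x" using adjoin_subset L by (force simp: intermediate_field_def)
 fix a b assume "a : adjoin L x" "b : adjoin L x"
 then obtain q r where "poly_over L q" "poly_over L r" "a = poly q x" "b = poly r x"
  by (auto simp: adjoin_def)
 then show "a - b : adjoin L x" "a * b : adjoin L x"
  using poly_over_closed(2,3)[OF L, of q r] unfolding adjoin_def by (force simp: poly_diff poly_mult)+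
qed

lemma adjoin_reduced:
 assumes m: "poly_over L m" "m ~= 0" "poly m x = 0"
 shows "poly_over L q ==> EX r. poly_over L r & poly r x = poly q x & degree r < degree m"
proof (induction "degree q" arbitrary: q rule: less_induct)
 case less
 have dm: "degree m > 0"
 proof (rule ccontr)
  assume "~ 0 < degree m"
  then obtain c where "m = [:c:]" using degree_eq_zeroE by blast
  then show False using m(2,3) by simp
 qed
 show ?case
 proof (cases "degree q < degree m")
  case False
  let ?k = "degree q - degree m"
  let ?c = "lead_coeff q * inverse (lead_coeff m)"
  have "?c : L" using less.prems m(1) by (auto simp: poly_over_def intro!: ifieldD[OF L])
  define q' where "q' = q - monom ?c ?k * m"
  have po: "poly_over L q'" unfolding q'_def
   by (intro poly_over_closed[OF L] less.prems m \<open>?c : L\<close>)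
  have qx: "poly q' x = poly q x" using m(3) by (simp add: q'_def)
  have lc: "coeff (monom ?c ?k * m) (degree q) = lead_coeff q"
   using False m(2) by (simp add: coeff_monom_mult)
  have dle: "degree (monom ?c ?k * m) <= degree q"
   using degree_mult_le[of "monom ?c ?k" m] degree_monom_le[of ?c ?k] False by linarith
  have "degree q' < degree q"
  proof (rule ccontr)
   assume "~ degree q' < degree q"
   moreover have "degree q' <= degree q"
    unfolding q'_def using dle by (simp add: degree_diff_le)
   ultimately have "lead_coeff q' = 0" using lc by (simp add: q'_def)
   then have "q' = 0" by simp
   then show False using \<open>~ degree q' < degree q\<close> False dm by simp
  qed
  then show ?thesis using less.hyps[OF _ po] qx by simp
 qed (use less.prems in blast)
qed

text \<open>If \<open>y = q(x)\<close> is fixed, then \<open>q - y\<close> vanishes at all conjugates of \<open>x\<close>, which are too many.\<close>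

lemma adjoin_separable_fixed:
 assumes x: "separable_element x" and y: "y : adjoin L x" "!!s. s : field_auts L ==> s y = y"
 shows "y : L"
proof -
 obtain m where m: "poly_over L m" "m ~= 0" "poly m x = 0"
  "!!q. poly_over L q ==> poly q x = 0 ==> m dvd q"
  "!!y. poly m y = 0 ==> EX s:field_auts L. s x = y"
  using minimal_polynomial[OF L, of x] by blast
 obtain p where p: "p ~= 0" "poly (ac_poly p) x = 0"
  "!!z. poly (ac_poly p) z = 0 ==> poly (pderiv (ac_poly p)) z ~= 0"
  using separable_elementD[OF x] by blast
 have mp: "m dvd ac_poly p" using m(4) p(2) poly_over_ac_poly[OF L] by blast
 have "card {z. poly m z = 0} = degree m"
 proof (rule card_simple_roots[OF m(2)])
  fix z assume "poly m z = 0"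
  then have "poly (ac_poly p) z = 0" using mp by auto
  then show "~ [:- z, 1:] ^ 2 dvd m" using simple_root_not_square_dvd[OF mp p(3)] by blast
 qed
 moreover obtain q where q: "poly_over L q" "poly q x = y" "degree q < degree m"
  using y(1) adjoin_reduced[OF m(1-3)] by (auto simp: adjoin_def)
 have "poly (q - [:y:]) z = 0" if "poly m z = 0" for z
 proof -
  have "EX s:field_auts L. s x = z" using m(5) that by blast
  then obtain s where s: "s : field_auts L" "s x = z" by blast
  have "s (poly q x) = poly q (s x)"
   unfolding poly_altdef using q(1) by (simp add: auts_sum[OF s(1)] autsD[OF s(1)] poly_over_def)
  then show ?thesis using s q(2) y(2)[OF s(1)] by simp
 qed
 then have sub: "{z. poly m z = 0} <= {z. poly (q - [:y:]) z = 0}" by blast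
 have "q - [:y:] = 0"
 proof (rule ccontr)
  assume n0: "q - [:y:] ~= 0"
  have "degree (q - [:y:]) < degree m"
   using q(3) by (intro degree_diff_less) auto
  moreover have "card {z. poly m z = 0} <= degree (q - [:y:])"
   using card_mono[OF poly_roots_finite[OF n0] sub] card_poly_roots_bound[OF n0] by linarith
  ultimately show False using \<open>card {z. poly m z = 0} = degree m\<close> by simp
 qed
 then have "coeff q 0 = y" by (metis coeff_pCons_0 eq_iff_diff_eq_0)
 then show "y : L" using q(1) by (auto simp: poly_over_def)
qed

lemma separable_fixed:
 assumes "separable_element x" "!!s. s : field_auts L ==> s x = x"
 shows "x : L"
 using adjoin_separable_fixed[OF assms(1) adjoin_mem] assms(2) by blast

end

definition gen_field :: "'f::field alg_closure set => 'f alg_closure set => 'f alg_closure set" where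
 "gen_field L A = {x. ALL M. intermediate_field M --> L <= M --> A <= M --> x : M}"

lemma ifield_base: "intermediate_field base_field"
 by (auto simp: intermediate_field_def simp flip: to_ac_diff to_ac_mult to_ac_inverse)

lemma base_field_subset: "intermediate_field L ==> base_field <= L"
 by (simp add: intermediate_field_def)

lemma ifield_gen: "intermediate_field (gen_field L A)"
 by (rule ifieldI) (auto simp: gen_field_def ifieldD)

lemma gen_field_subset: "L <= gen_field L A" "A <= gen_field L A"
 by (auto simp: gen_field_def)

lemma gen_field_least: "intermediate_field M ==> L <= M ==> A <= M ==> gen_field L A <= M"
 by (auto simp: gen_field_def)

lemma gen_field_insert: "gen_field L (insert x A) <= adjoin (gen_field L A) x"
 using adjoin_subset[OF ifield_gen, of L A x] adjoin_mem[OF ifield_gen, of x L A]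
  gen_field_subset(1)[of L A] gen_field_subset(2)[of A L]
 by (intro gen_field_least ifield_adjoin ifield_gen) auto

text \<open>The generators are removed one at a time, as automorphisms over a larger field are among
  those over \<open>L\<close>. Separability is assumed of the generators only and not of
  \<open>y\<close>, so that \<open>gen_field_separable\<close> can be derived from it.\<close>

lemma gen_field_separable_fixed:
 assumes L: "intermediate_field L"
 shows "finite A ==> (!!x. x : A ==> separable_element x) ==> y : gen_field L A ==>
  (!!s. s : field_auts L ==> s y = y) ==> y : L"
proof (induction A rule: finite_induct)
 case empty
 then show ?case using gen_field_least[OF L, of L "{}"] by auto
next
 case (insert x A)
 have "y : gen_field L A"
 proof (rule adjoin_separable_fixed[OF ifield_gen])
  show "y : adjoin (gen_field L A) x" using insert.prems gen_field_insert by blast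
  show "separable_element x" using insert.prems by blast
  fix s assume "s : field_auts (gen_field L A)"
  then show "s y = y" using insert.prems(3) auts_mono[OF gen_field_subset(1)] by blast
 qed
 then show ?case using insert by blast
qed

definition conjugates :: "'f::field alg_closure => 'f alg_closure set" where
 "conjugates x = (%s. s x) ` abs_galois"

lemma finite_conjugates: "finite (conjugates x)"
proof -
 obtain p where "p ~= 0" "poly (ac_poly p) x = 0" by (rule alg_closure_algebraic)
 then have "conjugates x <= {z. poly (ac_poly p) z = 0}"
  by (auto simp: conjugates_def autsD simp flip: auts_poly)
 then show ?thesis using \<open>p ~= 0\<close> poly_roots_finite[of "ac_poly p"] by (simp add: finite_subset)
qed

declare finite_conjugates [simp]

lemma conjugates_refl: "x : conjugates x"
 unfolding conjugates_def by (rule image_eqI[OF _ id_auts]) simp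

lemma image_conjugates:
 assumes s: "s : abs_galois" shows "s ` conjugates x = conjugates x"
proof
 show "s ` conjugates x <= conjugates x"
  unfolding conjugates_def using auts_comp[OF s] by (auto simp: image_iff) (metis comp_apply)
 show "conjugates x <= s ` conjugates x"
 proof
  fix y assume "y : conjugates x"
  then obtain t where "t : abs_galois" "y = t x" by (auto simp: conjugates_def)
  then have "y = s ((ginv s o t) x)" "ginv s o t : abs_galois"
   using ginv_simps[OF s] auts_comp auts_inv[OF s] by auto
  then show "y : s ` conjugates x" unfolding conjugates_def by blast
 qed
qed

lemma separable_conjugate:
 assumes "separable_element x" "s : abs_galois" shows "separable_element (s x)"
 using assms auts_poly[OF assms(2)] unfolding separable_element_def
 by (metis autsD(5)[OF assms(2)])

lemma gen_field_stable:
 assumes s: "s : abs_galois" and A: "!!t. t : abs_galois ==> t ` A <= A"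
 shows "s ` gen_field base_field A = gen_field base_field A"
proof -
 have sub: "s ` gen_field base_field A <= gen_field base_field A" if s: "s : abs_galois" for s
 proof -
  let ?M = "{z. s z : gen_field base_field A}"
  have "intermediate_field ?M"
   using ifieldD[OF ifield_gen[of base_field A]]
   by (intro ifieldI) (auto simp: s autsD[OF s])
  moreover have "base_field <= ?M" using s gen_field_subset(1)[of base_field A] by auto
  moreover have "A <= ?M" using A[OF s] gen_field_subset(2)[of A base_field] by auto
  ultimately show ?thesis using gen_field_least by blast
 qed
 have "z : s ` gen_field base_field A" if "z : gen_field base_field A" for z
  using sub[OF auts_inv[OF s]] that ginv_simps(1)[OF s, of z] by (metis image_eqI image_subset_iff)
 then show ?thesis using sub[OF s] by blast
qed

lemma pderiv_prod_roots:
 fixes A :: "'a::field set"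
 assumes "finite A" "z : A"
 shows "poly (pderiv (PROD x:A. [:- x, 1:])) z ~= 0"
proof -
 have "(PROD x:A. [:- x, 1:]) = [:- z, 1:] * (PROD x:A - {z}. [:- x, 1:])"
  using assms by (simp add: prod.remove)
 then have "poly (pderiv (PROD x:A. [:- x, 1:])) z = (PROD x:A - {z}. z - x)"
  by (simp only: pderiv_mult poly_add poly_mult) (simp add: poly_prod pderiv_pCons)
 then show ?thesis using assms by (simp add: prod_zero_iff)
qed

lemma field_auts_map_poly_prod:
 assumes "s : field_auts L"
 shows "map_poly s (PROD x:A. [:- x, 1:]) = (PROD x:A. [:- s x, 1:])"
proof -
 have m: "map_poly s (p * q) = map_poly s p * map_poly s q" for p q
  by (rule poly_eqI) (simp add: coeff_map_poly coeff_mult auts_sum[OF assms] autsD[OF assms])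
 show ?thesis
  by (induction A rule: infinite_finite_induct)
   (simp_all add: m autsD[OF assms] map_poly_pCons map_poly_1' del: mult_pCons_left)
qed

text \<open>The product of the linear factors at the distinct conjugates of \<open>y\<close> has
  simple roots. Its coefficients are Galois invariant and lie in the generated field, hence in
  F.\<close>

lemma gen_field_separable:
 assumes A: "finite A" "!!x. x : A ==> separable_element x"
  and stable: "!!t. t : abs_galois ==> t ` A <= A" and y: "y : gen_field base_field A"
 shows "separable_element y"
proof -
 let ?E = "gen_field base_field A"
 define f where "f = (PROD x:conjugates y. [:- x, 1:])"
 have cE: "conjugates y <= ?E" using gen_field_stable[OF _ stable] y by (auto simp: conjugates_def)
 have "poly_over ?E f"
 proof -
  have "poly_over ?E (PROD x:Y. [:- x, 1:])" if "finite Y" "Y <= ?E" for Y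
   using that
  proof (induction Y)
   case empty then show ?case using ifieldD[OF ifield_gen] by (auto simp: poly_over_def coeff_1)
  next
   case (insert a Y)
   have "poly_over ?E [:- a, 1:]"
    using insert.prems ifieldD[OF ifield_gen] by (auto simp: poly_over_def coeff_pCons split: nat.splits)
   then show ?case using insert poly_over_closed(3)[OF ifield_gen] by (simp del: mult_pCons_left)
  qed
  then show ?thesis unfolding f_def using cE finite_conjugates by blast
 qed
 moreover have "map_poly s f = f" if s: "s : abs_galois" for s
  unfolding f_def field_auts_map_poly_prod[OF s]
  using autsD(1)[OF s] by (subst (2) image_conjugates[OF s, symmetric])
   (simp add: prod.reindex inj_on_subset[OF bij_is_inj])
 then have "s (coeff f i) = coeff f i" if "s : abs_galois" for s i
  using that by (metis coeff_map_poly autsD(5))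
 ultimately have "poly_over base_field f"
  using gen_field_separable_fixed[OF ifield_base A] by (auto simp: poly_over_def)
 then have f: "f = ac_poly (map_poly of_ac f)"
  by (intro poly_eqI) (auto simp: coeff_map_poly poly_over_def to_ac_of_ac)
 have "f ~= 0" by (simp add: f_def)
 have root: "poly f z = 0 \<longleftrightarrow> z : conjugates y" for z
  by (simp add: f_def poly_prod)
 show ?thesis
 proof (rule separable_elementI[of "map_poly of_ac f"])
  show "map_poly of_ac f ~= 0" using f \<open>f ~= 0\<close> by auto
  show "poly (ac_poly (map_poly of_ac f)) y = 0" using f root conjugates_refl by metis
  fix z assume "poly (ac_poly (map_poly of_ac f)) z = 0"
  then show "poly (pderiv (ac_poly (map_poly of_ac f))) z ~= 0"
   using f root pderiv_prod_roots[OF finite_conjugates, of z y] by (metis f_def)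
 qed
qed

lemma ifield_separable: "intermediate_field {x :: 'f::field alg_closure. separable_element x}"
proof (rule ifieldI)
 have "separable_element (to_ac c)" for c :: 'f
  by (rule separable_elementI[of "[:- c, 1:]"]) (auto simp: map_poly_pCons pderiv_pCons)
 then show "base_field <= {x :: 'f alg_closure. separable_element x}" by auto
 fix x y :: "'f alg_closure" assume xy: "x : {x. separable_element x}" "y : {x. separable_element x}"
 let ?A = "conjugates x Un conjugates y"
 have sep: "separable_element z" if "z : gen_field base_field ?A" for z
 proof (rule gen_field_separable[OF _ _ _ that])
  show "finite ?A" by (simp add: finite_conjugates)
  show "separable_element w" if "w : ?A" for w
   using that xy separable_conjugate by (auto simp: conjugates_def)
  show "t ` ?A <= ?A" if "t : abs_galois" for t using image_conjugates[OF that] by (simp add: image_Un)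
 qed
 have "x : gen_field base_field ?A" "y : gen_field base_field ?A"
  using conjugates_refl gen_field_subset(2) by fastforce+
 then show "x - y : {x. separable_element x}" "x * y : {x. separable_element x}"
  using sep[OF ifieldD(4)[OF ifield_gen]]
   sep[OF ifieldD(5)[OF ifield_gen]] by simp_all
qed

lemmas sep_closed = ifieldD[OF ifield_separable, unfolded mem_Collect_eq]
 ifield_sum[OF ifield_separable, unfolded mem_Collect_eq]
 ifield_prod[OF ifield_separable, unfolded mem_Collect_eq]

lemma separable_to_ac: "separable_element (to_ac c)"
 by (rule sep_closed)

section \<open>Finite extensions and Galois closures\<close>

lemma subspace_ifield: "intermediate_field K ==> ac.subspace K"
 by (auto simp: ac.subspace_def ifieldD)

lemma finite_extensionI:
 assumes K: "intermediate_field K" and B: "finite B" "K <= ac.span B"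
 obtains B' where "finite B'" "ac.independent B'" "K = ac.span B'" "finite_extension K"
proof -
 obtain B' where B': "B' <= K" "ac.independent B'" "K <= ac.span B'"
  by (rule ac.basis_exists[of K])
 have "finite B'" using ac.independent_span_bound[OF B(1) B'(2)] B'(1) B(2) by blast
 moreover have "ac.span B' = K"
  using B'(1,3) subspace_ifield[OF K] by (simp add: ac.span_minimal subset_antisym)
 ultimately show ?thesis using that[of B'] B'(2) K by (auto simp: finite_extension_def)
qed

lemma finite_extension_basis:
 assumes "finite_extension K"
 obtains B where "finite B" "ac.independent B" "K = ac.span B"
proof -
 obtain B where "finite B" "intermediate_field K" "K <= ac.span B"
  using assms by (auto simp: finite_extension_def)
 then show ?thesis using finite_extensionI that by metis
qed

lemma finite_extension_subset:
 assumes "finite_extension E" "intermediate_field K" "K <= E" shows "finite_extension K"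
 using assms finite_extensionI[of K] unfolding finite_extension_def by blast

lemma finite_ext_field: "finite_extension K ==> intermediate_field K"
 by (simp add: finite_extension_def)

lemma finite_extension_adjoin:
 assumes M: "finite_extension M" shows "finite_extension (adjoin M x)"
proof -
 note Mf = finite_ext_field[OF M]
 obtain B where B: "finite B" "M = ac.span B" using M by (auto simp: finite_extension_def)
 obtain m where m: "poly_over M m" "m ~= 0" "poly m x = 0" by (rule minimal_polynomial[OF Mf, of x])
 define C where "C = (%(b, i). b * x ^ i) ` (B \<times> {..degree m})"
 have "adjoin M x <= ac.span C"
 proof
  fix y assume "y : adjoin M x"
  then obtain q where q: "poly_over M q" "poly q x = y" "degree q < degree m"
   using adjoin_reduced[OF Mf m] by (auto simp: adjoin_def)
  have "a * x ^ i : ac.span C" if "i <= degree m" "a : ac.span B" for a i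
   using that(2)
  proof (induction rule: ac.span_induct_alt)
   case base
   then show ?case by (simp add: ac.span_zero)
  next
   case (step c b a)
   have "b * x ^ i : C" using step that(1) by (auto simp: C_def)
   then have "to_ac c * (b * x ^ i) : ac.span C" using ac.span_scale ac.span_base by blast
   then have "to_ac c * (b * x ^ i) + a * x ^ i : ac.span C" using step by (intro ac.span_add)
   then show ?case by (simp add: algebra_simps)
  qed
  then show "y : ac.span C" using q B(2)
   unfolding q(2)[symmetric] poly_altdef by (auto intro!: ac.span_sum simp: poly_over_def)
 qed
 moreover have "finite C" using B(1) by (simp add: C_def)
 ultimately show ?thesis using finite_extensionI[OF ifield_adjoin[OF Mf]] by blast
qed

lemma finite_extension_base: "finite_extension base_field"
proof -
 have "base_field <= ac.span {1}"
  using ac.span_scale[OF ac.span_base[of 1 "{1}"]] by fastforce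
 then show ?thesis using finite_extensionI[OF ifield_base] by blast
qed

lemma finite_extension_gen: "finite A ==> finite_extension (gen_field base_field A)"
proof (induction A rule: finite_induct)
 case empty
 have "gen_field base_field {} <= base_field" by (rule gen_field_least[OF ifield_base]) auto
 then show ?case using finite_extension_subset[OF finite_extension_base ifield_gen] by blast
next
 case (insert x A)
 then show ?case
  using finite_extension_subset[OF finite_extension_adjoin ifield_gen gen_field_insert] by blast
qed

lemma gen_field_galois:
 assumes "finite A" "!!x. x : A ==> separable_element x" "!!t. t : abs_galois ==> t ` A <= A"
 shows "galois_extension (gen_field base_field A)"
 unfolding galois_extension_def
 using gen_field_separable[OF assms] gen_field_stable[OF _ assms(3)] finite_extension_gen[OF assms(1)] by blast

lemma galoisD:
 assumes "galois_extension E"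
 shows "finite_extension E" "intermediate_field E" "x : E ==> separable_element x"
  "s : abs_galois ==> s ` E = E" "s : abs_galois ==> x : E ==> s x : E"
 using assms by (auto simp: galois_extension_def finite_extension_def)

lemma field_auts_eq_gen_field:
 assumes s: "s : abs_galois" "t : abs_galois" and eq: "!!x. x : A ==> s x = t x"
  and x: "x : gen_field base_field A"
 shows "s x = t x"
proof -
 have "intermediate_field {x. s x = t x}"
  using s by (intro ifieldI) (auto simp: autsD[OF s(1)] autsD[OF s(2)])
 then have "gen_field base_field A <= {x. s x = t x}"
  using eq s by (intro gen_field_least) auto
 then show ?thesis using x by blast
qed

lemma finite_extension_generators:
 assumes "finite_extension K"
 obtains A where "finite A" "K = gen_field base_field A"
proof -
 obtain B where B: "finite B" "K = ac.span B" using assms by (auto simp: finite_extension_def)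
 have "K <= gen_field base_field B"
  unfolding B(2) using subspace_ifield[OF ifield_gen] gen_field_subset(2)
  by (intro ac.span_minimal)
 moreover have "gen_field base_field B <= K"
  using finite_ext_field[OF assms] base_field_subset ac.span_superset B(2) by (intro gen_field_least) auto
 ultimately show ?thesis using that B(1) by blast
qed

text \<open>The last clause records that the generators are conjugates of elements of
  \<open>K\<close>; \<open>tame_closure\<close> uses it to carry tameness from \<open>K\<close> to
  the Galois closure.\<close>

lemma galois_closure_exists:
 assumes K: "finite_extension K" "!!x. x : K ==> separable_element x"
 obtains A where "finite A" "!!x. x : A ==> separable_element x" "!!t. t : abs_galois ==> t ` A <= A"
  "K <= gen_field base_field A" "A <= {s x |s x. s : abs_galois & x : K}"
proof -
 obtain B where B: "finite B" "K = gen_field base_field B" using finite_extension_generators[OF K(1)] by blast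
 have BK: "B <= K" using B(2) gen_field_subset(2) by blast
 let ?A = "UN b:B. conjugates b"
 show ?thesis
 proof (rule that[of ?A])
  show "finite ?A" using B(1) by simp
  show "separable_element x" if "x : ?A" for x
   using that K(2) BK separable_conjugate by (auto simp: conjugates_def)
  show "t ` ?A <= ?A" if "t : abs_galois" for t using image_conjugates[OF that] by fastforce
  have "B <= ?A" using conjugates_refl by blast
  then show "K <= gen_field base_field ?A"
   unfolding B(2) using gen_field_subset[where L = base_field and A = ?A]
   by (intro gen_field_least ifield_gen) auto
  show "?A <= {s x |s x. s : abs_galois & x : K}" using BK by (auto simp: conjugates_def)
 qed
qed

section \<open>Embeddings, norms and independence of characters\<close>

definition aut_group :: "('f::field alg_closure => 'f alg_closure) set => bool" where
 "aut_group H \<longleftrightarrow> H <= abs_galois & id : H & (ALL s:H. ginv s : H & (ALL t:H. s o t : H))"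

lemma aut_groupD:
 assumes "aut_group H"
 shows "s : H ==> s : abs_galois" "id : H" "s : H ==> ginv s : H"
  "s : H ==> t : H ==> s o t : H" "H <= abs_galois"
 using assms by (auto simp: aut_group_def)

lemma aut_group_auts: "intermediate_field L ==> aut_group (field_auts L)"
 using auts_abs by (auto simp: aut_group_def id_auts auts_inv auts_comp)

lemma aut_group_funpow: "aut_group H ==> s : H ==> s ^^ n : H"
 by (induction n) (auto intro: aut_groupD simp: aut_groupD(2)[unfolded id_def] id_def)

lemma restrictionsI: "s : H ==> restrict s K : restrictions H K"
 by (simp add: restrictions_def)

lemma restrictionsE:
 assumes "t : restrictions H K" obtains s where "s : H" "t = restrict s K"
 using assms by (auto simp: restrictions_def)

lemma restrict_eq: "restrict f K = restrict g K \<longleftrightarrow> (ALL x:K. f x = g x)"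
 by (metis restrict_apply' restrict_ext)

text \<open>A restriction is determined by its values on finitely many generators, and each value is
  one of finitely many conjugates.\<close>

lemma finite_restrictions:
 assumes K: "finite_extension K" and H: "H <= abs_galois"
 shows "finite (restrictions H K)"
proof -
 obtain A where A: "finite A" "K = gen_field base_field A" using finite_extension_generators[OF K] .
 have AK: "A <= K" using A(2) gen_field_subset(2) by blast
 have "inj_on (%t. restrict t A) (restrictions H K)"
 proof (rule inj_onI)
  fix t t' assume "t : restrictions H K" "t' : restrictions H K" and eq: "restrict t A = restrict t' A"
  then obtain u u' where s: "u : H" "u' : H" "t = restrict u K" "t' = restrict u' K"
   by (auto elim!: restrictionsE)
  have "u x = u' x" if "x : A" for x using eq that AK by (auto simp: s restrict_eq dest!: bspec)
  then show "t = t'" unfolding s restrict_eq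
   using field_auts_eq_gen_field[of u u' A] s(1,2) H A(2) by blast
 qed
 moreover have "(%t. restrict t A) ` restrictions H K <= Pi\<^sub>E A conjugates"
 proof
  fix g assume "g : (%t. restrict t A) ` restrictions H K"
  then obtain u where s: "u : H" "g = restrict (restrict u K) A" by (auto simp: restrictions_def)
  then have "g = restrict u A" using AK by (simp add: Int_absorb1)
  moreover have "u x : conjugates x" for x using s(1) H by (auto simp: conjugates_def)
  ultimately show "g : Pi\<^sub>E A conjugates" by simp
 qed
 moreover have "finite (Pi\<^sub>E A conjugates)" using A(1) by (intro finite_PiE) auto
 ultimately show ?thesis by (rule inj_on_finite)
qed

lemma restrictions_left:
 assumes H: "aut_group H" and s: "s : H"
 shows "bij_betw (%t. restrict (s o t) K) (restrictions H K) (restrictions H K)"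
proof (rule bij_betw_byWitness[where f' = "%t. restrict (ginv s o t) K"])
 have *: "(%t. restrict (r o t) K) ` restrictions H K <= restrictions H K" if "r : H" for r
 proof
  fix y assume "y : (%t. restrict (r o t) K) ` restrictions H K"
  then obtain t where "t : H" "y = restrict (r o t) K"
   by (auto elim!: restrictionsE simp: restrict_eq)
  then show "y : restrictions H K" using aut_groupD(4)[OF H that] by (auto intro: restrictionsI)
 qed
 show "(%t. restrict (s o t) K) ` restrictions H K <= restrictions H K"
  "(%t. restrict (ginv s o t) K) ` restrictions H K <= restrictions H K"
  using * s aut_groupD(3)[OF H s] by auto
 note si = ginv_simps[OF aut_groupD(1)[OF H s]]
 show "ALL t:restrictions H K. restrict (ginv s o restrict (s o t) K) K = t"
  "ALL t:restrictions H K. restrict (s o restrict (ginv s o t) K) K = t"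
  by (auto elim!: restrictionsE simp: restrict_eq si)
qed

lemma restrictions_right:
 assumes H: "aut_group H" and s: "s : H" "s ` K = K"
 shows "bij_betw (%t. restrict (t o s) K) (restrictions H K) (restrictions H K)"
proof (rule bij_betw_byWitness[where f' = "%t. restrict (t o ginv s) K"])
 note si = ginv_simps[OF aut_groupD(1)[OF H s(1)]]
 have "ginv s ` (s ` K) = K" unfolding image_image si(2) by simp
 then have s': "ginv s ` K = K" using s(2) by simp
 have *: "(%t. restrict (t o r) K) ` restrictions H K <= restrictions H K" if "r : H" "r ` K = K" for r
 proof
  fix y assume "y : (%t. restrict (t o r) K) ` restrictions H K"
  then obtain t where "t : H" "y = restrict (restrict t K o r) K" by (auto elim!: restrictionsE)
  moreover have "restrict (restrict t K o r) K = restrict (t o r) K"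
   using that(2) by (auto simp: restrict_eq)
  ultimately show "y : restrictions H K" using aut_groupD(4)[OF H _ that(1)] by (auto intro: restrictionsI)
 qed
 show "(%t. restrict (t o s) K) ` restrictions H K <= restrictions H K"
  "(%t. restrict (t o ginv s) K) ` restrictions H K <= restrictions H K"
  using *[OF s] *[OF aut_groupD(3)[OF H s(1)] s'] .
 have "!!x. x : K ==> s x : K" "!!x. x : K ==> ginv s x : K" using s(2) s' by blast+
 then show "ALL t:restrictions H K. restrict (restrict (t o s) K o ginv s) K = t"
  "ALL t:restrictions H K. restrict (restrict (t o ginv s) K o s) K = t"
  by (auto elim!: restrictionsE simp: restrict_eq si)
qed

lemma restrictions_prod_left:
 assumes "aut_group H" "s : H" "x : K"
 shows "s (PROD t:restrictions H K. t x) = (PROD t:restrictions H K. t x)"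
proof -
 have "(PROD t:restrictions H K. t x) = (PROD t:restrictions H K. restrict (s o t) K x)"
  by (rule prod.reindex_bij_betw[OF restrictions_left[OF assms(1,2)], symmetric])
 also have "... = (PROD t:restrictions H K. s (t x))" using assms(3) by simp
 finally show ?thesis using auts_prod[OF aut_groupD(1)[OF assms(1,2)], of "%t. t x"] by metis
qed

lemma restrictions_sum_left:
 assumes "aut_group H" "s : H" "x : K"
 shows "s (SUM t:restrictions H K. t x) = (SUM t:restrictions H K. t x)"
proof -
 have "(SUM t:restrictions H K. t x) = (SUM t:restrictions H K. restrict (s o t) K x)"
  by (rule sum.reindex_bij_betw[OF restrictions_left[OF assms(1,2)], symmetric])
 also have "... = (SUM t:restrictions H K. s (t x))" using assms(3) by simp
 finally show ?thesis using auts_sum[OF aut_groupD(1)[OF assms(1,2)], of "%t. t x"] by metis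
qed

lemma restrictions_prod_right:
 assumes "aut_group H" "s : H" "s ` K = K" "x : K"
 shows "(PROD t:restrictions H K. t (s x)) = (PROD t:restrictions H K. t x)"
proof -
 have "(PROD t:restrictions H K. t x) = (PROD t:restrictions H K. restrict (t o s) K x)"
  by (rule prod.reindex_bij_betw[OF restrictions_right[OF assms(1-3)], symmetric])
 then show ?thesis using assms(4) by simp
qed

lemma restrictions_mem:
 assumes "H <= abs_galois" "t : restrictions H K" "x : K" "separable_element x"
 shows "separable_element (t x)"
proof -
 obtain s where "s : abs_galois" "t = restrict s K" using assms(1,2) by (auto elim!: restrictionsE)
 then show ?thesis using assms(3,4) separable_conjugate by simp
qed

lemma restrictions_mult:
 assumes "H <= abs_galois" "t : restrictions H K" "intermediate_field K" "x : K" "y : K"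
 shows "t (x * y) = t x * t y" "t (x + y) = t x + t y" "t x = 0 \<longleftrightarrow> x = 0"
proof -
 obtain s where s: "s : abs_galois" "t = restrict s K" using assms(1,2) by (auto elim!: restrictionsE)
 show "t (x * y) = t x * t y" "t (x + y) = t x + t y" "t x = 0 \<longleftrightarrow> x = 0"
  using assms(4,5) ifieldD[OF assms(3)] by (simp_all add: s(2) autsD[OF s(1)])
qed

context
 fixes L K :: "'f::field alg_closure set"
 assumes L: "intermediate_field L" and K: "finite_extension K"
begin

lemma field_norm_mult: "x : K ==> y : K ==> field_norm L K (x * y) = field_norm L K x * field_norm L K y"
 unfolding field_norm_def prod.distrib[symmetric]
 using restrictions_mult(1)[OF aut_groupD(5)[OF aut_group_auts[OF L]] _ finite_ext_field[OF K]]
 by (intro prod.cong refl) blast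

lemma field_norm_eq_0: "x : K ==> field_norm L K x = 0 \<longleftrightarrow> x = 0"
 unfolding field_norm_def
 using prod_zero_iff[OF finite_restrictions[OF K aut_groupD(5)[OF aut_group_auts[OF L]]]]
  restrictions_mult(3)[OF aut_groupD(5)[OF aut_group_auts[OF L]] _ finite_ext_field[OF K]]
 by (metis (no_types, lifting) id_auts restrictionsI)

lemma field_norm_1: "field_norm L K 1 = 1"
 unfolding field_norm_def using ifieldD(3)[OF finite_ext_field[OF K]]
 by (intro prod.neutral) (auto elim!: restrictionsE simp: autsD)

lemma field_norm_mem:
 assumes "x : K" "separable_element x" shows "field_norm L K x : L"
 unfolding field_norm_def
proof (rule separable_fixed[OF L])
 note H = aut_group_auts[OF L]
 show "separable_element (PROD t:restrictions (field_auts L) K. t x)"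
  using restrictions_mem[OF aut_groupD(5)[OF H] _ assms] by (rule sep_closed(12))
 show "s (PROD t:restrictions (field_auts L) K. t x) = (PROD t:restrictions (field_auts L) K. t x)"
  if "s : field_auts L" for s using restrictions_prod_left[OF H that assms(1)] .
qed

lemma field_trace_mem:
 assumes "x : K" "separable_element x" shows "(SUM t:restrictions (field_auts L) K. t x) : L"
proof (rule separable_fixed[OF L])
 note H = aut_group_auts[OF L]
 show "separable_element (SUM t:restrictions (field_auts L) K. t x)"
  using restrictions_mem[OF aut_groupD(5)[OF H] _ assms] by (rule sep_closed(11))
 show "s (SUM t:restrictions (field_auts L) K. t x) = (SUM t:restrictions (field_auts L) K. t x)"
  if "s : field_auts L" for s using restrictions_sum_left[OF H that assms(1)] .
qed

end

lemma field_norm_conj: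
 assumes "intermediate_field L" "s : field_auts L" "s ` K = K" "x : K"
 shows "field_norm L K (s x) = field_norm L K x"
 unfolding field_norm_def using restrictions_prod_right[OF aut_group_auts[OF assms(1)] assms(2-4)] .

text \<open>The embeddings of \<open>E\<close> over \<open>L\<close> are grouped by their
  restriction to \<open>K\<close>. Those that agree with \<open>s\<close> on \<open>K\<close> are
  \<open>s\<close> composed with the embeddings over \<open>K\<close>, so their product is
  \<open>s\<close> applied to the norm from \<open>E\<close> to \<open>K\<close>.\<close>

lemma field_norm_trans:
 assumes L: "intermediate_field L" "L <= K" and K: "intermediate_field K" "K <= E" and E: "finite_extension E"
  and x: "x : E" "separable_element x"
 shows "field_norm L E x = field_norm L K (field_norm K E x)"
proof -
 let ?S = "restrictions (field_auts L) E" and ?T = "restrictions (field_auts L) K"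
 note H = aut_group_auts[OF L(1)] and HK = aut_group_auts[OF K(1)]
 have Kf: "finite_extension K" using finite_extension_subset[OF E K] .
 have fin: "finite ?S" "finite ?T" using finite_restrictions E Kf aut_groupD(5)[OF H] by blast+
 have im: "(%t. restrict t K) ` ?S <= ?T"
 proof
  fix y assume "y : (%t. restrict t K) ` ?S"
  then obtain s where s: "s : field_auts L" "y = restrict (restrict s E) K" by (auto elim!: restrictionsE)
  then have "y = restrict s K" using K(2) by (simp add: Int_absorb1)
  then show "y : ?T" using s(1) by (simp add: restrictionsI)
 qed
 have "(PROD t:{t:?S. restrict t K = r}. t x) = r (field_norm K E x)" if rho: "r : ?T" for r
 proof -
  obtain s where s: "s : field_auts L" "r = restrict s K" using rho by (rule restrictionsE)
  have si: "s (ginv s z) = z" "ginv s (s z) = z" for z using ginv_simps[OF s(1)] by auto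
  have "bij_betw (%t. restrict (s o t) E) (restrictions (field_auts K) E) {t:?S. restrict t K = r}"
  proof (rule bij_betw_byWitness[where f' = "%t. restrict (ginv s o t) E"])
   show "ALL t:restrictions (field_auts K) E. restrict (ginv s o restrict (s o t) E) E = t"
    "ALL t:{t:?S. restrict t K = r}. restrict (s o restrict (ginv s o t) E) E = t"
    by (auto elim!: restrictionsE simp: restrict_eq si)
   show "(%t. restrict (s o t) E) ` restrictions (field_auts K) E <= {t:?S. restrict t K = r}"
   proof
    fix y assume "y : (%t. restrict (s o t) E) ` restrictions (field_auts K) E"
    then obtain t where t: "t : field_auts K" "y = restrict (s o t) E"
     by (auto elim!: restrictionsE simp: restrict_eq)
    have "s o t : field_auts L" using auts_comp[OF s(1)] t(1) auts_mono[OF L(2)] by blast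
    moreover have "restrict y K = r"
     using K(2) autsD(4)[OF t(1)] by (simp add: t(2) s(2) Int_absorb1) (simp add: restrict_eq)
    ultimately show "y : {t:?S. restrict t K = r}" using t(2) by (simp add: restrictionsI)
   qed
   show "(%t. restrict (ginv s o t) E) ` {t:?S. restrict t K = r} <= restrictions (field_auts K) E"
   proof
    fix y assume "y : (%t. restrict (ginv s o t) E) ` {t:?S. restrict t K = r}"
    then obtain t where t: "t : field_auts L" "restrict (restrict t E) K = r" "y = restrict (ginv s o t) E"
     by (auto elim!: restrictionsE simp: restrict_eq)
    have ts: "t z = s z" if "z : K" for z using t(2) that K(2) by (simp add: s(2) Int_absorb1 restrict_eq)
    have "ginv s o t : abs_galois"
     using auts_comp[OF auts_inv[OF s(1)] t(1)] auts_abs[OF L(1)] by blast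
    then have "ginv s o t : field_auts K"
     using autsD(1-3)[OF \<open>ginv s o t : abs_galois\<close>] by (intro autsI) (auto simp: ts si)
    then show "y : restrictions (field_auts K) E" using t(3) by (simp add: restrictionsI)
   qed
  qed
  then have "(PROD t:{t:?S. restrict t K = r}. t x) = (PROD t:restrictions (field_auts K) E. restrict (s o t) E x)"
   by (rule prod.reindex_bij_betw[symmetric])
  also have "... = s (field_norm K E x)" using x(1) by (simp add: field_norm_def auts_prod[OF s(1)])
  also have "... = r (field_norm K E x)" using field_norm_mem[OF K(1) E x] s(2) by simp
  finally show ?thesis .
 qed
 then have "(PROD r:?T. r (field_norm K E x)) = (PROD r:?T. PROD t:{t:?S. restrict t K = r}. t x)"
  by (intro prod.cong) auto
 also have "... = field_norm L E x" unfolding field_norm_def by (rule prod.group[OF fin im])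
 finally show ?thesis by (simp add: field_norm_def)
qed

text \<open>Dedekind's elimination modulo a prime ideal \<open>P\<close> of \<open>R\<close>:
  subtracting \<open>f j a\<close> times the relation at \<open>b\<close> from the relation at
  \<open>a * b\<close> removes the index \<open>j\<close>. With \<open>P = {0}\<close> it yields
  Artin's theorem, with \<open>P\<close> the maximal ideal it yields independence of residue
  characters.\<close>

lemma dedekind_mod_prime:
 fixes P R :: "'b::comm_ring_1 set" and f :: "'i => 'a::times => 'b"
 assumes R: "!!x y. x : R ==> y : R ==> x * y : R" "!!x y. x : R ==> y : R ==> x - y : R"
  and P: "!!x y. x : P ==> y : P ==> x - y : P" "!!x y. x : R ==> y : P ==> x * y : P"
  and prime: "!!x y. x : R ==> y : R ==> x * y : P ==> x : P | y : P"
  and A: "!!a b. a : A ==> b : A ==> a * b : A"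
 shows "finite I ==> (!!i a. i : I ==> a : A ==> f i a : R) ==>
  (!!i a b. i : I ==> a : A ==> b : A ==> f i (a * b) = f i a * f i b) ==>
  (!!i j. i : I ==> j : I ==> i ~= j ==> EX a:A. f i a - f j a ~: P) ==>
  (!!i. i : I ==> EX a:A. f i a ~: P) ==> (!!i. i : I ==> c i : R) ==>
  (!!a. a : A ==> (SUM i:I. c i * f i a) : P) ==> i : I ==> c i : P"
proof (induction I arbitrary: c i rule: finite_induct)
 case (insert j I)
 have cI: "c k : P" if k: "k : I" for k
 proof -
  obtain a where a: "a : A" "f k a - f j a ~: P"
   using insert.prems(3)[of k j] k insert.hyps(2) by blast
  have "c k * (f k a - f j a) : P"
  proof (rule insert.IH[of "%i. c i * (f i a - f j a)"])
   show "c i * (f i a - f j a) : R" if "i : I" for i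
    using insert.prems(1,5) that a(1) by (intro R) auto
   fix b assume b: "b : A"
   have "(SUM i:insert j I. c i * f i (a * b)) - f j a * (SUM i:insert j I. c i * f i b) : P"
    using insert.prems(1,6) A a(1) b by (intro P) auto
   also have "(SUM i:insert j I. c i * f i (a * b)) - f j a * (SUM i:insert j I. c i * f i b)
     = (SUM i:insert j I. c i * (f i a - f j a) * f i b)"
    unfolding sum_distrib_left sum_subtractf[symmetric]
    by (rule sum.cong) (use insert.prems(2) a(1) b in \<open>auto simp: algebra_simps\<close>)
   also have "... = (SUM i:I. c i * (f i a - f j a) * f i b)" using insert.hyps by simp
   finally show "(SUM i:I. c i * (f i a - f j a) * f i b) : P" .
  qed (use insert.prems k in auto)
  then show ?thesis using prime[of "c k" "f k a - f j a"] a insert.prems(1,5) k R(2) by blast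
 qed
 have sumP: "sum g I : P" if "!!k. k : I ==> g k : P" "I ~= {}" for g
 proof -
  have 0: "0 : P" using that P(1)[of "g k" "g k" for k] by fastforce
  have add: "x + y : P" if "x : P" "y : P" for x y using P(1)[OF that(1) P(1)[OF 0 that(2)]] by simp
  show ?thesis using insert.hyps(1) that(1) by (induction I) (auto intro: 0 add)
 qed
 have cj: "c j : P"
 proof -
  obtain a where a: "a : A" "f j a ~: P" using insert.prems(4) by blast
  have s: "c j * f j a + (SUM i:I. c i * f i a) : P" using insert.prems(6)[OF a(1)] insert.hyps by simp
  have "c j * f j a : P"
  proof (cases "I = {}")
   case False
   have "(SUM i:I. c i * f i a) : P"
    using P(2) cI insert.prems(1) a(1) by (intro sumP[OF _ False]) (metis insertI2 mult.commute)
   then show ?thesis using P(1)[OF s] by fastforce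
  qed (use s in simp)
  then show ?thesis using prime a insert.prems(1,5) by blast
 qed
 show ?case using cI cj insert.prems(7) by blast
qed simp

text \<open>If \<open>t\<close> agreed with no element of \<open>H\<close> on \<open>E\<close>, the
  maps \<open>h\<close> and \<open>t o h\<close> for \<open>h\<close> in \<open>H\<close> would be
  distinct characters of \<open>E\<close>. But the sum of all \<open>h a\<close> is fixed by
  \<open>H\<close>, hence by \<open>t\<close>, which is a relation between them with coefficients 1
  and -1.\<close>

theorem artin:
 assumes H: "aut_group H" and E: "finite_extension E" "!!s. s : H ==> s ` E = E"
  and t: "t : abs_galois" "!!x. x : E ==> (!!h. h : H ==> h x = x) ==> t x = x"
 obtains h where "h : H" "!!x. x : E ==> t x = h x"
proof (rule ccontr)
 assume "~ thesis"
 then have no: "restrict t E ~: restrictions H E"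
  using that unfolding restrictions_def image_iff restrict_eq by blast
 note Ef = finite_ext_field[OF E(1)]
 let ?S = "restrictions H E" and ?T = "(%w. restrict (t o w) E) ` restrictions H E"
 define c where "c = (%r. if r : ?S then 1 else - 1 :: 'a alg_closure)"
 have fS: "finite ?S" using finite_restrictions[OF E(1) aut_groupD(5)[OF H]] .
 have disj: "?S Int ?T = {}"
 proof (rule ccontr)
  assume "?S Int ?T ~= {}"
  then obtain r where "r : ?S" "r : ?T" by blast
  then obtain s w where s: "s : H" "w : H" "restrict s E = restrict (t o w) E"
   by (auto elim!: restrictionsE simp: restrict_eq)
  have "t x = (s o ginv w) x" if "x : E" for x
  proof -
   have "ginv w x : E" using E(2)[OF aut_groupD(3)[OF H s(2)]] that by blast
   then have "s (ginv w x) = t (w (ginv w x))" using s(3) by (auto simp: restrict_eq)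
   then show ?thesis using ginv_simps[OF aut_groupD(1)[OF H s(2)]] by simp
  qed
  then have "restrict t E = restrict (s o ginv w) E" by (auto simp: restrict_eq)
  then show False using no aut_groupD(4)[OF H s(1) aut_groupD(3)[OF H s(2)]] by (simp add: restrictionsI)
 qed
 have el: "EX s:abs_galois. r = restrict s E" if "r : ?S Un ?T" for r
  using that auts_comp[OF t(1)] aut_groupD(1)[OF H]
  by (auto elim!: restrictionsE simp: restrict_eq) (metis comp_apply)
 have "c (restrict id E) : {0}"
 proof (rule dedekind_mod_prime[where R = UNIV and P = "{0}" and A = E and f = "%r. r" and I = "?S Un ?T" and c = c])
  fix a assume a: "a : E"
  let ?y = "SUM w:?S. w a"
  have yE: "?y : E"
  proof (intro ifield_sum[OF Ef])
   fix w assume "w : ?S"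
   then obtain s where "s : H" "w = restrict s E" by (rule restrictionsE)
   then show "w a : E" using a E(2)[of s] by auto
  qed
  have "(SUM r:?S Un ?T. c r * r a) = (SUM r:?S. c r * r a) + (SUM r:?T. c r * r a)"
   using fS disj by (intro sum.union_disjoint) auto
  also have "(SUM r:?S. c r * r a) = ?y" by (rule sum.cong) (auto simp: c_def)
  also have "(SUM r:?T. c r * r a) = (SUM r:?T. - r a)" using disj by (intro sum.cong) (auto simp: c_def)
  also have "... = (SUM w:?S. - restrict (t o w) E a)"
  proof -
   have "inj_on (%w. restrict (t o w) E) ?S"
    by (auto intro!: inj_onI elim!: restrictionsE simp: restrict_eq autsD(13)[OF t(1)])
   then show ?thesis by (simp add: sum.reindex)
  qed
  also have "... = - t ?y" using a by (simp add: sum_negf auts_sum[OF t(1)])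
  also have "t ?y = ?y" using t(2)[OF yE] restrictions_sum_left[OF H _ a] by blast
  finally have "(SUM r:?S Un ?T. c r * r a) = 0" by (simp only: add.right_inverse)
  then show "(SUM r:?S Un ?T. c r * r a) : {0}" by (simp only: singletonI)
 next
  fix r r' assume "r : ?S Un ?T" "r' : ?S Un ?T" "r ~= r'"
  then obtain s s' where "r = restrict s E" "r' = restrict s' E" using el by blast
  then show "EX a:E. r a - r' a ~: {0}" using \<open>r ~= r'\<close> by (auto simp: restrict_eq)
 next
  fix r assume "r : ?S Un ?T"
  then obtain s where "s : abs_galois" "r = restrict s E" using el by blast
  then show "EX a:E. r a ~: {0}" using ifieldD(3)[OF Ef] by (intro bexI[of _ 1]) (auto simp: autsD)
 next
  fix r a b assume "r : ?S Un ?T" "a : E" "b : E"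
  then obtain s where "s : abs_galois" "r = restrict s E" using el by blast
  then show "r (a * b) = r a * r b"
   using ifieldD(5)[OF Ef \<open>a : E\<close> \<open>b : E\<close>] \<open>a : E\<close> \<open>b : E\<close> by (simp add: autsD)
 qed (use fS aut_groupD(2)[OF H] in \<open>auto intro: restrictionsI ifieldD[OF Ef]\<close>)
 moreover have "c (restrict id E) = 1" using aut_groupD(2)[OF H] by (simp add: c_def restrictionsI)
 ultimately show False by simp
qed

text \<open>The restrictions form a finite group of exponent dividing \<open>e\<close>. If
  \<open>p\<close> divided its order, a subgroup of order \<open>p\<close> would contain a
  nontrivial element whose order divides both \<open>p\<close> and \<open>e\<close>.\<close>

lemma coprime_card_restrictions:
 assumes H: "aut_group H" and E: "finite_extension E" "!!s. s : H ==> s ` E = E"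
  and e: "!!s x. s : H ==> x : E ==> (s ^^ e) x = x" "coprime p e" "Factorial_Ring.prime (p :: nat)"
 shows "coprime p (card (restrictions H E))"
proof -
 define mul :: "('a alg_closure => 'a alg_closure) => _" where "mul = (%f g. restrict (f o g) E)"
 define one where "one = restrict (id :: 'a alg_closure => _) E"
 let ?G = "\<lparr>carrier = restrictions H E, mult = mul, one = one\<rparr>"
 have HE: "s x : E" if "s : H" "x : E" for s x using E(2) that by blast
 have cmp: "mul (restrict s E) (restrict t E) = restrict (s o t) E" if "t : H" for s t
  unfolding mul_def restrict_eq using HE[OF that] by auto
 have oneH: "one = restrict id E" "id : H" using aut_groupD(2)[OF H] by (auto simp: one_def)
 interpret G: group ?G
 proof (rule groupI)
  fix x assume "x : carrier ?G"
  then obtain s where s: "s : H" "x = restrict s E" by (auto elim: restrictionsE)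
  have "mul (restrict (ginv s) E) x = one"
   unfolding s(2) cmp[OF s(1)] one_def using ginv_simps[OF aut_groupD(1)[OF H s(1)]] by (simp add: restrict_eq)
  moreover have "restrict (ginv s) E : carrier ?G" using aut_groupD(3)[OF H s(1)] by (simp add: restrictionsI)
  ultimately show "EX y:carrier ?G. y \<otimes>\<^bsub>?G\<^esub> x = \<one>\<^bsub>?G\<^esub>" by auto
 next
  fix x y assume "x : carrier ?G" "y : carrier ?G"
  then obtain s t where s: "s : H" "x = restrict s E" "t : H" "y = restrict t E"
   by (auto elim!: restrictionsE)
  then have "mul x y : restrictions H E"
   unfolding s(2,4) cmp[OF s(3)] using aut_groupD(4)[OF H] by (blast intro: restrictionsI)
  then show "x \<otimes>\<^bsub>?G\<^esub> y : carrier ?G" by simp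
 next
  fix x y z assume "x : carrier ?G" "y : carrier ?G" "z : carrier ?G"
  then obtain s t r where s: "x = restrict s E" "t : H" "y = restrict t E" "r : H" "z = restrict r E"
   by (auto elim!: restrictionsE)
  have "mul (mul x y) z = mul x (mul y z)"
   unfolding s(1,3,5) cmp[OF s(2)] cmp[OF s(4)] cmp[OF aut_groupD(4)[OF H s(2,4)]] by (simp add: o_assoc)
  then show "x \<otimes>\<^bsub>?G\<^esub> y \<otimes>\<^bsub>?G\<^esub> z = x \<otimes>\<^bsub>?G\<^esub> (y \<otimes>\<^bsub>?G\<^esub> z)" by simp
 next
  fix x assume "x : carrier ?G"
  then obtain s where "s : H" "x = restrict s E" by (auto elim!: restrictionsE)
  then have "mul one x = x" using cmp[of s id] by (simp add: oneH(1))
  then show "\<one>\<^bsub>?G\<^esub> \<otimes>\<^bsub>?G\<^esub> x = x" by simp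
 next
  show "\<one>\<^bsub>?G\<^esub> : carrier ?G" using restrictionsI[OF oneH(2)] oneH(1) by simp
 qed
 have fin: "finite (carrier ?G)" using finite_restrictions[OF E(1) aut_groupD(5)[OF H]] by simp
 have pw: "restrict s E [^]\<^bsub>?G\<^esub> (n::nat) = restrict (s ^^ n) E" if "s : H" for s n
 proof (induction n)
  case 0
  show ?case unfolding nat_pow_0 funpow.simps(1) by (simp only: oneH(1) monoid.simps)
 next
  case (Suc n)
  then have "restrict s E [^]\<^bsub>?G\<^esub> Suc n = mul (restrict (s ^^ n) E) (restrict s E)"
   by (simp only: G.nat_pow_Suc monoid.simps)
  then show ?case unfolding cmp[OF that] by (simp only: funpow_Suc_right)
 qed
 show ?thesis
 proof (rule ccontr)
  assume "~ coprime p (card (restrictions H E))"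
  then have "p dvd card (restrictions H E)" using e(3) prime_imp_coprime by blast
  then obtain k where k: "order ?G = p ^ 1 * k" by (auto simp: order_def)
  obtain U where U: "subgroup U ?G" "card U = p ^ 1" using sylow_thm[OF e(3) G.group_axioms k fin] by blast
  have "card U > 1" using U(2) prime_gt_1_nat[OF e(3)] by simp
  then have "EX x:U. x ~= \<one>\<^bsub>?G\<^esub>" using card_mono[of "{\<one>\<^bsub>?G\<^esub>}" U] by fastforce
  then obtain x where x: "x : U" "x ~= \<one>\<^bsub>?G\<^esub>" by blast
  interpret U: group "?G\<lparr>carrier := U\<rparr>" using G.subgroup_imp_group[OF U(1)] .
  have xG: "x : carrier ?G" using x(1) subgroup.subset[OF U(1)] by blast
  have "x [^]\<^bsub>?G\<lparr>carrier := U\<rparr>\<^esub> order (?G\<lparr>carrier := U\<rparr>) = \<one>\<^bsub>?G\<lparr>carrier := U\<rparr>\<^esub>"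
   using x(1) by (intro U.pow_order_eq_1) simp
  then have "x [^]\<^bsub>?G\<^esub> p = \<one>\<^bsub>?G\<^esub>" using U(2) by (simp add: order_def nat_pow_def)
  then have "G.ord x dvd p" using G.pow_eq_id[OF xG] by simp
  moreover obtain s where s: "s : H" "x = restrict s E" using xG by (auto elim!: restrictionsE)
  have "restrict (s ^^ e) E = one" unfolding oneH(1) restrict_eq using e(1)[OF s(1)] by simp
  then have "x [^]\<^bsub>?G\<^esub> e = \<one>\<^bsub>?G\<^esub>" using pw[OF s(1), of e] s(2) by simp
  then have "G.ord x dvd e" using G.pow_eq_id[OF xG] by simp
  ultimately have "G.ord x = 1" using e(2) by (meson coprime_common_divisor_nat)
  then have "x [^]\<^bsub>?G\<^esub> (1::nat) = \<one>\<^bsub>?G\<^esub>" using G.pow_eq_id[OF xG, of 1] by simp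
  then show False using x(2) G.nat_pow_eone[OF xG] by metis
 qed
qed

section \<open>The absolute value of the algebraic closure\<close>

text \<open>
  On a finite extension, the maximum norm with respect to an \<open>F\<close>-basis is multiplicative up to
  bounded factors, by compactness of the unit ball. Its homogenization is the absolute value.
\<close>

locale local_field =
 fixes v :: "'f::field => int"
 assumes local_field: "nonarch_local_field v"
begin

text \<open>The base 2 replaces the usual cardinality of the residue field, so that a uniformizer
  has absolute value 1/2 and all values are powers of 2.\<close>

definition av :: "'f => real" where
 "av x = (if x = 0 then 0 else 2 powr (- of_int (v x)))"

lemma v_mult: "x ~= 0 ==> y ~= 0 ==> v (x * y) = v x + v y"
 and v_add: "x ~= 0 ==> y ~= 0 ==> x + y ~= 0 ==> min (v x) (v y) <= v (x + y)"
 and v_surj: "EX \<pi>. \<pi> ~= 0 & v \<pi> = 1"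
 and v_complete: "(ALL c. EX M. ALL m>=M. ALL n>=M. s m - s n : val_ge v c) ==> EX l. ALL c. EX M. ALL n>=M. (s n :: 'f) - l : val_ge v c"
 and v_residue: "finite (val_ge v 0 // {(x, y). x : val_ge v 0 & y : val_ge v 0 & x - y : val_ge v 1})"
 for s :: "nat => 'f"
proof -
 note a = local_field[unfolded nonarch_local_field_def]
 show "x ~= 0 ==> y ~= 0 ==> v (x * y) = v x + v y" using conjunct1[OF a] by blast
 note a = conjunct2[OF a]
 show "x ~= 0 ==> y ~= 0 ==> x + y ~= 0 ==> min (v x) (v y) <= v (x + y)" using conjunct1[OF a] by blast
 note a = conjunct2[OF a]
 show "EX \<pi>. \<pi> ~= 0 & v \<pi> = 1" by (rule conjunct1[OF a])
 note a = conjunct2[OF a]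
 show "(ALL c. EX M. ALL m>=M. ALL n>=M. s m - s n : val_ge v c) ==> EX l. ALL c. EX M. ALL n>=M. (s n :: 'f) - l : val_ge v c"
  using spec[OF conjunct1[OF a], of s] by (rule mp)
 show "finite (val_ge v 0 // {(x, y). x : val_ge v 0 & y : val_ge v 0 & x - y : val_ge v 1})"
  by (rule conjunct2[OF a])
qed

lemma av_0 [simp]: "av 0 = 0" and av_nonneg [simp]: "av x >= 0" and av_eq_0 [simp]: "av x = 0 \<longleftrightarrow> x = 0"
 by (auto simp: av_def)

lemma av_mult: "av (x * y) = av x * av y"
 by (auto simp: av_def v_mult powr_add[symmetric])

lemma av_1 [simp]: "av 1 = 1"
 using av_mult[of 1 1] by (metis av_eq_0 mult_cancel_left2 mult_1 zero_neq_one)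

lemma av_add: "av (x + y) <= max (av x) (av y)"
proof (cases "x = 0 | y = 0 | x + y = 0")
 case False
 then show ?thesis using v_add[of x y] by (auto simp: av_def max_def min_def split: if_splits)
qed (auto simp: max_def)

lemma av_minus [simp]: "av (- x) = av x"
proof -
 have "av (- 1) * av (- 1) = 1" using av_mult[of "- 1" "- 1"] by simp
 then have "av (- 1) = 1" using av_nonneg[of "- 1"] by (metis abs_of_nonneg real_sqrt_abs2 real_sqrt_one)
 then show ?thesis using av_mult[of "- 1" x] by simp
qed

lemma av_diff: "av (x - y) <= max (av x) (av y)"
 using av_add[of x "- y"] by simp

lemma av_le_iff: "av x <= 2 powr (- of_int c) \<longleftrightarrow> x : val_ge v c"
 by (auto simp: av_def val_ge_def)

lemma av_of_nat_le: "av (of_nat n) <= 1"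
proof (induction n)
 case (Suc n)
 then show ?case using av_add[of 1 "of_nat n"] by simp
qed simp

definition \<pi> :: 'f where "\<pi> = (SOME \<pi>. \<pi> ~= 0 & v \<pi> = 1)"

lemma pi: "\<pi> ~= 0" "v \<pi> = 1" and av_pi: "av \<pi> = 1 / 2"
proof -
 show "\<pi> ~= 0" "v \<pi> = 1" using someI_ex[OF v_surj] by (auto simp: \<pi>_def)
 then show "av \<pi> = 1 / 2" by (simp add: av_def powr_minus)
qed

lemma av_power: "av (x ^ n) = av x ^ n"
 by (induction n) (auto simp: av_mult)

text \<open>Total boundedness of balls: finitely many residues give precision 1/2, and expansion in
  powers of the uniformizer gives the precision \<open>(1 / 2) ^ m\<close>. Multiplication by
  \<open>\<pi> ^ a\<close> reduces the ball of radius \<open>2 ^ a\<close> to the unit ball.\<close>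

lemma av_finite_cover: "EX T. finite T & (ALL x. av x <= 2 ^ a --> (EX t:T. av (x - t) <= (1 / 2) ^ m))"
proof -
 let ?r = "{(x, y). x : val_ge v 0 & y : val_ge v 0 & x - y : val_ge v 1}"
 define T where "T = (%C. SOME t. t : C) ` (val_ge v 0 // ?r)"
 have finT: "finite T" using v_residue by (simp add: T_def)
 have T: "EX t:T. av (x - t) <= 1 / 2" if "av x <= 1" for x
 proof -
  have x: "x : val_ge v 0" using that av_le_iff[of x 0] by simp
  let ?C = "?r `` {x}"
  have C: "?C : val_ge v 0 // ?r" using x by (rule quotientI)
  have "x - x : val_ge v 1" by (simp add: val_ge_def)
  then have "x : ?C" using x by simp
  then have "(SOME t. t : ?C) : ?C" by (rule someI)
  then have "x - (SOME t. t : ?C) : val_ge v 1" by blast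
  then have "av (x - (SOME t. t : ?C)) <= 1 / 2"
   using av_le_iff[of _ 1] by (simp add: powr_minus del: Image_singleton_iff)
  moreover have "(SOME t. t : ?C) : T" unfolding T_def using C by (rule imageI)
  ultimately show ?thesis by blast
 qed
 have U: "EX U. finite U & (ALL x. av x <= 1 --> (EX t:U. av (x - t) <= (1 / 2) ^ m))" for m
 proof (induction m)
  case 0
  show ?case by (intro exI[of _ "{0}"]) auto
 next
  case (Suc m)
  then obtain U where U: "finite U" "!!x. av x <= 1 ==> EX t:U. av (x - t) <= (1 / 2) ^ m" by blast
  show ?case
  proof (intro exI[of _ "(%(t, u). t + \<pi> * u) ` (T \<times> U)"] conjI allI impI)
   fix x assume "av x <= 1"
   then obtain t where t: "t : T" "av (x - t) <= 1 / 2" using T by blast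
   then have "av ((x - t) / \<pi>) <= 1"
    using av_mult[of "(x - t) / \<pi>" \<pi>] pi(1) av_pi by simp
   then obtain u where u: "u : U" "av ((x - t) / \<pi> - u) <= (1 / 2) ^ m" using U(2) by blast
   have "x - (t + \<pi> * u) = \<pi> * ((x - t) / \<pi> - u)" using pi(1) by (simp add: field_simps)
   then have "av (x - (t + \<pi> * u)) = 1 / 2 * av ((x - t) / \<pi> - u)" by (simp only: av_mult av_pi)
   then have "av (x - (t + \<pi> * u)) <= (1 / 2) ^ Suc m" using u(2) by simp
   then show "EX t:(%(t, u). t + \<pi> * u) ` (T \<times> U). av (x - t) <= (1 / 2) ^ Suc m" using t(1) u(1) by force
  qed (use finT U(1) in auto)
 qed
 obtain U where U: "finite U" "!!x. av x <= 1 ==> EX t:U. av (x - t) <= (1 / 2) ^ (m + a)" using U[of "m + a"] by blast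
 show ?thesis
 proof (intro exI[of _ "(%u. u / \<pi> ^ a) ` U"] conjI allI impI)
  fix x assume x: "av x <= 2 ^ a"
  have "av (x * \<pi> ^ a) <= 1" using x by (simp add: av_mult av_power av_pi power_one_over field_simps)
  then obtain u where u: "u : U" "av (x * \<pi> ^ a - u) <= (1 / 2) ^ (m + a)" using U(2) by blast
  have "x * \<pi> ^ a - u = (x - u / \<pi> ^ a) * \<pi> ^ a" using pi(1) by (simp add: field_simps)
  then have "av (x - u / \<pi> ^ a) * (1 / 2) ^ a <= (1 / 2) ^ m * (1 / 2) ^ a"
   using u(2) by (simp add: av_mult av_power av_pi power_add)
  then have "av (x - u / \<pi> ^ a) <= (1 / 2) ^ m" by (simp add: mult_le_cancel_right)
  then show "EX t:(%u. u / \<pi> ^ a) ` U. av (x - t) <= (1 / 2) ^ m" using u(1) by blast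
 qed (use U(1) in simp)
qed

lemma av_complete:
 assumes "!!m. av (s (Suc m) - s m) <= (1 / 2) ^ m"
 shows "EX l. ALL k. EX M. ALL n>=M. av (s n - l) <= (1 / 2) ^ k"
proof -
 have 1: "av (s n - s m) <= (1 / 2) ^ m" if "m <= n" for m n
  using that
 proof (induction n rule: dec_induct)
  case (step n)
  have "av (s (Suc n) - s m) <= max (av (s (Suc n) - s n)) (av (s n - s m))"
   using av_add[of "s (Suc n) - s n" "s n - s m"] by simp
  moreover have "(1 / 2 :: real) ^ n <= (1 / 2) ^ m" using step.hyps by (intro power_decreasing) auto
  ultimately show ?case using assms[of n] step.IH by linarith
 qed simp
 have pw: "2 powr (- of_int (int n)) = (1 / 2 :: real) ^ n" for n
  by (simp add: powr_minus powr_realpow power_one_over inverse_eq_divide)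
 have "ALL c. EX M. ALL m>=M. ALL n>=M. s m - s n : val_ge v c"
 proof (intro allI exI[of _ "nat c" for c] impI)
  fix c m n assume mn: "nat c <= m" "nat c <= n"
  have "av (s m - s n) <= max (av (s m - s (nat c))) (av (s n - s (nat c)))"
   using av_diff[of "s m - s (nat c)" "s n - s (nat c)"] by simp
  also have "... <= (1 / 2) ^ nat c" using 1 mn by simp
  also have "... = 2 powr (- of_int (int (nat c)))" by (simp only: pw)
  also have "... <= 2 powr (- of_int c)" by (intro powr_mono) auto
  finally show "s m - s n : val_ge v c" by (simp add: av_le_iff)
 qed
 then obtain l where l: "!!c. EX M. ALL n>=M. s n - l : val_ge v c" using v_complete[of s] by blast
 have "EX M. ALL n>=M. av (s n - l) <= (1 / 2) ^ k" for k
  using l[of "int k"] unfolding av_le_iff[symmetric] pw .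
 then show ?thesis by blast
qed

section \<open>The maximum norm with respect to a basis\<close>

definition field_basis :: "'f alg_closure set => bool" where
 "field_basis B \<longleftrightarrow> finite B & ac.independent B & intermediate_field (ac.span B)"

definition nB :: "'f alg_closure set => 'f alg_closure => real" where
 "nB B x = Max (insert 0 ((%b. av (ac.representation B x b)) ` B))"

context
 fixes B :: "'f alg_closure set"
 assumes B: "field_basis B"
begin

lemma fB: "finite B" and iB: "ac.independent B" and spB: "intermediate_field (ac.span B)"
 using B by (auto simp: field_basis_def)

lemmas span_closed = ifieldD[OF spB]

lemma nB_coord_le: "b : B ==> av (ac.representation B x b) <= nB B x"
 unfolding nB_def using fB by (intro Max_ge) auto

lemma nB_nonneg: "0 <= nB B x"
 unfolding nB_def using fB by (intro Max_ge) auto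

lemma nB_leI: "0 <= r ==> (!!b. b : B ==> av (ac.representation B x b) <= r) ==> nB B x <= r"
 unfolding nB_def using fB by (intro Max.boundedI) auto

lemma nB_attained: "nB B x = 0 | (EX b:B. nB B x = av (ac.representation B x b))"
 using Max_in[of "insert 0 ((%b. av (ac.representation B x b)) ` B)"] fB unfolding nB_def by auto

lemma rep_sum: "x : ac.span B ==> x = (SUM b:B. to_ac (ac.representation B x b) * b)"
 using ac.sum_representation_eq[OF iB _ fB order_refl] by simp

lemma nB_add: "x : ac.span B ==> y : ac.span B ==> nB B (x + y) <= max (nB B x) (nB B y)"
proof (intro nB_leI)
 fix b assume "b : B" and xy: "x : ac.span B" "y : ac.span B"
 have "av (ac.representation B (x + y) b) <= max (av (ac.representation B x b)) (av (ac.representation B y b))"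
  using ac.representation_add[OF iB xy(2,1)] av_add by simp
 then show "av (ac.representation B (x + y) b) <= max (nB B x) (nB B y)"
  using nB_coord_le[OF \<open>b : B\<close>] by (meson max.mono order_trans)
qed (use nB_nonneg in \<open>auto simp: le_max_iff_disj\<close>)

lemma nB_scale: "x : ac.span B ==> nB B (to_ac c * x) = av c * nB B x"
proof -
 assume x: "x : ac.span B"
 have r: "av (ac.representation B (to_ac c * x) b) = av c * av (ac.representation B x b)" for b
  by (simp add: ac.representation_scale[OF iB x] av_mult)
 show ?thesis
 proof (rule antisym)
  show "nB B (to_ac c * x) <= av c * nB B x"
   by (rule nB_leI) (auto simp: r nB_nonneg nB_coord_le mult_left_mono)
  show "av c * nB B x <= nB B (to_ac c * x)"
   using nB_attained[of x] nB_nonneg nB_coord_le[of _ "to_ac c * x"] by (auto simp: r)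
 qed
qed

lemma nB_minus: "x : ac.span B ==> nB B (- x) = nB B x"
 using nB_scale[of x "- 1"] by simp

lemma nB_diff: "x : ac.span B ==> y : ac.span B ==> nB B (x - y) <= max (nB B x) (nB B y)"
 using nB_add[of x "- y"] nB_minus[of y] span_closed(7)[of y] by simp

lemma nB_eq_0: "x : ac.span B ==> nB B x = 0 \<longleftrightarrow> x = 0"
proof
 assume x: "x : ac.span B" and 0: "nB B x = 0"
 have "ac.representation B x b = 0" if "b : B" for b
  using nB_coord_le[OF that, of x] 0 av_nonneg[of "ac.representation B x b"] by (metis antisym av_eq_0)
 then show "x = 0" using rep_sum[OF x] by simp
next
 show "x = 0 ==> nB B x = 0" using nB_scale[OF span_closed(2), of 0] by simp
qed

lemma nB_pos: "x : ac.span B ==> x ~= 0 ==> 0 < nB B x"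
 using nB_eq_0[of x] nB_nonneg[of x] by linarith

lemma nB_sum_le:
 assumes "0 <= r" "!!i. i : A ==> g i : ac.span B" "!!i. i : A ==> nB B (g i) <= r"
 shows "nB B (sum g A) <= r"
 using assms(2,3)
proof (induction A rule: infinite_finite_induct)
 case (insert i A)
 then have "sum g A : ac.span B" by (intro ac.span_sum) auto
 then have "nB B (sum g (insert i A)) <= max (nB B (g i)) (nB B (sum g A))"
  using insert nB_add by simp
 moreover have "nB B (g i) <= r" "nB B (sum g A) <= r" using insert by auto
 ultimately show ?case by (meson max.boundedI order_trans)
qed (use assms(1) nB_eq_0[OF span_closed(2)] in auto)

lemma nB_mult_upper: "EX C>0. ALL x:ac.span B. ALL y:ac.span B. nB B (x * y) <= C * nB B x * nB B y"
proof -
 \<comment> \<open>The largest norm of a product of two basis vectors suffices by the ultrametric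
   inequality; the inserted 1 makes it positive.\<close>
 define C where "C = Max (insert 1 ((%(b, c). nB B (b * c)) ` (B \<times> B)))"
 have C1: "1 <= C" unfolding C_def using fB by (intro Max_ge) auto
 have C: "nB B (b * c) <= C" if "b : B" "c : B" for b c
  unfolding C_def using fB that by (intro Max_ge) auto
 show ?thesis
 proof (intro exI[of _ C] conjI ballI)
  fix x y assume xy: "x : ac.span B" "y : ac.span B"
  let ?x = "ac.representation B x" and ?y = "ac.representation B y"
  have bs: "b : ac.span B" if "b : B" for b using that ac.span_base by blast
  have "x * y = (SUM b:B. to_ac (?x b) * b) * (SUM c:B. to_ac (?y c) * c)"
   using rep_sum[OF xy(1)] rep_sum[OF xy(2)] by simp
  also have "... = (SUM b:B. SUM c:B. to_ac (?x b * ?y c) * (b * c))"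
   unfolding sum_product by (intro sum.cong refl) simp
  finally have eq: "x * y = (SUM b:B. SUM c:B. to_ac (?x b * ?y c) * (b * c))" .
  have "nB B (to_ac (?x b * ?y c) * (b * c)) <= C * nB B x * nB B y" if bc: "b : B" "c : B" for b c
  proof -
   have "nB B (to_ac (?x b * ?y c) * (b * c)) = (av (?x b) * av (?y c)) * nB B (b * c)"
    using bs bc span_closed(5) by (subst nB_scale) (auto simp: av_mult)
   also have "... <= (nB B x * nB B y) * C"
    using bc C1 nB_nonneg by (intro mult_mono nB_coord_le C) auto
   finally show ?thesis by (simp add: mult_ac)
  qed
  then show "nB B (x * y) <= C * nB B x * nB B y"
   unfolding eq using C1 nB_nonneg bs span_closed(1,5)
   by (intro nB_sum_le ac.span_sum) auto
 qed (use C1 in auto)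
qed

lemma rep_lincomb:
 assumes b: "b : B" shows "ac.representation B (SUM b:B. to_ac (f b) * b) b = f b"
proof -
 have "ac.representation B (SUM b:B. to_ac (f b) * b) b = (SUM c:B. ac.representation B (to_ac (f c) * c) b)"
  using ac.representation_sum[OF iB, of B "%b. to_ac (f b) * b"] by (simp add: ac.span_scale ac.span_base)
 also have "... = (SUM c:B. if c = b then f c else 0)"
  by (intro sum.cong refl) (simp add: ac.representation_scale[OF iB] ac.span_base ac.representation_basis[OF iB])
 finally show ?thesis using fB b by simp
qed

lemma nB_finite_cover: "EX T. finite T & T <= ac.span B &
  (ALL x:ac.span B. nB B x <= 2 ^ a --> (EX t:T. nB B (x - t) <= (1 / 2) ^ m))"
proof -
 obtain T where T: "finite T" "!!x. av x <= 2 ^ a ==> EX t:T. av (x - t) <= (1 / 2) ^ m"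
  using av_finite_cover[of a m] by blast
 let ?g = "%f. SUM b:B. to_ac (f b) * b"
 have gs: "?g f : ac.span B" for f by (intro ac.span_sum ac.span_scale ac.span_base)
 show ?thesis
 proof (intro exI[of _ "?g ` (Pi\<^sub>E B (%_. T))"] conjI ballI impI)
  show "finite (?g ` (Pi\<^sub>E B (%_. T)))" using fB T(1) by (intro finite_imageI finite_PiE) auto
  show "?g ` (Pi\<^sub>E B (%_. T)) <= ac.span B" using gs by blast
  fix x assume x: "x : ac.span B" "nB B x <= 2 ^ a"
  have "EX t:T. av (ac.representation B x b - t) <= (1 / 2) ^ m" if "b : B" for b
   using T(2) nB_coord_le[OF that, of x] x(2) by (meson order_trans)
  then obtain f where f: "!!b. b : B ==> f b : T & av (ac.representation B x b - f b) <= (1 / 2) ^ m" by metis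
  let ?f = "restrict f B"
  have "x - ?g ?f = (SUM b:B. to_ac (ac.representation B x b) * b) - ?g f" using rep_sum[OF x(1)] by simp
  also have "... = ?g (%b. ac.representation B x b - f b)"
   by (simp add: sum_subtractf[symmetric] left_diff_distrib)
  finally have eq: "x - ?g ?f = ?g (%b. ac.representation B x b - f b)" .
  have "nB B (?g (%b. ac.representation B x b - f b)) <= (1 / 2) ^ m"
   using f by (intro nB_leI) (simp_all only: rep_lincomb, simp_all)
  moreover have "?f : Pi\<^sub>E B (%_. T)" using f by auto
  ultimately show "EX t:?g ` (Pi\<^sub>E B (%_. T)). nB B (x - t) <= (1 / 2) ^ m"
   by (intro bexI[of _ "?g ?f"] imageI) (simp_all only: eq)
 qed
qed

lemma nB_complete:
 assumes s: "!!m. s m : ac.span B" "!!m. nB B (s (Suc m) - s m) <= (1 / 2) ^ m"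
 shows "EX t:ac.span B. ALL k. EX M. ALL n>=M. nB B (s n - t) <= (1 / 2) ^ k"
proof -
 let ?r = "%n. ac.representation B (s n)"
 have "EX l. ALL k. EX M. ALL n>=M. av (?r n b - l) <= (1 / 2) ^ k" if "b : B" for b
 proof (rule av_complete)
  fix m
  have "av (?r (Suc m) b - ?r m b) = av (ac.representation B (s (Suc m) - s m) b)"
   by (simp add: ac.representation_diff[OF iB s(1) s(1)])
  then show "av (?r (Suc m) b - ?r m b) <= (1 / 2) ^ m"
   using nB_coord_le[OF that] s(2) by (metis order_trans)
 qed
 then obtain l where l: "!!b k. b : B ==> EX M. ALL n>=M. av (?r n b - l b) <= (1 / 2) ^ k" by metis
 define t where "t = (SUM b:B. to_ac (l b) * b)"
 have t: "t : ac.span B" unfolding t_def by (intro ac.span_sum ac.span_scale ac.span_base)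
 have rt: "ac.representation B t b = l b" if b: "b : B" for b
  unfolding t_def by (rule rep_lincomb[OF b])
 have "EX M. ALL n>=M. nB B (s n - t) <= (1 / 2) ^ k" for k
 proof -
  have "ALL b:B. EX M. ALL n>=M. av (?r n b - l b) <= (1 / 2) ^ k" using l by blast
  then obtain M where M: "ALL b:B. ALL n>=M b. av (?r n b - l b) <= (1 / 2) ^ k" by (metis bchoice)
  have "nB B (s n - t) <= (1 / 2) ^ k" if n: "n >= Max (insert 0 (M ` B))" for n
  proof (rule nB_leI)
   fix b assume b: "b : B"
   then have "n >= M b" using n fB by (meson Max_ge finite_imageI finite_insert image_eqI insertI2 order_trans)
   then show "av (ac.representation B (s n - t) b) <= (1 / 2) ^ k"
   proof -
    have "av (?r n b - l b) <= (1 / 2) ^ k" using M b \<open>n >= M b\<close> by blast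
    then show ?thesis by (simp only: ac.representation_diff[OF iB t s(1)] rt[OF b])
   qed
  qed simp
  then show ?thesis by blast
 qed
 then show ?thesis using t by blast
qed

text \<open>If products of vectors of norm 1 could be arbitrarily small, the left factors would have
  a limit point \<open>t\<close> of norm 1. Multiplication by \<open>t\<close> would then fail to be
  bounded below, although \<open>t\<close> is invertible in the field.\<close>

lemma nB_mult_lower: "EX \<delta>>0. ALL x:ac.span B. ALL y:ac.span B. \<delta> * nB B x * nB B y <= nB B (x * y)"
proof -
 let ?K = "ac.span B"
 obtain C where C: "C > 0" "!!x y. x : ?K ==> y : ?K ==> nB B (x * y) <= C * nB B x * nB B y"
  using nB_mult_upper by blast
 \<comment> \<open>\<open>D t m\<close> says that the ball of radius \<open>(1 / 2) ^ m\<close>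
   about \<open>t\<close> contains left factors of products as small as desired; nested balls with
   this property converge to the limit point.\<close>
 define D where "D = (%t m. ALL k. EX x:?K. EX y:?K. nB B x = 1 & nB B y = 1 & nB B (x - t) <= (1 / 2) ^ m & nB B (x * y) <= (1 / 2) ^ k)"
 have "EX k. ALL x:?K. ALL y:?K. nB B x = 1 --> nB B y = 1 --> (1 / 2) ^ k < nB B (x * y)"
 proof (rule ccontr)
  assume no: "\<nexists>k. ALL x:?K. ALL y:?K. nB B x = 1 --> nB B y = 1 --> (1 / 2) ^ k < nB B (x * y)"
  have D0: "D 0 0" unfolding D_def
  proof
   fix k
   obtain x y where "x : ?K" "y : ?K" "nB B x = 1" "nB B y = 1" "~ (1 / 2) ^ k < nB B (x * y)"
    using no by blast
   then show "EX x:?K. EX y:?K. nB B x = 1 & nB B y = 1 & nB B (x - 0) <= (1 / 2) ^ 0 & nB B (x * y) <= (1 / 2) ^ k"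
    by (intro bexI[of _ x] bexI[of _ y]) auto
  qed
  have step: "EX t'. (t' : ?K & D t' (Suc m)) & nB B (t' - t) <= (1 / 2) ^ m" if t: "t : ?K & D t m" for t m
  proof (rule ccontr)
   assume no: "\<nexists>t'. (t' : ?K & D t' (Suc m)) & nB B (t' - t) <= (1 / 2) ^ m"
   obtain T where T: "finite T" "T <= ?K" "!!x. x : ?K ==> nB B x <= 1 ==> EX u:T. nB B (x - u) <= (1 / 2) ^ Suc m"
    using nB_finite_cover[of 0 "Suc m"] by auto
   let ?T = "{u : T. nB B (u - t) <= (1 / 2) ^ m}"
   have "ALL u:?T. EX k. ALL x:?K. ALL y:?K. nB B x = 1 --> nB B y = 1 --> nB B (x - u) <= (1 / 2) ^ Suc m --> ~ nB B (x * y) <= (1 / 2) ^ k"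
   proof (rule ballI, rule ccontr)
    fix u assume u: "u : ?T" and n: "\<nexists>k. ALL x:?K. ALL y:?K. nB B x = 1 --> nB B y = 1 --> nB B (x - u) <= (1 / 2) ^ Suc m --> ~ nB B (x * y) <= (1 / 2) ^ k"
    have "D u (Suc m)" unfolding D_def
    proof
     fix k
     show "EX x:?K. EX y:?K. nB B x = 1 & nB B y = 1 & nB B (x - u) <= (1 / 2) ^ Suc m & nB B (x * y) <= (1 / 2) ^ k"
      using n by (simp only: not_ex not_all not_imp not_not Ball_def Bex_def)
    qed
    then show False using no u T(2) by blast
   qed
   then obtain k where k0: "ALL u:?T. ALL x:?K. ALL y:?K. nB B x = 1 --> nB B y = 1 --> nB B (x - u) <= (1 / 2) ^ Suc m --> ~ nB B (x * y) <= (1 / 2) ^ k u"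
    by (rule bchoice[THEN exE])
   then have k: "!!u x y. u : ?T ==> x : ?K ==> y : ?K ==> nB B x = 1 ==> nB B y = 1 ==>
     nB B (x - u) <= (1 / 2) ^ Suc m ==> ~ nB B (x * y) <= (1 / 2) ^ k u" by blast
   let ?k = "Max (insert 0 (k ` ?T))"
   obtain x y where xy: "x : ?K" "y : ?K" "nB B x = 1" "nB B y = 1" "nB B (x - t) <= (1 / 2) ^ m" "nB B (x * y) <= (1 / 2) ^ ?k"
    using t unfolding D_def by blast
   obtain u where u: "u : T" "nB B (x - u) <= (1 / 2) ^ Suc m" using T(3)[OF xy(1)] xy(3) by auto
   have uK: "u : ?K" using u(1) T(2) by blast
   have "u - t = (x - t) - (x - u)" by simp
   then have "nB B (u - t) <= max (nB B (x - t)) (nB B (x - u))"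
    using nB_diff[of "x - t" "x - u"] span_closed(4) xy(1) t uK by metis
   also have "... <= (1 / 2) ^ m" using xy(5) u(2) by (auto intro: order_trans[OF u(2)])
   finally have uT: "u : ?T" using u(1) by simp
   then have "k u <= ?k" using T(1) by (intro Max_ge) auto
   then have "(1 / 2 :: real) ^ ?k <= (1 / 2) ^ k u" by (intro power_decreasing) auto
   then show False using k[OF uT xy(1-4) u(2)] xy(6) by linarith
  qed
  obtain s where s: "!!m. s m : ?K & D (s m) m" "!!m. nB B (s (Suc m) - s m) <= (1 / 2) ^ m"
   using dependent_nat_choice[of "%m t. t : ?K & D t m" "%m t t'. nB B (t' - t) <= (1 / 2) ^ m"]
    D0 span_closed(2) step by metis
  obtain t where t: "t : ?K" "!!k. EX M. ALL n>=M. nB B (s n - t) <= (1 / 2) ^ k"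
   using nB_complete[of s] s by blast
  have Dt: "EX x:?K. EX y:?K. nB B x = 1 & nB B y = 1 & nB B (x - t) <= (1 / 2) ^ m & nB B (x * y) <= (1 / 2) ^ m" for m
  proof -
   obtain M where M: "!!n. n >= M ==> nB B (s n - t) <= (1 / 2) ^ m" using t(2) by blast
   let ?n = "max m M"
   obtain x y where xy: "x : ?K" "y : ?K" "nB B x = 1" "nB B y = 1" "nB B (x - s ?n) <= (1 / 2) ^ ?n" "nB B (x * y) <= (1 / 2) ^ m"
    using s(1)[of ?n] unfolding D_def by blast
   have "nB B (x - t) <= max (nB B (x - s ?n)) (nB B (s ?n - t))"
    using nB_add[OF span_closed(4)[OF xy(1) conjunct1[OF s(1)[of ?n]]] span_closed(4)[OF conjunct1[OF s(1)[of ?n]] t(1)]] by simp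
   also have "... <= (1 / 2) ^ m"
    using M[of ?n] order_trans[OF xy(5) power_decreasing[of m ?n "1 / 2 :: real"]] by auto
   finally show ?thesis using xy by blast
  qed
  have t0: "t ~= 0" using Dt[of 1] by force
  define i where "i = inverse t"
  have i: "i : ?K" "i * t = 1" using span_closed(6)[OF t(1)] t0 by (auto simp: i_def)
  \<comment> \<open>Since \<open>y = i * (x * y - (x - t) * y)\<close>, the norm 1 of
    \<open>y\<close> is at most \<open>?c * (1 / 2) ^ m\<close>, which is impossible for large
    \<open>m\<close>.\<close>
  let ?c = "C * nB B i * max 1 C"
  have "(%m. ?c * (1 / 2) ^ m) \<longlonglongrightarrow> ?c * 0" by (intro tendsto_mult_left LIMSEQ_power_zero) auto
  then have "eventually (%m. ?c * (1 / 2) ^ m < 1) sequentially" by (rule order_tendstoD) simp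
  then obtain m where m: "?c * (1 / 2) ^ m < 1" by (auto simp: eventually_sequentially)
  obtain x y where xy: "x : ?K" "y : ?K" "nB B x = 1" "nB B y = 1" "nB B (x - t) <= (1 / 2) ^ m" "nB B (x * y) <= (1 / 2) ^ m"
   using Dt by blast
  have K': "x * y : ?K" "(x - t) * y : ?K" "x - t : ?K" using xy t span_closed(4,5) by auto
  have "y = i * (x * y - (x - t) * y)" using i(2) by (simp add: algebra_simps mult.assoc[symmetric])
  then have le1: "1 <= C * nB B i * nB B (x * y - (x - t) * y)" using C(2)[OF i(1) span_closed(4)[OF K'(1,2)]] xy(4) by simp
  have Ci: "0 <= C * nB B i" using C(1) nB_nonneg by simp
  have "nB B ((x - t) * y) <= C * nB B (x - t)" using C(2)[OF K'(3) xy(2)] xy(4) by simp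
  also have "... <= C * (1 / 2) ^ m" using xy(5) C(1) by (intro mult_left_mono) auto
  finally have "nB B ((x - t) * y) <= C * (1 / 2) ^ m" .
  moreover have "C * (1 / 2) ^ m <= max 1 C * (1 / 2) ^ m" "1 * (1 / 2) ^ m <= max 1 C * (1 / 2 :: real) ^ m"
   by (intro mult_right_mono; simp)+
  ultimately have "nB B (x * y - (x - t) * y) <= max 1 C * (1 / 2) ^ m"
   using xy(6) nB_diff[OF K'(1,2)] by linarith
  then have "C * nB B i * nB B (x * y - (x - t) * y) <= C * nB B i * (max 1 C * (1 / 2) ^ m)"
   using Ci by (rule mult_left_mono)
  then show False using m le1 by (simp add: mult.assoc)
 qed
 then obtain k where k: "!!x y. x : ?K ==> y : ?K ==> nB B x = 1 ==> nB B y = 1 ==> (1 / 2) ^ k < nB B (x * y)" by blast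
 have norm: "EX c. c ~= 0 & av c = nB B x" if "x : ?K" "x ~= 0" for x
  using nB_attained[of x] nB_pos[OF that] by (metis av_eq_0 less_irrefl)
 show ?thesis
 proof (intro exI[of _ "(1 / 2) ^ k"] conjI ballI)
  fix x y assume xy: "x : ?K" "y : ?K"
  show "(1 / 2) ^ k * nB B x * nB B y <= nB B (x * y)"
  proof (cases "x = 0 | y = 0")
   case True
   then have "nB B x = 0 | nB B y = 0" using nB_eq_0 xy by blast
   then show ?thesis using nB_nonneg by auto
  next
   case False
   obtain c d where c: "c ~= 0" "av c = nB B x" and d: "d ~= 0" "av d = nB B y" using norm xy False by metis
   define x' where "x' = to_ac (inverse c) * x"
   define y' where "y' = to_ac (inverse d) * y"
   have K': "x' : ?K" "y' : ?K" unfolding x'_def y'_def using xy span_closed(1,5) by blast+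
   have x: "x = to_ac c * x'" "y = to_ac d * y'" using c(1) d(1) by (auto simp: x'_def y'_def)
   have "av c * nB B x' = av c" "av d * nB B y' = av d" using nB_scale[OF K'(1), of c] nB_scale[OF K'(2), of d] x c d by auto
   then have "nB B x' = 1" "nB B y' = 1" using c(1) d(1) by auto
   then have "(1 / 2) ^ k < nB B (x' * y')" using k K' by blast
   then have "(1 / 2) ^ k * (av c * av d) <= nB B (x' * y') * (av c * av d)" by (intro mult_right_mono) auto
   moreover have "x * y = to_ac (c * d) * (x' * y')" by (simp add: x)
   then have "nB B (x * y) = av c * av d * nB B (x' * y')"
    using nB_scale[OF span_closed(5)[OF K'], of "c * d"] by (simp add: av_mult)
   ultimately show ?thesis using c d by (simp add: mult_ac)
  qed
 qed simp
qed

end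

end

text \<open>Comparing \<open>a (m * n)\<close> with both \<open>m * a n\<close> and
  \<open>n * a m\<close> bounds the difference of the latter two by \<open>(m + n + 2) * D\<close>.
  Hence the quotients \<open>a n / n\<close> are Cauchy, and dividing by \<open>m\<close> and
  letting \<open>m\<close> grow leaves the error \<open>D\<close>.\<close>

lemma quasi_additive_limit:
 fixes a :: "nat => real"
 assumes "!!m n. \<bar>a (m + n) - a m - a n\<bar> <= D"
 shows "convergent (%n. a n / n)" "\<bar>a n - n * lim (%n. a n / n)\<bar> <= D"
proof -
 have mul: "\<bar>a (m * n) - m * a n\<bar> <= (m + 1) * D" for m n
 proof (induction m)
  case 0
  then show ?case using assms[of 0 0] by simp
 next
  case (Suc m)
  then show ?case using assms[of n "m * n"] by (simp add: algebra_simps)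
 qed
 have D: "0 <= D" using assms[of 0 0] by linarith
 have key: "\<bar>n * a m - m * a n\<bar> <= (m + n + 2) * D" for m n
  using mul[of m n] mul[of n m] by (simp add: mult.commute algebra_simps)
 have diff: "\<bar>a m / m - a n / n\<bar> <= 2 * D / m + 2 * D / n" if "m > 0" "n > 0" for m n
 proof -
  have "\<bar>a m / m - a n / n\<bar> = \<bar>n * a m - m * a n\<bar> / (m * n)"
   using that by (simp add: field_simps abs_divide flip: abs_mult)
  also have "... <= (2 * (m + n)) * D / (m * n)"
  proof (rule divide_right_mono)
   have "(real (m + n + 2)) * D <= (2 * (m + n)) * D" using that D by (intro mult_right_mono) auto
   then show "\<bar>real n * a m - real m * a n\<bar> <= real (2 * (m + n)) * D" using key[where m = m and n = n] by (simp add: add_ac)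
  qed simp
  also have "... = 2 * D / m + 2 * D / n" using that by (simp add: field_simps)
  finally show ?thesis .
 qed
 have "Cauchy (%n. a n / n)"
 proof (rule CauchyI)
  fix e :: real assume e: "0 < e"
  obtain M :: nat where M: "M > 0" "4 * D / e < M" using reals_Archimedean2[of "max 0 (4 * D / e)"] by auto
  have "norm (a m / m - a n / n) < e" if "m >= M" "n >= M" for m n
  proof -
   have "2 * D / m <= 2 * D / M" "2 * D / n <= 2 * D / M" using that M D by (auto intro!: divide_left_mono)
   moreover have "2 * D / M + 2 * D / M < e" using M e by (simp add: field_simps)
   ultimately show ?thesis using diff[of m n] that M by simp
  qed
  then show "EX M. ALL m>=M. ALL n>=M. norm (a m / m - a n / n) < e" by blast
 qed
 then show c: "convergent (%n. a n / n)" by (simp add: Cauchy_convergent_iff)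
 let ?L = "lim (%n. a n / n)"
 have L: "(%n. a n / n) \<longlonglongrightarrow> ?L" using c by (simp add: convergent_LIMSEQ_iff)
 show "\<bar>a n - n * ?L\<bar> <= D"
 proof (cases "n = 0")
  case True
  then show ?thesis using assms[of 0 0] by simp
 next
  case False
  have "(%m. \<bar>a n - n * (a m / m)\<bar>) \<longlonglongrightarrow> \<bar>a n - n * ?L\<bar>" by (intro tendsto_intros L)
  moreover have "(%m. D + (n + 2) * D / m) \<longlonglongrightarrow> D + 0"
   by (intro tendsto_add tendsto_const lim_const_over_n)
  moreover have "\<bar>a n - n * (a m / m)\<bar> <= D + (n + 2) * D / m" if "m > 0" for m
  proof -
   have "\<bar>a n - n * (a m / m)\<bar> = \<bar>n * a m - m * a n\<bar> / m" using that by (simp add: field_simps abs_divide)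
   also have "... <= (m + n + 2) * D / m" using key[where m = m and n = n] by (intro divide_right_mono) (simp_all add: add_ac)
   also have "... = D + (n + 2) * D / m" using that by (simp add: add_divide_distrib distrib_right)
   finally show ?thesis .
  qed
  ultimately have "\<bar>a n - n * ?L\<bar> <= D + 0"
   by (intro LIMSEQ_le[of "%m. \<bar>a n - n * (a m / m)\<bar>" _ "%m. D + (n + 2) * D / m"] exI[of _ 1]) auto
  then show ?thesis by simp
 qed
qed

context local_field
begin

text \<open>The logarithm of the spectral norm. Passing to powers and dividing by the exponent
  removes the bounded error by which \<open>nB\<close> fails to be multiplicative.\<close>

definition log_norm :: "'f alg_closure set => 'f alg_closure => real" where
 "log_norm B x = lim (%n. ln (nB B (x ^ n)) / n)"

context
 fixes B :: "'f alg_closure set"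
 assumes B: "field_basis B"
begin

lemma nB_quasi: "EX D. ALL x:ac.span B - {0}. ALL y:ac.span B - {0}. \<bar>ln (nB B (x * y)) - ln (nB B x) - ln (nB B y)\<bar> <= D"
proof -
 obtain C where C: "C > 0" "!!x y. x : ac.span B ==> y : ac.span B ==> nB B (x * y) <= C * nB B x * nB B y"
  using nB_mult_upper[OF B] by blast
 obtain \<delta> where d: "\<delta> > 0" "!!x y. x : ac.span B ==> y : ac.span B ==> \<delta> * nB B x * nB B y <= nB B (x * y)"
  using nB_mult_lower[OF B] by blast
 show ?thesis
 proof (intro exI[of _ "\<bar>ln C\<bar> + \<bar>ln \<delta>\<bar>"] ballI)
  fix x y assume xy: "x : ac.span B - {0}" "y : ac.span B - {0}"
  then have p: "nB B x > 0" "nB B y > 0" "nB B (x * y) > 0"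
   using nB_pos[OF B] span_closed(5)[OF B] by auto
  have "ln (nB B (x * y)) <= ln (C * nB B x * nB B y)" using C(2) xy p C(1) by simp
  also have "... = ln C + ln (nB B x) + ln (nB B y)" using p C(1) by (simp add: ln_mult)
  finally have 1: "ln (nB B (x * y)) <= ln C + ln (nB B x) + ln (nB B y)" .
  have "ln \<delta> + ln (nB B x) + ln (nB B y) = ln (\<delta> * nB B x * nB B y)" using p d(1) by (simp add: ln_mult)
  also have "... <= ln (nB B (x * y))" using d(2) xy p d(1) by simp
  finally show "\<bar>ln (nB B (x * y)) - ln (nB B x) - ln (nB B y)\<bar> <= \<bar>ln C\<bar> + \<bar>ln \<delta>\<bar>" using 1 by linarith
 qed
qed

lemma log_norm_quasi:
 obtains D where "!!x. x : ac.span B ==> x ~= 0 ==> (%n. ln (nB B (x ^ n)) / n) \<longlonglongrightarrow> log_norm B x"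
  "!!x n. x : ac.span B ==> x ~= 0 ==> \<bar>ln (nB B (x ^ n)) - n * log_norm B x\<bar> <= D"
  "ALL x:ac.span B - {0}. ALL y:ac.span B - {0}. \<bar>ln (nB B (x * y)) - ln (nB B x) - ln (nB B y)\<bar> <= D"
proof -
 obtain D where D: "ALL x:ac.span B - {0}. ALL y:ac.span B - {0}. \<bar>ln (nB B (x * y)) - ln (nB B x) - ln (nB B y)\<bar> <= D"
  using nB_quasi by (rule exE)
 have q: "\<bar>ln (nB B (x ^ (m + n))) - ln (nB B (x ^ m)) - ln (nB B (x ^ n))\<bar> <= D" if "x : ac.span B" "x ~= 0" for x m n
  using D span_closed(10)[OF B that(1)] that(2) by (simp add: power_add)
 show ?thesis
 proof (rule that[OF _ _ D])
  fix x n assume x: "x : ac.span B" "x ~= 0"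
  show "(%n. ln (nB B (x ^ n)) / n) \<longlonglongrightarrow> log_norm B x"
   unfolding log_norm_def using quasi_additive_limit(1)[of "%n. ln (nB B (x ^ n))", OF q[OF x]]
   by (simp add: convergent_LIMSEQ_iff)
  show "\<bar>ln (nB B (x ^ n)) - n * log_norm B x\<bar> <= D"
   unfolding log_norm_def using quasi_additive_limit(2)[of "%n. ln (nB B (x ^ n))", OF q[OF x]] .
 qed
qed

lemma log_norm_limit:
 assumes "x : ac.span B" "x ~= 0" shows "(%n. ln (nB B (x ^ n)) / n) \<longlonglongrightarrow> log_norm B x"
 by (rule log_norm_quasi) (use assms in blast)

lemma log_norm_mult:
 assumes x: "x : ac.span B" "x ~= 0" and y: "y : ac.span B" "y ~= 0"
 shows "log_norm B (x * y) = log_norm B x + log_norm B y"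
proof -
 obtain D where D: "ALL x:ac.span B - {0}. ALL y:ac.span B - {0}. \<bar>ln (nB B (x * y)) - ln (nB B x) - ln (nB B y)\<bar> <= D"
  using nB_quasi by (rule exE)
 have xy: "x * y : ac.span B" "x * y ~= 0" using x y span_closed(5)[OF B] by auto
 let ?d = "%n. ln (nB B ((x * y) ^ n)) / n - ln (nB B (x ^ n)) / n - ln (nB B (y ^ n)) / n"
 have "?d \<longlonglongrightarrow> log_norm B (x * y) - log_norm B x - log_norm B y"
  by (intro tendsto_diff log_norm_limit x y xy)
 moreover have "?d \<longlonglongrightarrow> 0"
 proof (rule Lim_null_comparison)
  show "eventually (%n. norm (?d n) <= D / n) sequentially"
  proof (intro always_eventually allI)
   fix n
   have "norm (?d n) = \<bar>ln (nB B (x ^ n * y ^ n)) - ln (nB B (x ^ n)) - ln (nB B (y ^ n))\<bar> / n"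
    by (simp add: power_mult_distrib abs_divide flip: diff_divide_distrib)
   also have "... <= D / n" using D span_closed(10)[OF B x(1)] span_closed(10)[OF B y(1)] x(2) y(2)
    by (intro divide_right_mono) auto
   finally show "norm (?d n) <= D / n" .
  qed
  show "(%n. D / real n) \<longlonglongrightarrow> 0" by (rule lim_const_over_n)
 qed
 ultimately have "log_norm B (x * y) - log_norm B x - log_norm B y = 0" by (rule LIMSEQ_unique)
 then show ?thesis by simp
qed

lemma log_norm_to_ac:
 assumes "c ~= 0" shows "log_norm B (to_ac c) = ln (av c)"
proof -
 have "(%n. ln (nB B (to_ac c ^ n)) / n) \<longlonglongrightarrow> log_norm B (to_ac c)"
  using log_norm_limit[OF span_closed(1)[OF B]] assms by simp
 have "ln (nB B (to_ac c ^ n)) / n = ln (av c) + ln (nB B 1) / n" if "n > 0" for n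
 proof -
  have "nB B (to_ac c ^ n) = av c ^ n * nB B 1"
   using nB_scale[OF B span_closed(3)[OF B], of "c ^ n"] by (simp add: av_power)
  moreover have "nB B 1 > 0" "av c > 0"
   using nB_pos[OF B span_closed(3)[OF B]] assms av_nonneg[of c] by (auto simp: less_le simp del: av_nonneg)
  moreover have "av c ^ n > 0" using \<open>av c > 0\<close> by simp
  ultimately have "ln (nB B (to_ac c ^ n)) = n * ln (av c) + ln (nB B 1)" by (simp add: ln_mult_pos ln_realpow)
  then show ?thesis using that by (simp add: add_divide_distrib)
 qed
 then have e: "\<forall>\<^sub>F n in sequentially. ln (av c) + ln (nB B 1) / n = ln (nB B (to_ac c ^ n)) / n"
  by (auto simp: eventually_sequentially intro!: exI[of _ 1])
 have l: "(%n. ln (av c) + ln (nB B 1) / n) \<longlonglongrightarrow> ln (av c) + 0"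
  by (intro tendsto_add tendsto_const lim_const_over_n)
 have "(%n. ln (nB B (to_ac c ^ n)) / n) \<longlonglongrightarrow> ln (av c) + 0"
  by (rule Lim_transform_eventually[OF l e])
 then show ?thesis
  using LIMSEQ_unique[OF \<open>(%n. ln (nB B (to_ac c ^ n)) / n) \<longlonglongrightarrow> log_norm B (to_ac c)\<close>] by simp
qed

text \<open>The powers of \<open>x\<close> have norm at most \<open>exp D\<close>, and binomial
  coefficients have absolute value at most 1, so the powers of \<open>1 + x\<close> obey the same
  bound. After scaling this becomes the ultrametric inequality.\<close>

lemma log_norm_1_plus:
 assumes x: "x : ac.span B" "x ~= 0" "1 + x ~= 0" and le: "log_norm B x <= 0"
 shows "log_norm B (1 + x) <= 0"
proof -
 let ?K = "ac.span B"
 obtain D where D: "!!x. x : ?K ==> x ~= 0 ==> (%n. ln (nB B (x ^ n)) / n) \<longlonglongrightarrow> log_norm B x"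
  "!!x n. x : ?K ==> x ~= 0 ==> \<bar>ln (nB B (x ^ n)) - n * log_norm B x\<bar> <= D"
  by (rule log_norm_quasi) blast
 have pw: "x ^ i : ?K" for i using span_closed(10)[OF B x(1)] .
 have b: "nB B (x ^ i) <= exp D" for i
 proof -
  have "ln (nB B (x ^ i)) <= D" using D(2)[OF x(1,2), of i] le mult_nonneg_nonpos[of "real i" "log_norm B x"] by linarith
  moreover have "0 < nB B (x ^ i)" using nB_pos[OF B pw] x(2) by simp
  ultimately show ?thesis by (metis exp_le_cancel_iff exp_ln)
 qed
 have bb: "nB B ((1 + x) ^ n) <= exp D" for n
 proof -
  have "(1 + x) ^ n = (SUM i<=n. to_ac (of_nat (n choose i)) * x ^ i)"
   using binomial_ring[of x 1 n] by (simp add: add.commute)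
  also have "nB B ... <= exp D"
  proof (rule nB_sum_le[OF B])
   fix i
   show "to_ac (of_nat (n choose i)) * x ^ i : ?K" using span_closed(1,5)[OF B] pw by blast
   have "nB B (to_ac (of_nat (n choose i)) * x ^ i) = av (of_nat (n choose i)) * nB B (x ^ i)"
    by (rule nB_scale[OF B pw])
   also have "... <= 1 * exp D" using av_of_nat_le nB_nonneg[OF B] b by (intro mult_mono) auto
   finally show "nB B (to_ac (of_nat (n choose i)) * x ^ i) <= exp D" by simp
  qed simp
  finally show ?thesis .
 qed
 have x1: "1 + x : ?K" using span_closed(3,8)[OF B] x(1) by blast
 have "ln (nB B ((1 + x) ^ n)) <= D" for n
  using bb[of n] nB_pos[OF B span_closed(10)[OF B x1], of n] x(3) by (metis ln_exp ln_le_cancel_iff exp_gt_zero power_not_zero)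
 then have "!!n. ln (nB B ((1 + x) ^ n)) / n <= D / n" by (intro divide_right_mono) auto
 then show ?thesis using LIMSEQ_le[OF D(1)[OF x1 x(3)] lim_const_over_n[of D]] by blast
qed

end

lemma field_basis_exists:
 assumes "finite_extension K" obtains B where "field_basis B" "K = ac.span B"
proof -
 obtain B where "finite B" "ac.independent B" "K = ac.span B" using finite_extension_basis[OF assms] .
 then show ?thesis using that finite_ext_field[OF assms] by (auto simp: field_basis_def)
qed

lemma field_basis_mem:
 assumes "finite A" obtains B where "field_basis B" "A <= ac.span B"
proof -
 obtain B where "field_basis B" "gen_field base_field A = ac.span B"
  using field_basis_exists[OF finite_extension_gen[OF assms]] .
 then show ?thesis using that gen_field_subset(2) by metis
qed

text \<open>On a finite-dimensional space the F-linear map \<open>s\<close> is bounded by a constant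
  \<open>M\<close>, which disappears when the powers are averaged out. Independence of the basis and
  Galois invariance both follow from this.\<close>

lemma log_norm_le_image:
 assumes B: "field_basis B" and C: "field_basis C" and s: "s : abs_galois" "s ` ac.span B <= ac.span C"
  and x: "x : ac.span B" "x ~= 0"
 shows "log_norm C (s x) <= log_norm B x"
proof -
 define M where "M = Max (insert 1 ((%b. nB C (s b)) ` B))"
 have M1: "1 <= M" and M: "b : B ==> nB C (s b) <= M" for b
  unfolding M_def using fB[OF B] by (auto intro!: Max_ge)
 have bC: "s b : ac.span C" if "b : B" for b using that s(2) ac.span_base by blast
 have le: "nB C (s y) <= M * nB B y" if y: "y : ac.span B" for y
 proof -
  have "nB C (SUM b:B. to_ac (ac.representation B y b) * s b) <= M * nB B y"
  proof (rule nB_sum_le[OF C])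
   fix b assume b: "b : B"
   show "to_ac (ac.representation B y b) * s b : ac.span C" using bC[OF b] ac.span_scale by blast
   have "nB C (to_ac (ac.representation B y b) * s b) = av (ac.representation B y b) * nB C (s b)"
    by (rule nB_scale[OF C bC[OF b]])
   also have "... <= nB B y * M"
    using M[OF b] nB_coord_le[OF B b] nB_nonneg[OF B] nB_nonneg[OF C] by (intro mult_mono) auto
   finally show "nB C (to_ac (ac.representation B y b) * s b) <= M * nB B y" by (simp add: mult.commute)
  qed (use M1 nB_nonneg[OF B] in auto)
  moreover have "s y = (SUM b:B. to_ac (ac.representation B y b) * s b)"
   by (subst rep_sum[OF B y]) (simp add: auts_sum[OF s(1)] autsD[OF s(1)] s(1))
  ultimately show ?thesis by simp
 qed
 have xn: "x ^ n : ac.span B" "s x ^ n : ac.span C" "x ^ n ~= 0" "s x ~= 0" for n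
  using span_closed(10)[OF B x(1)] span_closed(10)[OF C] s(2) x by (auto simp: autsD[OF s(1)])
 have "ln (nB C (s x ^ n)) / n <= ln M / n + ln (nB B (x ^ n)) / n" for n
 proof -
  have p: "0 < nB C (s x ^ n)" "0 < nB B (x ^ n)" using nB_pos[OF C] nB_pos[OF B] xn by auto
  then have "ln (nB C (s x ^ n)) <= ln (M * nB B (x ^ n))"
   using le[OF xn(1), of n] M1 by (simp add: autsD[OF s(1)])
  also have "... = ln M + ln (nB B (x ^ n))" using p M1 by (simp add: ln_mult)
  finally show ?thesis by (simp add: divide_right_mono flip: add_divide_distrib)
 qed
 moreover have "(%n. ln (nB C (s x ^ n)) / n) \<longlonglongrightarrow> log_norm C (s x)"
  using log_norm_limit[OF C, of "s x"] x s(2) xn(4) by blast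
 moreover have "(%n. ln M / n + ln (nB B (x ^ n)) / n) \<longlonglongrightarrow> 0 + log_norm B x"
  using log_norm_limit[OF B x] by (intro tendsto_add lim_const_over_n)
 ultimately show ?thesis using LIMSEQ_le by fastforce
qed

text \<open>The one-sided bound for the inclusion, applied to \<open>x\<close> and to its inverse,
  is an equality.\<close>

lemma log_norm_superfield:
 assumes B: "field_basis B" and C: "field_basis C" "ac.span B <= ac.span C" and x: "x : ac.span B" "x ~= 0"
 shows "log_norm C x = log_norm B x"
proof -
 have i: "inverse x : ac.span B" "inverse x ~= 0" using span_closed(6)[OF B x(1)] x(2) by auto
 have "log_norm B' 1 = 0" if "field_basis B'" for B' using log_norm_to_ac[OF that, of 1] by simp
 then have s: "log_norm B' x + log_norm B' (inverse x) = 0"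
  if "field_basis B'" "x : ac.span B'" "inverse x : ac.span B'" for B'
  using log_norm_mult[OF that(1,2) x(2) that(3) i(2)] \<open>!!B'. field_basis B' ==> log_norm B' 1 = 0\<close>[OF that(1)] x(2) by simp
 show ?thesis
  using log_norm_le_image[OF B C(1) id_auts _ x] log_norm_le_image[OF B C(1) id_auts _ i] s[OF B x(1) i(1)] s[OF C(1)] x i C(2)
  by fastforce
qed

lemma log_norm_indep:
 assumes B: "field_basis B" "x : ac.span B" and C: "field_basis C" "x : ac.span C" and x: "x ~= 0"
 shows "log_norm B x = log_norm C x"
proof -
 obtain A where A: "field_basis A" "B Un C <= ac.span A"
  using field_basis_mem[of "B Un C"] fB[OF B(1)] fB[OF C(1)] by auto
 then have "ac.span B <= ac.span A" "ac.span C <= ac.span A" by (simp_all add: ac.span_minimal)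
 then show ?thesis using log_norm_superfield[OF B(1) A(1) _ B(2) x] log_norm_superfield[OF C(1) A(1) _ C(2) x] by simp
qed

section \<open>The absolute value and the ultrametric inequality\<close>

definition nrm :: "'f alg_closure => real" where
 "nrm x = (if x = 0 then 0 else exp (log_norm (SOME B. field_basis B & x : ac.span B) x))"

lemma nrm_eq:
 assumes "field_basis B" "x : ac.span B" "x ~= 0" shows "nrm x = exp (log_norm B x)"
proof -
 let ?B = "SOME B. field_basis B & x : ac.span B"
 have "field_basis ?B & x : ac.span ?B" using assms by (intro someI[of "%B. field_basis B & x : ac.span B"]) auto
 then show ?thesis using log_norm_indep[of ?B x B] assms by (simp add: nrm_def)
qed

lemma nrm_0 [simp]: "nrm 0 = 0" by (simp add: nrm_def)

lemma nrm_nonneg [simp]: "0 <= nrm x" by (simp add: nrm_def)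

lemma nrm_eq_0 [simp]: "nrm x = 0 \<longleftrightarrow> x = 0" by (simp add: nrm_def)

lemma nrm_pos [simp]: "0 < nrm x \<longleftrightarrow> x ~= 0" by (simp add: nrm_def)

lemma nrm_mult: "nrm (x * y) = nrm x * nrm y"
proof (cases "x = 0 | y = 0")
 case False
 obtain B where B: "field_basis B" "{x, y} <= ac.span B" using field_basis_mem[of "{x, y}"] by auto
 then have "log_norm B (x * y) = log_norm B x + log_norm B y"
  using log_norm_mult[OF B(1), of x y] False by simp
 moreover have "x * y : ac.span B" using span_closed(5)[OF B(1)] B(2) by auto
 ultimately show ?thesis using B False nrm_eq[OF B(1)] by (simp add: exp_add)
qed auto

lemma nrm_to_ac [simp]: "nrm (to_ac c) = av c"
proof (cases "c = 0")
 case False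
 obtain B where B: "field_basis B" "{to_ac c} <= ac.span B" using field_basis_mem[of "{to_ac c}"] by auto
 have "0 < av c" using False av_nonneg[of c] by (auto simp: less_le simp del: av_nonneg)
 then show ?thesis using nrm_eq[OF B(1), of "to_ac c"] B(2) False log_norm_to_ac[OF B(1) False] by simp
qed simp

lemma nrm_1 [simp]: "nrm 1 = 1" using nrm_to_ac[of 1] by simp

lemma nrm_power: "nrm (x ^ n) = nrm x ^ n" by (induction n) (auto simp: nrm_mult)

lemma nrm_inverse: "nrm (inverse x) = inverse (nrm x)"
proof (cases "x = 0")
 case False
 then have "nrm x * nrm (inverse x) = 1" by (simp flip: nrm_mult)
 then show ?thesis by (metis inverse_unique)
qed simp

lemma nrm_divide: "nrm (x / y) = nrm x / nrm y" by (simp add: divide_inverse nrm_mult nrm_inverse)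

lemma nrm_minus [simp]: "nrm (- x) = nrm x"
 using nrm_mult[of "to_ac (- 1)" x] by (simp only: nrm_to_ac av_minus) simp

lemma nrm_prod: "nrm (prod f A) = (PROD i:A. nrm (f i))"
 by (induction A rule: infinite_finite_induct) (auto simp: nrm_mult)

lemma nrm_add: "nrm (x + y) <= max (nrm x) (nrm y)"
proof -
 have 1: "nrm (1 + z) <= 1" if z: "nrm z <= 1" for z
 proof (cases "z = 0 | 1 + z = 0")
  case False
  obtain B where B: "field_basis B" "{z} <= ac.span B" using field_basis_mem[of "{z}"] by auto
  have "log_norm B z <= 0" using z nrm_eq[OF B(1), of z] B(2) False by simp
  then have "log_norm B (1 + z) <= 0" using log_norm_1_plus[OF B(1), of z] B(2) False by simp
  moreover have "1 + z : ac.span B" using span_closed(3,8)[OF B(1)] B(2) by simp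
  ultimately show ?thesis using nrm_eq[OF B(1), of "1 + z"] False by simp
 qed auto
 have 2: "nrm (x + y) <= nrm y" if "nrm x <= nrm y" for x y
 proof (cases "y = 0")
  case False
  have "nrm (x / y) <= 1" using that False by (simp add: nrm_divide)
  then have "nrm (y * (1 + x / y)) <= nrm y" using 1[of "x / y"] by (simp add: nrm_mult mult_left_le)
  moreover have "y * (1 + x / y) = x + y" using False by (simp add: field_simps)
  ultimately show ?thesis by simp
 qed (use that in \<open>auto dest: antisym\<close>)
 show ?thesis using 2[of x y] 2[of y x] by (cases "nrm x <= nrm y") (auto simp: add.commute)
qed

lemma nrm_diff: "nrm (x - y) <= max (nrm x) (nrm y)"
 using nrm_add[of x "- y"] by simp

lemma nrm_minus_commute: "nrm (x - y) = nrm (y - x)"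
 by (metis minus_diff_eq nrm_minus)

lemma nrm_sum_le: "0 <= r ==> (!!i. i : A ==> nrm (f i) <= r) ==> nrm (sum f A) <= r"
proof (induction A rule: infinite_finite_induct)
 case (insert i A)
 then show ?case using nrm_add[of "f i" "sum f A"] by fastforce
qed auto

lemma nrm_sum_less: "0 < r ==> (!!i. i : A ==> nrm (f i) < r) ==> nrm (sum f A) < r"
proof (induction A rule: infinite_finite_induct)
 case (insert i A)
 then show ?case using nrm_add[of "f i" "sum f A"] by fastforce
qed auto

lemma nrm_eqI: "nrm (x - y) < nrm x ==> nrm x = nrm y"
 using nrm_add[of "x - y" y] nrm_diff[of x "x - y"] by (simp add: max_def split: if_splits)

lemma nrm_galois [simp]:
 assumes s: "s : abs_galois" shows "nrm (s x) = nrm x"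
proof (cases "x = 0")
 case False
 obtain B where B: "field_basis B" "gen_field base_field (conjugates x) = ac.span B"
  using field_basis_exists[OF finite_extension_gen] finite_conjugates by blast
 have st: "s ` ac.span B <= ac.span B" if "s : abs_galois" for s
  using gen_field_stable[OF that, of "conjugates x"] image_conjugates B(2) by auto
 have x: "x : ac.span B" using conjugates_refl gen_field_subset(2) B(2) by blast
 then have sx: "s x : ac.span B" using st[OF s] by blast
 have "log_norm B (ginv s (s x)) <= log_norm B (s x)"
  using log_norm_le_image[OF B(1) B(1) auts_inv[OF s] st[OF auts_inv[OF s]] sx] False
  by (simp add: autsD[OF s])
 then have "log_norm B (s x) = log_norm B x"
  using log_norm_le_image[OF B(1) B(1) s st[OF s] x False] by (simp add: ginv_simps[OF s])
 then show ?thesis using nrm_eq[OF B(1) sx] nrm_eq[OF B(1) x] False by (simp add: autsD[OF s])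
qed (simp add: autsD[OF s])

end

section \<open>Integers, residues and roots of unity\<close>

context local_field
begin

text \<open>If \<open>nrm x > 1\<close>, the leading term of an integral equation would dominate all
  the others. Conversely, all roots of the minimal polynomial are conjugates of \<open>x\<close> and
  so have absolute value at most 1; the coefficients of the monic polynomial inherit this
  bound.\<close>

lemma integers_iff: "x : integers v \<longleftrightarrow> nrm x <= 1"
proof
 assume "x : integers v"
 then obtain p where p: "lead_coeff p = 1" "!!i. coeff p i : val_ge v 0" "poly (ac_poly p) x = 0"
  by (auto simp: integers_def)
 let ?n = "degree p"
 show "nrm x <= 1"
 proof (rule ccontr)
  assume "~ nrm x <= 1"
  then have x: "nrm x > 1" by simp
  have "(SUM i<=?n. to_ac (coeff p i) * x ^ i) = 0"
   using p(3) by (simp add: poly_altdef coeff_map_poly)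
  then have eq: "x ^ ?n = - (\<Sum>i<?n. to_ac (coeff p i) * x ^ i)"
   using p(1) by (simp add: lessThan_Suc_atMost[symmetric] eq_neg_iff_add_eq_0 add.commute)
  have "?n > 0"
  proof (rule ccontr)
   assume "~ ?n > 0"
   then have "p = 1" using p(1) by (metis degree_eq_zeroE gr0I lead_coeff_pCons(2) one_pCons)
   then show False using p(3) by simp
  qed
  have "nrm (\<Sum>i<?n. to_ac (coeff p i) * x ^ i) < nrm x ^ ?n"
  proof (rule nrm_sum_less)
   fix i assume i: "i : {..<?n}"
   have "av (coeff p i) <= 1" using av_le_iff[of _ 0] p(2) by simp
   then have "nrm (to_ac (coeff p i) * x ^ i) <= nrm x ^ i"
    by (simp add: nrm_mult nrm_power mult_left_le_one_le)
   also have "... < nrm x ^ ?n" using i x by (intro power_strict_increasing) auto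
   finally show "nrm (to_ac (coeff p i) * x ^ i) < nrm x ^ ?n" .
  next
   show "0 < nrm x ^ ?n" by (rule zero_less_power[OF less_trans[OF zero_less_one x]])
  qed
  moreover have "nrm x ^ ?n = nrm (\<Sum>i<?n. to_ac (coeff p i) * x ^ i)"
   using arg_cong[OF eq, of nrm] by (simp add: nrm_power)
  ultimately show False by simp
 qed
next
 assume x: "nrm x <= 1"
 obtain m where m: "poly_over base_field m" "m ~= 0" "poly m x = 0"
  "!!y. poly m y = 0 ==> EX s:field_auts base_field. s x = y"
  by (rule minimal_polynomial[OF ifield_base, of x]) blast
 obtain A where A: "m = smult (lead_coeff m) (\<Prod>a\<in>#A. [:- a, 1:])"
  using alg_closed_imp_factorization[OF m(2)] by blast
 let ?g = "\<Prod>a\<in>#A. [:- a, 1:]"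
 have rt: "nrm a <= 1" if "a \<in># A" for a
 proof -
  have "poly m a = 0" by (subst A) (use that in \<open>auto simp: poly_prod_mset prod_mset_zero_iff\<close>)
  then show ?thesis using m(4) x nrm_galois by metis
 qed
 have "ALL i. nrm (coeff (\<Prod>a\<in>#C. [:- a, 1:]) i) <= 1" if "C <=# A" for C
  using that
 proof (induction C)
  case empty
  then show ?case by (auto simp: coeff_1)
 next
  case (add a C)
  have a: "nrm a <= 1" using rt add.prems by (meson mset_subset_eqD union_single_eq_member)
  have C: "nrm (coeff (\<Prod>a\<in>#C. [:- a, 1:]) i) <= 1" for i
   using add.IH add.prems by (meson mset_subset_eq_insertD subset_mset.less_imp_le)
  show ?case
  proof
   fix i
   let ?q = "\<Prod>a\<in>#C. [:- a, 1:]"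
   have "coeff (\<Prod>a\<in>#add_mset a C. [:- a, 1:]) i = (case i of 0 => 0 | Suc j => coeff ?q j) - a * coeff ?q i"
    by (simp add: coeff_pCons split: nat.splits)
   also have "nrm ... <= 1"
    using C a nrm_diff[of "case i of 0 => 0 | Suc j => coeff ?q j" "a * coeff ?q i"]
     mult_le_one[OF a nrm_nonneg C]
    by (auto simp: nrm_mult split: nat.splits intro: order_trans)
   finally show "nrm (coeff (\<Prod>a\<in>#add_mset a C. [:- a, 1:]) i) <= 1" .
  qed
 qed
 then have cg: "nrm (coeff ?g i) <= 1" for i by blast
 let ?p = "map_poly of_ac ?g"
 have lm: "lead_coeff m ~= 0" using m(2) by simp
 have "?g = smult (inverse (lead_coeff m)) m" using lm by (subst (2) A) simp
 then have "poly_over base_field ?g"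
  using m(1) by (auto simp: poly_over_def intro!: ifieldD[OF ifield_base])
 then have ci: "to_ac (coeff ?p i) = coeff ?g i" for i
  by (simp add: coeff_map_poly poly_over_def to_ac_of_ac)
 then have g: "ac_poly ?p = ?g" by (intro poly_eqI) (simp add: coeff_map_poly)
 have lg: "lead_coeff ?g = 1"
  by (induction A) (simp_all add: lead_coeff_mult del: mult_pCons_left)
 show "x : integers v" unfolding integers_def
 proof (intro CollectI exI[of _ ?p] conjI allI)
  have "degree ?p = degree ?g" using degree_ac_poly[of ?p] unfolding g by (rule sym)
  then have "to_ac (lead_coeff ?p) = to_ac 1" by (simp only: ci lg to_ac_1)
  then show "lead_coeff ?p = 1" by (simp only: to_ac_eq_iff)
  show "coeff ?p i : val_ge v 0" for i
   using cg[of i] av_le_iff[of _ 0] by (simp flip: ci)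
  have "poly m x = lead_coeff m * poly ?g x" by (subst A) simp
  then show "poly (ac_poly ?p) x = 0" unfolding g using m(3) lm by simp
 qed
qed

lemma unit_integers_iff: "x : unit_integers v \<longleftrightarrow> nrm x = 1"
 by (auto simp: unit_integers_def integers_iff nrm_inverse inverse_le_1_iff dest: antisym)

lemma max_ideal_iff: "x : max_ideal v \<longleftrightarrow> nrm x < 1"
 by (auto simp: max_ideal_def integers_iff unit_integers_iff)

lemma principal_iff: "x : principal_units v E \<longleftrightarrow> x : E & nrm (x - 1) < 1"
 by (simp add: principal_units_def max_ideal_iff)

lemma smooth_iff: "c ~= 0 ==> (x - 1) / to_ac c : integers v \<longleftrightarrow> nrm (x - 1) <= av c"
 using nrm_to_ac[of c] nrm_pos[of "to_ac c"] by (simp add: integers_iff nrm_divide)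

lemma nrm_principal: "nrm (x - 1) < 1 ==> nrm x = 1"
 using nrm_eqI[of 1 x] by (simp add: nrm_minus_commute)

section \<open>The residue characteristic and p-th powers\<close>

abbreviation "p \<equiv> residue_char v"

text \<open>By the pigeonhole principle two natural numbers lie in the same residue class, and their
  difference is a positive integer in the maximal ideal.\<close>

lemma residue_char_pos: "0 < p" and residue_char_mem: "of_nat p : val_ge v 1"
proof -
 obtain T where T: "finite T" "!!x. av x <= 1 ==> EX t:T. av (x - t) <= 1 / 2"
  using av_finite_cover[of 0 1] by auto
 have "ALL n :: nat. EX t. t : T & av (of_nat n - t) <= 1 / 2" using T(2) av_of_nat_le by blast
 then obtain f where f: "!!n :: nat. f n : T & av (of_nat n - f n) <= 1 / 2" by metis
 then have "~ inj_on f UNIV" using T(1) by (metis finite_imageD finite_subset image_subsetI infinite_UNIV_nat)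
 then obtain i j where ij: "i < j" "f i = f j" unfolding inj_on_def by (metis linorder_neqE_nat)
 have "av (of_nat j - of_nat i) <= 1 / 2"
  using av_diff[of "of_nat j - f j" "of_nat i - f i"] f[of i] f[of j] ij(2) by auto
 then have "0 < j - i & of_nat (j - i) : val_ge v 1"
  using ij(1) av_le_iff[of "of_nat (j - i)" 1] by (simp add: powr_minus of_nat_diff)
 then have "0 < p & (of_nat p :: 'f) : val_ge v 1" unfolding residue_char_def by (rule LeastI)
 then show "0 < p" "of_nat p : val_ge v 1" by blast+
qed

lemma nrm_p_le: "nrm (of_nat p) <= 1 / 2"
proof -
 have "av (of_nat p) <= 1 / 2" using residue_char_mem av_le_iff[of "of_nat p" 1] by (simp add: powr_minus)
 then show ?thesis using nrm_to_ac[of "of_nat p"] by simp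
qed

lemma nrm_of_nat_le: "nrm (of_nat n) <= 1"
 using av_of_nat_le[of n] nrm_to_ac[of "of_nat n"] by simp

lemma av_less_1: "av x < 1 \<longleftrightarrow> x : val_ge v 1"
proof (cases "x = 0")
 case False
 have "2 powr (- of_int (v x)) < (1 :: real) \<longleftrightarrow> 0 < v x" using powr_less_cancel_iff[of 2 "- of_int (v x)" 0] by simp
 then show ?thesis using False by (auto simp: av_def val_ge_def)
qed (simp add: val_ge_def)

lemma prime_p: "Factorial_Ring.prime p"
proof -
 have min: "av (of_nat n) = 1" if "0 < n" "n < p" for n
  using not_less_Least[of n "%p. 0 < p & (of_nat p :: 'f) : val_ge v 1"] that av_of_nat_le[of n] av_less_1[of "of_nat n"]
  by (auto simp: residue_char_def)
 have "p ~= 1" using residue_char_mem av_less_1[of 1] by auto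
 then have p1: "1 < p" using residue_char_pos by simp
 show ?thesis
 proof (rule prime_natI)
  show "2 <= p" using p1 by simp
  fix a b assume "p dvd a * b"
  show "p dvd a | p dvd b"
  proof (rule ccontr)
   assume no: "~ (p dvd a | p dvd b)"
   have u: "av (of_nat a) = 1" if "~ p dvd a" for a
   proof -
    have "a mod p ~= 0" using that by (simp add: dvd_eq_mod_eq_0)
    then have m: "av (of_nat (a mod p)) = 1" using min p1 by simp
    have "av (of_nat p * of_nat (a div p)) < 1"
     using residue_char_mem av_less_1[of "of_nat p"] av_of_nat_le[of "a div p"]
     by (auto simp: av_mult intro: le_less_trans[OF mult_left_le])
    moreover have "(of_nat (a mod p) :: 'f) = of_nat a - of_nat p * of_nat (a div p)"
     by (metis add_diff_cancel_left' mult_div_mod_eq of_nat_add of_nat_mult)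
    ultimately show ?thesis
     using m av_diff[of "of_nat a" "of_nat p * of_nat (a div p)"] av_of_nat_le[of a] by (auto simp: max_def split: if_splits)
   qed
   have "av (of_nat (a * b)) = 1" using u no by (simp add: av_mult)
   moreover obtain k where "a * b = p * k" using \<open>p dvd a * b\<close> by blast
   then have "av (of_nat (a * b)) < 1"
    using residue_char_mem av_less_1[of "of_nat p"] av_of_nat_le[of k]
    by (auto simp: av_mult intro: le_less_trans[OF mult_left_le])
   ultimately show False by simp
  qed
 qed
qed

lemma p_gt_1: "1 < p" using prime_p prime_gt_1_nat by blast

lemma nrm_of_nat_dvd: "p dvd n ==> nrm (of_nat n) <= 1 / 2"
 using nrm_p_le nrm_of_nat_le mult_mono[of "nrm (of_nat p)" "1 / 2" "nrm (of_nat k)" 1 for k]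
 by (auto elim!: dvdE simp: nrm_mult)

lemma nrm_of_nat_coprime:
 assumes "~ p dvd n" shows "nrm (of_nat n) = 1"
proof -
 have "coprime n p" using assms prime_p by (metis coprime_commute prime_imp_coprime)
 then obtain a where a: "[n * a = 1] (mod p)" using coprime_iff_invertible_nat[of n p] by auto
 have "n * a ~= 0" using a p_gt_1 by (intro notI) (simp add: cong_def)
 then have "1 <= n * a" by simp
 then have d: "p dvd n * a - 1" using a by (simp add: cong_altdef_nat cong_sym)
 have "nrm (of_nat (n * a) - 1) <= 1 / 2"
  using nrm_of_nat_dvd[OF d] \<open>1 <= n * a\<close> by (simp add: of_nat_diff)
 then have "nrm (of_nat n * of_nat a) = 1" using nrm_principal[of "of_nat (n * a)"] by simp
 then show ?thesis using nrm_of_nat_le[of n] nrm_of_nat_le[of a] mult_left_le[of "nrm (of_nat a)" "nrm (of_nat n)"]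
  by (simp add: nrm_mult)
qed

text \<open>The middle binomial coefficients are divisible by \<open>p\<close>. The factor
  \<open>nrm t\<close> is kept because \<open>power_p_principal\<close> needs a contraction and not
  only a bound below 1.\<close>

lemma frobenius_residue:
 assumes "nrm t <= 1" shows "nrm ((1 + t) ^ p - 1 - t ^ p) <= nrm t / 2"
proof -
 have "(1 + t) ^ p = (SUM i<=p. of_nat (p choose i) * t ^ i)" using binomial_ring[of t 1 p] by (simp add: add.commute)
 also have "{..p} = insert 0 (insert p {0<..<p})" using p_gt_1 by auto
 finally have "(1 + t) ^ p - 1 - t ^ p = (SUM i:{0<..<p}. of_nat (p choose i) * t ^ i)" using p_gt_1 by simp
 also have "nrm ... <= nrm t / 2"
 proof (rule nrm_sum_le)
  fix i assume i: "i : {0<..<p}"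
  then have "p dvd (p choose i)" using prime_p by (intro dvd_choose_prime) auto
  then have "nrm (of_nat (p choose i)) <= 1 / 2" by (rule nrm_of_nat_dvd)
  moreover have "nrm t ^ i <= nrm t ^ 1" using i assms by (intro power_decreasing) auto
  ultimately have "nrm (of_nat (p choose i)) * nrm t ^ i <= 1 / 2 * nrm t" by (intro mult_mono) auto
  then show "nrm (of_nat (p choose i) * t ^ i) <= nrm t / 2" by (simp add: nrm_mult nrm_power)
 qed simp
 finally show ?thesis .
qed

lemma frobenius_injective:
 assumes "nrm x <= 1" "nrm (x ^ p ^ k - 1) < 1" shows "nrm (x - 1) < 1"
 using assms(2)
proof (induction k)
 case (Suc k)
 have x1: "nrm (x ^ p ^ k - 1) <= 1" using nrm_diff[of "x ^ p ^ k" 1] power_le_one[of "nrm x" "p ^ k"] assms(1) by (simp add: nrm_power)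
 let ?t = "x ^ p ^ k - 1"
 have "nrm ((1 + ?t) ^ p - 1 - ?t ^ p) <= 1 / 2" using frobenius_residue[OF x1] x1 by linarith
 moreover have "(1 + ?t) ^ p = x ^ p ^ Suc k" by (simp add: mult.commute flip: power_mult)
 moreover have "?t ^ p = ((1 + ?t) ^ p - 1) - ((1 + ?t) ^ p - 1 - ?t ^ p)" by simp
 ultimately have "nrm (?t ^ p) < 1"
  using Suc.prems nrm_diff[of "(1 + ?t) ^ p - 1" "(1 + ?t) ^ p - 1 - ?t ^ p"] by simp
 then have "nrm ?t < 1" using x1 by (metis nrm_power order_le_less power_one less_irrefl)
 then show ?case by (rule Suc.IH)
qed simp

lemma power_p_principal:
 assumes "nrm (x - 1) < 1" "e > 0" shows "EX k0. ALL k>=k0. nrm (x ^ p ^ k - 1) < e"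
proof -
 \<comment> \<open>The contraction rate of taking a p-th power near 1: the middle binomial terms
   shrink the distance by 1/2, the last term by at least \<open>nrm (x - 1)\<close>.\<close>
 define c where "c = max (1 / 2) (nrm (x - 1))"
 have c: "0 < c" "c < 1" using assms(1) by (auto simp: c_def)
 have b: "nrm (x ^ p ^ k - 1) <= c ^ k * nrm (x - 1)" for k
 proof (induction k)
  case (Suc k)
  let ?t = "x ^ p ^ k - 1"
  have "c ^ k <= 1" using c by (intro power_le_one) auto
  then have t: "nrm ?t <= nrm (x - 1)" using Suc.IH by (meson mult_left_le_one_le nrm_nonneg order_trans zero_le_power less_imp_le c(1))
  then have t1: "nrm ?t <= 1" using assms(1) by simp
  have "nrm (?t ^ p) <= nrm ?t ^ 2" using p_gt_1 t1 by (simp add: nrm_power power_decreasing)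
  also have "... <= c * nrm ?t" using t by (auto simp: power2_eq_square c_def intro!: mult_right_mono)
  finally have 1: "nrm (?t ^ p) <= c * nrm ?t" .
  have "nrm ((1 + ?t) ^ p - 1 - ?t ^ p) <= c * nrm ?t"
   using frobenius_residue[OF t1] mult_right_mono[of "1 / 2" c "nrm ?t"] by (simp add: c_def)
  then have "nrm ((1 + ?t) ^ p - 1) <= c * nrm ?t"
   using nrm_add[of "(1 + ?t) ^ p - 1 - ?t ^ p" "?t ^ p"] 1 by simp
  also have "... <= c * (c ^ k * nrm (x - 1))" using Suc.IH c by (intro mult_left_mono) auto
  finally show ?case by (simp add: mult_ac flip: power_mult)
 qed simp
 have "(%k. c ^ k) \<longlonglongrightarrow> 0" using c by (intro LIMSEQ_power_zero) auto
 then have "eventually (%k. c ^ k < e) sequentially" using assms(2) by (rule order_tendstoD)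
 then obtain k0 where k0: "!!k. k >= k0 ==> c ^ k < e" by (auto simp: eventually_sequentially)
 have "nrm (x ^ p ^ k - 1) < e" if "k >= k0" for k
 proof -
  have "c ^ k * nrm (x - 1) <= c ^ k" using assms(1) c by (intro mult_left_le) auto
  then show ?thesis using b[of k] k0[OF that] by linarith
 qed
 then show ?thesis by blast
qed

text \<open>\<open>log_norm_quasi\<close> for the exponent 1 shows that \<open>nrm\<close> and
  \<open>nB\<close> differ by at most the factor \<open>exp D\<close>, so covers transfer from one
  to the other.\<close>

lemma finite_cover:
 assumes K: "finite_extension K" and r: "0 < r"
 shows "EX T. finite T & T <= K & (ALL x:K. nrm x <= R --> (EX t:T. nrm (x - t) < r))"
proof -
 obtain B where B: "field_basis B" "K = ac.span B" using field_basis_exists[OF K] .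
 obtain D where D: "!!x n. x : ac.span B ==> x ~= 0 ==> \<bar>ln (nB B (x ^ n)) - n * log_norm B x\<bar> <= D"
  by (rule log_norm_quasi[OF B(1)]) blast
 have q: "nB B x <= exp D * nrm x & nrm x <= exp D * nB B x" if x: "x : K" for x
 proof (cases "x = 0")
  case False
  have p: "0 < nB B x" using nB_pos[OF B(1)] x B(2) False by simp
  have "\<bar>ln (nB B x) - log_norm B x\<bar> <= D" using D[of x 1] x B(2) False by simp
  moreover have "nrm x = exp (log_norm B x)" using nrm_eq[OF B(1)] x B(2) False by simp
  moreover have "nB B x = exp (ln (nB B x))" using p by simp
  ultimately show ?thesis by (metis (no_types, lifting) abs_diff_le_iff add.commute exp_add exp_le_cancel_iff diff_le_eq le_diff_eq)
 qed (use nB_eq_0[OF B(1) span_closed(2)[OF B(1)]] in simp)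
 obtain a :: nat where a: "exp D * R < 2 ^ a" using real_arch_pow[of 2] by auto
 have "0 < r / exp D" using r by simp
 then obtain m :: nat where m: "(1 / 2) ^ m < r / exp D" using real_arch_pow_inv[of "r / exp D" "1 / 2"] by auto
 obtain T where T: "finite T" "T <= K" "!!x. x : K ==> nB B x <= 2 ^ a ==> EX t:T. nB B (x - t) <= (1 / 2) ^ m"
  using nB_finite_cover[OF B(1), of a m] B(2) by auto
 have "EX t:T. nrm (x - t) < r" if x: "x : K" "nrm x <= R" for x
 proof -
  have "nB B x <= 2 ^ a"
  proof -
   have "exp D * nrm x <= exp D * R" using x(2) by (intro mult_left_mono) auto
   then show ?thesis using q[OF x(1)] a by linarith
  qed
  then obtain t where t: "t : T" "nB B (x - t) <= (1 / 2) ^ m" using T(3)[OF x(1)] by blast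
  have "nrm (x - t) <= exp D * nB B (x - t)"
   using q ifieldD(4)[OF finite_ext_field[OF K] x(1)] t(1) T(2) by blast
  also have "... <= exp D * (1 / 2) ^ m" using t(2) by simp
  also have "... < exp D * (r / exp D)" by (intro mult_strict_left_mono m) simp
  finally show ?thesis using t(1) by auto
 qed
 then show ?thesis using T by blast
qed

lemma nrm_pi: "nrm (to_ac \<pi>) = 1 / 2" by (simp add: av_pi)

lemma pi_powi: "to_ac \<pi> powi k ~= 0" "nrm (to_ac \<pi> powi k) = 2 powi (- k)" "to_ac \<pi> powi k : base_field"
proof -
 show "to_ac \<pi> powi k ~= 0" using pi(1) by simp
 show "nrm (to_ac \<pi> powi k) = 2 powi (- k)"
  by (cases k rule: int_cases2) (auto simp: nrm_power nrm_inverse nrm_divide power_int_minus av_pi power_one_over inverse_eq_divide)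
 show "to_ac \<pi> powi k : base_field"
  by (cases k rule: int_cases2) (auto simp: power_int_minus simp flip: to_ac_power to_ac_inverse)
qed

text \<open>A finite cover shows that only finitely many values, say \<open>N\<close>, lie above 1/2
  and at most 1. Among the powers of \<open>x\<close> with exponents 0 to \<open>N\<close>, scaled
  into this range by powers of the uniformizer, two have equal value. So \<open>nrm x\<close> raised
  to some positive exponent up to \<open>N\<close> is a power of 2, and the factorial of
  \<open>N\<close> serves for all \<open>x\<close>.\<close>

lemma value_exponent:
 assumes K: "finite_extension K"
 shows "EX e>0. ALL x:K - {0}. EX z::int. nrm x ^ e = 2 powi z"
proof -
 obtain T where T: "finite T" "T <= K" "!!x. x : K ==> nrm x <= 1 ==> EX t:T. nrm (x - t) < 1 / 2"
  using finite_cover[OF K, of "1 / 2" 1] by auto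
 have fin: "nrm x : nrm ` T" if x: "x : K" "nrm x <= 1" "1 / 2 < nrm x" for x
 proof -
  obtain t where "t : T" "nrm (x - t) < 1 / 2" using T(3)[OF x(1,2)] by blast
  then have "nrm x = nrm t" using x(3) by (intro nrm_eqI) simp
  then show ?thesis using \<open>t : T\<close> by blast
 qed
 show ?thesis
 proof (intro exI[of _ "fact (card (nrm ` T)) :: nat"] conjI ballI)
  fix x assume x: "x : K - {0}"
  let ?N = "card (nrm ` T)"
  have Kf: "intermediate_field K" using finite_ext_field[OF K] .
  define k where "k = (%i::nat. \<lceil>log 2 (nrm x ^ i)\<rceil>)"
  define g where "g = (%i. x ^ i * to_ac \<pi> powi k i)"
  have ng: "nrm (g i) = nrm x ^ i * 2 powi (- k i)" for i by (simp add: g_def nrm_mult nrm_power pi_powi(2))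
  have "nrm (g i) : nrm ` T" for i
  proof (rule fin)
   have "base_field <= K" by (rule base_field_subset[OF Kf])
   then show "g i : K" unfolding g_def using x pi_powi(3) ifieldD(5,10)[OF Kf] by blast
   have pos: "0 < nrm x ^ i" using x by simp
   have l: "real_of_int (k i) - 1 < log 2 (nrm x ^ i)" "log 2 (nrm x ^ i) <= k i" unfolding k_def by linarith+
   have "nrm x ^ i = 2 powr (log 2 (nrm x ^ i))" using pos by simp
   moreover have "2 powi (- k i) = 2 powr (- real_of_int (k i))" using powr_real_of_int'[of 2 "- k i"] by simp
   ultimately have eq: "nrm (g i) = 2 powr (log 2 (nrm x ^ i) - k i)" unfolding ng by (metis powr_add diff_conv_add_uminus)
   show "nrm (g i) <= 1" unfolding eq using l(2) powr_mono[of "log 2 (nrm x ^ i) - k i" 0 2] by simp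
   have "2 powr (- 1 :: real) < 2 powr (log 2 (nrm x ^ i) - k i)" using l(1) by (intro powr_less_mono) auto
   then show "1 / 2 < nrm (g i)" unfolding eq powr_minus by simp
  qed
  then have "(%i. nrm (g i)) ` {..?N} <= nrm ` T" by blast
  then have "card ((%i. nrm (g i)) ` {..?N}) < card {..?N}" using card_mono[OF finite_imageI[OF T(1)]] by (metis card_atMost le_imp_less_Suc)
  then have "~ inj_on (%i. nrm (g i)) {..?N}" by (rule pigeonhole)
  then obtain i j where ij: "i < j" "j <= ?N" "nrm (g i) = nrm (g j)"
   unfolding inj_on_def by (metis atMost_iff linorder_neqE_nat)
  have "nrm x ^ i * nrm x ^ (j - i) = nrm x ^ j" using ij(1) by (simp flip: power_add)
  then have "nrm x ^ i * (2 powi (- k i)) = nrm x ^ i * (nrm x ^ (j - i) * 2 powi (- k j))"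
   using ij(3) unfolding ng by (metis mult.assoc)
  then have "2 powi (- k i) = nrm x ^ (j - i) * 2 powi (- k j)" using x by simp
  then have e: "nrm x ^ (j - i) = 2 powi (k j - k i)" by (simp add: power_int_diff power_int_minus field_simps)
  have "j - i dvd fact ?N" using ij by (intro dvd_fact) auto
  then obtain m where m: "fact ?N = (j - i) * m" by blast
  have "nrm x ^ fact ?N = 2 powi ((k j - k i) * int m)" unfolding m power_mult e by (simp add: power_int_mult)
  then show "EX z::int. nrm x ^ fact ?N = 2 powi z" by blast
 next
  show "(0::nat) < fact (card (nrm ` T))" by simp
 qed
qed

text \<open>The powers of \<open>x\<close> meet finitely many residue classes, so some positive
  power is congruent to 1. Injectivity of the Frobenius map on residues removes the p-part of the
  exponent.\<close>

lemma unit_power: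
 assumes x: "nrm x = 1" shows "EX n>0. ~ p dvd n & nrm (x ^ n - 1) < 1"
proof -
 let ?K = "gen_field base_field {x}"
 have xK: "x : ?K" using gen_field_subset(2) by blast
 obtain T where T: "finite T" "!!y. y : ?K ==> nrm y <= 1 ==> EX t:T. nrm (y - t) < 1"
  using finite_cover[OF finite_extension_gen, of "{x}" 1 1] by auto
 have "EX t:T. nrm (x ^ i - t) < 1" for i
  using T(2) ifieldD(10)[OF ifield_gen xK] x by (simp add: nrm_power)
 then obtain f where f: "!!i. f i : T & nrm (x ^ i - f i) < 1" by metis
 then have "~ inj_on f UNIV" using T(1) by (metis finite_imageD finite_subset image_subsetI infinite_UNIV_nat)
 then obtain i j where ij: "i < j" "f i = f j" unfolding inj_on_def by (metis linorder_neqE_nat)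
 have "nrm (x ^ j - x ^ i) < 1" using nrm_diff[of "x ^ j - f j" "x ^ i - f i"] f[of i] f[of j] ij(2) by auto
 moreover have "x ^ j - x ^ i = x ^ i * (x ^ (j - i) - 1)" using ij(1) by (simp add: algebra_simps flip: power_add)
 ultimately have "nrm (x ^ (j - i) - 1) < 1" using x by (simp add: nrm_mult nrm_power)
 moreover obtain a n where an: "j - i = p ^ a * n" "~ p dvd n"
  using multiplicity_decompose'[of "j - i" p] ij(1) p_gt_1 by (metis not_prime_unit prime_p zero_less_diff less_not_refl)
 ultimately have "nrm ((x ^ n) ^ p ^ a - 1) < 1" by (simp add: mult.commute flip: power_mult)
 then have "nrm (x ^ n - 1) < 1" using frobenius_injective[of "x ^ n" a] x by (simp add: nrm_power)
 moreover have "n > 0" using an ij(1) by (metis mult_0_right gr0I zero_less_diff less_irrefl)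
 ultimately show ?thesis using an(2) by blast
qed

text \<open>The Teichmueller representatives: by \<open>teichmueller\<close> and
  \<open>mu_inj\<close> each unit of the closure is congruent to exactly one of these roots of
  unity.\<close>

definition mu :: "'f alg_closure set" where
 "mu = {z. EX n>0. ~ p dvd n & z ^ n = 1}"

lemma nrm_mu: "z : mu ==> nrm z = 1"
proof -
 assume "z : mu"
 then obtain n where n: "n > 0" "z ^ n = 1" by (auto simp: mu_def)
 then have "nrm z ^ n = 1" using nrm_power[of z n] by simp
 then show ?thesis using power_eq_imp_eq_base[of "nrm z" n 1] n(1) by simp
qed

lemma mu_closed: "1 : mu" "z : mu ==> w : mu ==> z * w : mu" "z : mu ==> inverse z : mu" "z : mu ==> z ^ k : mu"
 "s : abs_galois ==> z : mu ==> s z : mu"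
proof -
 show "1 : mu" using p_gt_1 by (auto simp: mu_def intro!: exI[of _ 1])
 show "z : mu ==> w : mu ==> z * w : mu"
  unfolding mu_def
 proof clarify
  fix m n assume "0 < m" "~ p dvd m" "z ^ m = 1" "0 < n" "~ p dvd n" "w ^ n = 1"
  moreover have "(z * w) ^ (m * n) = (z ^ m) ^ n * (w ^ n) ^ m"
   by (simp add: power_mult_distrib mult.commute flip: power_mult)
  ultimately show "EX n>0. ~ p dvd n & (z * w) ^ n = 1"
   using prime_p by (intro exI[of _ "m * n"]) (auto simp: prime_dvd_mult_iff)
 qed
 show "z : mu ==> inverse z : mu" by (auto simp: mu_def power_inverse)
 show "z : mu ==> z ^ k : mu" by (auto simp: mu_def) (metis mult.commute power_mult power_one)
 show "s : abs_galois ==> z : mu ==> s z : mu" by (auto simp: mu_def) (metis autsD(6,11))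
qed

text \<open>If \<open>u\<close> is congruent to 1, has \<open>u ^ n = 1\<close> and differs from 1,
  then the sum of its first \<open>n\<close> powers vanishes; yet this sum is congruent to
  \<open>n\<close>, which is a unit.\<close>

lemma mu_inj:
 assumes "z : mu" "w : mu" "nrm (z - w) < 1" shows "z = w"
proof -
 have w: "w ~= 0" "nrm w = 1" using nrm_mu[OF assms(2)] by auto
 define u where "u = z * inverse w"
 have u: "u : mu" unfolding u_def using assms mu_closed by blast
 have "u - 1 = (z - w) * inverse w" using w(1) by (simp add: u_def field_simps)
 then have u1: "nrm (u - 1) < 1" using assms(3) w(2) by (simp add: nrm_mult nrm_inverse)
 obtain n where n: "n > 0" "~ p dvd n" "u ^ n = 1" using u by (auto simp: mu_def)
 have "u = 1"
 proof (rule ccontr)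
  assume "u ~= 1"
  have "(\<Sum>i<n. u ^ i) * (u - 1) = 0" using power_diff_1_eq[of u n] n(3) by (simp add: mult.commute)
  then have s: "(\<Sum>i<n. u ^ i) = 0" using \<open>u ~= 1\<close> by simp
  have "nrm (u ^ i - 1) < 1" for i
  proof (induction i)
   case (Suc i)
   have "u ^ Suc i - 1 = u * (u ^ i - 1) + (u - 1)" by (simp add: algebra_simps)
   moreover have "nrm (u * (u ^ i - 1)) < 1" using Suc.IH nrm_mu[OF u] by (simp add: nrm_mult)
   ultimately show ?case using nrm_add[of "u * (u ^ i - 1)" "u - 1"] u1 by (simp only:)
  qed simp
  then have "nrm (\<Sum>i<n. u ^ i - 1) < 1" by (intro nrm_sum_less) auto
  then have "nrm (of_nat n) < 1" using s by (simp add: sum_subtractf)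
  then show False using nrm_of_nat_coprime[OF n(2)] by simp
 qed
 then show ?thesis using w(1) by (simp add: u_def field_simps)
qed

text \<open>For a suitable \<open>n\<close> prime to \<open>p\<close>, the small number
  \<open>x ^ n - 1\<close> is the product of the differences between \<open>x\<close> and the n-th
  roots of unity, so one of these differences is small.\<close>

lemma teichmueller:
 assumes "nrm x = 1" shows "EX z:mu. nrm (x - z) < 1"
proof -
 obtain n where n: "n > 0" "~ p dvd n" "nrm (x ^ n - 1) < 1" using unit_power[OF assms] by blast
 let ?f = "monom 1 n - 1 :: 'f alg_closure poly"
 have c: "coeff ?f n = 1" using n(1) by (simp add: coeff_1)
 then have "?f ~= 0" by (metis coeff_0 zero_neq_one)
 then obtain A where A: "?f = smult (lead_coeff ?f) (\<Prod>a\<in>#A. [:- a, 1:])"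
  using alg_closed_imp_factorization by blast
 have "degree ?f = n"
  using n(1) by (intro antisym degree_diff_le le_degree) (auto simp: degree_monom_le coeff_1)
 then have lc: "lead_coeff ?f = 1" using c by simp
 have pf: "poly ?f y = (\<Prod>a\<in>#A. y - a)" for y
  by (subst A) (simp only: lc poly_smult poly_prod_mset, simp add: multiset.map_comp o_def)
 have "nrm (\<Prod>a\<in>#A. x - a) < 1" using n(3) pf[of x] by (simp add: poly_monom)
 moreover have "\<exists>a\<in>#C. nrm (x - a) < 1" if "nrm (\<Prod>a\<in>#C. x - a) < 1" for C
  using that
 proof (induction C)
  case (add a C)
  show ?case
  proof (cases "nrm (x - a) < 1")
   case False
   then have "nrm (\<Prod>a\<in>#C. x - a) * 1 <= nrm (\<Prod>a\<in>#C. x - a) * nrm (x - a)" by (intro mult_left_mono) auto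
   then have "nrm (\<Prod>a\<in>#C. x - a) < 1" using add.prems by (simp add: nrm_mult mult.commute)
   then show ?thesis using add.IH by auto
  qed simp
 qed simp
 ultimately obtain a where a: "a \<in># A" "nrm (x - a) < 1" by blast
 have "poly ?f a = 0" unfolding pf using a(1) by (auto simp: prod_mset_zero_iff)
 then have "a ^ n = 1" by (simp add: poly_monom)
 then show ?thesis using a(2) n(1,2) by (auto simp: mu_def)
qed

lemma separable_mu: "z : mu ==> separable_element z"
proof -
 assume "z : mu"
 then obtain n where n: "n > 0" "~ p dvd n" "z ^ n = 1" by (auto simp: mu_def)
 have n0: "(of_nat n :: 'f alg_closure) ~= 0" using nrm_of_nat_coprime[OF n(2)] by auto
 let ?f = "monom 1 n - 1 :: 'f poly"
 have fa: "ac_poly ?f = monom 1 n - 1" by (rule poly_eqI) (simp add: coeff_map_poly coeff_1)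
 show ?thesis
 proof (rule separable_elementI[of ?f])
  have "coeff ?f n = 1" using n(1) by (simp add: coeff_1)
  then show "?f ~= 0" by (metis coeff_0 zero_neq_one)
  show "poly (ac_poly ?f) z = 0" unfolding fa using n(3) by (simp add: poly_monom)
  fix y assume "poly (ac_poly ?f) y = 0"
  then have "y ^ n = 1" by (simp add: fa poly_monom)
  then have "y ~= 0" using n(1) by (metis power_0_left less_irrefl zero_neq_one)
  then show "poly (pderiv (ac_poly ?f)) y ~= 0"
   using n0 by (simp add: fa pderiv_diff pderiv_monom poly_monom)
 qed
qed

text \<open>With \<open>n\<close> the exact order of \<open>z\<close>, the powers of
  \<open>z\<close> exhaust the roots of unity of exponent \<open>n\<close>. Since power maps
  commute, commutators of automorphisms fix \<open>mu\<close> and so belong to inertia.\<close>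

lemma mu_galois_power:
 assumes z: "z : mu" and s: "s : abs_galois" shows "EX k. s z = z ^ k"
proof -
 obtain n0 where "n0 > 0 & z ^ n0 = 1" using z by (auto simp: mu_def)
 define n where "n = (LEAST n. n > 0 & z ^ n = 1)"
 have n: "n > 0" "z ^ n = 1" using LeastI[of "%n. n > 0 & z ^ n = 1" n0] \<open>n0 > 0 & z ^ n0 = 1\<close> by (auto simp: n_def)
 have min: "~ (0 < m & z ^ m = 1)" if "m < n" for m using that not_less_Least unfolding n_def by blast
 have z0: "z ~= 0" using nrm_mu[OF z] by auto
 have "inj_on (%i. z ^ i) {..<n}"
 proof (rule inj_onI)
  have *: "~ (i < j & z ^ i = z ^ j)" if "j < n" for i j
  proof
   assume ij: "i < j & z ^ i = z ^ j"
   then have "z ^ i * z ^ (j - i) = z ^ i * 1" using power_add[of z i "j - i"] by simp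
   then have "z ^ (j - i) = 1" using z0 by simp
   then have "z ^ j = z ^ i" "0 < j - i & z ^ (j - i) = 1" using ij by auto
   moreover have "j - i < n" using that by simp
   ultimately show False using min by blast
  qed
  fix i j assume "i : {..<n}" "j : {..<n}" "z ^ i = z ^ j"
  then show "i = j" using *[of i j] *[of j i] by (metis lessThan_iff linorder_neqE_nat)
 qed
 then have card: "card ((%i. z ^ i) ` {..<n}) = n" by (simp add: card_image)
 let ?f = "monom 1 n - 1 :: 'f alg_closure poly"
 have "coeff ?f n = 1" using n(1) by (simp add: coeff_1)
 then have f0: "?f ~= 0" by (metis coeff_0 zero_neq_one)
 have "(%i. z ^ i) ` {..<n} <= {y. poly ?f y = 0}"
  using n(2) by (auto simp: poly_monom) (metis mult.commute power_mult power_one)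
 moreover have "card {y. poly ?f y = 0} <= n"
  using card_poly_roots_bound[OF f0] degree_diff_le[of "monom (1 :: 'f alg_closure) n" n 1] degree_monom_le[of 1 n]
  by fastforce
 ultimately have "(%i. z ^ i) ` {..<n} = {y. poly ?f y = 0}"
  using card by (intro card_seteq poly_roots_finite[OF f0]) auto
 moreover have "poly ?f (s z) = 0"
  using n(2) by (simp add: poly_monom autsD(6)[OF s] flip: autsD(11)[OF s])
 ultimately show ?thesis by blast
qed

lemma mu_galois_commute: "z : mu ==> s : abs_galois ==> t : abs_galois ==> s (t z) = t (s z)"
 using mu_galois_power[of z s] mu_galois_power[of z t]
 by (auto simp: autsD(11) simp flip: power_mult) (simp add: mult.commute)

text \<open>A unit differs from its Teichmueller representative by an element of the maximal ideal,
  and two congruent elements of \<open>mu\<close> are equal. So acting trivially on residues amounts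
  to fixing \<open>mu\<close>.\<close>

lemma inertia_iff: "s : inertia v \<longleftrightarrow> s : abs_galois & (ALL z:mu. s z = z)"
proof safe
 assume i: "s : inertia v"
 then show s: "s : abs_galois" by (simp add: inertia_def)
 fix z assume z: "z : mu"
 then have "nrm (s z - z) < 1" using i nrm_mu by (auto simp: inertia_def integers_iff max_ideal_iff)
 then show "s z = z" using mu_inj mu_closed(5)[OF s z] z by blast
next
 assume s: "s : abs_galois" and z: "ALL z:mu. s z = z"
 have "nrm (s x - x) < 1" if x: "nrm x <= 1" for x
 proof (cases "nrm x = 1")
  case True
  then obtain w where w: "w : mu" "nrm (x - w) < 1" using teichmueller by blast
  have "s x - x = s (x - w) - (x - w)" using z w(1) by (simp add: autsD[OF s])
  moreover have "nrm (s (x - w) - (x - w)) < 1" using nrm_diff[of "s (x - w)" "x - w"] w(2) s by simp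
  ultimately show ?thesis by (simp only:)
 next
  case False
  then show ?thesis using nrm_diff[of "s x" x] x s by simp
 qed
 then show "s : inertia v" using s by (auto simp: inertia_def integers_iff max_ideal_iff)
qed

lemma aut_group_inertia: "aut_group (inertia v)"
 unfolding aut_group_def
proof (intro conjI ballI subsetI)
 show "s : abs_galois" if "s : inertia v" for s using that by (simp add: inertia_iff)
 show "id : inertia v" by (simp add: inertia_iff id_auts)
 fix s t assume s: "s : inertia v"
 then show "ginv s : inertia v" using ginv_simps(2)[of s base_field]
  by (auto simp: inertia_iff auts_inv) metis
 assume "t : inertia v"
 then show "s o t : inertia v" using s by (auto simp: inertia_iff intro: auts_comp)
qed

lemma inertia_normal:
 assumes "\<iota> : inertia v" "s : abs_galois" shows "ginv s o \<iota> o s : inertia v"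
 using assms ginv_simps(2)[OF assms(2)] mu_closed(5)[OF assms(2)]
 by (auto simp: inertia_iff intro!: auts_comp auts_inv)

end

section \<open>Tame and unramified extensions\<close>

context local_field
begin

text \<open>Tameness in terms of values: their exponents have denominators dividing some
  \<open>j\<close> prime to \<open>p\<close>. In contrast to the ramification index being prime to
  \<open>p\<close>, this visibly passes to subfields with the same \<open>j\<close>.\<close>

definition tame_exp :: "'f alg_closure set => nat => bool" where
 "tame_exp K j \<longleftrightarrow> finite_extension K & 0 < j & ~ p dvd j & (ALL x:K - {0}. EX z::int. nrm x ^ j = 2 powi z)"

definition coset :: "'f alg_closure set => 'f alg_closure set => 'f alg_closure => 'f alg_closure set" where
 "coset L K x = {x * y * u |y u. y : L - {0} & u : K Int unit_integers v}"

lemma coset_eq_iff: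
 assumes L: "intermediate_field L" "L <= K" and K: "intermediate_field K" and xy: "x : K - {0}" "y : K - {0}"
 shows "coset L K x = coset L K y \<longleftrightarrow> (EX a:L - {0}. nrm x = nrm y * nrm a)"
proof
 assume "coset L K x = coset L K y"
 moreover have "x * 1 * 1 : coset L K x"
  unfolding coset_def using ifieldD(3)[OF L(1)] ifieldD(3)[OF K] unit_integers_iff[of 1]
  by (intro CollectI exI conjI refl) auto
 ultimately have "x : coset L K y" by simp
 then show "EX a:L - {0}. nrm x = nrm y * nrm a" by (auto simp: coset_def unit_integers_iff nrm_mult)
next
 have *: "coset L K x <= coset L K y"
  if xy: "x : K - {0}" "y : K - {0}" and a: "a : L - {0}" "nrm x = nrm y * nrm a" for x y a
 proof
  fix z assume "z : coset L K x"
  then obtain b u where b: "z = x * b * u" "b : L - {0}" "u : K" "nrm u = 1" by (auto simp: coset_def unit_integers_iff)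
  have "z = y * (a * b) * (u * (x / (y * a)))" using xy a(1) by (simp add: b(1) field_simps)
  moreover have "nrm (u * (x / (y * a))) = 1" using a xy b(4) by (simp add: nrm_mult nrm_divide)
  moreover have "u * (x / (y * a)) : K" using b(3) xy a(1) L(2) by (intro ifieldD[OF K]) auto
  moreover have "a * b : L - {0}" using a(1) b(2) ifieldD(5)[OF L(1)] by auto
  ultimately show "z : coset L K y" unfolding coset_def unit_integers_iff[symmetric] by blast
 qed
 assume "EX a:L - {0}. nrm x = nrm y * nrm a"
 then obtain a where a: "a : L - {0}" "nrm x = nrm y * nrm a" by blast
 then have "nrm y = nrm x * nrm (inverse a)" by (simp add: nrm_inverse)
 then show "coset L K x = coset L K y"
  using *[OF xy a] *[OF xy(2,1), of "inverse a"] a(1) ifieldD(6)[OF L(1)] by auto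
qed

lemma ramification_index_coset: "ramification_index v L K = card (coset L K ` (K - {0}))"
 by (simp add: ramification_index_def coset_def)

lemma nrm_base: "a : base_field - {0} ==> EX z::int. nrm a = 2 powi z"
proof -
 assume "a : base_field - {0}"
 then obtain c where "a = to_ac c" "c ~= 0" by auto
 then have "nrm a = 2 powi (- v c)" using powr_real_of_int'[of 2 "- v c"] by (simp add: av_def)
 then show ?thesis by blast
qed

lemma powi_2: "(2 :: real) powi z = 2 powr z"
 by (simp add: powr_real_of_int')

lemma powi_2_inject: "(2 :: real) powi a = 2 powi b \<longleftrightarrow> a = b"
 unfolding powi_2 by (simp add: powr_inj)

lemma powi_2_power: "((2 :: real) powi z) ^ n = 2 powi (z * int n)"
 by (simp add: power_int_mult)

text \<open>The exponents of the values of \<open>K\<close>, in units of \<open>1/j\<close>, form a subgroup \<open>d\<int>\<close> containing \<open>j\<close>.\<close>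

lemma ramification_index_dvd:
 assumes K: "finite_extension K" and j: "0 < j" "ALL x:K - {0}. EX z::int. nrm x ^ j = 2 powi z"
 defines "e \<equiv> ramification_index v base_field K"
 shows "e dvd j" "ALL x:K - {0}. EX z::int. nrm x ^ e = 2 powi z"
proof -
 note Kf = finite_ext_field[OF K]
 obtain k where k: "!!x. x : K - {0} ==> nrm x ^ j = 2 powi (k x :: int)" using j(2) by metis
 have kmul: "k (x * y) = k x + k y" if "x : K - {0}" "y : K - {0}" for x y
  using k[OF that(1)] k[OF that(2)] k[of "x * y"] that ifieldD(5)[OF Kf, of x y]
  by (simp add: nrm_mult power_mult_distrib flip: power_int_add powi_2_inject)
 have kbase: "k (to_ac \<pi> powi z) = - int j * z" for z
 proof -
  have "to_ac \<pi> powi z : K - {0}" using pi_powi base_field_subset[OF Kf] by blast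
  then have "2 powi k (to_ac \<pi> powi z) = (2 powi (- z) :: real) ^ j" using k pi_powi(2) by metis
  also have "... = 2 powi (- int j * z)" unfolding powi_2_power by (simp add: mult.commute)
  finally show ?thesis by (simp only: powi_2_inject)
 qed
 have kK: "to_ac \<pi> powi z : K - {0}" for z using pi_powi base_field_subset[OF Kf] by blast
 define G where "G = k ` (K - {0})"
 have Gadd: "a + b : G" if ab: "a : G" "b : G" for a b
 proof -
  obtain x y where "x : K - {0}" "y : K - {0}" "a = k x" "b = k y" using ab unfolding G_def by blast
  moreover from this have "x * y : K - {0}" using ifieldD(5)[OF Kf] by auto
  ultimately show ?thesis using kmul by (metis G_def image_eqI)
 qed
 have G0: "0 : G" using kbase[of 0] kK[of 0] by (force simp: G_def)
 have Gneg: "- a : G" if a: "a : G" for a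
 proof -
  obtain x where x: "x : K - {0}" "a = k x" using a unfolding G_def by blast
  then have "inverse x : K - {0}" using ifieldD(6)[OF Kf] by auto
  moreover have "k x + k (inverse x) = 0" using kmul[OF x(1) \<open>inverse x : K - {0}\<close>] x(1) kbase[of 0] by simp
  ultimately show ?thesis using x(2) by (metis G_def image_eqI add_eq_0_iff)
 qed
 have Gmul: "int n * a : G" if "a : G" for a n
  by (induction n) (use G0 Gadd[OF that] in \<open>auto simp: distrib_right\<close>)
 have Gmul': "z * a : G" if "a : G" for a z
  using Gmul[OF that] Gneg[OF Gmul[OF that]] by (cases z rule: int_cases2) auto
 have jG: "int j : G" using kbase[of "- 1"] kK[of "- 1"] unfolding G_def by (metis image_eqI minus_mult_minus mult.right_neutral)
 define d where "d = (LEAST n. 0 < n & int n : G)"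
 have d: "0 < d" "int d : G" using LeastI[of "%n. 0 < n & int n : G" j] j(1) jG by (auto simp: d_def)
 have dG: "int d dvd a" if "a : G" for a
 proof (rule ccontr)
  assume "~ int d dvd a"
  then have "0 < a mod int d" "a mod int d < int d"
   using d(1) pos_mod_bound[of "int d" a] pos_mod_sign[of "int d" a] unfolding dvd_eq_mod_eq_0 by linarith+
  moreover have "a mod int d = a + (- (a div int d)) * int d" by (simp add: minus_div_mult_eq_mod[symmetric])
  then have "a mod int d : G" using Gadd[OF that Gmul'[OF d(2)]] by metis
  ultimately have "0 < nat (a mod int d) & int (nat (a mod int d)) : G" "nat (a mod int d) < d" by auto
  then show False using not_less_Least unfolding d_def by blast
 qed
 obtain m where m: "j = d * m" using dG[OF jG] by (auto elim!: dvdE)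
 have m0: "0 < m" using m j(1) by auto
 have kd: "k x = int d * (k x div int d)" if "x : K - {0}" for x
  using dG[of "k x"] that by (auto simp: G_def)
 \<comment> \<open>Multiplication by elements of F changes the exponent by multiples of
   \<open>j = d * m\<close>, so in units of \<open>d\<close> the cosets are the residues modulo
   \<open>m\<close>.\<close>
 let ?h = "%x. (k x div int d) mod int m"
 have pw: "nrm x = 2 powr (k x / j)" if "x : K - {0}" for x
 proof -
  have "nrm x ^ j = 2 powr (k x)" using k[OF that] by (simp add: powi_2)
  also have "... = (2 powr (k x / j)) ^ j" using j(1) by (simp add: powr_powr flip: powr_realpow)
  finally show ?thesis by (rule power_eq_imp_eq_base) (use j(1) in auto)
 qed
 have h: "coset base_field K x = coset base_field K y \<longleftrightarrow> ?h x = ?h y" if xy: "x : K - {0}" "y : K - {0}" for x y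
 proof -
  have "coset base_field K x = coset base_field K y \<longleftrightarrow> (EX z::int. k x = k y + int j * z)"
   unfolding coset_eq_iff[OF ifield_base base_field_subset[OF Kf] Kf xy]
  proof
   assume "EX a:base_field - {0}. nrm x = nrm y * nrm a"
   then obtain z :: int where "nrm x = nrm y * 2 powi z" using nrm_base by metis
   then have "nrm x ^ j = nrm y ^ j * 2 powi (int j * z)" by (simp add: power_mult_distrib powi_2_power mult.commute)
   then show "EX z::int. k x = k y + int j * z"
    using k[OF xy(1)] k[OF xy(2)] by (auto simp flip: power_int_add simp: powi_2_inject)
  next
   assume "EX z::int. k x = k y + int j * z"
   then obtain z :: int where z: "k x = k y + int j * z" by blast
   have "nrm x = 2 powr (k y / j + z)" using pw[OF xy(1)] z j(1) by (simp add: add_divide_distrib)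
   also have "... = nrm y * 2 powi z" using pw[OF xy(2)] powr_real_of_int'[of 2 z] by (simp add: powr_add)
   also have "2 powi z = nrm (to_ac \<pi> powi (- z))" using pi_powi(2)[of "- z"] by simp
   finally show "EX a:base_field - {0}. nrm x = nrm y * nrm a" using pi_powi[of "- z"] by blast
  qed
  also have "... \<longleftrightarrow> (EX z::int. k x div int d = k y div int d + int m * z)"
  proof -
   have "k x = k y + int j * z \<longleftrightarrow> int d * (k x div int d) = int d * (k y div int d + int m * z)" for z
    using kd[OF xy(1)] kd[OF xy(2)] m by (simp add: distrib_left mult.assoc)
   then show ?thesis using d(1) by simp
  qed
  also have "... \<longleftrightarrow> ?h x = ?h y" by (auto simp: mod_eq_dvd_iff dvd_def algebra_simps)
  finally show ?thesis .
 qed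
 have "?h ` (K - {0}) = {0..<int m}"
 proof
  show "?h ` (K - {0}) <= {0..<int m}" using m0 by auto
  show "{0..<int m} <= ?h ` (K - {0})"
  proof
   fix a assume a: "a : {0..<int m}"
   have "a * int d : G" by (rule Gmul'[OF d(2)])
   then obtain x where "x : K - {0}" "k x = a * int d" unfolding G_def by (metis imageE)
   then show "a : ?h ` (K - {0})" using a d(1) by (intro image_eqI[of _ _ x]) auto
  qed
 qed
 then have "card (?h ` (K - {0})) = m" by simp
 moreover have "card (coset base_field K ` (K - {0})) = card (?h ` (K - {0}))"
 proof (rule bij_betw_same_card)
  let ?g = "%C. ?h (SOME x. x : K - {0} & coset base_field K x = C)"
  have gx: "?g (coset base_field K x) = ?h x" if "x : K - {0}" for x
   using someI[of "%y. y : K - {0} & coset base_field K y = coset base_field K x" x] that h by blast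
  show "bij_betw ?g (coset base_field K ` (K - {0})) (?h ` (K - {0}))"
   using gx h by (auto simp: bij_betw_def inj_on_def image_image cong: image_cong_simp)
 qed
 ultimately have em: "e = m" by (simp add: e_def ramification_index_coset)
 show "e dvd j" using em m by simp
 show "ALL x:K - {0}. EX z::int. nrm x ^ e = 2 powi z"
 proof
  fix x assume x: "x : K - {0}"
  have "real_of_int (k x) / j * m = of_int (k x div int d)" by (subst kd[OF x]) (use m d(1) m0 in simp)
  then have "nrm x ^ e = 2 powr of_int (k x div int d)" unfolding pw[OF x] em by (simp add: powr_powr flip: powr_realpow)
  then show "EX z::int. nrm x ^ e = 2 powi z" using powr_real_of_int'[of 2 "k x div int d"] by auto
 qed
qed

lemma tame_iff: "tamely_ramified v K \<longleftrightarrow> (EX j. tame_exp K j)"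
proof
 assume t: "tamely_ramified v K"
 then have K: "finite_extension K" and c: "coprime p (ramification_index v base_field K)" by (auto simp: tamely_ramified_def)
 obtain j where j: "0 < j" "ALL x:K - {0}. EX z::int. nrm x ^ j = 2 powi z" using value_exponent[OF K] by blast
 have "~ p dvd ramification_index v base_field K"
  using c p_gt_1 by (metis coprime_common_divisor_nat dvd_refl less_irrefl)
 moreover from this have "0 < ramification_index v base_field K" by (intro gr0I) auto
 ultimately show "EX j. tame_exp K j"
  using ramification_index_dvd(2)[OF K j] K unfolding tame_exp_def by blast
next
 assume "EX j. tame_exp K j"
 then obtain j where j: "finite_extension K" "0 < j" "~ p dvd j" "ALL x:K - {0}. EX z::int. nrm x ^ j = 2 powi z"
  by (auto simp: tame_exp_def)
 have "~ p dvd ramification_index v base_field K" using ramification_index_dvd(1)[OF j(1,2,4)] j(3) dvd_trans by blast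
 then show "tamely_ramified v K" using j(1) prime_p by (simp add: tamely_ramified_def prime_imp_coprime)
qed

lemma tame_exp_subset:
 assumes "tame_exp K j" "intermediate_field M" "M <= K" shows "tame_exp M j"
 using assms finite_extension_subset by (auto simp: tame_exp_def)

text \<open>
  The \<open>Q\<close>-th power of \<open>y\<close>, rescaled by an element of \<open>F\<close>, is close to \<open>y\<close> for a suitable large power
  \<open>Q\<close> of \<open>p\<close>, while it is almost fixed by the automorphism.
\<close>

lemma tame_rigid:
 assumes K: "tame_exp K j" and s: "q : abs_galois"
  and small: "!!x. x : K ==> x ~= 0 ==> nrm (q x / x - 1) < 1" and x: "x : K"
 shows "q x = x"
proof -
 have Kf: "intermediate_field K" and j: "0 < j" "~ p dvd j" "!!x. x : K ==> x ~= 0 ==> EX z::int. nrm x ^ j = 2 powi z"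
  using K finite_ext_field by (auto simp: tame_exp_def)
 \<comment> \<open>The smallest possible ratio between two different values of
   \<open>K\<close>.\<close>
 define c where "c = (2 :: real) powr (1 / j)"
 have c1: "1 < c" using j(1) by (simp add: c_def)
 have cj: "c ^ j = 2" using j(1) by (simp add: c_def powr_powr flip: powr_realpow)
 have gap: "nrm y' * c <= nrm y" if yy: "y' : K" "y : K" "nrm y' < nrm y" for y y'
 proof (cases "y' = 0")
  case False
  have "y ~= 0" using that(3) nrm_nonneg[of y'] by (intro notI) (simp del: nrm_nonneg)
  obtain a :: int where a: "nrm y' ^ j = 2 powi a" using j(3)[OF yy(1) False] by blast
  obtain b :: int where b: "nrm y ^ j = 2 powi b" using j(3)[OF yy(2) \<open>y ~= 0\<close>] by blast
  note ab = a b
  have "nrm y' ^ j < nrm y ^ j" using that(3) j(1) by (intro power_strict_mono) auto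
  then have "a < b" unfolding ab powi_2 by simp
  then have "(2 :: real) powi (a + 1) <= 2 powi b" by (intro power_int_increasing) auto
  then have "(nrm y' * c) ^ j <= nrm y ^ j" unfolding power_mult_distrib ab cj by (simp add: power_int_add)
  then show ?thesis using j(1) by (simp add: power_mono_iff c1 less_imp_le order_less_imp_le[OF less_trans[OF zero_less_one c1]])
 qed simp
 \<comment> \<open>Induction over shells: \<open>y\<close> is replaced by the smaller
   \<open>y - yQ\<close>, which lies one shell further in by the gap between values, while
   \<open>yQ\<close> is moved by at most \<open>R\<close> because it is a high p-power times an
   element of F.\<close>
 have main: "ALL y:K. nrm y <= R * c ^ n --> nrm (q y - y) <= R" if R: "0 < R" for R n
 proof (induction n)
  case 0
  have "nrm (q y - y) <= nrm y" for y using nrm_diff[of "q y" y] s by simp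
  then show ?case by (auto intro: order_trans)
 next
  case (Suc n)
  show ?case
  proof (intro ballI impI)
   fix y assume y: "y : K" "nrm y <= R * c ^ Suc n"
   show "nrm (q y - y) <= R"
   proof (cases "y = 0")
    case False
    obtain k :: int where k: "nrm y ^ j = 2 powi k" using j(3) y(1) False by blast
    define u where "u = y ^ j * to_ac \<pi> powi k"
    have "nrm u = 1" by (simp add: u_def nrm_mult nrm_power k pi_powi(2) flip: power_int_add)
    then obtain m where m: "0 < m" "~ p dvd m" "nrm (u ^ m - 1) < 1" using unit_power by blast
    have "nrm (q y / y - 1) < 1" using small y(1) False by blast
    moreover have "0 < R / nrm y" using R False by simp
    ultimately obtain t0 where t0: "!!t. t >= t0 ==> nrm ((q y / y) ^ p ^ t - 1) < R / nrm y" using power_p_principal by blast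
    \<comment> \<open>Euler's theorem makes \<open>p ^ t\<close> congruent to 1 modulo
      \<open>j * m\<close>, so that the rescaled power of \<open>y\<close> is \<open>y\<close> times
      a power of \<open>u ^ m\<close>; the factor \<open>Suc t0\<close> makes \<open>t\<close> large
      enough.\<close>
    define t where "t = totient (j * m) * Suc t0"
    have jm: "0 < j * m" "coprime p (j * m)" using j m prime_p by (auto simp: prime_imp_coprime prime_dvd_mult_iff)
    have "0 < totient (j * m)" using jm(1) by simp
    then have tt: "t0 <= t" by (cases "totient (j * m)") (auto simp: t_def)
    have "[(p ^ totient (j * m)) ^ Suc t0 = 1 ^ Suc t0] (mod j * m)" by (intro cong_pow euler_theorem jm(2))
    then have "[p ^ t = 1] (mod j * m)" unfolding t_def power_mult power_one .
    moreover have "1 <= p ^ t" using p_gt_1 by simp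
    ultimately have "j * m dvd p ^ t - 1" by (simp add: cong_altdef_nat cong_sym)
    then obtain l where "p ^ t - 1 = j * m * l" by blast
    then have l: "p ^ t = j * m * l + 1" using \<open>1 <= p ^ t\<close> by simp
    define b where "b = (to_ac \<pi> powi k) ^ (m * l)"
    define yQ where "yQ = y ^ p ^ t * b"
    have bF: "b : base_field" unfolding b_def by (intro ifieldD(10)[OF ifield_base] pi_powi)
    have yQ: "yQ = y * (u ^ m) ^ l"
     by (simp add: yQ_def b_def u_def l power_mult_distrib mult_ac flip: power_mult)
    have K': "yQ : K" unfolding yQ_def using bF base_field_subset[OF Kf] y(1)
     by (intro ifieldD(5,10)[OF Kf]) auto
    have um: "nrm ((u ^ m) ^ l - 1) < 1"
    proof (induction l)
     case (Suc l)
     have "(u ^ m) ^ Suc l - 1 = u ^ m * ((u ^ m) ^ l - 1) + (u ^ m - 1)" by (simp add: algebra_simps)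
     moreover have "nrm (u ^ m * ((u ^ m) ^ l - 1)) < 1" using Suc.IH \<open>nrm u = 1\<close> by (simp add: nrm_mult nrm_power)
     ultimately show ?case using nrm_add[of "u ^ m * ((u ^ m) ^ l - 1)" "u ^ m - 1"] m(3) by (simp only:)
    qed simp
    have "y - yQ = - (y * ((u ^ m) ^ l - 1))" unfolding yQ by (simp add: algebra_simps)
    then have "nrm (y - yQ) < nrm y" using um False by (simp add: nrm_mult)
    then have "nrm (y - yQ) * c <= R * c ^ n * c" using gap[OF ifieldD(4)[OF Kf y(1) K'] y(1)] y(2) by (simp add: mult_ac)
    then have "nrm (y - yQ) <= R * c ^ n" using c1 by simp
    then have 1: "nrm (q (y - yQ) - (y - yQ)) <= R" using Suc.IH ifieldD(4)[OF Kf y(1) K'] by blast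
    have "q b = b" using bF s autsD(4) by blast
    then have "q yQ - yQ = yQ * ((q y / y) ^ p ^ t - 1)"
     using False by (simp add: yQ_def autsD[OF s] power_divide field_simps)
    moreover have "nrm yQ = nrm y" unfolding yQ using \<open>nrm u = 1\<close> by (simp add: nrm_mult nrm_power)
    ultimately have "nrm (q yQ - yQ) <= nrm y * (R / nrm y)"
     using mult_left_mono[OF less_imp_le[OF t0[OF tt]], of "nrm y"] by (simp only: nrm_mult nrm_nonneg)
    then have 2: "nrm (q yQ - yQ) <= R" using False by simp
    have "q y - y = (q (y - yQ) - (y - yQ)) + (q yQ - yQ)" by (simp add: autsD[OF s])
    then show ?thesis using nrm_add[of "q (y - yQ) - (y - yQ)" "q yQ - yQ"] 1 2 by (simp only:)
   qed (use R s in \<open>simp add: autsD\<close>)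
  qed
 qed
 have "nrm (q x - x) <= R" if R: "0 < R" for R
 proof -
  obtain n where "nrm x / R < c ^ n" using real_arch_pow[OF c1] by blast
  then have "nrm x <= R * c ^ n" using R by (simp add: field_simps)
  then show ?thesis using main[OF R] x by blast
 qed
 then have "nrm (q x - x) = 0" using field_le_epsilon[of "nrm (q x - x)" 0] nrm_nonneg by (metis add_0 antisym)
 then show ?thesis by simp
qed

section \<open>Adjoining roots of unity of order prime to p\<close>

definition mu_n :: "nat => 'f alg_closure set" where "mu_n n = {z. z ^ n = 1}"

lemma finite_mu_n: "0 < n ==> finite (mu_n n)"
proof -
 assume n: "0 < n"
 let ?f = "monom 1 n - 1 :: 'f alg_closure poly"
 have "coeff ?f n = 1" using n by (simp add: coeff_1)
 then have "?f ~= 0" by (metis coeff_0 zero_neq_one)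
 then show ?thesis using poly_roots_finite[of ?f] by (simp add: poly_monom mu_n_def)
qed

lemma mu_n_subset: "0 < n ==> ~ p dvd n ==> mu_n n <= mu"
 by (auto simp: mu_n_def mu_def)

lemma mu_n_galois: "s : abs_galois ==> z : mu_n n ==> s z : mu_n n"
 by (auto simp: mu_n_def autsD(6) simp flip: autsD(11))

lemma mu_n_mult: "z : mu_n n ==> w : mu_n n ==> z * w : mu_n n"
 by (simp add: mu_n_def power_mult_distrib)

lemma gen_field_mu:
 assumes L: "intermediate_field L" and x: "x : gen_field L mu"
 obtains n where "0 < n" "~ p dvd n" "x : gen_field L (mu_n n)"
proof -
 let ?U = "{x. EX n>0. ~ p dvd n & x : gen_field L (mu_n n)}"
 have mono: "gen_field L (mu_n m) <= gen_field L (mu_n (m * n))" for m n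
 proof (rule gen_field_least[OF ifield_gen gen_field_subset(1)])
  have "mu_n m <= mu_n (m * n)" by (auto simp: mu_n_def power_mult)
  then show "mu_n m <= gen_field L (mu_n (m * n))" using gen_field_subset(2) by blast
 qed
 have "intermediate_field ?U"
 proof (rule ifieldI)
  have "1 : {n. 0 < n & ~ p dvd n}" using p_gt_1 by auto
  then show "base_field <= ?U" using base_field_subset[OF ifield_gen] by blast
  fix a b assume "a : ?U" "b : ?U"
  then obtain m n where mn: "0 < m" "~ p dvd m" "a : gen_field L (mu_n m)" "0 < n" "~ p dvd n" "b : gen_field L (mu_n n)"
   by blast
  then have "a : gen_field L (mu_n (m * n))" "b : gen_field L (mu_n (m * n))"
   using mono[of m n] mono[of n m] by (auto simp: mult.commute)
  then have "a - b : gen_field L (mu_n (m * n))" "a * b : gen_field L (mu_n (m * n))"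
   using ifieldD(4,5)[OF ifield_gen] by blast+
  moreover have "0 < m * n & ~ p dvd m * n" using mn prime_p by (simp add: prime_dvd_mult_iff)
  ultimately show "a - b : ?U" "a * b : ?U" by blast+
 qed
 moreover have "L <= ?U" "mu <= ?U"
 proof -
  have "1 : {n. 0 < n & ~ p dvd n}" using p_gt_1 by auto
  then show "L <= ?U" using gen_field_subset(1)[of L] by blast
  show "mu <= ?U"
  proof
   fix z assume "z : mu"
   then obtain n where "0 < n" "~ p dvd n" "z : mu_n n" by (auto simp: mu_def mu_n_def)
   then show "z : ?U" using gen_field_subset(2) by blast
  qed
 qed
 ultimately have "x : ?U" using gen_field_least x by blast
 then show ?thesis using that by blast
qed

text \<open>An automorphism over \<open>gen_field L mu\<close> fixes \<open>mu\<close> and therefore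
  lies in inertia; so it fixes \<open>x\<close> by assumption, and separability applies.\<close>

lemma inertia_fixed:
 assumes L: "intermediate_field L" and x: "separable_element x" "!!u. u : inertia v ==> u : field_auts L ==> u x = x"
 shows "x : gen_field L mu"
proof (rule separable_fixed[OF ifield_gen x(1)])
 fix u assume s: "u : field_auts (gen_field L mu)"
 then have "u : field_auts L" using auts_mono[OF gen_field_subset(1)] by blast
 moreover have "u z = z" if "z : mu" for z using autsD(4)[OF s] gen_field_subset(2) that by blast
 then have "u : inertia v" using auts_abs[OF ifield_gen s] by (simp add: inertia_iff)
 ultimately show "u x = x" using x(2) by blast
qed

text \<open>Independence of characters over the residue field. Since the values lie in
  \<open>mu\<close>, characters that differ also differ modulo the maximal ideal, by
  \<open>mu_inj\<close>.\<close>

lemma dedekind_residue: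
 assumes I: "finite I" "I ~= {}" and A: "!!a b. a : A ==> b : A ==> a * b : A" "1 : A" "A <= mu"
  and f: "!!i a. i : I ==> a : A ==> f i a : mu" "!!i a b. i : I ==> a : A ==> b : A ==> f i (a * b) = f i a * f i b"
  and d: "!!i j. i : I ==> j : I ==> i ~= j ==> EX a:A. f i a ~= f j a" and c: "!!i. i : I ==> nrm (c i) = 1"
 shows "EX a:A. nrm (SUM i:I. c i * f i a) = 1"
proof (rule ccontr)
 assume no: "~ (EX a:A. nrm (SUM i:I. c i * f i a) = 1)"
 obtain i where i: "i : I" using I(2) by blast
 have "c i : {x. nrm x < 1}"
 proof (rule dedekind_mod_prime[where R = "{x. nrm x <= 1}" and P = "{x. nrm x < 1}" and A = A and f = f and I = I and c = c])
  fix x y :: "'f alg_closure"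
  assume "x : {x. nrm x <= 1}" "y : {x. nrm x <= 1}"
  then show "x * y : {x. nrm x <= 1}" "x - y : {x. nrm x <= 1}"
   using nrm_diff[of x y] by (auto simp: nrm_mult mult_le_one)
 next
  fix x y :: "'f alg_closure"
  assume "x : {x. nrm x < 1}" "y : {x. nrm x < 1}"
  then show "x - y : {x. nrm x < 1}" using nrm_diff[of x y] by auto
 next
  fix x y :: "'f alg_closure"
  assume "x : {x. nrm x <= 1}" "y : {x. nrm x < 1}"
  then show "x * y : {x. nrm x < 1}" using mult_left_le_one_le[of "nrm y" "nrm x"] by (auto simp: nrm_mult)
 next
  fix x y :: "'f alg_closure"
  assume "x : {x. nrm x <= 1}" "y : {x. nrm x <= 1}" "x * y : {x. nrm x < 1}"
  then show "x : {x. nrm x < 1} | y : {x. nrm x < 1}" by (auto simp: nrm_mult)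
 next
  fix i j assume ij: "i : I" "j : I" "i ~= j"
  then obtain a where "a : A" "f i a ~= f j a" using d by blast
  then show "EX a:A. f i a - f j a ~: {x. nrm x < 1}" using mu_inj f(1) ij by blast
 next
  fix i assume "i : I"
  then show "EX a:A. f i a ~: {x. nrm x < 1}" using nrm_mu[OF f(1)] A(2) by (intro bexI[of _ 1]) auto
 next
  fix a assume a: "a : A"
  have "nrm (SUM i:I. c i * f i a) <= 1" using c nrm_mu[OF f(1)] a by (intro nrm_sum_le) (auto simp: nrm_mult)
  then show "(SUM i:I. c i * f i a) : {x. nrm x < 1}" using no a by (auto simp: less_le)
 qed (use I i A f c nrm_mu in \<open>auto\<close>)
 then show False using c[OF i] by simp
qed

text \<open>Roots of unity of order prime to \<open>p\<close> do not enlarge the value group. The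
  trace of \<open>x * b\<close> down to \<open>L\<close> is \<open>x\<close> times a combination of
  residue characters with unit coefficients, and for a suitable root of unity \<open>b\<close> this
  combination is a unit.\<close>

lemma gen_field_mu_value:
 assumes L: "intermediate_field L" and n: "0 < n" "~ p dvd n" and x: "x : gen_field L (mu_n n)" "x ~= 0"
 shows "EX y:L - {0}. nrm y = nrm x"
proof -
 let ?M = "gen_field L (mu_n n)" and ?G = "restrictions (field_auts L) (mu_n n)"
 note H = aut_group_auts[OF L]
 have ab: "s : abs_galois" if "s : field_auts L" for s using auts_abs[OF L that] .
 have eq: "s w = t w" if st: "s : field_auts L" "t : field_auts L" "restrict s (mu_n n) = restrict t (mu_n n)" "w : ?M" for s t w
 proof -
  have "intermediate_field {w. s w = t w}"
   using ab[OF st(1)] ab[OF st(2)] by (intro ifieldI) (auto simp: autsD[OF st(1)] autsD[OF st(2)])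
  then have "?M <= {w. s w = t w}"
   using st by (intro gen_field_least) (auto simp: restrict_eq autsD(4)[OF st(1)] autsD(4)[OF st(2)])
  then show ?thesis using st(4) by blast
 qed
 have stM: "s w : ?M" if s: "s : field_auts L" "w : ?M" for s w
 proof -
  have "intermediate_field {w. s w : ?M}"
   using ab[OF s(1)] by (intro ifieldI) (auto simp: autsD[OF s(1)] ifieldD[OF ifield_gen])
  moreover have "L <= {w. s w : ?M}" using autsD(4)[OF s(1)] gen_field_subset(1)[of L "mu_n n"] by auto
  moreover have "mu_n n <= {w. s w : ?M}" using mu_n_galois[OF ab[OF s(1)]] gen_field_subset(2)[of "mu_n n" L] by auto
  ultimately have "?M <= {w. s w : ?M}" by (rule gen_field_least)
  then show ?thesis using s(2) by blast
 qed
 define r where "r = (%g. SOME s. s : field_auts L & restrict s (mu_n n) = g)"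
 have r: "r g : field_auts L" "restrict (r g) (mu_n n) = g" if "g : ?G" for g
  using someI_ex[of "%s. s : field_auts L & restrict s (mu_n n) = g"] that unfolding r_def by (auto elim!: restrictionsE)
 have finG: "finite ?G"
 proof (rule finite_subset)
  show "?G <= Pi\<^sub>E (mu_n n) (%_. mu_n n)" using mu_n_galois ab by (auto simp: restrictions_def)
  show "finite (Pi\<^sub>E (mu_n n) (%_. mu_n n))" using finite_mu_n[OF n(1)] by (intro finite_PiE) auto
 qed
 have gz: "g z = r g z" if "g : ?G" "z : mu_n n" for g z using r(2)[OF that(1)] that(2) by (metis restrict_apply')
 have "EX b:mu_n n. nrm (SUM g:?G. (r g x / x) * g b) = 1"
 proof (rule dedekind_residue)
  show "?G ~= {}" using restrictionsI[OF id_auts] by blast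
  show "1 : mu_n n" by (simp add: mu_n_def)
  show "mu_n n <= mu" by (rule mu_n_subset[OF n])
  show "g a : mu" if "g : ?G" "a : mu_n n" for g a
   unfolding gz[OF that] using mu_closed(5) ab r(1)[OF that(1)] that(2) mu_n_subset[OF n] by blast
  show "g (a * b) = g a * g b" if "g : ?G" "a : mu_n n" "b : mu_n n" for g a b
   unfolding gz[OF that(1) mu_n_mult[OF that(2,3)]] gz[OF that(1,2)] gz[OF that(1,3)]
   by (rule autsD(3)[OF r(1)[OF that(1)]])
  show "EX a:mu_n n. g a ~= h a" if "g : ?G" "h : ?G" "g ~= h" for g h
   using r(2) that by (metis restrict_ext gz)
  show "nrm (r g x / x) = 1" if "g : ?G" for g
   using ab[OF r(1)[OF that]] x(2) by (simp add: nrm_divide)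
 qed (use finG mu_n_mult in auto)
 then obtain b where b: "b : mu_n n" "nrm (SUM g:?G. (r g x / x) * g b) = 1" by blast
 define y where "y = (SUM g:?G. r g (x * b))"
 have "y = x * (SUM g:?G. (r g x / x) * g b)"
  unfolding y_def sum_distrib_left using x(2) gz b(1) autsD(3)[OF r(1)] by (intro sum.cong) auto
 then have ny: "nrm y = nrm x" using b(2) by (simp add: nrm_mult)
 have xb: "x * b : ?M" using x(1) b(1) gen_field_subset(2) ifieldD(5)[OF ifield_gen] by blast
 have "y : L"
 proof (rule gen_field_separable_fixed[OF L finite_mu_n[OF n(1)]])
  show "separable_element z" if "z : mu_n n" for z using separable_mu mu_n_subset[OF n] that by blast
  show "y : ?M" unfolding y_def using stM r xb by (intro ifield_sum[OF ifield_gen]) blast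
  fix t assume t: "t : field_auts L"
  have "t y = (SUM g:?G. t (r g (x * b)))" unfolding y_def by (rule auts_sum[OF t])
  also have "... = (SUM g:?G. r (restrict (t o g) (mu_n n)) (x * b))"
  proof (rule sum.cong)
   fix g assume g: "g : ?G"
   have G': "restrict (t o g) (mu_n n) : ?G" using restrictions_left[OF H t, of "mu_n n"] g by (auto simp: bij_betw_def)
   have "restrict (t o r g) (mu_n n) = restrict (r (restrict (t o g) (mu_n n))) (mu_n n)"
    unfolding r(2)[OF G'] using gz[OF g] by (auto simp: restrict_eq)
   then show "t (r g (x * b)) = r (restrict (t o g) (mu_n n)) (x * b)"
    using eq[OF auts_comp[OF t r(1)[OF g]] r(1)[OF G'] _ xb] by simp
  qed simp
  also have "... = y" unfolding y_def
   by (rule sum.reindex_bij_betw[OF restrictions_left[OF H t], of "%g. r g (x * b)"])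
  finally show "t y = y" .
 qed
 then show ?thesis using ny x(2) by (metis DiffI empty_iff insert_iff nrm_eq_0)
qed

end

context local_field
begin

section \<open>Unramified extensions and inertia\<close>

lemma unramified_value:
 assumes L: "intermediate_field L" "L <= K" and K: "intermediate_field K"
 shows "unramified v L K \<longleftrightarrow> (ALL x:K - {0}. EX y:L - {0}. nrm x = nrm y)"
proof -
 have 1: "1 : K - {0}" using ifieldD(3)[OF K] by simp
 have "card (coset L K ` (K - {0})) = 1 \<longleftrightarrow> (ALL x:K - {0}. coset L K x = coset L K 1)"
 proof
  assume "card (coset L K ` (K - {0})) = 1"
  then obtain C where "coset L K ` (K - {0}) = {C}" by (rule card_1_singletonE)
  then show "ALL x:K - {0}. coset L K x = coset L K 1" using 1 by blast
 next
  assume "ALL x:K - {0}. coset L K x = coset L K 1"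
  then have "coset L K ` (K - {0}) = {coset L K 1}" using 1 by blast
  then show "card (coset L K ` (K - {0})) = 1" by simp
 qed
 then show ?thesis
  unfolding unramified_def ramification_index_coset using coset_eq_iff[OF L K _ 1] by simp
qed

lemma small_of_unit_multiple:
 assumes s: "s : abs_galois" and y: "s y = y" "y ~= 0" "nrm x = nrm y" and u: "nrm (s (x / y) - x / y) < 1"
 shows "nrm (s x / x - 1) < 1"
proof -
 have x0: "x ~= 0" using y(2,3) by (metis nrm_eq_0)
 have "s x / x - 1 = (s (x / y) - x / y) / (x / y)" using y(1,2) x0 by (simp add: autsD[OF s] field_simps)
 moreover have "nrm (x / y) = 1" using y(3,2) by (simp add: nrm_divide)
 ultimately show ?thesis using u by (simp only: nrm_divide)
qed

lemma tame_expD: "tame_exp K j ==> finite_extension K" "tame_exp K j ==> intermediate_field K"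
 by (auto simp: tame_exp_def finite_extension_def)

lemma inertia_integral: "s : inertia v ==> nrm x <= 1 ==> nrm (s x - x) < 1"
 by (simp add: inertia_def integers_iff max_ideal_iff)

text \<open>If \<open>y\<close> in \<open>L\<close> has the value of \<open>x\<close>, inertia over
  \<open>L\<close> preserves the residue of the unit \<open>x / y\<close>, hence multiplies
  \<open>x\<close> by a principal unit, and \<open>tame_rigid\<close> applies. Conversely, an
  element fixed by inertia over \<open>L\<close> lies in the field generated by \<open>L\<close> and
  \<open>mu\<close>, whose values come from \<open>L\<close>.\<close>

theorem unramified_iff:
 assumes K: "tame_exp K j" "!!x. x : K ==> separable_element x" and L: "intermediate_field L" "L <= K"
 shows "unramified v L K \<longleftrightarrow> (ALL s:inertia v. s : field_auts L --> (ALL x:K. s x = x))"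
proof -
 have Kf: "intermediate_field K" using tame_expD(2)[OF K(1)] .
 show ?thesis unfolding unramified_value[OF L Kf]
 proof (intro iffI ballI impI)
  fix s x assume a: "ALL x:K - {0}. EX y:L - {0}. nrm x = nrm y" and s: "s : inertia v" "s : field_auts L" and x: "x : K"
  have s': "s : abs_galois" using s(1) by (simp add: inertia_iff)
  show "s x = x"
  proof (rule tame_rigid[OF K(1) s' _ x])
   fix x assume "x : K" "x ~= 0"
   then obtain y where y: "y : L - {0}" "nrm x = nrm y" using a by blast
   then show "nrm (s x / x - 1) < 1"
    using inertia_integral[OF s(1), of "x / y"] autsD(4)[OF s(2)]
    by (intro small_of_unit_multiple[OF s', of y]) (auto simp: nrm_divide)
  qed
 next
  fix x assume a: "ALL s:inertia v. s : field_auts L --> (ALL x:K. s x = x)" and x0: "x : K - {0}"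
  then have x: "x : K" "x ~= 0" by auto
  have "x : gen_field L mu" using inertia_fixed[OF L(1) K(2)[OF x(1)]] a x(1) by blast
  then obtain n where "0 < n" "~ p dvd n" "x : gen_field L (mu_n n)" using gen_field_mu[OF L(1)] by blast
  then have "EX y:L - {0}. nrm y = nrm x" using gen_field_mu_value[OF L(1) _ _ _ x(2)] by blast
  then show "EX y:L - {0}. nrm x = nrm y" by metis
 qed
qed

text \<open>Galois acts on \<open>mu\<close> through commuting maps, so the commutator of
  \<open>s\<close> with an automorphism \<open>t\<close> over \<open>K\<close> is an inertia element
  over \<open>L\<close> and fixes \<open>x\<close>. This means that \<open>t\<close> fixes
  \<open>s x\<close>. It is the normality of unramified extensions.\<close>

lemma inertia_trivial_normal:
 assumes K: "intermediate_field K" "!!x. x : K ==> separable_element x" and L: "intermediate_field L" "L <= K"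
  and unr: "!!s x. s : inertia v ==> s : field_auts L ==> x : K ==> s x = x"
  and s: "s : field_auts L" and x: "x : K"
 shows "s x : K"
proof (rule separable_fixed[OF K(1)])
 have sa: "s : abs_galois" using auts_abs[OF L(1) s] .
 show "separable_element (s x)" using separable_conjugate[OF K(2)[OF x] sa] .
 fix t assume t: "t : field_auts K"
 then have tL: "t : field_auts L" and ta: "t : abs_galois"
  using auts_mono[OF L(2)] auts_abs[OF K(1)] by auto
 let ?c = "ginv s o t o s o ginv t"
 have cL: "?c : field_auts L" using s tL auts_inv auts_comp by metis
 have "?c z = z" if z: "z : mu" for z
 proof -
  have "t (s (ginv t z)) = s (t (ginv t z))"
   using mu_galois_commute[OF mu_closed(5)[OF auts_inv[OF ta] z] ta sa] .
  then show ?thesis using ginv_simps[OF ta] ginv_simps[OF sa] by simp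
 qed
 then have "?c : inertia v" using auts_abs[OF L(1) cL] by (simp add: inertia_iff)
 then have "?c x = x" using unr cL x by blast
 moreover have "ginv t x = x" using autsD(4)[OF t x] ginv_simps(2)[OF ta] by metis
 ultimately have "s (ginv s (t (s x))) = s x" by simp
 then show "t (s x) = s x" using ginv_simps(1)[OF sa] by simp
qed

text \<open>The quotient of \<open>x\<close> and its image is a \<open>j\<close>-th root of unity modulo the maximal ideal, fixed by the automorphism.\<close>

lemma residue_trivial_power:
 assumes K: "tame_exp K j" and D: "intermediate_field D" "K <= D" "!!x. x : D ==> s x : D"
  and s: "s : abs_galois" and res: "!!u. u : D ==> nrm u = 1 ==> nrm (s u - u) < 1" and x: "x : K"
 shows "(s ^^ j) x = x"
proof (rule tame_rigid[OF K _ _ x])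
 show sj: "s ^^ j : abs_galois" using aut_group_funpow[OF aut_group_auts[OF ifield_base] s] .
 fix x assume x: "x : K" "x ~= 0"
 define a where "a = s x / x"
 have xD: "x : D" using x(1) D(2) by blast
 have aD: "a : D" unfolding a_def using xD D(3) by (intro ifieldD(9)[OF D(1)]) auto
 have na: "nrm a = 1" using x(2) s by (simp add: a_def nrm_divide)
 have sx: "s x ~= 0" using x(2) by (simp add: autsD[OF s])
 have "(s ^^ i) x / x : D & nrm ((s ^^ i) x / x) = 1 & nrm ((s ^^ i) x / x - a ^ i) < 1" for i
 proof (induction i)
  case 0
  then show ?case using x(2) ifieldD(3)[OF D(1)] by simp
 next
  case (Suc i)
  let ?w = "(s ^^ i) x / x"
  have eq: "(s ^^ Suc i) x / x = s ?w * a" using sx x(2) by (simp add: a_def autsD[OF s])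
  have "s ?w * a - a ^ Suc i = (s ?w - ?w) * a + (?w - a ^ i) * a" by (simp add: algebra_simps)
  moreover have "nrm ((s ?w - ?w) * a + (?w - a ^ i) * a) < 1"
   using nrm_add[of "(s ?w - ?w) * a" "(?w - a ^ i) * a"] res[of ?w] Suc.IH na by (simp only: nrm_mult) auto
  ultimately show ?case unfolding eq using Suc.IH na s D(3) ifieldD(5)[OF D(1) _ aD]
   by (simp add: nrm_mult)
 qed
 then have 1: "nrm ((s ^^ j) x / x - a ^ j) < 1" by blast
 obtain z :: int where z: "nrm x ^ j = 2 powi z" using K x by (auto simp: tame_exp_def)
 have "nrm (s (x ^ j) / x ^ j - 1) < 1"
 proof (rule small_of_unit_multiple[OF s, of "to_ac \<pi> powi (- z)"])
  have bD: "to_ac \<pi> powi (- z) : D" using pi_powi(3) base_field_subset[OF D(1)] by blast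
  show "s (to_ac \<pi> powi - z) = to_ac \<pi> powi - z" using autsD(4)[OF s pi_powi(3)] .
  show "to_ac \<pi> powi - z ~= 0" by (rule pi_powi)
  show n: "nrm (x ^ j) = nrm (to_ac \<pi> powi - z)" using z pi_powi(2)[of "- z"] by (simp add: nrm_power)
  show "nrm (s (x ^ j / to_ac \<pi> powi - z) - x ^ j / to_ac \<pi> powi - z) < 1"
  proof (rule res)
   show "x ^ j / to_ac \<pi> powi - z : D" using xD bD by (intro ifieldD(9,10)[OF D(1)])
   show "nrm (x ^ j / to_ac \<pi> powi - z) = 1" using n pi_powi(1) by (simp add: nrm_divide)
  qed
 qed
 then have 2: "nrm (a ^ j - 1) < 1" by (simp add: a_def power_divide autsD[OF s])
 have "(s ^^ j) x / x - 1 = ((s ^^ j) x / x - a ^ j) + (a ^ j - 1)" by simp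
 then show "nrm ((s ^^ j) x / x - 1) < 1" using nrm_add[of "(s ^^ j) x / x - a ^ j" "a ^ j - 1"] 1 2 by (simp only:)
qed

lemma ifield_UNIV: "intermediate_field UNIV"
 by (rule ifieldI) auto

lemma inertia_power: "tame_exp K j ==> s : inertia v ==> x : K ==> (s ^^ j) x = x"
 using inertia_integral by (intro residue_trivial_power[OF _ ifield_UNIV]) (auto simp: inertia_iff)

lemma prime_coprime_p: "~ p dvd j ==> coprime p j"
 using prime_p by (simp add: prime_imp_coprime)

text \<open>Each inertia element has trivial j-th power on the conjugates of \<open>K\<close>, since
  inertia is normal; hence the group it induces on the closure has order prime to \<open>p\<close>.
  The product of the inertia conjugates of \<open>x\<close> is fixed by inertia and so has a value
  of F, which makes this order a tame exponent.\<close>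

theorem tame_closure:
 assumes K: "tame_exp K j" "!!x. x : K ==> separable_element x"
  and A: "finite A" "!!x. x : A ==> separable_element x" "!!t. t : abs_galois ==> t ` A <= A"
   "A <= {s x |s x. s : abs_galois & x : K}"
 shows "tame_exp (gen_field base_field A) (card (restrictions (inertia v) (gen_field base_field A)))"
proof -
 let ?E = "gen_field base_field A" and ?J = "restrictions (inertia v) (gen_field base_field A)"
 have E: "galois_extension ?E" by (rule gen_field_galois[OF A(1-3)])
 note I = aut_group_inertia
 have finJ: "finite ?J" using finite_restrictions[OF galoisD(1)[OF E] aut_groupD(5)[OF I]] .
 have pw: "(s ^^ j) x = x" if s: "s : inertia v" and x: "x : ?E" for s x
 proof -
  have "(s ^^ j) x = id x"
  proof (rule field_auts_eq_gen_field[OF _ id_auts _ x])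
   show "s ^^ j : abs_galois" using aut_groupD(1)[OF I aut_group_funpow[OF I s]] .
   fix a assume "a : A"
   then obtain t y where t: "t : abs_galois" "y : K" "a = t y" using A(4) by blast
   have "((ginv t o s o t) ^^ i) y = ginv t ((s ^^ i) (t y))" for i
    by (induction i) (simp_all add: ginv_simps[OF t(1)])
   then have "ginv t ((s ^^ j) (t y)) = y" using inertia_power[OF K(1) inertia_normal[OF s t(1)] t(2)] by metis
   then show "(s ^^ j) a = id a" using ginv_simps(1)[OF t(1)] t(3) by (metis id_apply)
  qed
  then show ?thesis by simp
 qed
 have "coprime p j" using K(1) prime_coprime_p by (simp add: tame_exp_def)
 then have "coprime p (card ?J)"
  using coprime_card_restrictions[OF I galoisD(1)[OF E] galoisD(4)[OF E] pw _ prime_p]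
   aut_groupD(1)[OF I] by blast
 then have cp: "~ p dvd card ?J" using p_gt_1 by (metis coprime_common_divisor_nat dvd_refl less_irrefl)
 have "0 < card ?J" using finJ restrictionsI[OF aut_groupD(2)[OF I]] card_gt_0_iff by blast
 moreover have "EX z::int. nrm x ^ card ?J = 2 powi z" if x: "x : ?E - {0}" for x
 proof -
  define N where "N = (PROD t:?J. t x)"
  have nN: "nrm N = nrm x ^ card ?J"
   unfolding N_def nrm_prod using x aut_groupD(1)[OF I] by (subst prod.cong[OF refl, of _ _ "%_. nrm x"]) (auto elim!: restrictionsE)
  have "separable_element N" unfolding N_def
   using restrictions_mem[OF aut_groupD(5)[OF I]] galoisD(3)[OF E] x by (intro sep_closed) auto
  moreover have "s N = N" if "s : inertia v" for s
   unfolding N_def using restrictions_prod_left[OF I that] x by blast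
  ultimately have "N : gen_field base_field mu" using inertia_fixed[OF ifield_base] by blast
  then obtain n where n: "0 < n" "~ p dvd n" "N : gen_field base_field (mu_n n)" using gen_field_mu[OF ifield_base] by blast
  have "N ~= 0" using nN x by (metis DiffE nrm_eq_0 power_not_zero insertI1)
  then obtain y where "y : base_field - {0}" "nrm y = nrm N" using gen_field_mu_value[OF ifield_base n] by blast
  then show ?thesis using nrm_base nN by metis
 qed
 ultimately show ?thesis unfolding tame_exp_def using cp galoisD(1)[OF E] by blast
qed

lemma restrictions_fiber:
 assumes L: "intermediate_field L" and s: "s : field_auts L" and Z: "Z <= E"
 shows "bij_betw (%t. restrict (s o t) E) (restrictions {t:field_auts L. ALL z:Z. t z = z} E)
  {t:restrictions (field_auts L) E. restrict t Z = restrict s Z}"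
proof (rule bij_betw_byWitness[where f' = "%t. restrict (ginv s o t) E"])
 note si = ginv_simps[OF s]
 let ?S = "restrictions {t:field_auts L. ALL z:Z. t z = z} E"
  and ?T = "{t:restrictions (field_auts L) E. restrict t Z = restrict s Z}"
 show "ALL t:?S. restrict (ginv s o restrict (s o t) E) E = t" "ALL t:?T. restrict (s o restrict (ginv s o t) E) E = t"
  by (auto elim!: restrictionsE simp: restrict_eq si)
 show "(%t. restrict (s o t) E) ` ?S <= ?T"
 proof
  fix y assume "y : (%t. restrict (s o t) E) ` ?S"
  then obtain t where t: "t : field_auts L" "ALL z:Z. t z = z" "y = restrict (s o t) E"
   by (auto elim!: restrictionsE simp: restrict_eq)
  have "restrict y Z = restrict s Z" using Z t(2) by (simp add: t(3) Int_absorb1) (simp add: restrict_eq)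
  then show "y : ?T" using auts_comp[OF s t(1)] t(3) by (simp add: restrictionsI)
 qed
 show "(%t. restrict (ginv s o t) E) ` ?T <= ?S"
 proof
  fix y assume "y : (%t. restrict (ginv s o t) E) ` ?T"
  then obtain r where r: "r : ?T" "y = restrict (ginv s o r) E" by blast
  then obtain t where t: "t : field_auts L" "r = restrict t E" by (auto elim: restrictionsE)
  then have t: "t : field_auts L" "restrict (restrict t E) Z = restrict s Z" "y = restrict (ginv s o t) E"
   using r by (auto simp: restrict_eq)
  have "t z = s z" if "z : Z" for z using t(2) that Z by (simp add: Int_absorb1 restrict_eq)
  then have "ALL z:Z. (ginv s o t) z = z" by (simp add: si)
  then show "y : ?S" using t(3) auts_comp[OF auts_inv[OF s] t(1)] by (simp add: restrictionsI)
 qed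
qed

text \<open>An automorphism fixing \<open>x\<close> moves the representative \<open>z\<close> to a
  congruent root of unity, hence fixes it.\<close>

lemma teichmueller_mem:
 assumes E: "intermediate_field E" and x: "x : E" "nrm x = 1"
 shows "EX z:mu Int E. nrm (x - z) < 1"
proof -
 obtain z where z: "z : mu" "nrm (x - z) < 1" using teichmueller[OF x(2)] by blast
 have "z : E"
 proof (rule separable_fixed[OF E separable_mu[OF z(1)]])
  fix s assume s: "s : field_auts E"
  have sa: "s : abs_galois" using auts_abs[OF E s] .
  have "s z - z = (x - z) - s (x - z)" using autsD(4)[OF s x(1)] by (simp add: autsD[OF sa])
  moreover have "nrm ((x - z) - s (x - z)) < 1" using nrm_diff[of "x - z" "s (x - z)"] z(2) sa by simp
  ultimately show "s z = z" using mu_inj[OF mu_closed(5)[OF sa z(1)] z(1)] by (simp only:)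
 qed
 then show ?thesis using z by blast
qed

text \<open>On a root of unity in \<open>E\<close>, the trace is the order of the inertia group of
  \<open>E\<close> over \<open>L\<close> times a sum of distinct residue characters. The order is a
  unit by tameness, and the sum is a unit for some root of unity \<open>z\<close> by independence;
  \<open>z\<close> is then divided by its trace.\<close>

theorem trace_one:
 assumes E: "tame_exp E j" "!!x. x : E ==> separable_element x" and L: "intermediate_field L" "L <= E"
  and st: "!!q. q : field_auts L ==> q ` E = E"
 shows "EX a:E. nrm a <= 1 & (SUM w:restrictions (field_auts L) E. w a) = 1"
proof -
 note Ef = tame_expD[OF E(1)]
 note H = aut_group_auts[OF L(1)]
 let ?G = "restrictions (field_auts L) E"
 define Z where "Z = mu Int E"
 \<comment> \<open>Automorphisms over \<open>L\<close> that are trivial on the residues of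
   \<open>E\<close>, expressed through the roots of unity in \<open>E\<close>; on \<open>E\<close>
   they induce the inertia group.\<close>
 define HJ where "HJ = {w:field_auts L. ALL z:Z. w z = z}"
 have finG: "finite ?G" using finite_restrictions[OF Ef(1) aut_groupD(5)[OF H]] .
 have stZ: "q z : Z" if "q : field_auts L" "z : Z" for q z
  using that st mu_closed(5)[OF aut_groupD(1)[OF H that(1)]] by (auto simp: Z_def)
 have HJ: "aut_group HJ"
  unfolding aut_group_def
 proof (intro conjI ballI subsetI)
  show "id : HJ" by (simp add: HJ_def id_auts)
  show "q : abs_galois" if "q : HJ" for q using that aut_groupD(1)[OF H] by (simp add: HJ_def)
  fix q w assume s: "q : HJ"
  then have sL: "q : field_auts L" by (simp add: HJ_def)
  have "ginv q z = z" if "z : Z" for z using s that ginv_simps(2)[OF sL, of z] by (simp add: HJ_def)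
  then show "ginv q : HJ" using auts_inv[OF sL] by (simp add: HJ_def)
  assume "w : HJ"
  then show "q o w : HJ" using s auts_comp by (auto simp: HJ_def)
 qed
 have HJL: "q : HJ ==> q : field_auts L" for q by (simp add: HJ_def)
 have "coprime p (card (restrictions HJ E))"
 proof (rule coprime_card_restrictions[OF HJ Ef(1) st[OF HJL] _ _ prime_p])
  fix q x assume s: "q : HJ" and x: "x : E"
  show "(q ^^ j) x = x"
  proof (rule residue_trivial_power[OF E(1) Ef(2) order_refl _ aut_groupD(1)[OF HJ s] _ x])
   show "q y : E" if "y : E" for y using st[OF HJL[OF s]] that by blast
   fix u assume "u : E" "nrm u = 1"
   then obtain z where z: "z : Z" "nrm (u - z) < 1" using teichmueller_mem[OF Ef(2)] by (auto simp: Z_def)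
   have "q u - u = q (u - z) - (u - z)" using s z(1) by (simp add: HJ_def autsD[OF aut_groupD(1)[OF HJ s]])
   then show "nrm (q u - u) < 1" using nrm_diff[of "q (u - z)" "u - z"] z(2) aut_groupD(1)[OF HJ s] by (metis le_less_trans max_less_iff_conj nrm_galois)
  qed
 qed (use E(1) prime_coprime_p in \<open>auto simp: tame_exp_def\<close>)
 then have cp: "nrm (of_nat (card (restrictions HJ E))) = 1"
  using p_gt_1 by (intro nrm_of_nat_coprime) (metis coprime_common_divisor_nat dvd_refl less_irrefl)
 let ?G' = "(%w. restrict w Z) ` ?G"
 have ZE: "Z <= E" by (auto simp: Z_def)
 have G': "EX q:field_auts L. g = restrict q Z" if "g : ?G'" for g
  using that ZE by (auto elim!: restrictionsE simp: Int_absorb1)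
 have tr: "(SUM w:?G. w z) = (SUM g:?G'. of_nat (card (restrictions HJ E)) * g z)" if z: "z : Z" for z
 proof -
  have "(SUM w:?G. w z) = (SUM g:?G'. SUM w:{w:?G. restrict w Z = g}. w z)"
   by (rule sum.group[symmetric]) (use finG in auto)
  also have "... = (SUM g:?G'. of_nat (card (restrictions HJ E)) * g z)"
  proof (rule sum.cong)
   fix g assume "g : ?G'"
   then obtain q where s: "q : field_auts L" "g = restrict q Z" using G' by blast
   have "(SUM w:{w:?G. restrict w Z = g}. w z) = (SUM w:{w:?G. restrict w Z = g}. g z)"
    using z by (intro sum.cong) (auto dest: fun_cong[of _ _ z])
   also have "... = of_nat (card {w:?G. restrict w Z = g}) * g z" by simp
   also have "card {w:?G. restrict w Z = g} = card (restrictions HJ E)"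
    using bij_betw_same_card[OF restrictions_fiber[OF L(1) s(1) ZE]] by (simp add: HJ_def s(2))
   finally show "(SUM w:{w:?G. restrict w Z = g}. w z) = of_nat (card (restrictions HJ E)) * g z" .
  qed simp
  finally show ?thesis .
 qed
 have "EX z:Z. nrm (SUM g:?G'. of_nat (card (restrictions HJ E)) * g z) = 1"
 proof (rule dedekind_residue)
  show "?G' ~= {}" using restrictionsI[OF id_auts] by blast
  show "1 : Z" using mu_closed(1) ifieldD(3)[OF Ef(2)] by (simp add: Z_def)
  show ZZ: "a * b : Z" if "a : Z" "b : Z" for a b
   using that mu_closed(2) ifieldD(5)[OF Ef(2)] by (simp add: Z_def)
  show "Z <= mu" by (simp add: Z_def)
  show "g a : mu" if "g : ?G'" "a : Z" for g a using G'[OF that(1)] stZ that(2) by (auto simp: Z_def)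
  show "g (a * b) = g a * g b" if "g : ?G'" "a : Z" "b : Z" for g a b
   using G'[OF that(1)] that ZZ[OF that(2,3)] by (auto simp: autsD(3))
  show "EX a:Z. g a ~= h a" if gh: "g : ?G'" "h : ?G'" "g ~= h" for g h
  proof -
   obtain q w where "g = restrict q Z" "h = restrict w Z" using G' gh(1,2) by blast
   then show ?thesis using gh(3) by (auto simp: restrict_eq)
  qed
 qed (use finG cp in auto)
 then obtain z where z: "z : Z" "nrm (SUM w:?G. w z) = 1" using tr by auto
 define t where "t = (SUM w:?G. w z)"
 have zE: "z : E" using z(1) by (simp add: Z_def)
 have tL: "t : L" unfolding t_def by (rule field_trace_mem[OF L(1) Ef(1) zE E(2)[OF zE]])
 have t0: "t ~= 0" using z(2) by (auto simp: t_def)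
 show ?thesis
 proof (intro bexI[of _ "z / t"] conjI)
  show zt: "z / t : E" using ifieldD(9)[OF Ef(2) zE] tL L(2) by blast
  show "nrm (z / t) <= 1" using z(2) nrm_mu[of z] z(1) by (simp add: nrm_divide t_def Z_def)
  have "(SUM w:?G. w (z / t)) = (SUM w:?G. w z / t)"
  proof (rule sum.cong)
   fix w assume "w : ?G"
   then obtain q where s: "q : field_auts L" "w = restrict q E" by (rule restrictionsE)
   then show "w (z / t) = w z / t" using zt zE autsD(4)[OF s(1) tL] by (simp add: autsD(10)[OF s(1)])
  qed simp
  also have "... = 1" using t0 by (simp add: t_def flip: sum_divide_distrib)
  finally show "(SUM w:?G. w (z / t)) = 1" .
 qed
qed

end

section \<open>Norms and characters in tame extensions\<close>

context local_field
begin

lemma nrm_le_addI: "z = x + y ==> nrm x <= r ==> nrm y <= r ==> nrm z <= r"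
 using nrm_add[of x y] by simp

lemma prod_one_plus:
 assumes "finite A" "0 <= r" "r < 1" "!!i. i : A ==> nrm (f i) <= r"
 shows "nrm ((PROD i:A. 1 + f i) - 1 - sum f A) <= r ^ 2" "nrm ((PROD i:A. 1 + f i) - 1) <= r"
proof -
 have "nrm ((PROD i:A. 1 + f i) - 1 - sum f A) <= r ^ 2 & nrm ((PROD i:A. 1 + f i) - 1) <= r"
  using assms(1,4)
 proof (induction A rule: finite_induct)
  case empty
  then show ?case using assms(2) by simp
 next
  case (insert i A)
  let ?P = "PROD i:A. 1 + f i"
  have IH: "nrm (?P - 1 - sum f A) <= r ^ 2" "nrm (?P - 1) <= r" and fi: "nrm (f i) <= r" using insert by auto
  have rr: "r ^ 2 <= r" using assms(2,3) by (simp add: power2_eq_square mult_left_le)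
  have p: "nrm (f i * (?P - 1)) <= r ^ 2"
   using mult_mono[OF fi IH(2)] assms(2) by (simp add: nrm_mult power2_eq_square)
  have "(PROD i:insert i A. 1 + f i) - 1 - sum f (insert i A) = f i * (?P - 1) + (?P - 1 - sum f A)"
   using insert.hyps by (simp add: algebra_simps)
  then have 1: "nrm ((PROD i:insert i A. 1 + f i) - 1 - sum f (insert i A)) <= r ^ 2"
   using p IH(1) by (rule nrm_le_addI)
  have "(PROD i:insert i A. 1 + f i) - 1 = (f i * (?P - 1) + f i) + (?P - 1)"
   using insert.hyps by (simp add: algebra_simps)
  moreover have "nrm (f i * (?P - 1) + f i) <= r" using nrm_add[of "f i * (?P - 1)" "f i"] p fi rr by linarith
  ultimately have "nrm ((PROD i:insert i A. 1 + f i) - 1) <= r"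
   using IH(2) by (rule nrm_le_addI)
  with 1 show ?case ..
 qed
 then show "nrm ((PROD i:A. 1 + f i) - 1 - sum f A) <= r ^ 2" "nrm ((PROD i:A. 1 + f i) - 1) <= r" by auto
qed

lemma power2_power_small:
 fixes s m :: real
 assumes "0 <= s" "s < 1" "0 < m" shows "EX n. s ^ 2 ^ n <= m"
proof -
 obtain k where k: "s ^ k < m" using real_arch_pow_inv[OF assms(3,2)] by blast
 have "k <= 2 ^ k" by (rule less_imp_le) (rule less_exp)
 then have "s ^ 2 ^ k <= s ^ k" using assms by (intro power_decreasing) auto
 then show ?thesis using k by (intro exI[of _ k]) linarith
qed

lemma fin_restrictions:
 "finite_extension K ==> intermediate_field L ==> finite (restrictions (field_auts L) K)"
 using finite_restrictions aut_groupD(5)[OF aut_group_auts] by blast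

lemma field_norm_near:
 assumes K: "finite_extension K" and L: "intermediate_field L" and r: "0 <= r" "r < 1"
  and x: "x : K" "nrm (x - 1) <= r"
 shows "nrm (field_norm L K x - 1) <= r"
  "nrm (field_norm L K x - 1 - (SUM t:restrictions (field_auts L) K. t (x - 1))) <= r ^ 2"
proof -
 have K1: "1 : K" "x - 1 : K" using x(1) ifieldD(3,4)[OF finite_ext_field[OF K]] by auto
 let ?G = "restrictions (field_auts L) K"
 have t: "t x = 1 + t (x - 1)" "nrm (t (x - 1)) <= r" if "t : ?G" for t
  using that K1 x aut_groupD(1)[OF aut_group_auts[OF L]]
  by (auto elim!: restrictionsE simp: autsD simp del: nrm_galois) (metis autsD(6,8) nrm_galois)
 have "field_norm L K x = (PROD t:?G. 1 + t (x - 1))" unfolding field_norm_def by (intro prod.cong refl t)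
 then show "nrm (field_norm L K x - 1) <= r" "nrm (field_norm L K x - 1 - (SUM t:?G. t (x - 1))) <= r ^ 2"
  using prod_one_plus[OF fin_restrictions[OF K L] r t(2)] by simp_all
qed

lemma principal_div:
 assumes "nrm (x - 1) <= r" "nrm (y - 1) <= r" "r < 1"
 shows "nrm (x * y - 1) <= r" "nrm (inverse x - 1) <= r" "nrm x = 1"
proof -
 have x: "nrm x = 1" "nrm y = 1" using assms by (auto intro!: nrm_principal)
 have "x * y - 1 = (x - 1) * y + (y - 1)" by (simp add: algebra_simps)
 moreover have "nrm ((x - 1) * y) <= r" using x assms(1) by (simp add: nrm_mult)
 ultimately show "nrm (x * y - 1) <= r" using assms(2) by (rule nrm_le_addI)
 have "x ~= 0" using x(1) by auto
 then have "inverse x - 1 = - ((x - 1) * inverse x)" by (simp add: field_simps)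
 moreover have "nrm ((x - 1) * inverse x) <= r" using x assms(1) by (simp add: nrm_mult nrm_inverse)
 ultimately show "nrm (inverse x - 1) <= r" by simp
qed (use assms in \<open>auto intro!: nrm_principal\<close>)

lemma principal_prod:
 assumes "0 <= r" "r < 1" "!!i. i : A ==> nrm (f i - 1) <= r" shows "nrm (prod f A - 1) <= r"
 using assms(3) by (induction A rule: infinite_finite_induct) (use principal_div(1) assms(1,2) in auto)

section \<open>Approximate image and kernel of the norm on principal units\<close>

definition tame_galois :: "'f alg_closure set => 'f alg_closure set => bool" where
 "tame_galois L E \<longleftrightarrow> intermediate_field L & L <= E & (EX j. tame_exp E j) & (ALL x:E. separable_element x) &
  (ALL s:field_auts L. s ` E = E)"

lemma tame_galoisD:
 assumes "tame_galois L E"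
 shows "intermediate_field L" "L <= E" "finite_extension E" "intermediate_field E" "x : E ==> separable_element x"
  "s : field_auts L ==> s ` E = E" "s : field_auts L ==> x : E ==> s x : E"
  "x : E ==> field_norm L E x : L"
proof -
 show L: "intermediate_field L" "L <= E" and E: "finite_extension E" "intermediate_field E"
  and sep: "!!x. x : E ==> separable_element x"
  and st: "s : field_auts L ==> s ` E = E"
 proof -
  obtain j where "intermediate_field L" "L <= E" and j: "tame_exp E j" and "ALL x:E. separable_element x" "ALL s:field_auts L. s ` E = E"
   using assms by (auto simp: tame_galois_def)
  then show "intermediate_field L" "L <= E" "!!x. x : E ==> separable_element x" "s : field_auts L ==> s ` E = E"
   by blast+
  show "finite_extension E" "intermediate_field E" by (rule tame_expD[OF j])+
 qed
 show "s : field_auts L ==> x : E ==> s x : E" using st by blast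
 show "x : E ==> field_norm L E x : L" using field_norm_mem[OF L(1) E(1)] sep by blast
qed

lemma tame_galois_trace_one:
 "tame_galois L E ==> EX a:E. nrm a <= 1 & (SUM t:restrictions (field_auts L) E. t a) = 1"
proof -
 assume tg: "tame_galois L E"
 then obtain j where "tame_exp E j" by (auto simp: tame_galois_def)
 then show ?thesis using trace_one[OF _ tame_galoisD(5)[OF tg] tame_galoisD(1,2,6)[OF tg]] by blast
qed

text \<open>To first order the norm of \<open>1 + b\<close> is 1 plus the trace of \<open>b\<close>,
  and the trace of \<open>a * (u - 1)\<close> is \<open>u - 1\<close>.\<close>

lemma field_norm_near_trace:
 assumes K: "finite_extension E" "!!x. x : E ==> separable_element x" and L: "intermediate_field L" "L <= E"
  and a: "a : E" "nrm a <= 1" "(SUM t:restrictions (field_auts L) E. t a) = 1"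
  and u: "u : L" "nrm (u - 1) <= s" "0 <= s" "s < 1"
 shows "nrm (field_norm L E (1 + a * (u - 1)) - u) <= s ^ 2" "1 + a * (u - 1) : E" "nrm (1 + a * (u - 1) - 1) <= s"
proof -
 note Ef = finite_ext_field[OF K(1)]
 have uE: "u - 1 : E" "u - 1 : L" using u(1) L(2) ifieldD(3,4)[OF Ef] ifieldD(3,4)[OF L(1)] by auto
 show y: "1 + a * (u - 1) : E" using uE a(1) ifieldD(3,5,8)[OF Ef] by blast
 show ny: "nrm (1 + a * (u - 1) - 1) <= s"
  using mult_mono[OF a(2) u(2)] by (simp add: nrm_mult)
 have aE: "a * (u - 1) : E" using a(1) uE(1) by (rule ifieldD(5)[OF Ef])
 have "(SUM t:restrictions (field_auts L) E. t (a * (u - 1))) = (SUM t:restrictions (field_auts L) E. t a * (u - 1))"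
 proof (rule sum.cong)
  fix t assume "t : restrictions (field_auts L) E"
  then obtain q where s: "q : field_auts L" "t = restrict q E" by (rule restrictionsE)
  then show "t (a * (u - 1)) = t a * (u - 1)"
   using aE a(1) autsD(4)[OF s(1) uE(2)] by (simp add: autsD(3)[OF s(1)])
 qed simp
 also have "... = u - 1" using a(3) by (simp flip: sum_distrib_right)
 finally show "nrm (field_norm L E (1 + a * (u - 1)) - u) <= s ^ 2"
  using field_norm_near(2)[OF K(1) L(1) u(3,4) y ny] by (simp add: algebra_simps)
qed

text \<open>Newton iteration: each correction by \<open>field_norm_near_trace\<close> squares the
  relative error, while the corrections themselves stay within distance \<open>s\<close> of 1.
  Finitely many steps reach any prescribed precision.\<close>

lemma norm_surj:
 assumes tg: "tame_galois L E"
 shows "u : L ==> nrm (u - 1) <= s ==> 0 <= s ==> s < 1 ==>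
  EX y:E. nrm (y - 1) <= s & nrm (field_norm L E y - u) <= s ^ 2 ^ n"
proof (induction n arbitrary: u s)
 case 0
 then show ?case using tame_galoisD[OF tg] field_norm_1[of L E] ifieldD(3)
  by (intro bexI[of _ 1]) (auto simp: nrm_minus_commute)
next
 case (Suc n)
 obtain a where a: "a : E" "nrm a <= 1" "(SUM t:restrictions (field_auts L) E. t a) = 1"
  using tame_galois_trace_one[OF tg] by blast
 note T = tame_galoisD[OF tg]
 define y1 where "y1 = 1 + a * (u - 1)"
 note y1 = field_norm_near_trace[OF T(3,5,1,2) a Suc.prems, folded y1_def]
 let ?N = "field_norm L E"
 have N1: "nrm (?N y1 - 1) <= s" using field_norm_near(1)[OF T(3,1) Suc.prems(3,4) y1(2,3)] .
 have nN1: "nrm (?N y1) = 1" using N1 Suc.prems(4) by (intro nrm_principal) simp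
 then have N0: "?N y1 ~= 0" by auto
 define u' where "u' = u / ?N y1"
 have u'L: "u' : L" unfolding u'_def using Suc.prems(1) T(8)[OF y1(2)] by (rule ifieldD(9)[OF T(1)])
 have "u' - 1 = - ((?N y1 - u) / ?N y1)" using N0 by (simp add: u'_def field_simps)
 then have "nrm (u' - 1) <= s ^ 2" using y1(1) nN1 by (simp add: nrm_divide)
 moreover have "s ^ 2 < 1" "s ^ 2 <= s" "0 <= s ^ 2"
  using Suc.prems(3,4) power_decreasing[of 1 2 s] by auto
 ultimately obtain y2 where y2: "y2 : E" "nrm (y2 - 1) <= s ^ 2" "nrm (?N y2 - u') <= (s ^ 2) ^ 2 ^ n"
  using Suc.IH[OF u'L, of "s ^ 2"] by blast
 show ?case
 proof (intro bexI[of _ "y1 * y2"] conjI)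
  show "y1 * y2 : E" using y1(2) y2(1) by (rule ifieldD(5)[OF T(4)])
  show "nrm (y1 * y2 - 1) <= s" using principal_div(1)[OF y1(3) _ Suc.prems(4)] y2(2) \<open>s ^ 2 <= s\<close> by simp
  have "?N (y1 * y2) - u = ?N y1 * (?N y2 - u')"
   using N0 field_norm_mult[OF T(1,3) y1(2) y2(1)] by (simp add: u'_def field_simps)
  then show "nrm (?N (y1 * y2) - u) <= s ^ 2 ^ Suc n" using y2(3) nN1 by (simp add: nrm_mult power_mult)
 qed
qed

lemma norm_surj_approx:
 assumes tg: "tame_galois L E" and u: "u : L" "nrm (u - 1) < 1" and m: "0 < m"
 shows "EX y:E. nrm (y - 1) < 1 & nrm (field_norm L E y - u) <= m"
proof -
 obtain n where "nrm (u - 1) ^ 2 ^ n <= m" using power2_power_small[OF nrm_nonneg u(2) m] by blast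
 then show ?thesis using norm_surj[OF tg u(1) order_refl nrm_nonneg u(2), of n] u(2)
  by (meson order_le_less_trans order_trans)
qed

definition lift :: "('f alg_closure => 'f alg_closure) set => 'f alg_closure set =>
  ('f alg_closure => 'f alg_closure) => ('f alg_closure => 'f alg_closure)" where
 "lift H K g = (SOME s. s : H & restrict s K = g)"

lemma lift:
 assumes "g : restrictions H K" shows "lift H K g : H" "restrict (lift H K g) K = g" "x : K ==> lift H K g x = g x"
proof -
 show "lift H K g : H" and r: "restrict (lift H K g) K = g"
  using someI_ex[of "%s. s : H & restrict s K = g"] assms unfolding lift_def by (auto elim!: restrictionsE)
 show "x : K ==> lift H K g x = g x" using r by (metis restrict_apply')
qed

lemma restrictions_inverse:
 assumes H: "aut_group H" and st: "!!u. u : H ==> u ` K = K"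
 shows "bij_betw (%g. restrict (ginv (lift H K g)) K) (restrictions H K) (restrictions H K)"
proof (rule bij_betw_byWitness[where f' = "%g. restrict (ginv (lift H K g)) K"])
 let ?f = "%g. restrict (ginv (lift H K g)) K"
 have in': "?f g : restrictions H K" if "g : restrictions H K" for g
  using aut_groupD(3)[OF H lift(1)[OF that]] by (rule restrictionsI)
 then show "?f ` restrictions H K <= restrictions H K" "?f ` restrictions H K <= restrictions H K" by blast+
 have "?f (?f g) = g" if g: "g : restrictions H K" for g
 proof -
  let ?s = "lift H K g" and ?t = "lift H K (?f g)"
  have s: "?s : H" "?t : H" using lift(1)[OF g] lift(1)[OF in'[OF g]] .
  note si = ginv_simps[OF aut_groupD(1)[OF H s(1)]] and ti = ginv_simps[OF aut_groupD(1)[OF H s(2)]]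
  have "ginv ?t x = ?s x" if x: "x : K" for x
  proof -
   have "?s x : K" using st[OF s(1)] x by blast
   then have "?t (?s x) = ginv ?s (?s x)" using lift(3)[OF in'[OF g]] by simp
   then show ?thesis using si(2)[of x] ti(2)[of "?s x"] by simp
  qed
  then have "?f (?f g) = restrict ?s K" by (simp add: restrict_eq)
  then show ?thesis using lift(2)[OF g] by simp
 qed
 then show "ALL g:restrictions H K. ?f (?f g) = g" "ALL g:restrictions H K. ?f (?f g) = g" by blast+
qed

text \<open>
  The additive relation \<open>t = a Tr(t) - \<Sum> (\<sigma>(b\<^sub>\<sigma>) - b\<^sub>\<sigma>)\<close> with \<open>b\<^sub>\<sigma> = \<sigma>\<inverse>(a) t\<close> is used to first order:
  \<open>1 + t\<close> is divided by quotients \<open>\<sigma>(z)/z\<close>, on which invariant characters are trivial.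
\<close>

lemma norm_kernel_step:
 assumes tg: "tame_galois L E" and y: "y : E" "nrm (y - 1) <= s" "0 <= s" "s < 1"
  and Ny: "nrm (field_norm L E y - 1) <= m"
 shows "EX Z. finite Z & (ALL u z. (u, z) : Z --> u : field_auts L & z : E & nrm (z - 1) <= s) &
  nrm (y * (\<Prod>(u, z)\<in>Z. u z / z) - 1) <= max m (s ^ 2)"
proof -
 note T = tame_galoisD[OF tg]
 note H = aut_group_auts[OF T(1)]
 let ?G = "restrictions (field_auts L) E"
 obtain a where a: "a : E" "nrm a <= 1" "(SUM w:?G. w a) = 1" using tame_galois_trace_one[OF tg] by blast
 define r where "r = lift (field_auts L) E"
 have r: "r g : field_auts L" "restrict (r g) E = g" "!!x. x : E ==> r g x = g x" if "g : ?G" for g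
  using lift[OF that] by (auto simp: r_def)
 have ra: "r g : abs_galois" if "g : ?G" for g using aut_groupD(1)[OF H r(1)[OF that]] .
 have fin: "finite ?G" using fin_restrictions[OF T(3,1)] .
 define t where "t = y - 1"
 have tE: "t : E" unfolding t_def using y(1) ifieldD(3,4)[OF T(4)] by blast
 have nt: "nrm t <= s" using y(2) by (simp add: t_def)
 define b where "b = (%g. ginv (r g) a * t)"
 have ia: "ginv (r g) a : E" if "g : ?G" for g using T(7)[OF auts_inv[OF r(1)[OF that]] a(1)] .
 have bE: "b g : E" if "g : ?G" for g unfolding b_def using ia[OF that] tE by (rule ifieldD(5)[OF T(4)])
 have nb: "nrm (b g) <= s" if "g : ?G" for g
  using mult_mono[OF a(2) nt] nrm_galois[OF auts_inv[OF ra[OF that]]] by (simp add: b_def nrm_mult)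
 have rb: "r g (b g) = a * g t" if "g : ?G" for g
  using r(3)[OF that tE] by (simp add: b_def autsD(3)[OF r(1)[OF that]] ginv_simps[OF r(1)[OF that]])
 have sum_ia: "(SUM g:?G. ginv (r g) a) = 1"
 proof -
  have "(SUM g:?G. ginv (r g) a) = (SUM g:?G. restrict (ginv (r g)) E a)" using a(1) by simp
  also have "... = (SUM w:?G. w a)"
   unfolding r_def by (rule sum.reindex_bij_betw[OF restrictions_inverse[OF H T(6)]])
  finally show ?thesis using a(3) by simp
 qed
 let ?T = "SUM w:?G. w t"
 define f where "f = (%g. r g (1 + b g) / (1 + b g) - 1)"
 have ff: "nrm (f g) <= s" "nrm (f g - (r g (b g) - b g)) <= s ^ 2" if g: "g : ?G" for g
 proof -
  have u: "nrm (1 + b g) = 1" using nb[OF g] y(4) by (intro nrm_principal) simp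
  then have u0: "1 + b g ~= 0" by auto
  have d: "nrm (r g (b g) - b g) <= s" using nrm_diff[of "r g (b g)" "b g"] nb[OF g] nrm_galois[OF ra[OF g], of "b g"] by simp
  have f1: "f g = (r g (b g) - b g) / (1 + b g)" using u0 by (simp add: f_def autsD[OF r(1)[OF g]] field_simps)
  then show "nrm (f g) <= s" using u d by (simp add: nrm_divide)
  have "f g - (r g (b g) - b g) = - (f g * b g)" using u0 unfolding f1 by (simp add: field_simps)
  then show "nrm (f g - (r g (b g) - b g)) <= s ^ 2"
   using mult_mono[OF \<open>nrm (f g) <= s\<close> nb[OF g]] y(3) by (simp add: nrm_mult power2_eq_square)
 qed
 have sumd: "(SUM g:?G. r g (b g) - b g) = a * ?T - t"
 proof -
  have "(SUM g:?G. r g (b g)) = a * ?T" using rb by (simp add: sum_distrib_left)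
  moreover have "(SUM g:?G. b g) = t" using sum_ia by (simp add: b_def flip: sum_distrib_right)
  ultimately show ?thesis by (simp add: sum_subtractf)
 qed
 define P where "P = (PROD g:?G. 1 + f g)"
 have P: "nrm (P - 1 - sum f ?G) <= s ^ 2" "nrm (P - 1) <= s"
  unfolding P_def using prod_one_plus[OF fin y(3,4) ff(1)] by auto
 have sd: "nrm (sum f ?G - (a * ?T - t)) <= s ^ 2"
  unfolding sumd[symmetric] sum_subtractf[symmetric] using ff(2) by (intro nrm_sum_le) auto
 have P': "nrm (P - 1 - (a * ?T - t)) <= s ^ 2" by (rule nrm_le_addI[OF _ P(1) sd]) simp
 have tr: "nrm ?T <= max m (s ^ 2)"
 proof -
  have "nrm (field_norm L E y - 1 - ?T) <= s ^ 2" unfolding t_def by (rule field_norm_near(2)[OF T(3,1) y(3,4,1,2)])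
  then show ?thesis using nrm_diff[of "field_norm L E y - 1" "field_norm L E y - 1 - ?T"] Ny by auto
 qed
 have "y * P - 1 = (P - 1 - (a * ?T - t)) + t * (P - 1) + a * ?T" by (simp add: t_def algebra_simps)
 moreover have "nrm (t * (P - 1)) <= s ^ 2" using mult_mono[OF nt P(2)] y(3) by (simp add: nrm_mult power2_eq_square)
 moreover have "nrm (a * ?T) <= max m (s ^ 2)" using mult_mono[OF a(2) tr] by (simp add: nrm_mult)
 moreover have "nrm (P - 1 - (a * ?T - t) + t * (P - 1)) <= s ^ 2"
  using nrm_add[of "P - 1 - (a * ?T - t)" "t * (P - 1)"] P' \<open>nrm (t * (P - 1)) <= s ^ 2\<close> by linarith
 ultimately have nyP: "nrm (y * P - 1) <= max m (s ^ 2)"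
  by (intro nrm_le_addI[of "y * P - 1" "P - 1 - (a * ?T - t) + t * (P - 1)" "a * ?T"]) (simp_all only: max.coboundedI2)
 let ?Z = "(%g. (r g, 1 + b g)) ` ?G"
 have injZ: "inj_on (%g. (r g, 1 + b g)) ?G" using r(2) by (intro inj_onI) (metis prod.inject)
 have "(\<Prod>(u, z)\<in>?Z. u z / z) = P"
  unfolding prod.reindex[OF injZ] P_def by (simp add: f_def)
 moreover have "u : field_auts L & z : E & nrm (z - 1) <= s" if "(u, z) : ?Z" for u z
  using that r(1) nb bE ifieldD(3,8)[OF T(4)] by auto
 ultimately show ?thesis using fin nyP by (intro exI[of _ ?Z]) auto
qed

text \<open>Multiplying by quotients \<open>u z / z\<close> changes neither \<open>\<psi>\<close>
  nor the norm. Each application of \<open>norm_kernel_step\<close> improves the distance to 1 from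
  \<open>s\<close> to the larger of \<open>m\<close> and \<open>s ^ 2\<close>, until the radius
  \<open>m\<close> on which \<open>\<psi>\<close> is trivial is reached.\<close>

lemma norm_kernel:
 assumes tg: "tame_galois L E" and m: "0 < m" "m < 1"
  and mult: "!!x y. x : principal_units v E ==> y : principal_units v E ==> \<psi> (x * y) = \<psi> x * (\<psi> y :: complex)"
  and nz: "!!x. x : principal_units v E ==> \<psi> x ~= 0"
  and inv: "!!u x. u : field_auts L ==> x : principal_units v E ==> \<psi> (u x) = \<psi> x"
  and triv: "!!x. x : E ==> nrm (x - 1) <= m ==> \<psi> x = 1"
  and Ny: "nrm (field_norm L E y - 1) <= m"
 shows "y : E ==> nrm (y - 1) < 1 ==> \<psi> y = 1"
proof -
 note T = tame_galoisD[OF tg]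
 have main: "y : E ==> nrm (y - 1) <= s ==> 0 <= s ==> s < 1 ==> s ^ 2 ^ n <= m ==>
   nrm (field_norm L E y - 1) <= m ==> \<psi> y = 1" for y s n
 proof (induction n arbitrary: y s)
  case 0
  then show ?case using triv by simp
 next
  case (Suc n)
  obtain Z where Z0: "finite Z" "ALL u z. (u, z) : Z --> u : field_auts L & z : E & nrm (z - 1) <= s"
   "nrm (y * (\<Prod>(u, z)\<in>Z. u z / z) - 1) <= max m (s ^ 2)"
   using norm_kernel_step[OF tg Suc.prems(1-4,6)] by (elim exE conjE)
  define y' where "y' = y * (\<Prod>(u, z)\<in>Z. u z / z)"
  have Z: "finite Z" "(u, z) : Z ==> u : field_auts L & z : E & nrm (z - 1) <= s"
   "y' = y * (\<Prod>(u, z)\<in>Z. u z / z)" "nrm (y' - 1) <= max m (s ^ 2)" for u z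
   using Z0 by (auto simp: y'_def)
  have one: "\<psi> (u z / z) = 1" "u z / z : principal_units v E" "field_norm L E (u z / z) = 1" if "(u, z) : Z" for u z
  proof -
   note z = Z(2)[OF that]
   have zE: "z : E" "u z : E" "u : field_auts L" using z T(7) by auto
   have sa: "u : abs_galois" using auts_abs[OF T(1)] zE(3) .
   have zs: "nrm (u z - 1) <= s" using z nrm_galois[OF sa, of "z - 1"] by (simp add: autsD[OF sa])
   have z0: "z ~= 0" using z Suc.prems(4) nrm_principal[of z] by fastforce
   have q: "nrm (u z / z - 1) <= s"
    unfolding divide_inverse using z zs principal_div(2)[of z s z] Suc.prems(4) by (intro principal_div(1)) auto
   have qE: "u z / z : E" using zE by (intro ifieldD(9)[OF T(4)])
   show qU: "u z / z : principal_units v E" using q qE Suc.prems(4) by (simp add: principal_iff)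
   have zU: "z : principal_units v E" using z Suc.prems(4) by (simp add: principal_iff)
   have "\<psi> (u z / z) * \<psi> z = \<psi> z" using mult[OF qU zU] inv[OF zE(3) zU] z0 by simp
   then show "\<psi> (u z / z) = 1" using nz[OF zU] by simp
   have "field_norm L E (u z / z) * field_norm L E z = field_norm L E z"
    using field_norm_mult[OF T(1,3) qE zE(1)] field_norm_conj[OF T(1) zE(3) T(6)[OF zE(3)] zE(1)] z0 by simp
   then show "field_norm L E (u z / z) = 1" using field_norm_eq_0[OF T(1,3) zE(1)] z0 by simp
  qed
  have U1: "1 : principal_units v E" using ifieldD(3)[OF T(4)] by (simp add: principal_iff)
  have Um: "x * w : principal_units v E" if "x : principal_units v E" "w : principal_units v E" for x w
   using that principal_div(1)[of x "max (nrm (x - 1)) (nrm (w - 1))" w] ifieldD(5)[OF T(4)]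
   by (auto simp: principal_iff)
  have "\<psi> 1 = 1" using triv[of 1] ifieldD(3)[OF T(4)] m(1) by simp
  have "C <= Z ==> \<psi> (\<Prod>(u, z)\<in>C. u z / z) = 1 & (\<Prod>(u, z)\<in>C. u z / z) : principal_units v E
    & field_norm L E (\<Prod>(u, z)\<in>C. u z / z) = 1" if "finite C" for C
   using that
  proof (induction C)
   case empty
   then show ?case using U1 \<open>\<psi> 1 = 1\<close> field_norm_1[OF T(1,3)] by simp
  next
   case (insert q C)
   obtain u z where q: "q = (u, z)" by (cases q)
   have qZ: "(u, z) : Z" using insert.prems q by blast
   have IH: "\<psi> (\<Prod>(u, z)\<in>C. u z / z) = 1" "(\<Prod>(u, z)\<in>C. u z / z) : principal_units v E"
    "field_norm L E (\<Prod>(u, z)\<in>C. u z / z) = 1" using insert.IH insert.prems by auto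
   have "(\<Prod>(u, z)\<in>insert q C. u z / z) = (u z / z) * (\<Prod>(u, z)\<in>C. u z / z)"
    using insert.hyps q by simp
   moreover have "field_norm L E ((u z / z) * (\<Prod>(u, z)\<in>C. u z / z)) = 1"
    using one(2,3)[OF qZ] IH(2,3) by (subst field_norm_mult[OF T(1,3)]) (auto simp: principal_units_def)
   ultimately show ?case using mult[OF one(2)[OF qZ] IH(2)] one(1)[OF qZ] IH(1) Um[OF one(2)[OF qZ] IH(2)] by simp
  qed
  from this[OF Z(1) order_refl] have P: "\<psi> (\<Prod>(u, z)\<in>Z. u z / z) = 1" "(\<Prod>(u, z)\<in>Z. u z / z) : principal_units v E"
   "field_norm L E (\<Prod>(u, z)\<in>Z. u z / z) = 1" by auto
  have yU: "y : principal_units v E" using Suc.prems(1,2,4) by (simp add: principal_iff)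
  have y'E: "y' : E" using Um[OF yU P(2)] Z(3) by (simp add: principal_units_def)
  have "\<psi> y' = \<psi> y" using mult[OF yU P(2)] P(1) Z(3) by simp
  moreover have N': "field_norm L E y' = field_norm L E y"
   using field_norm_mult[OF T(1,3) Suc.prems(1), of "\<Prod>(u, z)\<in>Z. u z / z"] P(2,3) Z(3) by (simp add: principal_units_def)
  moreover have "\<psi> y' = 1"
  proof (cases "nrm (y' - 1) <= m")
   case True
   then show ?thesis using triv y'E by blast
  next
   case False
   then have "nrm (y' - 1) <= s ^ 2" using Z(4) by auto
   moreover have "s ^ 2 < 1" using Suc.prems(3,4) by (simp add: power_less_one_iff)
   moreover have "(s ^ 2) ^ 2 ^ n <= m" using Suc.prems(5) by (simp add: power_mult)
   ultimately show ?thesis using Suc.IH[OF y'E, of "s ^ 2"] N' Suc.prems(6) by simp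
  qed
  ultimately show ?case by simp
 qed
 assume y: "y : E" "nrm (y - 1) < 1"
 obtain n where "nrm (y - 1) ^ 2 ^ n <= m" using power2_power_small[OF nrm_nonneg y(2) m(1)] by blast
 then show "\<psi> y = 1" using main[OF y(1) order_refl nrm_nonneg y(2)] Ny by blast
qed

lemma smooth_radius:
 assumes "smooth_character v A \<eta>"
 obtains m where "0 < m" "m < 1" "!!x. x : A ==> nrm (x - 1) <= m ==> \<eta> x = 1"
proof -
 obtain c where c: "c ~= 0" "ALL x:A. (x - 1) / to_ac c : integers v --> \<eta> x = 1"
  using assms by (auto simp: smooth_character_def)
 have "0 < av c" using c(1) av_nonneg[of c] by (simp add: less_le del: av_nonneg)
 then show ?thesis using that[of "min (1 / 2) (av c)"] c by (auto simp: smooth_iff)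
qed

lemma smooth_characterI:
 assumes "!!x. x : A ==> \<eta> x ~= 0" "!!x y. x : A ==> y : A ==> \<eta> (x * y) = \<eta> x * \<eta> y"
  "0 < m" "!!x. x : A ==> nrm (x - 1) <= m ==> \<eta> x = 1"
 shows "smooth_character v A \<eta>"
proof -
 obtain k where k: "(1 / 2 :: real) ^ k < m" using real_arch_pow_inv[OF assms(3), of "1 / 2"] by auto
 have "av (\<pi> ^ k) <= m" using k by (simp add: av_power av_pi)
 then show ?thesis unfolding smooth_character_def
  using assms pi(1) by (intro conjI exI[of _ "\<pi> ^ k"] ballI) (auto simp: smooth_iff simp del: to_ac_power)
qed

text \<open>As \<open>K\<close> need not be Galois over \<open>L\<close>, the character is pulled
  back to \<open>E\<close> by the norm. The value of \<open>\<theta>L\<close> at \<open>u\<close> is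
  that of the pullback at an approximate norm preimage of \<open>u\<close>. Two preimages differ by
  an element of norm close to 1, where \<open>norm_kernel\<close> applies.\<close>

theorem invariant_character_descends:
 assumes L: "tame_galois L E" and K: "tame_galois K E" "L <= K" and \<theta>: "smooth_character v (principal_units v K) \<theta>"
  and inv: "!!s x. s : field_auts L ==> x : principal_units v E ==> \<theta> (field_norm K E (s x)) = \<theta> (field_norm K E x)"
 shows "EX \<theta>L. smooth_character v (principal_units v L) \<theta>L & (ALL x:principal_units v K. \<theta> x = \<theta>L (field_norm L K x))"
proof -
 note T = tame_galoisD[OF L] and TK = tame_galoisD[OF K(1)]
 have Kf: "finite_extension K" using finite_extension_subset[OF T(3) TK(1,2)] .
 obtain m where m: "0 < m" "m < 1" "!!x. x : principal_units v K ==> nrm (x - 1) <= m ==> \<theta> x = 1"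
  by (rule smooth_radius[OF \<theta>]) blast
 have \<theta>m: "!!x y. x : principal_units v K ==> y : principal_units v K ==> \<theta> (x * y) = \<theta> x * \<theta> y"
  "!!x. x : principal_units v K ==> \<theta> x ~= 0"
  using \<theta> by (auto simp: smooth_character_def)
 define \<psi> where "\<psi> = (%x. \<theta> (field_norm K E x))"
 have NK: "field_norm K E x : principal_units v K" if "x : principal_units v E" for x
  using that TK(8) field_norm_near(1)[OF T(3) TK(1) nrm_nonneg _ _ order_refl, of x] by (auto simp: principal_iff)
 have mult: "\<psi> (x * y) = \<psi> x * \<psi> y" if "x : principal_units v E" "y : principal_units v E" for x y
  using that NK \<theta>m(1) field_norm_mult[OF TK(1) T(3), of x y] by (simp add: \<psi>_def principal_iff)
 have nz: "\<psi> x ~= 0" if "x : principal_units v E" for x using NK[OF that] \<theta>m(2) by (simp add: \<psi>_def)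
 have triv: "\<psi> x = 1" if "x : E" "nrm (x - 1) <= m" for x
  using m(3) NK[of x] that m(1,2) field_norm_near(1)[OF T(3) TK(1) _ m(2) that] by (simp add: \<psi>_def principal_iff)
 have ker: "\<psi> y = 1" if "y : E" "nrm (y - 1) < 1" "nrm (field_norm L E y - 1) <= m" for y
  by (rule norm_kernel[OF L m(1,2) mult nz _ triv that(3,1,2)]) (use inv in \<open>auto simp: \<psi>_def\<close>)
 define pre where "pre = (%u. SOME y. y : E & nrm (y - 1) < 1 & nrm (field_norm L E y - u) <= m)"
 have pre: "pre u : principal_units v E" "nrm (field_norm L E (pre u) - u) <= m" if u: "u : principal_units v L" for u
 proof -
  have "EX y. y : E & nrm (y - 1) < 1 & nrm (field_norm L E y - u) <= m"
   using norm_surj_approx[OF L _ _ m(1)] u by (auto simp: principal_iff)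
  then have "pre u : E & nrm (pre u - 1) < 1 & nrm (field_norm L E (pre u) - u) <= m" unfolding pre_def by (rule someI_ex)
  then show "pre u : principal_units v E" "nrm (field_norm L E (pre u) - u) <= m" by (auto simp: principal_iff)
 qed
 have eq: "\<psi> y = \<psi> y'" if y: "y : principal_units v E" "y' : principal_units v E"
  and d: "nrm (field_norm L E y - u) <= m" "nrm (field_norm L E y' - u) <= m" for y y' u
 proof -
  let ?N = "field_norm L E"
  have y': "nrm y' = 1" "y' ~= 0" using y(2) nrm_principal[of y'] by (auto simp: principal_iff)
  define q where "q = y * inverse y'"
  let ?r = "max (nrm (y - 1)) (nrm (y' - 1))"
  have r: "?r < 1" using y by (simp add: principal_iff)
  have q: "nrm (q - 1) <= ?r" unfolding q_def
   using principal_div(2)[of y' ?r y'] r by (intro principal_div(1)) auto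
  have qE: "q : E" "y : E" "y' : E" unfolding q_def using y ifieldD(5,6)[OF T(4)] by (auto simp: principal_units_def)
  have qU: "q : principal_units v E" using order_le_less_trans[OF q r] qE by (simp add: principal_iff)
  have yq: "y = q * y'" using y'(2) by (simp add: q_def)
  have N: "?N y = ?N q * ?N y'" unfolding yq by (rule field_norm_mult[OF T(1,3) qE(1,3)])
  have "nrm (?N y') = 1"
   using field_norm_near(1)[OF T(3,1) nrm_nonneg _ qE(3) order_refl] y(2) nrm_principal by (auto simp: principal_iff)
  moreover have "?N y - ?N y' = (?N q - 1) * ?N y'" unfolding N by (simp add: algebra_simps)
  moreover have "nrm (?N y - ?N y') <= m" using nrm_diff[of "?N y - u" "?N y' - u"] d by auto
  ultimately have "nrm (?N q - 1) <= m" by (simp add: nrm_mult)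
  then have "\<psi> q = 1" using ker qU by (simp add: principal_iff)
  then show ?thesis using mult[OF qU y(2)] yq by simp
 qed
 define \<theta>L where "\<theta>L = (%u. \<psi> (pre u))"
 have val: "\<theta>L u = \<psi> y" if "u : principal_units v L" "y : principal_units v E" "nrm (field_norm L E y - u) <= m" for u y
  unfolding \<theta>L_def using eq pre that by blast
 show ?thesis
 proof (intro exI[of _ \<theta>L] conjI ballI smooth_characterI[OF _ _ m(1)])
  show "\<theta>L u ~= 0" if "u : principal_units v L" for u unfolding \<theta>L_def using nz pre that by blast
  show "\<theta>L u = 1" if "u : principal_units v L" "nrm (u - 1) <= m" for u
   using val[OF that(1), of 1] triv[of 1] that(2) field_norm_1[OF T(1,3)] ifieldD(3)[OF T(4)] m(1)
   by (simp add: principal_iff nrm_minus_commute)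
  show "\<theta>L (u * w) = \<theta>L u * \<theta>L w" if u: "u : principal_units v L" and w: "w : principal_units v L" for u w
  proof -
   have uw: "u * w : principal_units v L"
    using u w principal_div(1)[of u "max (nrm (u - 1)) (nrm (w - 1))" w] ifieldD(5)[OF T(1)]
    by (auto simp: principal_iff)
   have pw: "pre u * pre w : principal_units v E"
    using pre(1)[OF u] pre(1)[OF w] principal_div(1)[of "pre u" "max (nrm (pre u - 1)) (nrm (pre w - 1))" "pre w"] ifieldD(5)[OF T(4)]
    by (auto simp: principal_iff)
   let ?N = "field_norm L E"
   have N: "?N (pre u * pre w) = ?N (pre u) * ?N (pre w)"
    using pre(1)[OF u] pre(1)[OF w] by (intro field_norm_mult[OF T(1,3)]) (auto simp: principal_units_def)
   have n1: "nrm (?N (pre w)) = 1"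
    using field_norm_near(1)[OF T(3,1) nrm_nonneg _ _ order_refl, of "pre w"] pre(1)[OF w] nrm_principal
    by (auto simp: principal_iff)
   have n2: "nrm u = 1" using u nrm_principal by (auto simp: principal_iff)
   have "?N (pre u * pre w) - u * w = (?N (pre u) - u) * ?N (pre w) + u * (?N (pre w) - w)"
    unfolding N by (simp add: algebra_simps)
   moreover have "nrm ((?N (pre u) - u) * ?N (pre w)) <= m" "nrm (u * (?N (pre w) - w)) <= m"
    using n1 n2 pre(2)[OF u] pre(2)[OF w] by (auto simp: nrm_mult)
   ultimately have "nrm (?N (pre u * pre w) - u * w) <= m"
    using nrm_add[of "(?N (pre u) - u) * ?N (pre w)" "u * (?N (pre w) - w)"] by simp
   then have "\<theta>L (u * w) = \<psi> (pre u * pre w)" by (rule val[OF uw pw])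
   then show ?thesis using mult[OF pre(1)[OF u] pre(1)[OF w]] by (simp add: \<theta>L_def)
  qed
  show "\<theta> x = \<theta>L (field_norm L K x)" if x: "x : principal_units v K" for x
  proof -
   obtain y where y: "y : E" "nrm (y - 1) < 1" "nrm (field_norm K E y - x) <= m"
    using norm_surj_approx[OF K(1) _ _ m(1), of x] x by (auto simp: principal_iff)
   let ?n = "field_norm K E y"
   have yU: "y : principal_units v E" using y by (simp add: principal_iff)
   have nU: "?n : principal_units v K" by (rule NK[OF yU])
   have x1: "nrm x = 1" "x ~= 0" "x : K" using x nrm_principal[of x] by (auto simp: principal_iff)
   define q where "q = ?n / x"
   have "q - 1 = (?n - x) / x" using x1(2) by (simp add: q_def field_simps)
   then have q: "nrm (q - 1) <= m" using y(3) x1(1) by (simp add: nrm_divide)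
   have qK: "q : K" unfolding q_def using TK(8)[OF y(1)] x1(3) by (rule ifieldD(9)[OF TK(1)])
   have nq: "?n = x * q" using x1(2) by (simp add: q_def)
   have "\<theta> ?n = \<theta> x" unfolding nq using \<theta>m(1)[OF x, of q] m(2) m(3)[of q] q qK by (simp add: principal_iff)
   have xN: "nrm (field_norm L K x - 1) < 1" "field_norm L K x : L"
    using field_norm_near(1)[OF Kf T(1) nrm_nonneg _ x1(3) order_refl] x field_norm_mem[OF T(1) Kf x1(3)] T(5) TK(2) x1(3)
    by (auto simp: principal_iff)
   have "field_norm L E y = field_norm L K ?n" by (rule field_norm_trans[OF T(1) K(2) TK(1,2) T(3) y(1) T(5)[OF y(1)]])
   also have "... = field_norm L K x * field_norm L K q" unfolding nq by (rule field_norm_mult[OF T(1) Kf x1(3) qK])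
   finally have "field_norm L E y - field_norm L K x = field_norm L K x * (field_norm L K q - 1)" by (simp add: algebra_simps)
   moreover have "nrm (field_norm L K q - 1) <= m" using field_norm_near(1)[OF Kf T(1) _ m(2) qK q] m(1) by simp
   ultimately have "nrm (field_norm L E y - field_norm L K x) <= m"
    using nrm_principal[OF xN(1)] by (simp add: nrm_mult)
   then have "\<theta>L (field_norm L K x) = \<psi> y" using xN by (intro val yU) (simp_all add: principal_iff)
   then show ?thesis using \<open>\<theta> ?n = \<theta> x\<close> by (simp add: \<psi>_def)
  qed
 qed
qed

end

text \<open>Divisibility of the multiplicative group of complex numbers. In a maximal graph of a
  partial character, a new \<open>x\<close> could be given the value \<open>c\<close>, where
  \<open>c ^ k\<close> is prescribed for the least positive \<open>k\<close> with
  \<open>x ^ k\<close> in the domain, and \<open>c = 1\<close> if there is no such \<open>k\<close>.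
  Thus the graph is already total.\<close>

lemma character_extension:
 fixes G :: "'a::field set" and f :: "'a => complex"
 assumes G: "1 : G" "!!x y. x : G ==> y : G ==> x * y : G" "!!x. x : G ==> inverse x : G" "0 ~: G"
  and A: "A <= G" "1 : A" "!!x y. x : A ==> y : A ==> x * y : A" "!!x. x : A ==> inverse x : A"
  and f: "!!x. x : A ==> f x ~= 0" "!!x y. x : A ==> y : A ==> f (x * y) = f x * f y"
 shows "EX g. (ALL x:G. g x ~= 0) & (ALL x:G. ALL y:G. g (x * y) = g x * g y) & (ALL x:A. g x = f x)"
proof -
 define ok :: "('a \<times> complex) set => bool" where "ok = (%R. (ALL a b. (a, b) : R --> a : G & b ~= 0 & (inverse a, inverse b) : R) & (1, 1) : R &
  (ALL a b c d. (a, b) : R --> (c, d) : R --> (a * c, b * d) : R) & (ALL b. (1, b) : R --> b = 1))"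
 have okD: "(a, b) : R ==> a : G" "(a, b) : R ==> b ~= 0" "(a, b) : R ==> (inverse a, inverse b) : R" "(1, 1) : R"
  "(a, b) : R ==> (c, d) : R ==> (a * c, b * d) : R" "(1, b) : R ==> b = 1" if "ok R" for R a b c d
  using that unfolding ok_def by metis+
 have sv: "b = b'" if R: "ok R" and ab: "(a, b) : R" "(a, b') : R" for R a b b'
 proof -
  have "a ~= 0" "b' ~= 0" using okD(1,2)[OF R] ab G(4) by blast+
  moreover have "(a * inverse a, b * inverse b') : R" using okD(3,5)[OF R] ab by blast
  ultimately have "b * inverse b' = 1" using okD(6)[OF R] by simp
  then show ?thesis using \<open>b' ~= 0\<close> by (simp add: field_simps)
 qed
 let ?A = "{(x, f x) |x. x : A}"
 have f1: "f 1 = 1" using f(1)[of 1] f(2)[of 1 1] A(2) by simp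
 have fi: "f (inverse x) = inverse (f x)" if "x : A" for x
 proof -
  have "x ~= 0" using that A(1) G(4) by blast
  then have "f x * f (inverse x) = 1" using f(2)[OF that A(4)[OF that]] f1 by simp
  then show ?thesis by (metis inverse_unique)
 qed
 have okA: "ok ?A" unfolding ok_def using A f f1 fi by (auto simp: subset_iff)
 define \<A> where "\<A> = {R. ok R & ?A <= R}"
 have "EX M:\<A>. ALL H:\<A>. M <= H --> H = M"
 proof (rule subset_Zorn_nonempty)
  show "\<A> ~= {}" using okA by (auto simp: \<A>_def)
  fix \<C> assume \<C>: "\<C> ~= {}" "subset.chain \<A> \<C>"
  have two: "EX R:\<C>. u : R & w : R" if uw: "u : \<Union>\<C>" "w \<in> \<Union>\<C>" for u w
  proof -
   obtain R S where "R : \<C>" "u : R" "S : \<C>" "w : S" using uw by blast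
   moreover from this have "R <= S | S <= R" using \<C>(2) by (auto simp: subset.chain_def)
   ultimately show ?thesis by blast
  qed
  have okR: "ok R" "?A <= R" if "R : \<C>" for R using \<C>(2) that by (auto simp: subset.chain_def \<A>_def)
  have "ok (\<Union>\<C>)" unfolding ok_def
  proof (intro conjI allI impI)
   fix a b c d assume "(a, b) : \<Union>\<C>" "(c, d) : \<Union>\<C>"
   then obtain R where "R : \<C>" "(a, b) : R" "(c, d) : R" using two by blast
   then show "(a * c, b * d) : \<Union>\<C>" using okD(5)[OF okR(1)] by blast
  next
   fix a b assume "(a, b) : \<Union>\<C>"
   then obtain R where R: "R : \<C>" "(a, b) : R" by blast
   show "a : G" "b ~= 0" "(inverse a, inverse b) : \<Union>\<C>" using okD(1-3)[OF okR(1)[OF R(1)] R(2)] R(1) by auto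
  next
   obtain R where "R : \<C>" using \<C>(1) by blast
   then show "(1, 1) : \<Union>\<C>" using okD(4)[OF okR(1)] by blast
  next
   fix b assume "(1, b) : \<Union>\<C>" then show "b = 1" using okD(6)[OF okR(1)] by blast
  qed
  moreover have "?A <= \<Union>\<C>" using \<C>(1) okR(2) by blast
  ultimately show "\<Union>\<C> \<in> \<A>" by (simp add: \<A>_def)
 qed
 then obtain R where "R : \<A>" and max0: "ALL H:\<A>. R <= H --> H = R" by (rule bexE)
 then have R: "ok R" "?A <= R" by (simp_all add: \<A>_def)
 then have max: "H = R" if "ok H" "R <= H" for H using max0 that by (auto simp: \<A>_def)
 have Rpow: "(a ^ n, b ^ n) : R" if "(a, b) : R" for a b n
  by (induction n) (use okD(4,5)[OF R(1)] that in auto)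
 have Rpowi: "(a powi i, b powi i) : R" if "(a, b) : R" for a b i
 proof (cases i rule: int_cases2)
  case (nonpos n)
  then show ?thesis using okD(3)[OF R(1) Rpow[OF that, of n]] by (simp add: power_int_minus)
 qed (use Rpow[OF that] in simp)
 have tot: "EX b. (x, b) : R" if x: "x : G" for x
 proof -
  have x0: "x ~= 0" using x G(4) by blast
  have "EX c. c ~= 0 & (ALL i d. (x powi i, d) : R --> d = c powi i)"
  proof (cases "EX k>0. EX d. (x ^ k, d) : R")
   case False
   show ?thesis
   proof (intro exI[of _ 1] conjI allI impI)
    fix i :: int and d assume id: "(x powi i, d) : R"
    have "i = 0"
    proof (cases i rule: int_cases2)
     case (nonpos n)
     then have "(x ^ n, inverse d) : R" using okD(3)[OF R(1) id] by (simp add: power_int_minus)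
     then show ?thesis using False nonpos by (metis gr0I of_nat_0 minus_zero)
    qed (use False id in \<open>metis gr0I of_nat_0 power_int_of_nat\<close>)
    then show "d = 1 powi i" using okD(6)[OF R(1)] id by simp
   qed simp
  next
   case True
   define k where "k = (LEAST k. 0 < k & (EX d. (x ^ k, d) : R))"
   have k: "0 < k" "EX d. (x ^ k, d) : R" using LeastI_ex[of "%k. 0 < k & (EX d. (x ^ k, d) : R)"] True by (auto simp: k_def)
   then obtain d0 where d0: "(x ^ k, d0) : R" by blast
   obtain c where c: "c ^ k = d0" using nth_root_exists[OF k(1)] by blast
   have c0: "c ~= 0" using c okD(2)[OF R(1) d0] k(1) by (auto simp: power_0_left)
   show ?thesis
   proof (intro exI[of _ c] conjI allI impI c0)
    fix i :: int and d assume id: "(x powi i, d) : R"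
    let ?q = "i div int k" and ?r = "i mod int k"
    have e: "x powi ?r = x powi i * inverse ((x ^ k) powi ?q)"
    proof -
     have "x powi i = x powi (int k * ?q + ?r)" by simp
     also have "... = (x powi (int k)) powi ?q * x powi ?r"
      using x0 power_int_add[of x "int k * ?q" ?r] power_int_mult[of x "int k" ?q] by (simp del: mult_div_mod_eq)
     finally show ?thesis using x0 by (simp add: field_simps)
    qed
    have "(x powi ?r, d * inverse (d0 powi ?q)) : R"
     unfolding e using okD(5)[OF R(1) id okD(3)[OF R(1) Rpowi[OF d0]]] .
    moreover have "?r = int (nat ?r)" using k(1) by simp
    ultimately have "(x ^ nat ?r, d * inverse (d0 powi ?q)) : R" by (metis power_int_of_nat)
    then have "EX d. (x ^ nat ?r, d) : R" by (rule exI)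
    moreover have "nat ?r < k" using k(1) by (simp add: nat_less_iff)
    then have "~ (0 < nat ?r & (EX d. (x ^ nat ?r, d) : R))" unfolding k_def by (rule not_less_Least)
    ultimately have "nat ?r = 0" by simp
    then have "?r = 0" using k(1) by (simp add: order_antisym)
    then have i: "i = int k * ?q" by auto
    have "(x powi i, d0 powi ?q) : R" using Rpowi[OF d0, of ?q] by (subst i) (simp add: power_int_mult)
    then have "d = d0 powi ?q" using sv[OF R(1) id] by blast
    also have "... = c powi i" by (subst (2) i) (simp add: power_int_mult c)
    finally show "d = c powi i" .
   qed
  qed
  then obtain c where c: "c ~= 0" "!!i d. (x powi i, d) : R ==> d = c powi i" by blast
  let ?H = "{(a * x powi i, b * c powi i) |a b i. (a, b) : R}"
  have mem: "(a * x powi i, b * c powi i) : ?H" if "(a, b) : R" for a b i using that by blast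
  have xG: "x powi i : G" for i
  proof -
   have n: "x ^ n : G" for n by (induction n) (use G(1,2) x in auto)
   show ?thesis by (cases i rule: int_cases2) (use n G(3) in \<open>auto simp: power_int_minus\<close>)
  qed
  have RH: "R <= ?H"
  proof
   fix z assume "z : R"
   then show "z : ?H" using mem[of "fst z" "snd z" 0] by simp
  qed
  have "ok ?H" unfolding ok_def
  proof (intro conjI allI impI)
   fix a b assume "(a, b) : ?H"
   then obtain a' b' i where h: "(a', b') : R" "a = a' * x powi i" "b = b' * c powi i" by blast
   show "a : G" "b ~= 0" using h okD(1,2)[OF R(1) h(1)] xG G(2) c(1) by auto
   show "(inverse a, inverse b) : ?H" using mem[OF okD(3)[OF R(1) h(1)], of "- i"] h by (simp add: power_int_minus)
  next
   show "(1, 1) : ?H" using mem[OF okD(4)[OF R(1)], of 0] by simp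
  next
   fix a b a' b' assume "(a, b) : ?H" "(a', b') : ?H"
   then obtain s t i s' t' j where h: "(s, t) : R" "a = s * x powi i" "b = t * c powi i"
    "(s', t') : R" "a' = s' * x powi j" "b' = t' * c powi j" by blast
   have "a * a' = (s * s') * x powi (i + j)" "b * b' = (t * t') * c powi (i + j)"
    using h x0 c(1) by (simp_all add: power_int_add)
   then show "(a * a', b * b') : ?H" using mem[OF okD(5)[OF R(1) h(1,4)], of "i + j"] by simp
  next
   fix b assume "(1, b) : ?H"
   then obtain s t i where h: "(s, t) : R" "1 = s * x powi i" "b = t * c powi i" by blast
   have "x powi (- i) = s" using h(2) x0 by (simp add: power_int_minus field_simps)
   then have "t = c powi (- i)" using c(2)[of "- i" t] h(1) by simp
   then show "b = 1" using h(3) c(1) by (simp add: power_int_minus)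
  qed
  then have "?H = R" using max RH by blast
  moreover have "(x, c) : ?H" using mem[OF okD(4)[OF R(1)], of 1] by simp
  ultimately show ?thesis by blast
 qed
 define g where "g = (%x. SOME b. (x, b) : R)"
 have g: "(x, g x) : R" if "x : G" for x using someI_ex[OF tot[OF that]] by (simp add: g_def)
 show ?thesis
 proof (intro exI[of _ g] conjI ballI)
  show "g x ~= 0" if "x : G" for x using okD(2)[OF R(1) g[OF that]] .
  show "g (x * y) = g x * g y" if "x : G" "y : G" for x y
   using sv[OF R(1) g[OF G(2)[OF that]] okD(5)[OF R(1) g[OF that(1)] g[OF that(2)]]] .
  show "g x = f x" if "x : A" for x using sv[OF R(1) g] R(2) A(1) that by blast
 qed
qed

context local_field
begin

section \<open>Cyclic unramified extensions\<close>

context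
 fixes K L j \<phi>
 assumes K: "tame_exp K j" "!!x. x : K ==> separable_element x" and L: "intermediate_field L" "L <= K"
  and unr: "unramified v L K"
  and \<phi>: "\<phi> : field_auts L" "\<phi> ` K = K" "!!x. x : K ==> \<phi> x = x ==> x : L"
begin

lemma phi_abs: "\<phi> : abs_galois" and phi_pow: "\<phi> ^^ i : field_auts L" "\<phi> ^^ i : abs_galois"
 and phi_K: "x : K ==> (\<phi> ^^ i) x : K"
proof -
 show "\<phi> : abs_galois" using auts_abs[OF L(1) \<phi>(1)] .
 show "\<phi> ^^ i : field_auts L" using aut_group_funpow[OF aut_group_auts[OF L(1)] \<phi>(1)] .
 then show "\<phi> ^^ i : abs_galois" using auts_abs[OF L(1)] by blast
 show "x : K ==> (\<phi> ^^ i) x : K" by (induction i) (use \<phi>(2) in auto)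
qed

lemma phi_finite_order: "EX n>0. ALL x:K. (\<phi> ^^ n) x = x"
proof -
 have "finite (restrictions (field_auts L) K)" using fin_restrictions[OF tame_expD(1)[OF K(1)] L(1)] .
 moreover have "range (%i. restrict (\<phi> ^^ i) K) <= restrictions (field_auts L) K" using restrictionsI[OF phi_pow(1)] by blast
 ultimately have "~ inj (%i. restrict (\<phi> ^^ i) K)" by (metis finite_imageD finite_subset infinite_UNIV_nat)
 then obtain a b where ab: "a < b" "restrict (\<phi> ^^ a) K = restrict (\<phi> ^^ b) K" unfolding inj_on_def by (metis linorder_neqE_nat)
 have "(\<phi> ^^ (b - a)) x = x" if "x : K" for x
 proof -
  have "(\<phi> ^^ a) ((\<phi> ^^ (b - a)) x) = (\<phi> ^^ b) x" using ab(1) funpow_add[of a "b - a" \<phi>] by (simp add: o_def fun_eq_iff)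
  also have "... = (\<phi> ^^ a) x" using ab(2) that by (simp add: restrict_eq)
  finally show ?thesis using autsD(13)[OF phi_pow(2)] by blast
 qed
 then show ?thesis using ab(1) by (intro exI[of _ "b - a"]) auto
qed

definition ord_phi :: nat where "ord_phi = (LEAST n. 0 < n & (ALL x:K. (\<phi> ^^ n) x = x))"

lemma ord_phi: "0 < ord_phi" "x : K ==> (\<phi> ^^ ord_phi) x = x" "0 < i ==> i < ord_phi ==> EX x:K. (\<phi> ^^ i) x ~= x"
proof -
 have "0 < ord_phi & (ALL x:K. (\<phi> ^^ ord_phi) x = x)" unfolding ord_phi_def using phi_finite_order by (rule LeastI_ex)
 then show "0 < ord_phi" "x : K ==> (\<phi> ^^ ord_phi) x = x" by auto
 show "0 < i ==> i < ord_phi ==> EX x:K. (\<phi> ^^ i) x ~= x" using not_less_Least unfolding ord_phi_def by blast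
qed

lemma ord_phi_mult: "x : K ==> (\<phi> ^^ (ord_phi * i)) x = x"
 by (induction i) (simp_all add: funpow_add ord_phi(2))

lemma phi_mod: "x : K ==> (\<phi> ^^ i) x = (\<phi> ^^ (i mod ord_phi)) x"
 using funpow_add[of "i mod ord_phi" "ord_phi * (i div ord_phi)" \<phi>] ord_phi_mult[of x "i div ord_phi"]
 by (simp add: add.commute)

lemma phi_eq:
 assumes "i < i'" "i' < ord_phi" "(\<phi> ^^ i) x = (\<phi> ^^ i') x" shows "(\<phi> ^^ (i' - i)) x = x"
proof -
 have "(\<phi> ^^ i) ((\<phi> ^^ (i' - i)) x) = (\<phi> ^^ i) x" using assms funpow_add[of i "i' - i" \<phi>] by (simp add: o_def fun_eq_iff)
 then show ?thesis using autsD(13)[OF phi_pow(2)] by blast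
qed

text \<open>Artin's theorem for the automorphisms that agree on \<open>K\<close> with a power of
  \<open>\<phi>\<close>: what they all fix in \<open>K\<close> is fixed by \<open>\<phi>\<close> and
  so lies in \<open>L\<close>.\<close>

lemma phi_generates:
 assumes t: "t : field_auts L" shows "EX i<ord_phi. ALL x:K. t x = (\<phi> ^^ i) x"
proof -
 define H where "H = {u:abs_galois. EX i. ALL x:K. u x = (\<phi> ^^ i) x}"
 have HK: "u x : K" if "u : H" "x : K" for u x using that phi_K by (auto simp: H_def)
 have inv: "ginv u : H" if s: "u : H" for u
 proof -
  obtain i where i: "u : abs_galois" "ALL x:K. u x = (\<phi> ^^ i) x" using s by (auto simp: H_def)
  have "ginv u x = (\<phi> ^^ (i * (ord_phi - 1))) x" if x: "x : K" for x
  proof -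
   have "u ((\<phi> ^^ (i * (ord_phi - 1))) x) = (\<phi> ^^ (i + i * (ord_phi - 1))) x" using i(2) phi_K[OF x] by (simp add: funpow_add)
   also have "i + i * (ord_phi - 1) = ord_phi * i" using ord_phi(1) by (cases ord_phi) auto
   finally show ?thesis using ord_phi_mult[OF x] ginv_simps(2)[OF i(1)] by metis
  qed
  then show ?thesis using auts_inv[OF i(1)] unfolding H_def by blast
 qed
 have "aut_group H" unfolding aut_group_def
 proof (intro conjI ballI)
  show "H <= abs_galois" by (auto simp: H_def)
  show "id : H" by (auto simp: H_def id_auts intro!: exI[of _ 0])
  fix u w assume s: "u : H"
  then show "ginv u : H" by (rule inv)
  assume t: "w : H"
  obtain i i' where i: "ALL x:K. u x = (\<phi> ^^ i) x" "ALL x:K. w x = (\<phi> ^^ i') x" using s t by (auto simp: H_def)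
  have "(u o w) x = (\<phi> ^^ (i + i')) x" if "x : K" for x using i that HK[OF t that] by (simp add: funpow_add)
  moreover have "u o w : abs_galois" using s t by (auto simp: H_def intro: auts_comp)
  ultimately show "u o w : H" unfolding H_def by blast
 qed
 moreover have "u ` K = K" if s: "u : H" for u
 proof -
  have sa: "u : abs_galois" using s by (simp add: H_def)
  have "x : u ` K" if "x : K" for x using HK[OF inv[OF s] that] ginv_simps(1)[OF sa, of x] by (metis image_eqI)
  then show ?thesis using HK[OF s] by blast
 qed
 moreover have "\<phi> : H" using phi_abs by (auto simp: H_def intro!: exI[of _ 1])
 then have "t x = x" if "x : K" "!!h. h : H ==> h x = x" for x using \<phi>(3) that autsD(4)[OF t] by blast
 ultimately obtain h where h: "h : H" "!!x. x : K ==> t x = h x"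
  using artin[OF _ tame_expD(1)[OF K(1)] _ auts_abs[OF L(1) t]] by metis
 then obtain i where "ALL x:K. t x = (\<phi> ^^ i) x" by (auto simp: H_def)
 then have "t x = (\<phi> ^^ (i mod ord_phi)) x" if "x : K" for x using phi_mod[OF that, of i] that by simp
 then show ?thesis using ord_phi(1) by (intro exI[of _ "i mod ord_phi"]) auto
qed

lemma cyclic_norm:
 assumes x: "x : K" shows "field_norm L K x = (\<Prod>i<ord_phi. (\<phi> ^^ i) x)"
proof -
 have "restrictions (field_auts L) K = (%i. restrict (\<phi> ^^ i) K) ` {..<ord_phi}"
 proof (intro antisym subsetI)
  fix w assume "w : restrictions (field_auts L) K"
  then obtain t where t: "t : field_auts L" "w = restrict t K" by (rule restrictionsE)
  obtain i where "i < ord_phi" "ALL x:K. t x = (\<phi> ^^ i) x" using phi_generates[OF t(1)] by blast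
  then show "w : (%i. restrict (\<phi> ^^ i) K) ` {..<ord_phi}" using t(2) by (auto simp: restrict_eq)
 qed (auto intro: restrictionsI phi_pow)
 moreover have "inj_on (%i. restrict (\<phi> ^^ i) K) {..<ord_phi}"
 proof -
  have ne: "restrict (\<phi> ^^ i) K ~= restrict (\<phi> ^^ i') K" if ii: "i < i'" "i' < ord_phi" for i i'
  proof
   assume e: "restrict (\<phi> ^^ i) K = restrict (\<phi> ^^ i') K"
   have "0 < i' - i" "i' - i < ord_phi" using ii by auto
   then obtain x where "x : K" "(\<phi> ^^ (i' - i)) x ~= x" using ord_phi(3) by blast
   then show False using e phi_eq[OF ii] by (simp add: restrict_eq)
  qed
  show ?thesis by (rule inj_onI) (metis lessThan_iff linorder_neqE_nat ne)
 qed
 ultimately show ?thesis using x by (simp add: field_norm_def prod.reindex)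
qed

lemma same_value_in_L: "x : K ==> x ~= 0 ==> EX y:L - {0}. nrm x = nrm y"
 using unr unramified_value[OF L tame_expD(2)[OF K(1)]] by blast

text \<open>If two powers agreed on the roots of unity in \<open>K\<close>, their quotient would act
  trivially on residues. As the values of \<open>K\<close> come from \<open>L\<close>,
  \<open>tame_rigid\<close> would make it trivial on \<open>K\<close>, against the choice of
  \<open>ord_phi\<close>.\<close>

lemma phi_distinct_residues:
 assumes "i < i'" "i' < ord_phi" shows "EX z:mu Int K. (\<phi> ^^ i) z ~= (\<phi> ^^ i') z"
proof (rule ccontr)
 assume no: "~ (EX z:mu Int K. (\<phi> ^^ i) z ~= (\<phi> ^^ i') z)"
 let ?s = "\<phi> ^^ (i' - i)"
 note Kf = tame_expD(2)[OF K(1)]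
 have fix_mu: "?s z = z" if "z : mu Int K" for z using no that phi_eq[OF assms] by blast
 have "?s x = x" if x: "x : K" for x
 proof (rule tame_rigid[OF K(1) phi_pow(2) _ x])
  fix x assume x: "x : K" "x ~= 0"
  obtain y where y: "y : L - {0}" "nrm x = nrm y" using same_value_in_L[OF x] by blast
  have xy: "x / y : K" "nrm (x / y) = 1" using y x L(2) by (auto intro!: ifieldD[OF Kf] simp: nrm_divide)
  obtain z where z: "z : mu Int K" "nrm (x / y - z) < 1" using teichmueller_mem[OF Kf xy] by blast
  have "?s (x / y) - x / y = ?s (x / y - z) - (x / y - z)" using fix_mu[OF z(1)] by (simp add: autsD(8)[OF phi_pow(2)])
  moreover have "nrm (?s (x / y - z) - (x / y - z)) < 1"
   using nrm_diff[of "?s (x / y - z)" "x / y - z"] z(2) by (simp only: nrm_galois[OF phi_pow(2)] max.idem)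
  ultimately have "nrm (?s (x / y) - x / y) < 1" by (simp only:)
  then show "nrm (?s x / x - 1) < 1"
   using y autsD(4)[OF phi_pow(1)] by (intro small_of_unit_multiple[OF phi_pow(2), of _ y]) auto
 qed
 moreover have "0 < i' - i" "i' - i < ord_phi" using assms by auto
 ultimately show False using ord_phi(3) by blast
qed

text \<open>Hilbert's Theorem 90, approximately; the resolvent is a unit for a suitable root of unity.\<close>

lemma hilbert90:
 assumes x: "x : K" and m: "m < 1" "nrm (field_norm L K x - 1) <= m"
 shows "EX z:K. nrm z = 1 & nrm (x * \<phi> z / z - 1) <= m"
proof -
 note Kf = tame_expD(2)[OF K(1)]
 let ?n = ord_phi and ?N = "field_norm L K x"
 have "nrm ?N = 1" using m by (intro nrm_principal) simp
 then have "nrm x ^ ?n = 1" unfolding cyclic_norm[OF x] nrm_prod by (simp add: nrm_galois[OF phi_pow(2)])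
 then have nx: "nrm x = 1" using power_eq_imp_eq_base[of "nrm x" ?n 1] ord_phi(1) by simp
 \<comment> \<open>The partial norms of \<open>x\<close>. Since
   \<open>x * \<phi> (a i) = a (Suc i)\<close>, applying \<open>\<phi>\<close> to the resolvent and
   multiplying by \<open>x\<close> shifts the sum by one index; the end terms leave exactly the
   error \<open>?N - 1\<close> times \<open>c\<close>.\<close>
 define a where "a = (%i. \<Prod>k<i. (\<phi> ^^ k) x)"
 have na: "nrm (a i) = 1" for i unfolding a_def nrm_prod by (simp add: nrm_galois[OF phi_pow(2)] nx)
 have aK: "a i : K" for i unfolding a_def using phi_K[OF x] by (intro ifield_prod[OF Kf])
 have a_step: "x * \<phi> (a i) = a (Suc i)" for i
  unfolding a_def auts_prod[OF phi_abs] prod.lessThan_Suc_shift by simp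
 have "EX c:mu Int K. nrm (\<Sum>i<?n. a i * (\<phi> ^^ i) c) = 1"
 proof (rule dedekind_residue)
  show "{..<?n} ~= {}" using ord_phi(1) by auto
  show "1 : mu Int K" using mu_closed(1) ifieldD(3)[OF Kf] by blast
  show "y * z : mu Int K" if "y : mu Int K" "z : mu Int K" for y z
   using that mu_closed(2) ifieldD(5)[OF Kf] by blast
  show "(\<phi> ^^ i) z : mu" if "i : {..<?n}" "z : mu Int K" for i z using mu_closed(5)[OF phi_pow(2)] that by blast
  show "EX z:mu Int K. (\<phi> ^^ i) z ~= (\<phi> ^^ i') z" if "i : {..<?n}" "i' : {..<?n}" "i ~= i'" for i i'
   using phi_distinct_residues[of i i'] phi_distinct_residues[of i' i] that by (metis lessThan_iff linorder_neqE_nat)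
 qed (use na autsD(3)[OF phi_pow(2)] in auto)
 then obtain c where c: "c : mu Int K" "nrm (\<Sum>i<?n. a i * (\<phi> ^^ i) c) = 1" by blast
 define z where "z = (\<Sum>i<?n. a i * (\<phi> ^^ i) c)"
 have zK: "z : K" unfolding z_def using aK phi_K c(1) by (intro ifield_sum[OF Kf] ifieldD(5)[OF Kf]) auto
 have z: "nrm z = 1" "z ~= 0" using c(2) by (auto simp: z_def)
 have "x * \<phi> z = (\<Sum>i<?n. a (Suc i) * (\<phi> ^^ Suc i) c)"
  unfolding z_def auts_sum[OF phi_abs] sum_distrib_left autsD(3)[OF phi_abs]
  by (intro sum.cong refl) (simp add: a_step[symmetric] mult.assoc)
 also have "... = z + a ?n * (\<phi> ^^ ?n) c - a 0 * (\<phi> ^^ 0) c"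
  unfolding z_def using sum.lessThan_Suc_shift[of "%i. a i * (\<phi> ^^ i) c" ?n] by (simp add: algebra_simps)
 also have "... = z + (?N - 1) * c"
  using ord_phi(2)[of c] c(1) by (simp add: a_def cyclic_norm[OF x] algebra_simps)
 finally have "x * \<phi> z / z - 1 = (?N - 1) * c / z" using z(2) by (simp add: field_simps)
 then have "nrm (x * \<phi> z / z - 1) <= m" using z(1) nrm_mu[of c] c(1) m(2) by (simp add: nrm_divide nrm_mult)
 then show ?thesis using zK z(1) by blast
qed

text \<open>Hilbert 90 makes \<open>\<theta>\<close> trivial on elements whose norm is close to 1,
  so it descends to the approximate norms and is then extended to all of \<open>L\<close>.
  Invariance on units implies invariance on all nonzero elements because each of them is a unit
  times an element of \<open>L\<close>.\<close>

theorem invariant_character_is_norm: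
 assumes \<theta>: "smooth_character v (K - {0}) \<theta>" and inv: "!!x. x : K ==> nrm x = 1 ==> \<theta> (\<phi> x) = \<theta> x"
 shows "EX \<theta>L. smooth_character v (L - {0}) \<theta>L & (ALL x:K - {0}. \<theta> x = \<theta>L (field_norm L K x))"
proof -
 note Kf = tame_expD(2)[OF K(1)] and Kfin = tame_expD(1)[OF K(1)]
 let ?N = "field_norm L K"
 obtain m where m: "0 < m" "m < 1" "!!x. x : K - {0} ==> nrm (x - 1) <= m ==> \<theta> x = 1"
  by (rule smooth_radius[OF \<theta>]) blast
 have mult: "\<theta> (x * y) = \<theta> x * \<theta> y" if "x : K - {0}" "y : K - {0}" for x y
  using \<theta> that by (auto simp: smooth_character_def)
 have nz: "\<theta> x ~= 0" if "x : K - {0}" for x using \<theta> that by (auto simp: smooth_character_def)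
 have t1: "\<theta> 1 = 1" using m(3)[of 1] m(1) ifieldD(3)[OF Kf] by simp
 have phiK: "\<phi> x : K - {0}" if "x : K - {0}" for x using that \<phi>(2) autsD(12)[OF phi_abs] by blast
 have inv': "\<theta> (\<phi> x) = \<theta> x" if x: "x : K - {0}" for x
 proof -
  obtain y where y: "y : L - {0}" "nrm x = nrm y" using same_value_in_L x by blast
  have yK: "y : K - {0}" using y(1) L(2) by blast
  have q: "x / y : K - {0}" using x yK ifieldD(9)[OF Kf] by simp
  have "nrm (x / y) = 1" using y by (simp add: nrm_divide)
  then have "\<theta> (\<phi> (x / y)) = \<theta> (x / y)" using inv q by blast
  moreover have "x = y * (x / y)" using y(1) by simp
  moreover have "\<phi> x = y * \<phi> (x / y)" using y(1) autsD(4)[OF \<phi>(1)] by (simp add: autsD(10)[OF phi_abs])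
  ultimately show ?thesis using mult[OF yK q] mult[OF yK phiK[OF q]] by simp
 qed
 have ker: "\<theta> x = 1" if x: "x : K - {0}" "nrm (?N x - 1) <= m" for x
 proof -
  obtain z where z: "z : K" "nrm z = 1" "nrm (x * \<phi> z / z - 1) <= m" using hilbert90[OF _ m(2) x(2)] x(1) by blast
  have z0: "z : K - {0}" using z(1,2) by auto
  have q: "x * \<phi> z / z : K - {0}"
   using x(1) phiK[OF z0] z0 ifieldD(5,9)[OF Kf] by auto
  have "x * \<phi> z / z * z = x * \<phi> z" using z0 by simp
  then have "\<theta> (x * \<phi> z / z) * \<theta> z = \<theta> x * \<theta> z"
   using mult[OF q z0] mult[OF x(1) phiK[OF z0]] inv'[OF z0] by (simp only:)
  then show ?thesis using m(3)[OF q z(3)] nz[OF z0] by simp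
 qed
 have NL: "?N x : L - {0}" if "x : K - {0}" for x
  using that field_norm_mem[OF L(1) Kfin] K(2) field_norm_eq_0[OF L(1) Kfin] by blast
 have Nm: "?N (x * y) = ?N x * ?N y" if "x : K" "y : K" for x y by (rule field_norm_mult[OF L(1) Kfin that])
 have Ni: "?N (inverse x) = inverse (?N x)" if x: "x : K - {0}" for x
 proof -
  have "?N x * ?N (inverse x) = 1"
   using Nm[of x "inverse x"] x ifieldD(6)[OF Kf] field_norm_1[OF L(1) Kfin] by simp
  then show ?thesis by (metis inverse_unique)
 qed
 have inK: "inverse x : K - {0}" if "x : K - {0}" for x using that ifieldD(6)[OF Kf] by simp
 have mK: "x * y : K - {0}" if "x : K - {0}" "y : K - {0}" for x y using that ifieldD(5)[OF Kf] by simp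
 \<comment> \<open>Elements within \<open>m\<close> of a norm, in the multiplicative sense. This
   group contains the ball of radius \<open>m\<close> about 1, so any extension of the character
   from it is automatically smooth.\<close>
 define A where "A = {u : L. EX x:K - {0}. nrm (u / ?N x - 1) <= m}"
 define f where "f = (%u. \<theta> (SOME x. x : K - {0} & nrm (u / ?N x - 1) <= m))"
 have f: "f u = \<theta> x" if u: "x : K - {0}" "nrm (u / ?N x - 1) <= m" for u x
 proof -
  define x' where "x' = (SOME x. x : K - {0} & nrm (u / ?N x - 1) <= m)"
  have x': "x' : K - {0}" "nrm (u / ?N x' - 1) <= m"
   using someI[of "%x. x : K - {0} & nrm (u / ?N x - 1) <= m" x] u by (auto simp: x'_def)
  have u0: "u ~= 0" using u(2) m(2) by auto
  have n0: "?N x ~= 0" "?N x' ~= 0" using NL u(1) x'(1) by auto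
  have "?N (x' * inverse x) = (u / ?N x) * inverse (u / ?N x')"
   using Nm[of x' "inverse x"] Ni[OF u(1)] x'(1) inK[OF u(1)] u0 n0 by (simp add: field_simps)
  then have "nrm (?N (x' * inverse x) - 1) <= m"
   using principal_div(1)[OF u(2) principal_div(2)[OF x'(2) x'(2) m(2)] m(2)] by simp
  then have "\<theta> (x' * inverse x) = 1" using ker mK[OF x'(1) inK[OF u(1)]] by blast
  moreover have "x' * inverse x * x = x'" using u(1) by simp
  ultimately have "\<theta> x' = \<theta> x" using mult[OF mK[OF x'(1) inK[OF u(1)]] u(1)] by (simp only: mult_1)
  then show ?thesis by (simp add: f_def x'_def)
 qed
 have AE: "EX x:K - {0}. nrm (u / ?N x - 1) <= m" "u : L" "u ~= 0" if "u : A" for u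
  using that m(2) by (auto simp: A_def)
 have Amult: "u * w : A & f (u * w) = f u * f w" if uw: "u : A" "w : A" for u w
 proof -
  obtain x where x: "x : K - {0}" "nrm (u / ?N x - 1) <= m" using AE(1)[OF uw(1)] by (rule bexE)
  obtain y where y: "y : K - {0}" "nrm (w / ?N y - 1) <= m" using AE(1)[OF uw(2)] by (rule bexE)
  note xy = x y
  have "(u * w) / ?N (x * y) = (u / ?N x) * (w / ?N y)" using Nm xy by simp
  then have q: "nrm ((u * w) / ?N (x * y) - 1) <= m" using principal_div(1)[OF xy(2,4) m(2)] by (simp only:)
  then show ?thesis using f[OF xy(1,2)] f[OF xy(3,4)] f[OF mK[OF xy(1,3)] q] mult[OF xy(1,3)] mK[OF xy(1,3)]
    AE(2)[OF uw(1)] AE(2)[OF uw(2)] ifieldD(5)[OF L(1)] by (auto simp: A_def)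
 qed
 have "EX g. (ALL x:L - {0}. g x ~= 0) & (ALL x:L - {0}. ALL y:L - {0}. g (x * y) = g x * g y) & (ALL x:A. g x = f x)"
 proof (rule character_extension)
  show "A <= L - {0}" using AE by blast
  have "nrm (1 / ?N 1 - 1) <= m" using m(1) field_norm_1[OF L(1) Kfin] by simp
  then show "1 : A" using ifieldD(3)[OF L(1)] ifieldD(3)[OF Kf] by (auto simp: A_def intro!: bexI[of _ 1])
  show "inverse u : A" if u: "u : A" for u
  proof -
   obtain x where x: "x : K - {0}" "nrm (u / ?N x - 1) <= m" using AE(1)[OF u] by blast
   have "inverse u / ?N (inverse x) = inverse (u / ?N x)" using Ni[OF x(1)] by (simp add: field_simps)
   then have "nrm (inverse u / ?N (inverse x) - 1) <= m" using principal_div(2)[OF x(2,2) m(2)] by simp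
   then show ?thesis using inK[OF x(1)] AE(2)[OF u] ifieldD(6)[OF L(1)] by (auto simp: A_def)
  qed
  show "f u ~= 0" if "u : A" for u using AE(1)[OF that] f nz by force
 qed (use Amult ifieldD[OF L(1)] in auto)
 then obtain g where gg: "(ALL x:L - {0}. g x ~= 0) & (ALL x:L - {0}. ALL y:L - {0}. g (x * y) = g x * g y) & (ALL x:A. g x = f x)"
  by (rule exE)
 have g: "x : L - {0} ==> g x ~= 0" "x : L - {0} ==> y : L - {0} ==> g (x * y) = g x * g y" "x : A ==> g x = f x" for x y
  using gg by simp_all
 show ?thesis
 proof (intro exI[of _ g] conjI ballI smooth_characterI[OF g(1,2) m(1)])
  fix u assume u: "u : L - {0}" "nrm (u - 1) <= m"
  have q: "nrm (u / ?N 1 - 1) <= m" "1 : K - {0}"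
   using u field_norm_1[OF L(1) Kfin] ifieldD(3)[OF Kf] by auto
  then have "u : A" using u(1) by (auto simp: A_def)
  then show "g u = 1" using g(3) f[OF q(2,1)] t1 by simp
 next
  fix x assume x: "x : K - {0}"
  have q: "nrm (?N x / ?N x - 1) <= m" using NL[OF x] m(1) by simp
  then have "?N x : A" using NL[OF x] x unfolding A_def by blast
  then show "\<theta> x = g (?N x)" using g(3) f[OF x q] by simp
 qed
qed

end

end

section \<open>Maximal tori of the general linear group\<close>

no_notation fps_nth (infixl "$" 75)

definition dg :: "('n::finite => 'a::zero) => 'a ^'n ^'n" where
 "dg h = (\<chi> i j. if i = j then h i else 0)"

lemma mult_dg: "(A ** dg h) $ i $ j = A $ i $ j * h j" for A :: "'a::comm_ring_1 ^'n ^'m"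
 by (simp add: matrix_matrix_mult_def dg_def if_distrib[of "%x. _ * x"] cong: if_cong)

lemma dg_mult: "(dg h ** A) $ i $ j = h i * A $ i $ j" for A :: "'a::comm_ring_1 ^'m ^'n"
 by (simp add: matrix_matrix_mult_def dg_def if_distrib[of "%x. x * _"] cong: if_cong)

lemma dg_dg: "dg h ** dg h' = dg (%k. h k * h' k)" for h :: "'n::finite => 'a::comm_ring_1"
 by (simp add: vec_eq_iff mult_dg) (simp add: dg_def)

lemma dg_const: "dg (%_. c) = mat c" by (simp add: dg_def mat_def)

lemma matrix_inv: "invertible A ==> A ** matrix_inv A = mat 1" "invertible A ==> matrix_inv A ** A = mat 1"
 for A :: "'a::field ^'n ^'n"
 using someI_ex[of "%B. A ** B = mat 1 & B ** A = mat 1"] unfolding matrix_inv_def invertible_def by auto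

lemma matrix_inv_eq: "A ** B = mat 1 ==> matrix_inv A = B" "A ** B = mat 1 ==> invertible A" for A B :: "'a::field ^'n ^'n"
proof -
 assume a: "A ** B = mat 1"
 then show i: "invertible A" using invertible_right_inverse by blast
 have "matrix_inv A ** (A ** B) = B" unfolding matrix_mul_assoc using matrix_inv(2)[OF i] by simp
 then show "matrix_inv A = B" using a by simp
qed

lemma map_matrix_mult: "s : field_auts L ==> map_matrix s (A ** B) = map_matrix s A ** map_matrix s B"
 by (simp add: vec_eq_iff matrix_matrix_mult_def auts_sum autsD(3))

lemma map_matrix_mat: "s : field_auts L ==> map_matrix s (mat 1) = mat 1"
 by (simp add: vec_eq_iff mat_def autsD(5,6))

lemma map_matrix_dg: "s : field_auts L ==> map_matrix s (dg h) = dg (%k. s (h k))"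
 by (simp add: vec_eq_iff dg_def autsD(5))

lemma map_matrix_inv:
 fixes A :: "'f::field alg_closure ^'n ^'n"
 assumes "s : field_auts L" "invertible A"
 shows "map_matrix s (matrix_inv A) = matrix_inv (map_matrix s A)" "invertible (map_matrix s A)"
proof -
 have "map_matrix s A ** map_matrix s (matrix_inv A) = mat 1"
  by (simp only: map_matrix_mult[OF assms(1), symmetric] matrix_inv[OF assms(2)] map_matrix_mat[OF assms(1)])
 from matrix_inv_eq[OF this] show "map_matrix s (matrix_inv A) = matrix_inv (map_matrix s A)" "invertible (map_matrix s A)" by auto
qed

lemma map_matrix_comp: "map_matrix s (map_matrix t A) = map_matrix (s o t) A"
 by (simp add: vec_eq_iff)

text \<open>The matrix \<open>matrix_inv g ** A\<close> intertwines diagonal matrices with diagonal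
  matrices. For the diagonal matrix with distinct entries \<open>h0\<close> this leaves at most one
  nonzero entry in each row, so invertibility makes the matrix monomial; \<open>w\<close> is its
  pattern.\<close>

lemma conj_monomial:
 fixes g A :: "'a::field ^'n ^'n" and h0 :: "'n => 'a"
 assumes g: "invertible g" and A: "invertible A" and h0: "inj h0" "ALL k. h0 k ~= 0"
  and conj: "!!h. ALL k. h k ~= 0 ==> EX h'. A ** dg h ** matrix_inv A = g ** dg h' ** matrix_inv g"
 shows "EX w. bij w & (ALL i j. (matrix_inv g ** A) $ i $ j ~= 0 \<longleftrightarrow> i = w j) &
  (ALL h. (ALL k. h k ~= 0) --> A ** dg (%k. h (w k)) ** matrix_inv A = g ** dg h ** matrix_inv g)"
proof -
 let ?M = "matrix_inv g ** A"
 have key: "EX h'. (ALL i j. ?M $ i $ j * h j = h' i * ?M $ i $ j) & A ** dg h ** matrix_inv A = g ** dg h' ** matrix_inv g"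
  if h: "ALL k. h k ~= 0" for h
 proof -
  obtain h' where h': "A ** dg h ** matrix_inv A = g ** dg h' ** matrix_inv g" using conj[OF h] by (rule exE)
  have "?M ** dg h = matrix_inv g ** (A ** dg h ** (matrix_inv A ** A))" by (simp add: matrix_inv(2)[OF A] matrix_mul_assoc)
  also have "... = matrix_inv g ** (A ** dg h ** matrix_inv A) ** A" by (simp add: matrix_mul_assoc)
  also have "... = dg h' ** ?M" unfolding h' by (simp add: matrix_mul_assoc matrix_inv(2)[OF g])
  finally have "?M $ i $ j * h j = h' i * ?M $ i $ j" for i j
   using mult_dg[of ?M h i j] dg_mult[of h' ?M i j] by (simp only:)
  then show ?thesis using h' by blast
 qed
 obtain h' where h': "!!i j. ?M $ i $ j * h0 j = h' i * ?M $ i $ j" using key[OF h0(2)] by (elim exE conjE) blast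
 have "matrix_inv A ** g ** ?M = matrix_inv A ** (g ** matrix_inv g) ** A" by (simp add: matrix_mul_assoc)
 also have "... = mat 1" by (simp add: matrix_inv(1)[OF g] matrix_inv(2)[OF A])
 finally have inv: "matrix_inv A ** g ** ?M = mat 1" .
 have col: "EX i. ?M $ i $ j ~= 0" for j
 proof (rule ccontr)
  assume "\<nexists>i. ?M $ i $ j ~= 0"
  then have "(matrix_inv A ** g ** ?M) $ j $ j = 0" unfolding matrix_matrix_mult_def[of "matrix_inv A ** g"] by simp
  then show False unfolding inv by (simp add: mat_def)
 qed
 define w where "w = (%j. SOME i. ?M $ i $ j ~= 0)"
 have w: "?M $ w j $ j ~= 0" for j unfolding w_def using someI_ex[OF col] .
 have row: "j = j'" if "?M $ i $ j ~= 0" "?M $ i $ j' ~= 0" for i j j'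
 proof -
  have "h0 j = h' i" "h0 j' = h' i" using h'[of i j] h'[of i j'] that by simp_all
  then show ?thesis using h0(1) by (simp add: inj_def)
 qed
 have "inj w" using row w by (metis injI)
 then have bij: "bij w" by (simp add: bij_def finite_UNIV_inj_surj)
 have pat: "?M $ i $ j ~= 0 \<longleftrightarrow> i = w j" for i j
  using row w bij by (metis bij_pointE)
 have "A ** dg (%k. h (w k)) ** matrix_inv A = g ** dg h ** matrix_inv g" if h: "ALL k. h k ~= 0" for h
 proof -
  obtain h' where h': "ALL i j. ?M $ i $ j * h (w j) = h' i * ?M $ i $ j"
   "A ** dg (%k. h (w k)) ** matrix_inv A = g ** dg h' ** matrix_inv g" using key[of "%k. h (w k)"] h by blast
  have "h' (w j) = h (w j)" for j using h'(1)[rule_format, of "w j" j] w[of j] by simp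
  then have "h' = h" using bij by (metis bij_pointE ext)
  then show ?thesis using h'(2) by simp
 qed
 then show ?thesis using bij pat by blast
qed

lemma regular_functions_sum: "(!!i. i : A ==> f i : regular_functions) ==> (%s. SUM i:A. f i s) : regular_functions"
 by (induction A rule: infinite_finite_induct) (auto intro: regular_functions.intros)

lemma regular_functions_prod: "(!!i. i : A ==> f i : regular_functions) ==> (%s. PROD i:A. f i s) : regular_functions"
 by (induction A rule: infinite_finite_induct) (auto intro: regular_functions.intros)

lemma regular_functions_power: "f : regular_functions ==> (%s. f s ^ n) : regular_functions"
 by (induction n) (auto intro: regular_functions.intros)

text \<open>A polynomial without nonzero roots over an algebraically closed field is a
  monomial.\<close>

lemma multiplicative_poly_is_power:
 fixes f :: "'a::alg_closed_field => 'a"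
 assumes f: "!!x. x ~= 0 ==> f x ~= 0" "f 1 = 1" and q: "!!x. x ~= 0 ==> x ^ m * f x = poly q x"
 shows "EX a::int. ALL x. x ~= 0 --> f x = x powi a"
proof -
 have "q ~= 0" using q[of 1] f(2) by auto
 then obtain r where r: "q = [:- 0, 1:] ^ Polynomial.order 0 q * r" "~ [:- 0, 1:] dvd r" using order_decomp by blast
 have "poly r x ~= 0" for x
 proof (cases "x = 0")
  case False
  then have "poly q x ~= 0" using q[OF False] f(1)[OF False] by (metis mult_eq_0_iff power_not_zero)
  then show ?thesis by (subst (asm) r(1)) simp
 qed (use r(2) poly_eq_0_iff_dvd[of r 0] in simp)
 then have "degree r = 0" using alg_closed_imp_poly_has_root by blast
 then obtain c where "r = [:c:]" by (rule degree_eq_zeroE)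
 then have qx: "poly q x = x ^ Polynomial.order 0 q * c" for x by (subst r(1)) (simp add: poly_power)
 have "c = 1" using qx[of 1] q[of 1] f(2) by simp
 then have "f x = x powi (int (Polynomial.order 0 q) - int m)" if "x ~= 0" for x
  using q[OF that] qx[of x] that by (simp add: power_int_diff field_simps)
 then show ?thesis by blast
qed

text \<open>The frame \<open>g\<close> is kept as fixed data: conjugation by it identifies
  \<open>S\<close> with the diagonal matrices, with \<open>el\<close> as this identification and
  \<open>co\<close> as the coordinates.\<close>

locale torus = local_field v for v :: "'f::field => int" +
 fixes S :: "('f alg_closure ^'n ^'n) set" and g :: "'f alg_closure ^'n ^'n"
 assumes g: "invertible g" and sep_g: "separable_element (g $ i $ k)"
  and S_eq: "S = {g ** d ** matrix_inv g |d. invertible d & (ALL i j. i ~= j --> d $ i $ j = 0)}"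
  and stable: "s : abs_galois ==> map_matrix s ` S = S"
begin

abbreviation "gi \<equiv> matrix_inv g"

definition el :: "('n => 'f alg_closure) => 'f alg_closure ^'n ^'n" where "el h = g ** dg h ** gi"

definition co :: "'n => 'f alg_closure ^'n ^'n => 'f alg_closure" where "co k s = (gi ** s ** g) $ k $ k"

lemma gg: "g ** gi = mat 1" "gi ** g = mat 1" "A ** g ** gi = A" "A ** gi ** g = A"
 using matrix_inv[OF g] by (simp_all add: matrix_mul_assoc[symmetric])

lemma gi_el: "gi ** el h ** g = dg h"
 unfolding el_def by (simp add: matrix_mul_assoc gg)

lemma co_el [simp]: "co k (el h) = h k"
 by (simp add: co_def gi_el) (simp add: dg_def)

lemma el_mult: "el h ** el h' = el (%k. h k * h' k)"
 unfolding el_def dg_dg[symmetric] by (simp add: matrix_mul_assoc gg)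

lemma mat_el: "mat c = el (%_. c)"
proof -
 have "g ** mat c = mat c ** g" unfolding dg_const[symmetric] by (simp add: vec_eq_iff mult_dg dg_mult mult.commute)
 then show ?thesis unfolding el_def dg_const by (simp add: gg)
qed

lemma S_iff: "s : S \<longleftrightarrow> (EX h. (ALL k. h k ~= 0) & s = el h)"
proof
 assume "s : S"
 then obtain d where d: "s = g ** d ** gi" "invertible d" "ALL i j. i ~= j --> d $ i $ j = 0" unfolding S_eq by blast
 have dd: "d = dg (%k. d $ k $ k)" using d(3) by (simp add: vec_eq_iff dg_def)
 have "det d = (PROD k:UNIV. d $ k $ k)" using d(3) by (intro det_diagonal) simp
 then have "d $ k $ k ~= 0" for k using d(2) by (simp add: invertible_det_nz)
 then show "EX h. (ALL k. h k ~= 0) & s = el h" using d(1) dd unfolding el_def by (intro exI[of _ "%k. d $ k $ k"]) simp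
next
 assume "EX h. (ALL k. h k ~= 0) & s = el h"
 then obtain h where h: "ALL k. h k ~= 0" "s = el h" by blast
 have "dg h ** dg (%k. inverse (h k)) = mat 1" using h(1) by (simp add: dg_dg dg_const)
 then have "invertible (dg h)" by (rule matrix_inv_eq(2))
 then show "s : S" unfolding S_eq h(2) el_def by (auto simp: dg_def intro!: exI[of _ "dg h"])
qed

lemma S_cases: "s : S ==> (!!h. ALL k. h k ~= 0 ==> s = el h ==> P) ==> P" using S_iff by blast

lemma el_S: "ALL k. h k ~= 0 ==> el h : S" using S_iff by blast

lemma el_co: "s : S ==> el (%k. co k s) = s" by (auto elim: S_cases)

lemma co_nz: "s : S ==> co k s ~= 0" by (auto elim: S_cases)

lemma S_mult: "s : S ==> t : S ==> s ** t : S" and co_mult: "s : S ==> t : S ==> co k (s ** t) = co k s * co k t"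
 by (auto elim!: S_cases simp: el_mult intro!: el_S)

lemma S_eqI: "s : S ==> t : S ==> (!!k. co k s = co k t) ==> s = t" by (metis el_co ext)

lemma el_inverse: "ALL k. h k ~= 0 ==> matrix_inv (el h) = el (%k. inverse (h k))"
 by (intro matrix_inv_eq) (simp add: el_mult mat_el)

lemma S_inv: "s : S ==> matrix_inv s : S" "s : S ==> co k (matrix_inv s) = inverse (co k s)" "s : S ==> invertible s"
proof -
 show "s : S ==> matrix_inv s : S" by (auto elim!: S_cases simp: el_inverse intro!: el_S)
 show "s : S ==> co k (matrix_inv s) = inverse (co k s)" by (auto elim!: S_cases simp: el_inverse)
 show "invertible s" if s: "s : S"
 proof -
  obtain h where h: "ALL k. h k ~= 0" "s = el h" using s by (rule S_cases)
  then have "s ** el (%k. inverse (h k)) = mat 1" by (simp add: el_mult mat_el)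
  then show ?thesis by (rule matrix_inv_eq(2))
 qed
qed

lemma det_el: "det (el h) = (PROD k:UNIV. h k)"
proof -
 have "det (el h) = det g * det gi * det (dg h)" by (simp add: el_def det_mul mult.commute mult.left_commute)
 also have "det g * det gi = 1" using det_mul[of g gi] by (simp add: gg)
 finally show ?thesis by (simp add: det_diagonal dg_def)
qed

lemma co_regular: "co k : regular_functions"
proof -
 have "(%s. SUM j:UNIV. (SUM i:UNIV. gi $ k $ i * s $ i $ j) * g $ j $ k) : regular_functions"
  by (intro regular_functions_sum regular_functions.intros)
 then show ?thesis by (simp add: co_def[abs_def] matrix_matrix_mult_def)
qed

text \<open>Distinct powers of the uniformizer have distinct values; they are the eigenvalues of a
  regular element.\<close>

lemma inj_frame: "EX h::'n => 'f alg_closure. inj h & (ALL k. h k ~= 0)"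
proof -
 obtain f :: "'n => nat" where f: "inj f" using finite_imp_inj_to_nat_seg[of "UNIV :: 'n set"] by auto
 have "k = l" if "to_ac \<pi> powi int (f k) = to_ac \<pi> powi int (f l)" for k l
 proof -
  have "(2::real) powi (- int (f k)) = 2 powi (- int (f l))" using that pi_powi(2) by metis
  then show ?thesis using f by (simp only: powi_2_inject) (simp add: inj_eq)
 qed
 then show ?thesis by (intro exI[of _ "%k. to_ac \<pi> powi int (f k)"] conjI injI allI pi_powi(1))
qed

lemma perm_exists:
 assumes s: "u : abs_galois" shows "EX w. bij w & (ALL s:S. ALL k. co (w k) (map_matrix u s) = u (co k s))"
proof -
 let ?A = "map_matrix u g"
 obtain h0 :: "'n => 'f alg_closure" where h0: "inj h0" "ALL k. h0 k ~= 0" using inj_frame by blast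
 have el: "map_matrix u (el h) = ?A ** dg (%k. u (h k)) ** matrix_inv ?A" for h
  by (simp add: el_def map_matrix_mult[OF s] map_matrix_inv[OF s g] map_matrix_dg[OF s])
 have "EX h'. ?A ** dg h ** matrix_inv ?A = g ** dg h' ** gi" if h: "ALL k. h k ~= 0" for h
 proof -
  have "el (%k. ginv u (h k)) : S" using h autsD(12)[OF auts_inv[OF s]] by (intro el_S) simp
  then have "?A ** dg (%k. u (ginv u (h k))) ** matrix_inv ?A : S" unfolding el[symmetric] using stable[OF s] by blast
  then show ?thesis unfolding ginv_simps(1)[OF s] S_iff el_def by blast
 qed
 from conj_monomial[OF g map_matrix_inv(2)[OF s g] h0 this]
 obtain w where w: "bij w" "!!h. ALL k. h k ~= 0 ==> ?A ** dg (%k. h (w k)) ** matrix_inv ?A = el h"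
  unfolding el_def by blast
 have "co (w k) (map_matrix u s) = u (co k s)" if ss: "s : S" for s k
 proof -
  obtain h where h: "ALL k. h k ~= 0" "s = el h" using ss by (rule S_cases)
  have "map_matrix u s = el (%k. u (h (ginv w k)))"
   using w(2)[of "%k. u (h (ginv w k))"] h autsD(12)[OF s] bij_is_inj[OF w(1)] by (simp add: el)
  then show ?thesis using h(2) bij_is_inj[OF w(1)] by simp
 qed
 then show ?thesis using w(1) by blast
qed

text \<open>The action of Galois on the weights of \<open>S\<close> in the standard representation,
  transported to the index type.\<close>

definition perm :: "('f alg_closure => 'f alg_closure) => 'n => 'n" where
 "perm u = (SOME w. bij w & (ALL s:S. ALL k. co (w k) (map_matrix u s) = u (co k s)))"

lemma perm: "u : abs_galois ==> bij (perm u)"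
 "u : abs_galois ==> s : S ==> co (perm u k) (map_matrix u s) = u (co k s)"
 using someI_ex[OF perm_exists] unfolding perm_def[symmetric] by blast+

lemma co_distinct: assumes "!!s. s : S ==> co k s = co l s" shows "k = l"
proof -
 obtain h :: "'n => 'f alg_closure" where h: "inj h" "ALL k. h k ~= 0" using inj_frame by blast
 then show ?thesis using assms[OF el_S[OF h(2)]] by (simp add: inj_eq)
qed

lemma perm_unique:
 assumes s: "u : abs_galois" and l: "!!s. s : S ==> co l (map_matrix u s) = u (co k s)" shows "perm u k = l"
proof (rule co_distinct)
 fix t assume "t : S"
 then obtain s where "s : S" "t = map_matrix u s" using stable[OF s] by blast
 then show "co (perm u k) t = co l t" using l perm(2)[OF s] by simp
qed

lemma perm_comp: assumes s: "s : abs_galois" "w : abs_galois" shows "perm (s o w) k = perm s (perm w k)"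
proof (rule perm_unique[OF auts_comp[OF s]])
 fix t assume t: "t : S"
 then have "map_matrix w t : S" using stable[OF s(2)] by blast
 then show "co (perm s (perm w k)) (map_matrix (s o w) t) = (s o w) (co k t)"
  using perm(2)[OF s(1), of "map_matrix w t"] perm(2)[OF s(2) t] by (simp add: map_matrix_comp)
qed

lemma perm_id [simp]: "perm id k = k"
 by (rule perm_unique[OF id_auts]) (simp add: map_matrix_def vec_nth_inverse)

lemma perm_ginv [simp]:
 assumes s: "s : abs_galois" shows "perm (ginv s) (perm s k) = k" "perm s (perm (ginv s) k) = k"
proof -
 have "ginv s o s = id" "s o ginv s = id" using ginv_simps[OF s] by auto
 then show "perm (ginv s) (perm s k) = k" "perm s (perm (ginv s) k) = k"
  using perm_comp[OF auts_inv[OF s] s] perm_comp[OF s auts_inv[OF s]] by (metis perm_id)+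
qed

lemma map_S: "u : abs_galois ==> s : S ==> map_matrix u s : S" using stable by blast

lemma co_map: "u : abs_galois ==> s : S ==> co k (map_matrix u s) = u (co (perm (ginv u) k) s)"
 using perm(2)[of u s "perm (ginv u) k"] by simp

section \<open>The character group and ellipticity\<close>

definition monoc :: "('n => int) => 'f alg_closure ^'n ^'n => 'f alg_closure" where
 "monoc a = restrict (%s. PROD k:UNIV. co k s powi a k) S"

lemma monoc_S: "s : S ==> monoc a s = (PROD k:UNIV. co k s powi a k)" by (simp add: monoc_def)

lemma monoc_eqI: "(!!s. s : S ==> monoc a s = f s) ==> monoc a = restrict f S"
 unfolding monoc_def by (rule restrict_ext) simp

lemma monoc_char: "monoc a : characters S"
proof -
 \<comment> \<open>A power of the inverse determinant that clears all negative exponents.\<close>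
 define N where "N = (SUM k:UNIV. nat (- a k))"
 let ?f = "%s. (PROD k:UNIV. co k s ^ nat (a k + int N)) * inverse (det s) ^ N"
 have "?f : regular_functions"
  by (intro regular_functions.mult regular_functions_prod regular_functions_power co_regular regular_functions.inv_det)
 moreover have "monoc a s = ?f s" if s: "s : S" for s
 proof -
  have e: "co k s powi a k = co k s ^ nat (a k + int N) * inverse (co k s) ^ N" for k
  proof -
   have "nat (- a k) <= N" unfolding N_def by (rule member_le_sum) auto
   then have "0 <= a k + int N" by linarith
   then have "co k s ^ nat (a k + int N) = co k s powi (a k + int N)" unfolding power_int_def by (simp only: if_True)
   also have "... = co k s powi a k * co k s ^ N" using co_nz[OF s, of k] power_int_add[of "co k s" "a k" "int N"] by (simp only: power_int_of_nat simp_thms)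
   finally show ?thesis using co_nz[OF s, of k] by (simp add: power_inverse field_simps)
  qed
  have "det s = (PROD k:UNIV. co k s)" using det_el[of "%k. co k s"] el_co[OF s] by simp
  then show ?thesis unfolding monoc_S[OF s] e prod.distrib by (simp add: prod_inversef[symmetric] prod_power_distrib)
 qed
 moreover have "monoc a (s ** t) = monoc a s * monoc a t" if "s : S" "t : S" for s t
  using that by (simp add: monoc_S S_mult co_mult power_int_mult_distrib prod.distrib)
 moreover have "monoc a s ~= 0" if "s : S" for s using co_nz[OF that] by (simp add: monoc_S[OF that])
 ultimately show ?thesis unfolding characters_def by (auto simp: monoc_def)
qed

text \<open>Along the one-parameter subgroup of a single coordinate a regular function is a Laurent
  polynomial; a character has no zeros there, hence is a power of the parameter. The coordinates are
  then multiplied together.\<close>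

lemma char_monoc:
 assumes e: "\<eta> : characters S" shows "EX a. \<eta> = monoc a"
proof -
 have mult: "\<eta> (s ** t) = \<eta> s * \<eta> t" if "s : S" "t : S" for s t using e that by (auto simp: characters_def)
 have nz: "\<eta> s ~= 0" if "s : S" for s using e that by (auto simp: characters_def)
 obtain f where f: "f : regular_functions" "!!s. s : S ==> \<eta> s = f s" using e by (auto simp: characters_def)
 define ek where "ek = (%k x. el (%l. if l = k then x else 1))"
 have ekS: "ek k x : S" if "x ~= 0" for k x unfolding ek_def using that by (intro el_S) simp
 have one: "mat 1 : S" unfolding mat_el by (intro el_S) simp
 have e1: "\<eta> (mat 1) = 1" using mult[OF one one] nz[OF one] by simp
 have ek_nth: "ek k x $ i $ j = poly [:SUM l:UNIV - {k}. g $ i $ l * gi $ l $ j, g $ i $ k * gi $ k $ j:] x" for k x i j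
 proof -
  have "ek k x $ i $ j = (SUM l:UNIV. g $ i $ l * (if l = k then x else 1) * gi $ l $ j)"
   unfolding ek_def el_def matrix_matrix_mult_def[of "g ** _"] by (simp add: mult_dg)
  also have "... = g $ i $ k * x * gi $ k $ j + (SUM l:UNIV - {k}. g $ i $ l * (if l = k then x else 1) * gi $ l $ j)"
   by (subst sum.remove[of _ k]) auto
  also have "(SUM l:UNIV - {k}. g $ i $ l * (if l = k then x else 1) * gi $ l $ j) = (SUM l:UNIV - {k}. g $ i $ l * gi $ l $ j)"
   by (intro sum.cong) auto
  finally show ?thesis by (simp add: algebra_simps)
 qed
 have det_ek: "det (ek k x) = x" for k x unfolding ek_def det_el by simp
 have "EX q m. ALL x. x ~= 0 --> x ^ m * f (ek k x) = poly q x" for k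
  using f(1)
 proof induction
  case (const c) show ?case by (intro exI[of _ "[:c:]"] exI[of _ 0]) simp
 next
  case (entry i j) show ?case using ek_nth[of k _ i j] by (intro exI[of _ "[:SUM l:UNIV - {k}. g $ i $ l * gi $ l $ j, g $ i $ k * gi $ k $ j:]"] exI[of _ 0]) simp
 next
  case inv_det show ?case by (intro exI[of _ 1] exI[of _ 1]) (simp add: det_ek)
 next
  case (add f1 f2) note IH = add.IH
  obtain q1 m1 where q1: "ALL x. x ~= 0 --> x ^ m1 * f1 (ek k x) = poly q1 x" using IH(1) by (elim exE)
  obtain q2 m2 where q2: "ALL x. x ~= 0 --> x ^ m2 * f2 (ek k x) = poly q2 x" using IH(2) by (elim exE)
  have pow: "x ^ (m1 + m2) * (f1 (ek k x) + f2 (ek k x)) = x ^ m2 * poly q1 x + x ^ m1 * poly q2 x" if "x ~= 0" for x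
   unfolding q1[rule_format, OF that, symmetric] q2[rule_format, OF that, symmetric] by (simp add: power_add algebra_simps)
  then show ?case
   by (intro exI[of _ "monom 1 m2 * q1 + monom 1 m1 * q2"] exI[of _ "m1 + m2"])
    (use pow in \<open>simp add: poly_monom\<close>)
 next
  case (mult f1 f2) note IH = mult.IH
  obtain q1 m1 where q1: "ALL x. x ~= 0 --> x ^ m1 * f1 (ek k x) = poly q1 x" using IH(1) by (elim exE)
  obtain q2 m2 where q2: "ALL x. x ~= 0 --> x ^ m2 * f2 (ek k x) = poly q2 x" using IH(2) by (elim exE)
  have pow: "x ^ (m1 + m2) * (f1 (ek k x) * f2 (ek k x)) = poly q1 x * poly q2 x" if "x ~= 0" for x
   unfolding q1[rule_format, OF that, symmetric] q2[rule_format, OF that, symmetric] by (simp add: power_add algebra_simps)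
  then show ?case
   by (intro exI[of _ "q1 * q2"] exI[of _ "m1 + m2"])
    (use pow in simp)
 qed
 then have "EX a::int. ALL x. x ~= 0 --> \<eta> (ek k x) = x powi a" for k
 proof -
  obtain q m where q: "!!x. x ~= 0 ==> x ^ m * f (ek k x) = poly q x"
   using \<open>!!k. EX q m. ALL x. x ~= 0 --> x ^ m * f (ek k x) = poly q x\<close>[of k] by (elim exE) blast
  have "ek k 1 = mat 1" unfolding ek_def mat_el by simp
  then show ?thesis using q nz[OF ekS] e1 f(2)[OF ekS] by (intro multiplicative_poly_is_power[of _ m q]) auto
 qed
 then obtain a :: "'n => int" where a: "!!k x. x ~= 0 ==> \<eta> (ek k x) = x powi a k" by metis
 have "\<eta> (el h) = monoc a (el h)" if h: "ALL k. h k ~= 0" for h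
 proof -
  have "\<eta> (el (%k. if k : A then h k else 1)) = (PROD k:A. h k powi a k)" if "finite A" for A
   using that
  proof induction
   case empty then show ?case using e1 by (simp add: mat_el)
  next
   case (insert k A)
   have "el (%l. if l : insert k A then h l else 1) = ek k (h k) ** el (%l. if l : A then h l else 1)"
    unfolding ek_def el_mult using insert(2) by (auto intro!: arg_cong[of _ _ el])
   then have "\<eta> (el (%l. if l : insert k A then h l else 1)) = \<eta> (ek k (h k)) * \<eta> (el (%l. if l : A then h l else 1))"
    using mult[OF ekS el_S] h by simp
   then show ?case using insert a h by simp
  qed
  from this[of UNIV] show ?thesis using el_S[OF h] by (simp add: monoc_S)
 qed
 moreover have "\<eta> s = undefined" if "s ~: S" for s using e that by (auto simp: characters_def)
 ultimately have "\<eta> s = monoc a s" for s by (cases "s : S") (metis S_cases, simp add: monoc_def)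
 then have "\<eta> = monoc a" by (rule ext)
 then show ?thesis by blast
qed

lemma galois_monoc:
 assumes s: "s : abs_galois" shows "galois_act S s (monoc a) = monoc (%k. a (perm (ginv s) k))"
proof -
 have "monoc (%k. a (perm (ginv s) k)) t = s (monoc a (map_matrix (ginv s) t))" if t: "t : S" for t
 proof -
  have gs: "ginv s : abs_galois" by (rule auts_inv[OF s])
  have "s (monoc a (map_matrix (ginv s) t)) = (PROD k:UNIV. s (co k (map_matrix (ginv s) t)) powi a k)"
   unfolding monoc_S[OF map_S[OF gs t]] auts_prod[OF s]
   by (intro prod.cong refl) (simp add: power_int_def autsD(9,11)[OF s])
  also have "... = (PROD k:UNIV. co (perm s k) t powi a k)"
  proof (intro prod.cong refl)
   fix k
   have "co (perm s k) (map_matrix s (map_matrix (ginv s) t)) = s (co k (map_matrix (ginv s) t))"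
    by (rule perm(2)[OF s map_S[OF gs t]])
   moreover have "map_matrix s (map_matrix (ginv s) t) = t" by (simp add: vec_eq_iff ginv_simps(1)[OF s])
   ultimately show "s (co k (map_matrix (ginv s) t)) powi a k = co (perm s k) t powi a k" by simp
  qed
  also have "... = (PROD k:UNIV. co k t powi a (perm (ginv s) k))"
   using prod.reindex_bij_betw[OF perm(1)[OF s], of "%k. co k t powi a (perm (ginv s) k)"] s by simp
  finally show ?thesis by (simp add: monoc_S[OF t])
 qed
 then show ?thesis unfolding galois_act_def by (intro monoc_eqI[symmetric])
qed

text \<open>If the orbit \<open>Q\<close> of \<open>k\<close> misses \<open>l\<close>, the exponents
  \<open>CARD('n) - card Q\<close> on \<open>Q\<close> and \<open>- card Q\<close> elsewhere are
  Galois invariant and add up to 0. They define a rational character that is trivial on scalars but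
  not on the l-th coordinate.\<close>

lemma elliptic_transitive:
 assumes el: "elliptic S" shows "EX s:abs_galois. perm s k = l"
proof (rule ccontr)
 assume no: "~ ?thesis"
 define Q where "Q = (%s. perm s k) ` abs_galois"
 define a where "a = (%m. (if m : Q then int CARD('n) else 0) - int (card Q))"
 have Q: "k : Q" "l ~: Q" using no image_eqI[of k "%s. perm s k" id abs_galois] id_auts by (auto simp: Q_def)
 have Qs: "perm s m : Q" if s: "s : abs_galois" "m : Q" for s m
 proof -
  obtain t where t: "t : abs_galois" "m = perm t k" using s(2) by (auto simp: Q_def)
  show ?thesis unfolding t(2) perm_comp[OF s(1) t(1), symmetric] Q_def by (intro imageI auts_comp s(1) t(1))
 qed
 have inv: "a (perm (ginv s) m) = a m" if s: "s : abs_galois" for s m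
  using Qs[OF s, of "perm (ginv s) m"] Qs[OF auts_inv[OF s], of m] s by (auto simp: a_def)
 have "(SUM m:UNIV. a m) = 0"
  unfolding a_def by (simp add: sum_subtractf sum.If_cases Int_absorb2)
 moreover have "(PROD m:A. c powi a m) = c powi (SUM m:A. a m)" if "c ~= 0" "finite A" for c :: "'f alg_closure" and A
  using that(2) by induction (auto simp: power_int_add that(1))
 ultimately have "monoc a (mat c) = 1" if "c ~= 0" for c
  using that el_S[of "%_. c"] by (simp add: mat_el monoc_S)
 then have tr: "monoc a = trivial_char S"
  using el[unfolded elliptic_def] monoc_char galois_monoc inv by simp
 let ?h = "%m. if m = l then to_ac \<pi> else 1"
 have h: "el ?h : S" using pi(1) by (intro el_S) simp
 have "monoc a (el ?h) = to_ac \<pi> powi a l"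
  unfolding monoc_S[OF h] by (simp add: if_distrib[of "%x. x powi _"] cong: if_cong)
 then have "nrm (to_ac \<pi> powi a l) = 1" using tr h by (simp add: trivial_char_def)
 then have "(2::real) powi (- a l) = 2 powi 0" unfolding pi_powi(2) by simp
 then have "card Q = 0" unfolding powi_2_inject using Q(2) by (simp add: a_def)
 then show False using Q(1) by auto
qed

end

section \<open>Matrices over subfields, generated groups and transvections\<close>

lemma matrix_inv_mem:
 fixes A :: "'a::field alg_closure ^'b ^'b"
 assumes M: "intermediate_field M" and A: "invertible A" "!!i j. A $ i $ j : M" shows "matrix_inv A $ i $ j : M"
proof -
 have det: "det B : M" if "!!i j. B $ i $ j : M" for B :: "'a alg_closure ^'b ^'b"
 proof -
  have "of_int (sign q) = (1::'a alg_closure) | of_int (sign q) = (- 1::'a alg_closure)" for q :: "'b => 'b" by (simp add: sign_def)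
  then have "of_int (sign q) : M" for q :: "'b => 'b" using ifieldD(3,7)[OF M] by metis
  then show ?thesis unfolding det_def using that by (intro ifield_sum[OF M] ifieldD(5)[OF M] ifield_prod[OF M]) auto
 qed
 let ?e = "\<chi> l. if l = j then 1 else 0" and ?x = "\<chi> k. matrix_inv A $ k $ j"
 have "A *v ?x = ?e"
  using arg_cong[OF matrix_inv(1)[OF A(1)], of "%B. \<chi> i. B $ i $ j"]
  by (simp add: matrix_vector_mult_def matrix_matrix_mult_def mat_def cong: if_cong)
 then have "?x = (\<chi> k. det (\<chi> i j. if j = k then ?e $ i else A $ i $ j) / det A)"
  using cramer A(1) unfolding invertible_det_nz by blast
 then have "matrix_inv A $ i $ j = det (\<chi> i' j. if j = i then ?e $ i' else A $ i' $ j) / det A" by (simp add: vec_eq_iff)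
 moreover have "det (\<chi> i' j. if j = i then ?e $ i' else A $ i' $ j) : M" using A(2) ifieldD(2,3)[OF M] by (intro det) simp
 ultimately show ?thesis using det[of A] A(2) ifieldD(9)[OF M] by simp
qed

lemma matrix_mult_mem:
 assumes "intermediate_field M" "!!i j. A $ i $ j : M" "!!i j. B $ i $ j : M" shows "(A ** B) $ i $ j : M"
 unfolding matrix_matrix_mult_def using assms by (auto intro!: ifield_sum ifieldD(5)[OF assms(1)])

lemma generate_GL_induct:
 assumes x: "x : generate GL H" and H: "!!h. h : H ==> invertible h & P h & P (matrix_inv h)"
  and one: "P (mat 1)" and mult: "!!x y. P x ==> P y ==> P (x ** y)"
 shows "invertible (x :: 'a::field ^'n ^'n) & P x"
 using x
proof induction
 case one then show ?case using assms(3) by (simp add: GL_def invertible_det_nz)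
next
 case (incl h) then show ?case using H by blast
next
 case (inv h)
 have h: "invertible h" using H[OF inv] by blast
 then have i: "invertible (matrix_inv h)" using matrix_inv(2) by (intro matrix_inv_eq(2)[of _ h])
 have "inv\<^bsub>GL\<^esub> h = matrix_inv h" unfolding m_inv_def
 proof (rule the_equality)
  show "matrix_inv h : carrier GL & h \<otimes>\<^bsub>GL\<^esub> matrix_inv h = \<one>\<^bsub>GL\<^esub> & matrix_inv h \<otimes>\<^bsub>GL\<^esub> h = \<one>\<^bsub>GL\<^esub>"
   using i matrix_inv[OF h] by (simp add: GL_def)
  show "y = matrix_inv h" if "y : carrier GL & h \<otimes>\<^bsub>GL\<^esub> y = \<one>\<^bsub>GL\<^esub> & y \<otimes>\<^bsub>GL\<^esub> h = \<one>\<^bsub>GL\<^esub>" for y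
   using that matrix_inv_eq(1)[of h y] by (simp add: GL_def)
 qed
 then show ?case using i H[OF inv] by simp
next
 case (eng x y) then show ?case using mult by (simp add: GL_def invertible_mult)
qed

lemma generate_GL: "mat 1 : generate GL H" "A : generate GL H ==> B : generate GL H ==> A ** B : generate GL H"
 using generate.one[of GL H] generate.eng[of A GL H B] by (auto simp: GL_def)

text \<open>For \<open>k ~= l\<close>, the elementary transvection with entry \<open>c\<close> at
  \<open>(k, l)\<close>; in the frame these matrices fill a root group.\<close>

definition tv :: "'n => 'n => 'a::comm_ring_1 => 'a ^'n ^'n::finite" where
 "tv k l c = (\<chi> i j. (if i = j then 1 else 0) + (if i = k & j = l then c else 0))"

lemma tv_mult: "(tv k l c ** B) $ i $ j = B $ i $ j + (if i = k then c * B $ l $ j else 0)"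
proof -
 have "tv k l c $ i $ m * B $ m $ j = (if i = m then B $ m $ j else 0) + (if m = l then (if i = k then c * B $ l $ j else 0) else 0)" for m
  by (auto simp: tv_def distrib_right)
 then show ?thesis by (simp add: matrix_matrix_mult_def sum.distrib)
qed

lemma tv_inverse: "k ~= l ==> tv k l c ** tv k l (- c) = mat 1"
 by (simp add: vec_eq_iff tv_mult) (simp add: tv_def mat_def)

lemma det_tv: assumes "k ~= l" shows "det (tv k l c) = 1"
proof -
 have "tv k l c = (\<chi> m. if m = k then row k (mat 1) + c *s row l (mat 1) else row m (mat 1))"
  by (simp add: vec_eq_iff tv_def row_def mat_def)
 then show ?thesis using det_row_operation[OF assms, of "mat 1" c] by simp
qed

context torus
begin

definition cj :: "'f alg_closure ^'n ^'n => 'f alg_closure ^'n ^'n" where "cj M = g ** M ** gi"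

definition uc :: "'f alg_closure ^'n ^'n => 'f alg_closure ^'n ^'n" where "uc A = gi ** A ** g"

lemma cj_uc [simp]: "cj (uc A) = A" "uc (cj M) = M"
 unfolding cj_def uc_def by (simp_all add: matrix_mul_assoc gg)

lemma cj_mult: "cj M ** cj N = cj (M ** N)" and uc_mult: "uc A ** uc B = uc (A ** B)"
 unfolding cj_def uc_def by (simp_all add: matrix_mul_assoc gg)

lemma cj_one [simp]: "cj (mat 1) = mat 1" "uc (mat 1) = mat 1" unfolding cj_def uc_def by (simp_all add: gg)

lemma el_cj: "el h = cj (dg h)" by (simp add: el_def cj_def)

lemma uc_el [simp]: "uc (el h) = dg h" by (simp add: el_cj)

lemma sep_gi: "separable_element (gi $ i $ j)"
 using matrix_inv_mem[OF ifield_separable g] sep_g by simp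

lemma splits_iff: assumes E: "intermediate_field E"
 shows "splits_over S E \<longleftrightarrow> (ALL u:field_auts E. ALL k. perm u k = k)"
proof
 assume sp: "splits_over S E"
 show "ALL u:field_auts E. ALL k. perm u k = k"
 proof (intro ballI allI)
  fix u k assume s: "u : field_auts E"
  have sa: "u : abs_galois" using auts_abs[OF E s] .
  have co: "monoc (%m. if m = k then 1 else 0) s = co k s" if "s : S" for s k
   using that by (simp add: monoc_S if_distrib[of "%x. _ powi x"] cong: if_cong)
  have "perm (ginv u) m = k \<longleftrightarrow> m = perm u k" for m using perm_ginv[OF sa] by metis
  then have "galois_act S u (monoc (%m. if m = k then 1 else 0)) = monoc (%m. if m = perm u k then 1 else 0)"
   unfolding galois_monoc[OF sa] by simp
  moreover have "galois_act S u (monoc (%m. if m = k then 1 else 0)) = monoc (%m. if m = k then 1 else 0)"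
   using sp s monoc_char by (auto simp: splits_over_def)
  ultimately have eq: "monoc (%m. if m = perm u k then 1 else 0) = monoc (%m. if m = k then 1 else 0)" by simp
  show "perm u k = k" by (rule co_distinct) (metis co eq)
 qed
next
 assume a: "ALL u:field_auts E. ALL k. perm u k = k"
 show "splits_over S E" unfolding splits_over_def
 proof (intro ballI)
  fix \<eta> u assume e: "\<eta> : characters S" and s: "u : field_auts E"
  obtain a where a': "\<eta> = monoc a" using char_monoc[OF e] by (rule exE)
  have "perm (ginv u) k = k" for k using a auts_inv[OF s] by blast
  then show "galois_act S u \<eta> = \<eta>" unfolding a' galois_monoc[OF auts_abs[OF E s]] by simp
 qed
qed

lemma map_el:
 assumes s: "s : abs_galois" and h: "ALL k. h k ~= 0" shows "map_matrix s (el h) = el (%k. s (h (perm (ginv s) k)))"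
 using el_co[OF map_S[OF s el_S[OF h]]] by (simp add: co_map[OF s el_S[OF h]])

lemma sep_el: "(!!k. separable_element (h k)) ==> separable_element (el h $ i $ j)"
 unfolding el_def using sep_g sep_gi sep_closed(2)
 by (intro matrix_mult_mem[OF ifield_separable, unfolded mem_Collect_eq]) (auto simp: dg_def)

text \<open>Galois descent for points of the torus: equivariance of the coordinates makes all matrix
  entries invariant, and separability of the frame then puts them into \<open>E\<close>.\<close>

lemma el_rational:
 assumes h: "!!k. h k ~= 0" "!!k. separable_element (h k)" and E: "intermediate_field E"
  and eq: "!!s k. s : field_auts E ==> s (h k) = h (perm s k)"
 shows "el h : rational_points E S"
proof -
 have "s (el h $ i $ j) = el h $ i $ j" if s: "s : field_auts E" for s i j
 proof -
  have sa: "s : abs_galois" using auts_abs[OF E s] .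
  have "map_matrix s (el h) = el h" using map_el[OF sa] h(1) eq[OF s] perm_ginv(2)[OF sa] by simp
  then show ?thesis by (metis nth_map_matrix)
 qed
 then have "el h $ i $ j : E" for i j using separable_fixed[OF E sep_el[of h]] h(2) by blast
 then show ?thesis using el_S h(1) by (simp add: rational_points_def)
qed

lemma co_rational:
 assumes s: "s : rational_points E S"
 shows "s : S" "(!!x. x : E ==> separable_element x) ==> separable_element (co k s)"
  "u : abs_galois ==> u : field_auts E ==> u (co k s) = co (perm u k) s"
proof -
 show sS: "s : S" using s by (simp add: rational_points_def)
 show "separable_element (co k s)" if "!!x. x : E ==> separable_element x"
  unfolding co_def using s sep_g sep_gi that
  by (auto simp: rational_points_def intro!: matrix_mult_mem[OF ifield_separable, unfolded mem_Collect_eq])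
 show "u (co k s) = co (perm u k) s" if "u : abs_galois" "u : field_auts E"
 proof -
  have "map_matrix u s = s" using s autsD(4)[OF that(2)] by (simp add: rational_points_def vec_eq_iff)
  then show ?thesis using perm(2)[OF that(1) sS, of k] by simp
 qed
qed

section \<open>Roots, root groups and coroots\<close>

definition rt :: "'n => 'n => 'f alg_closure ^'n ^'n => 'f alg_closure" where
 "rt k l = restrict (%s. co k s * inverse (co l s)) S"

lemma rt_S: "s : S ==> rt k l s = co k s * inverse (co l s)" by (simp add: rt_def)

lemma rt_monoc: "monoc (%m. (if m = k then 1 else 0) - (if m = l then 1 else 0)) = rt k l"
 unfolding rt_def
proof (rule monoc_eqI)
 fix s assume s: "s : S"
 have "co m s powi ((if m = k then 1 else 0) - (if m = l then 1 else 0)) = (if m = k then co m s else 1) * (if m = l then inverse (co m s) else 1)" for m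
  using co_nz[OF s, of m] by (auto simp: power_int_minus)
 then show "monoc (%m. (if m = k then 1 else 0) - (if m = l then 1 else 0)) s = co k s * inverse (co l s)"
  unfolding monoc_S[OF s] by (simp add: prod.distrib)
qed

lemma rt_char: "rt k l : characters S" unfolding rt_monoc[symmetric] by (rule monoc_char)

lemma rt_inverse: "restrict (%s. inverse (rt k l s)) S = rt l k" unfolding rt_def by (rule restrict_ext) simp

lemma galois_rt: assumes s: "u : abs_galois" shows "galois_act S u (rt k l) = rt (perm u k) (perm u l)"
proof -
 have "perm (ginv u) m = k \<longleftrightarrow> m = perm u k" for m k using perm_ginv[OF s] by metis
 then show ?thesis unfolding rt_monoc[symmetric] galois_monoc[OF s] by simp
qed

lemma pi_ne: "to_ac \<pi> ~= 0" "to_ac \<pi> ~= 1" "to_ac \<pi> * to_ac \<pi> ~= 1"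
proof -
 have n: "nrm (to_ac \<pi>) = 1 / 2" by (rule nrm_pi)
 show "to_ac \<pi> ~= 0" "to_ac \<pi> ~= 1" using n by auto
 have "nrm (to_ac \<pi> * to_ac \<pi>) ~= nrm 1" unfolding nrm_mult n by simp
 then show "to_ac \<pi> * to_ac \<pi> ~= 1" by metis
qed

text \<open>Testing on the k-th and l-th one-parameter subgroups at an element \<open>c\<close>
  separates the exponents, provided that neither \<open>c\<close> nor its square is 1.\<close>

lemma exponents_eq:
 assumes "k ~= l" "!!h. ALL k. h k ~= 0 ==> h i * h l = h k * (h j :: 'f alg_closure)" shows "i = k & j = l"
proof -
 obtain c :: "'f alg_closure" where c: "c ~= 0" "c ~= 1" "c * c ~= 1" using pi_ne by blast
 have "(if i = k then c else 1) = c * (if j = k then c else 1)"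
  using assms(2)[of "%m. if m = k then c else 1"] assms(1) c(1) by simp
 moreover have "(if i = l then c else 1) * c = (if j = l then c else 1)"
  using assms(2)[of "%m. if m = l then c else 1"] assms(1) c(1) by simp
 ultimately show ?thesis using c by (auto split: if_splits)
qed

lemma root_space_iff:
 assumes a: "!!h. ALL k. h k ~= 0 ==> \<alpha> (el h) = a h"
 shows "Y : root_space S \<alpha> \<longleftrightarrow> (ALL h. (ALL k. h k ~= 0) --> (ALL i j. h i * uc Y $ i $ j = a h * uc Y $ i $ j * h j))"
proof -
 have key: "el h ** Y ** matrix_inv (el h) = mat (a h) ** Y \<longleftrightarrow> (ALL i j. h i * uc Y $ i $ j = a h * uc Y $ i $ j * h j)"
  if h: "ALL k. h k ~= 0" for h
 proof -
  have 1: "uc (el h ** Y ** matrix_inv (el h)) = dg h ** uc Y ** dg (%k. inverse (h k))"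
   by (simp add: uc_mult[symmetric] el_inverse[OF h])
  have 2: "uc (mat (a h) ** Y) = dg (%_. a h) ** uc Y" by (simp add: uc_mult[symmetric] mat_el)
  have "el h ** Y ** matrix_inv (el h) = mat (a h) ** Y \<longleftrightarrow> dg h ** uc Y ** dg (%k. inverse (h k)) = dg (%_. a h) ** uc Y"
   unfolding 1[symmetric] 2[symmetric] by (metis cj_uc(1))
  then show ?thesis using h by (simp only: vec_eq_iff mult_dg dg_mult) (simp add: field_simps)
 qed
 show ?thesis
 proof
  assume Y: "Y : root_space S \<alpha>"
  have "h i * uc Y $ i $ j = a h * uc Y $ i $ j * h j" if h: "ALL k. h k ~= 0" for h i j
  proof -
   have "el h ** Y ** matrix_inv (el h) = mat (a h) ** Y" using Y el_S[OF h] a[OF h] by (auto simp: root_space_def)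
   then show ?thesis using key[OF h] by blast
  qed
  then show "ALL h. (ALL k. h k ~= 0) --> (ALL i j. h i * uc Y $ i $ j = a h * uc Y $ i $ j * h j)" by blast
 next
  assume R: "ALL h. (ALL k. h k ~= 0) --> (ALL i j. h i * uc Y $ i $ j = a h * uc Y $ i $ j * h j)"
  have "s ** Y ** matrix_inv s = mat (\<alpha> s) ** Y" if s: "s : S" for s
  proof -
   obtain h where h: "ALL k. h k ~= 0" "s = el h" using s by (rule S_cases)
   show ?thesis using key[OF h(1)] R h(1) unfolding h(2) a[OF h(1)] by blast
  qed
  then show "Y : root_space S \<alpha>" by (simp add: root_space_def)
 qed
qed

definition E1 :: "'n => 'n => 'f alg_closure => 'f alg_closure ^'n ^'n" where
 "E1 k l c = cj (\<chi> i j. if i = k & j = l then c else 0)"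

lemma root_space_rt: assumes "k ~= l" shows "root_space S (rt k l) = range (E1 k l)"
proof -
 have iff: "Y : root_space S (rt k l) \<longleftrightarrow> (ALL h. (ALL k. h k ~= 0) --> (ALL i j. h i * uc Y $ i $ j = h k * inverse (h l) * uc Y $ i $ j * h j))" for Y
  by (rule root_space_iff) (simp add: rt_S el_S)
 show ?thesis
 proof (intro antisym subsetI)
  fix Y assume Y: "Y : root_space S (rt k l)"
  have "i = k & j = l" if nz: "uc Y $ i $ j ~= 0" for i j
  proof (rule exponents_eq[OF assms])
   fix h :: "'n => 'f alg_closure" assume h: "ALL k. h k ~= 0"
   then have "h i * uc Y $ i $ j = h k * inverse (h l) * uc Y $ i $ j * h j" using Y unfolding iff by blast
   then show "h i * h l = h k * h j" using nz h by (simp add: field_simps)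
  qed
  then have "uc Y = (\<chi> i j. if i = k & j = l then uc Y $ k $ l else 0)" by (auto simp: vec_eq_iff)
  then have "Y = E1 k l (uc Y $ k $ l)" unfolding E1_def by (metis cj_uc(1))
  then show "Y : range (E1 k l)" by blast
 qed (auto simp: iff E1_def)
qed

lemma root_group_rt: assumes "k ~= l" shows "root_group S (rt k l) = range (%c. cj (tv k l c))"
proof -
 have "mat 1 + E1 k l c = cj (tv k l c)" for c
 proof -
  have "tv k l c = mat 1 + (\<chi> i j. if i = k & j = l then c else 0)" by (simp add: vec_eq_iff tv_def mat_def)
  moreover have "cj (A + B) = cj A + cj B" for A B
   by (simp add: cj_def matrix_matrix_mult_def vec_eq_iff sum.distrib distrib_left distrib_right)
  ultimately show ?thesis by (simp add: E1_def)
 qed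
 then show ?thesis unfolding root_group_def root_space_rt[OF assms] by (simp only: setcompr_eq_image Collect_mem_eq image_image)
qed

lemma roots_eq: "roots S = {rt k l |k l. k ~= l}"
proof (intro antisym subsetI)
 fix \<alpha> assume "\<alpha> : roots S"
 then have a: "\<alpha> : characters S" "\<alpha> ~= trivial_char S" "root_space S \<alpha> ~= {0}" by (auto simp: roots_def)
 have iff: "Y : root_space S \<alpha> \<longleftrightarrow> (ALL h. (ALL k. h k ~= 0) --> (ALL i j. h i * uc Y $ i $ j = \<alpha> (el h) * uc Y $ i $ j * h j))" for Y
  by (rule root_space_iff) simp
 have "uc 0 = 0" by (simp add: uc_def vec_eq_iff matrix_matrix_mult_def)
 then have "0 : root_space S \<alpha>" unfolding iff by simp
 then obtain Y where Y: "Y : root_space S \<alpha>" "Y ~= 0" using a(3) by blast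
 have "cj 0 = 0" by (simp add: cj_def vec_eq_iff matrix_matrix_mult_def)
 then have "uc Y ~= 0" using Y(2) by (metis cj_uc(1))
 then obtain i j where ij: "uc Y $ i $ j ~= 0" by (auto simp: vec_eq_iff)
 have "\<alpha> s = rt i j s" if "s : S" for s
 proof -
  obtain h where h: "ALL k. h k ~= 0" "s = el h" using \<open>s : S\<close> by (rule S_cases)
  have "h i * uc Y $ i $ j = \<alpha> s * uc Y $ i $ j * h j" using Y(1) h unfolding iff by blast
  then show ?thesis using ij h el_S[OF h(1)] by (simp add: rt_S field_simps)
 qed
 then have eq: "\<alpha> = rt i j" using a(1) by (intro ext) (auto simp: characters_def rt_def)
 moreover have "rt i i = trivial_char S" unfolding rt_def trivial_char_def by (rule restrict_ext) (simp add: co_nz)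
 ultimately show "\<alpha> : {rt k l |k l. k ~= l}" using a(2) by blast
next
 fix \<alpha> assume "\<alpha> : {rt k l |k l. k ~= l}"
 then obtain k l where kl: "\<alpha> = rt k l" "k ~= l" by blast
 let ?h = "%m. if m = k then to_ac \<pi> else 1"
 have h: "ALL m. ?h m ~= 0" using pi_ne(1) by simp
 have "rt k l (el ?h) ~= 1" using el_S[OF h] kl(2) pi_ne(2) by (simp add: rt_S)
 then have "\<alpha> ~= trivial_char S" using el_S[OF h] unfolding kl(1) trivial_char_def by auto
 moreover have "uc (E1 k l 1) $ k $ l ~= 0" by (simp add: E1_def)
 then have "E1 k l 1 ~= 0" unfolding uc_def by (auto simp: matrix_matrix_mult_def)
 ultimately show "\<alpha> : roots S" using kl rt_char root_space_rt[OF kl(2)] by (auto simp: roots_def)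
qed

lemma inv_tv: "k ~= l ==> matrix_inv (cj (tv k l c)) = cj (tv k l (- c))" "k ~= l ==> invertible (cj (tv k l c))"
 using matrix_inv_eq[of "cj (tv k l c)" "cj (tv k l (- c))"] by (simp_all add: cj_mult tv_inverse)

text \<open>The coordinates of the coroot of \<open>rt k l\<close> at \<open>x\<close>.\<close>

definition cw :: "'n => 'n => 'f alg_closure => 'n => 'f alg_closure" where
 "cw k l x m = (if m = k then x else if m = l then inverse x else 1)"

text \<open>Inside the subgroup generated by the two root groups, torus elements have determinant \<open>1\<close> and are trivial
  away from \<open>k\<close> and \<open>l\<close>; so \<open>c\<^sub>k\<close> squares to \<open>x\<^sup>2\<close>, and multiplicativity on \<open>x = y\<^sup>2\<close> removes the sign.\<close>

lemma coroot_rt: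
 assumes kl: "k ~= l" and x: "x ~= 0" shows "coroot S (rt k l) x = el (cw k l x)"
proof -
 let ?U = "root_group S (rt k l) Un root_group S (rt l k)"
 let ?\<mu> = "restrict (%x. el (cw k l x)) (UNIV - {0})"
 let ?P = "%\<mu>. \<mu> : cocharacters S & (ALL x. x ~= 0 --> rt k l (\<mu> x) = x ^ 2 & \<mu> x : generate GL ?U)"
 have cw: "ALL m. cw k l x m ~= 0" if "x ~= 0" for x using that by (simp add: cw_def)
 have lk: "l ~= k" using kl by simp
 have gen: "el (cw k l x) : generate GL ?U" if "x ~= 0" for x
 proof -
  have "cj (tv k l c) : generate GL ?U" "cj (tv l k c) : generate GL ?U" for c
   using root_group_rt[OF kl] root_group_rt[OF lk] by (auto intro!: generate.incl)
  then have "cj (tv k l (x - 1) ** (tv l k 1 ** (tv k l (inverse x - 1) ** tv l k (- x)))) : generate GL ?U"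
   unfolding cj_mult[symmetric] by (intro generate_GL(2))
  \<comment> \<open>The factorization of the diagonal matrix with entries \<open>x\<close> and
    \<open>inverse x\<close> into four transvections in the special linear group of rank
    one.\<close>
  moreover have "tv k l (x - 1) ** (tv l k 1 ** (tv k l (inverse x - 1) ** tv l k (- x))) = dg (cw k l x)"
   using kl that by (simp add: vec_eq_iff tv_mult) (auto simp: tv_def dg_def cw_def field_simps)
  ultimately show ?thesis by (simp add: el_cj)
 qed
 have inv: "invertible A & (det A = 1 & (ALL i j. i ~= k & i ~= l --> uc A $ i $ j = (if i = j then 1 else 0)))"
  if "A : generate GL ?U" for A
 proof (rule generate_GL_induct[OF that])
  have det_cj: "det (cj M) = det M" for M using det_el[of "%_. 1"] det_mul[of g gi] by (simp add: cj_def det_mul gg)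
  have *: "det (cj (tv k l c)) = 1 & (ALL i j. i ~= k & i ~= l --> uc (cj (tv k l c)) $ i $ j = (if i = j then 1 else 0))"
   "det (cj (tv l k c)) = 1 & (ALL i j. i ~= k & i ~= l --> uc (cj (tv l k c)) $ i $ j = (if i = j then 1 else 0))" for c
   unfolding det_cj det_tv[OF kl] det_tv[OF lk] by (simp_all add: tv_def)
  fix h assume "h : ?U"
  then obtain c where "h = cj (tv k l c) | h = cj (tv l k c)" unfolding root_group_rt[OF kl] root_group_rt[OF lk] by blast
  then show "invertible h & (det h = 1 & (ALL i j. i ~= k & i ~= l --> uc h $ i $ j = (if i = j then 1 else 0))) &
   det (matrix_inv h) = 1 & (ALL i j. i ~= k & i ~= l --> uc (matrix_inv h) $ i $ j = (if i = j then 1 else 0))"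
   using * inv_tv[OF kl] inv_tv[OF lk] by auto
 next
  fix A B assume A: "det A = 1 & (ALL i j. i ~= k & i ~= l --> uc A $ i $ j = (if i = j then 1 else 0))"
   and B: "det B = 1 & (ALL i j. i ~= k & i ~= l --> uc B $ i $ j = (if i = j then 1 else 0))"
  have "uc (A ** B) $ i $ j = (if i = j then 1 else 0)" if "i ~= k & i ~= l" for i j
  proof -
   have "uc A $ i $ m * uc B $ m $ j = (if i = m then uc B $ m $ j else 0)" for m using A that by simp
   then have "uc (A ** B) $ i $ j = uc B $ i $ j" by (simp add: uc_mult[symmetric] matrix_matrix_mult_def[of "uc A"])
   then show ?thesis using B that by simp
  qed
  then show "det (A ** B) = 1 & (ALL i j. i ~= k & i ~= l --> uc (A ** B) $ i $ j = (if i = j then 1 else 0))"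
   using A B by (simp add: det_mul)
 qed (simp only: cj_one det_I, simp add: mat_def)
 have "(THE \<mu>. ?P \<mu>) = ?\<mu>"
 proof (rule the_equality)
  have poly: "EX q m. ALL x. x ~= 0 --> x ^ m * ?\<mu> x $ i $ j = poly q x" for i j
  proof -
   define q where "q = (%m. if m = k then [:0, 0, 1:] else if m = l then 1 else [:0, 1 :: 'f alg_closure:])"
   have q: "x * cw k l x m = poly (q m) x" if "x ~= 0" for x m using that by (auto simp: cw_def q_def)
   have "x ^ 1 * ?\<mu> x $ i $ j = poly (SUM m:UNIV. smult (g $ i $ m * gi $ m $ j) (q m)) x" if "x ~= 0" for x
   proof -
    have "?\<mu> x $ i $ j = (SUM m:UNIV. g $ i $ m * cw k l x m * gi $ m $ j)"
     using that unfolding el_def matrix_matrix_mult_def[of "g ** _"] by (simp add: mult_dg)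
    then show ?thesis using q[OF that] by (simp add: poly_sum sum_distrib_left flip: q[OF that]) (simp add: mult_ac)
   qed
   then show ?thesis by blast
  qed
  have m: "?\<mu> (x * y) = ?\<mu> x ** ?\<mu> y" if "x ~= 0" "y ~= 0" for x y
   using that by (simp add: el_mult) (auto intro!: arg_cong[of _ _ el] simp: cw_def fun_eq_iff)
  have "rt k l (?\<mu> x) = x ^ 2" if "x ~= 0" for x
   using rt_S[OF el_S[OF cw[OF that]]] kl that by (simp add: power2_eq_square) (simp add: cw_def)
  then show "?P ?\<mu>" unfolding cocharacters_def using poly m el_S[OF cw] gen by auto
 next
  fix \<mu> assume P: "?P \<mu>"
  have mult: "\<mu> (x * y) = \<mu> x ** \<mu> y" if "x ~= 0" "y ~= 0" for x y using P that by (auto simp: cocharacters_def)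
  have S: "\<mu> x : S" if "x ~= 0" for x using P that by (auto simp: cocharacters_def)
  have props: "m ~= k ==> m ~= l ==> co m (\<mu> x) = 1" "co k (\<mu> x) * co l (\<mu> x) = 1" "co k (\<mu> x) ^ 2 = x ^ 2" if x: "x ~= 0" for x m
  proof -
   obtain h where h: "ALL k. h k ~= 0" "\<mu> x = el h" using S[OF x] by (rule S_cases)
   have i: "det (\<mu> x) = 1" "!!i. i ~= k ==> i ~= l ==> uc (\<mu> x) $ i $ i = 1" using inv P x by auto
   have 1: "h m = 1" if "m ~= k" "m ~= l" for m using i(2)[OF that] unfolding h(2) by (simp add: dg_def)
   then show "m ~= k ==> m ~= l ==> co m (\<mu> x) = 1" by (simp add: h(2))
   have "(PROD m:UNIV. h m) = (PROD m:{k, l}. h m)" using 1 by (intro prod.mono_neutral_right) auto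
   then have 2: "h k * h l = 1" using i(1) kl unfolding h(2) det_el by simp
   then show "co k (\<mu> x) * co l (\<mu> x) = 1" by (simp add: h(2))
   have "rt k l (\<mu> x) = x ^ 2" using P x by blast
   then have "h k * inverse (h l) = x ^ 2" using rt_S[OF S[OF x]] h(2) by simp
   moreover have "inverse (h l) = h k" using 2 by (metis inverse_unique mult.commute)
   ultimately show "co k (\<mu> x) ^ 2 = x ^ 2" by (simp add: h(2) power2_eq_square)
  qed
  have k: "co k (\<mu> x) = x" if x: "x ~= 0" for x
  proof -
   obtain y where y: "y ^ 2 = x" using nth_root_exists[of 2 x] by auto
   then have y0: "y ~= 0" using x by auto
   have "co k (\<mu> x) = co k (\<mu> y) ^ 2" unfolding y[symmetric] power2_eq_square mult[OF y0 y0] co_mult[OF S[OF y0] S[OF y0]] ..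
   then show ?thesis using props(3)[OF y0] y by simp
  qed
  have "\<mu> x = el (cw k l x)" if x: "x ~= 0" for x
  proof (rule S_eqI[OF S[OF x] el_S[OF cw[OF x]]])
   have "co l (\<mu> x) = inverse x" using props(2)[OF x] k[OF x] by (metis inverse_unique)
   then show "co m (\<mu> x) = co m (el (cw k l x))" for m using k[OF x] props(1)[OF x, of m] by (auto simp: cw_def)
  qed
  moreover have "\<mu> 0 = undefined" using P by (auto simp: cocharacters_def PiE_def extensional_def)
  ultimately show "\<mu> = ?\<mu>" by (intro ext) auto
 qed
 then show ?thesis unfolding coroot_def rt_inverse using x by simp
qed

lemma torus_norm_co:
 assumes H: "finite H" "!!t. t : H ==> map_matrix t s : S"
 shows "torus_norm S H s : S" "co k (torus_norm S H s) = (PROD t:H. co k (map_matrix t s))"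
proof -
 let ?G = "GL\<lparr>carrier := S\<rparr>"
 have "comm_monoid ?G"
 proof (rule comm_monoidI)
  show "\<one>\<^bsub>?G\<^esub> : carrier ?G" using el_S[of "%_. 1"] by (simp add: GL_def mat_el)
  show "x \<otimes>\<^bsub>?G\<^esub> y = y \<otimes>\<^bsub>?G\<^esub> x" if "x : carrier ?G" "y : carrier ?G" for x y
   using that by (auto intro!: S_eqI S_mult simp: GL_def co_mult)
 qed (auto simp: GL_def S_mult matrix_mul_assoc)
 then interpret G: comm_monoid ?G .
 have "finprod ?G (%t. map_matrix t s) A : S & co k (finprod ?G (%t. map_matrix t s) A) = (PROD t:A. co k (map_matrix t s))"
  if "finite A" "A <= H" for A
  using that
 proof induction
  case empty
  have "finprod ?G (%t. map_matrix t s) {} = el (%_. 1)" unfolding G.finprod_empty by (simp add: GL_def mat_el)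
  then show ?case using el_S[of "%_. 1"] by simp
 next
  case (insert t A)
  have "finprod ?G (%t. map_matrix t s) (insert t A) = map_matrix t s ** finprod ?G (%t. map_matrix t s) A"
   using insert H(2) by (subst G.finprod_insert) (auto simp: GL_def)
  then show ?case using insert H(2) by (auto simp: S_mult co_mult)
 qed
 from this[OF H(1) subset_refl] show "torus_norm S H s : S" "co k (torus_norm S H s) = (PROD t:H. co k (map_matrix t s))"
  unfolding torus_norm_def by auto
qed

end

section \<open>Permutation matrices and the subgroup generated by a set of roots\<close>

definition pm :: "('n => 'n) => 'a::comm_ring_1 ^'n ^'n::finite" where
 "pm w = (\<chi> i j. if i = w j then 1 else 0)"

lemma pm_pm: "pm w ** pm w' = pm (w o w')"
 by (simp add: vec_eq_iff matrix_matrix_mult_def pm_def if_distrib[of "%x. _ * x"] cong: if_cong)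

lemma pm_id: "pm id = mat 1" "pm (%x. x) = mat 1"
 by (simp_all add: vec_eq_iff pm_def mat_def)

text \<open>Three transvections give the usual Weyl element of rank one; the diagonal factor, which
  lies in the torus, corrects its sign.\<close>

lemma pm_transpose:
 assumes "k ~= l"
 shows "pm (Transposition.transpose k l) = tv k l 1 ** (tv l k (- 1) ** (tv k l 1 ** dg (%m. if m = k then - 1 else 1)))"
 using assms by (simp add: vec_eq_iff tv_mult) (auto simp: pm_def dg_def Transposition.transpose_def)

context torus
begin

text \<open>By \<open>R0plus_eq\<close> the set \<open>R0plus\<close> has this form for an
  equivalence relation on the coordinates, and the group \<open>G0\<close> then consists of matrices
  with one block for each class.\<close>

definition rel_roots :: "('n => 'n => bool) => ('f alg_closure ^'n ^'n => 'f alg_closure) set" where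
 "rel_roots eqr = {rt k l |k l. k ~= l & eqr k l}"

abbreviation "G0 eqr \<equiv> subgroup_of_roots S (rel_roots eqr)"

text \<open>Restricts the Weyl elements of the group: their permutations cannot leave a class. The
  reverse information is \<open>perm_in_G0\<close>.\<close>

lemma G0_block:
 assumes e: "equivp eqr" and A: "A : G0 eqr" shows "invertible A & (ALL i j. uc A $ i $ j ~= 0 --> eqr i j)"
proof (rule generate_GL_induct[OF A[unfolded subgroup_of_roots_def]])
 let ?P = "%A. ALL i j. uc A $ i $ j ~= 0 --> eqr i j"
 have S: "?P s" if "s : S" for s using that equivp_reflp[OF e] by (auto elim!: S_cases simp: dg_def split: if_splits)
 have tv: "?P (cj (tv k l c))" if "eqr k l" for k l c using that equivp_reflp[OF e] by (simp add: tv_def)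
 fix h assume "h : S Un \<Union> (root_group S ` rel_roots eqr)"
 then consider "h : S" | k l c where "k ~= l" "eqr k l" "h = cj (tv k l c)"
  using root_group_rt by (fastforce simp: rel_roots_def)
 then show "invertible h & ?P h & ?P (matrix_inv h)"
 proof cases
  case 1 then show ?thesis using S_inv S by blast
 next
  case 2 then show ?thesis using tv inv_tv by (simp del: cj_uc)
 qed
next
 show "ALL i j. uc (mat 1) $ i $ j ~= 0 --> eqr i j" unfolding cj_one using equivp_reflp[OF e] by (auto simp: mat_def split: if_splits)
 fix A B assume AB: "ALL i j. uc A $ i $ j ~= 0 --> eqr i j" "ALL i j. uc B $ i $ j ~= 0 --> eqr i j"
 show "ALL i j. uc (A ** B) $ i $ j ~= 0 --> eqr i j"
 proof (intro allI impI)
  fix i j assume "uc (A ** B) $ i $ j ~= 0"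
  then have "(SUM m:UNIV. uc A $ i $ m * uc B $ m $ j) ~= 0" unfolding uc_mult[symmetric] matrix_matrix_mult_def[of "uc A"] by simp
  then obtain m where "uc A $ i $ m * uc B $ m $ j ~= 0" by (meson sum.not_neutral_contains_not_neutral)
  then have "eqr i m" "eqr m j" using AB by auto
  then show "eqr i j" using equivp_transp[OF e] by blast
 qed
qed

text \<open>Composing \<open>w\<close> with the transposition of \<open>k\<close> and
  \<open>w k\<close> makes \<open>k\<close> a fixed point, moves no new point and respects the
  classes, so the number of moved points drops.\<close>

lemma perm_in_G0:
 assumes e: "equivp eqr" and w: "bij w" "!!k. eqr k (w k)" shows "cj (pm w) : G0 eqr"
 using w
proof (induction "card {k. w k ~= k}" arbitrary: w rule: less_induct)
 case less
 show ?case
 proof (cases "EX k. w k ~= k")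
  case False
  then have "w = id" by auto
  then show ?thesis using generate_GL(1) by (simp add: pm_id subgroup_of_roots_def)
 next
  case True
  then obtain k where k: "w k ~= k" by blast
  define l where "l = w k"
  let ?t = "Transposition.transpose k l"
  have kl: "k ~= l" "eqr k l" using k less.prems(2)[of k] by (auto simp: l_def)
  define w' where "w' = ?t o w"
  have "{m. w' m ~= m} <= {m. w m ~= m} - {k}"
   using less.prems(1) by (auto simp: w'_def l_def Transposition.transpose_def bij_def inj_eq)
  then have "card {m. w' m ~= m} < card {m. w m ~= m}" using k by (intro psubset_card_mono) auto
  moreover have "bij w'" unfolding w'_def by (intro bij_comp less.prems(1)) simp
  moreover have lk: "eqr l k" using kl(2) equivp_symp[OF e] by blast
  have "eqr m (?t m)" for m using kl(2) lk equivp_reflp[OF e] by (simp add: Transposition.transpose_def)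
  then have "eqr m (w' m)" for m using equivp_transp[OF e less.prems(2)[of m]] by (simp add: w'_def)
  ultimately have 1: "cj (pm w') : G0 eqr" using less.hyps by blast
  have gen: "x : G0 eqr" if "x : S Un \<Union> (root_group S ` rel_roots eqr)" for x
   using that unfolding subgroup_of_roots_def by (intro generate.incl)
  have "rt k l : rel_roots eqr" "rt l k : rel_roots eqr" using kl lk unfolding rel_roots_def by blast+
  then have 2: "cj (tv k l c) : G0 eqr" "cj (tv l k c) : G0 eqr" for c
   using kl root_group_rt[of k l] root_group_rt[of l k] by (blast intro!: gen)+
  have 3: "cj (dg (%m. if m = k then - 1 else 1)) : G0 eqr" unfolding el_cj[symmetric] by (intro gen UnI1 el_S) simp
  have "cj (pm ?t) : G0 eqr"
   unfolding pm_transpose[OF kl(1)] cj_mult[symmetric] using 2 3 unfolding subgroup_of_roots_def by (intro generate_GL(2))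
  then have "cj (pm ?t) ** cj (pm w') : G0 eqr" using 1 unfolding subgroup_of_roots_def by (rule generate_GL(2))
  moreover have "?t o w' = w" by (auto simp: w'_def)
  ultimately show ?thesis by (simp add: cj_mult pm_pm)
 qed
qed

lemma normalizer_perm:
 assumes e: "equivp eqr" and n: "n : normalizer_in S (G0 eqr)"
 shows "EX w. bij w & (ALL k. eqr (w k) k) & (ALL s:S. n ** s ** matrix_inv n : S & (ALL k. co (w k) (n ** s ** matrix_inv n) = co k s)) &
  ((ALL k. w k = k) --> n : S)"
proof -
 have nG: "n : G0 eqr" and nS: "n ** s ** matrix_inv n : S" if "s : S" for s using n that by (auto simp: normalizer_in_def)
 have n': "n : G0 eqr" using n by (simp add: normalizer_in_def)
 note ni = conjunct1[OF G0_block[OF e n']] and nb = conjunct2[OF G0_block[OF e n']]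
 let ?A = "n ** g"
 have iA: "invertible ?A" using ni g by (rule invertible_mult)
 have "?A ** (gi ** matrix_inv n) = mat 1" by (simp add: matrix_mul_assoc gg matrix_inv(1)[OF ni])
 then have inv: "matrix_inv ?A = gi ** matrix_inv n" by (rule matrix_inv_eq(1))
 have conj: "?A ** dg h ** matrix_inv ?A = n ** el h ** matrix_inv n" for h
  unfolding inv el_def by (simp add: matrix_mul_assoc)
 obtain h0 :: "'n => 'f alg_closure" where h0: "inj h0" "ALL k. h0 k ~= 0" using inj_frame by blast
 have "EX h'. ?A ** dg h ** matrix_inv ?A = g ** dg h' ** gi" if "ALL k. h k ~= 0" for h
  unfolding conj using nS[OF el_S[OF that]] unfolding S_iff el_def[symmetric] by blast
 from conj_monomial[OF g iA h0 this]
 obtain w where w: "bij w" "!!i j. (gi ** ?A) $ i $ j ~= 0 \<longleftrightarrow> i = w j"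
  "!!h. ALL k. h k ~= 0 ==> n ** el (%k. h (w k)) ** matrix_inv n = el h" unfolding conj el_def[symmetric] by blast
 have uc: "uc n $ i $ j ~= 0 \<longleftrightarrow> i = w j" for i j using w(2) by (simp add: uc_def matrix_mul_assoc)
 have "co (w k) (n ** s ** matrix_inv n) = co k s" if s: "s : S" for s k
 proof -
  obtain h where h: "ALL k. h k ~= 0" "s = el h" using s by (rule S_cases)
  have "n ** s ** matrix_inv n = el (%k. h (ginv w k))"
   using w(3)[of "%k. h (ginv w k)"] h bij_is_inj[OF w(1)] by simp
  then show ?thesis using h(2) bij_is_inj[OF w(1)] by simp
 qed
 moreover have "n : S" if "ALL k. w k = k"
 proof -
  have "uc n $ i $ j = 0" if "i ~= j" for i j using uc[of i j] that \<open>ALL k. w k = k\<close> by auto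
  then have "uc n = dg (%k. uc n $ k $ k)" by (simp add: vec_eq_iff dg_def)
  then have eq: "n = el (%k. uc n $ k $ k)" by (metis cj_uc(1) el_cj)
  have "ALL k. uc n $ k $ k ~= 0" using uc that by simp
  then show ?thesis by (subst eq) (rule el_S)
 qed
 ultimately show ?thesis using w(1) nb uc nS by (intro exI[of _ w]) blast
qed

lemma pm_conj:
 assumes w: "bij w" shows "matrix_inv (cj (pm w)) = cj (pm (ginv w))"
  "cj (pm w) ** el h ** matrix_inv (cj (pm w)) = el (%k. h (ginv w k))"
proof -
 have b: "bij w" "w o ginv w = id" "ginv w (w k) = k" "w (ginv w k) = k" for k
  using w by (auto simp: bij_def surj_iff surj_f_inv_f)
 have "cj (pm w) ** cj (pm (ginv w)) = mat 1" by (simp add: cj_mult pm_pm b pm_id)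
 then show inv: "matrix_inv (cj (pm w)) = cj (pm (ginv w))" by (rule matrix_inv_eq(1))
 have "pm w ** dg h = dg (%k. h (ginv w k)) ** pm w" by (auto simp: vec_eq_iff mult_dg dg_mult pm_def b)
 then have "pm w ** dg h ** pm (ginv w) = dg (%k. h (ginv w k))"
  by (simp add: matrix_mul_assoc[symmetric] pm_pm b pm_id)
 then show "cj (pm w) ** el h ** matrix_inv (cj (pm w)) = el (%k. h (ginv w k))" unfolding inv el_cj cj_mult by simp
qed

lemma pm_normalizer:
 assumes e: "equivp eqr" and w: "bij w" "!!k. eqr k (w k)" shows "cj (pm w) : normalizer_in S (G0 eqr)"
proof -
 have "s : (%s. cj (pm w) ** s ** matrix_inv (cj (pm w))) ` S" if s: "s : S" for s
 proof -
  obtain h where h: "ALL k. h k ~= 0" "s = el h" using s by (rule S_cases)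
  have "s = cj (pm w) ** el (%k. h (w k)) ** matrix_inv (cj (pm w))"
   unfolding pm_conj(2)[OF w(1)] h(2) using w(1) by (simp add: bij_def surj_f_inv_f)
  then show ?thesis using el_S[of "%k. h (w k)"] h(1) by blast
 qed
 moreover have "cj (pm w) ** s ** matrix_inv (cj (pm w)) : S" if s: "s : S" for s
  using s by (rule S_cases) (auto simp: pm_conj(2)[OF w(1)] intro!: el_S)
 ultimately show ?thesis using perm_in_G0[OF e w] by (auto simp: normalizer_in_def)
qed

text \<open>Scale the columns of \<open>g\<close> so that they become the components of a rational vector.\<close>

lemma normalized_frame:
 assumes el: "elliptic S"
 shows "EX g'. torus v S g' & (ALL u:abs_galois. ALL k. EX l. ALL i. u (g' $ i $ k) = g' $ i $ l)"
proof -
 \<comment> \<open>These products are the entries of the projection onto the k-th eigenline. Galois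
   permutes the projections exactly, whereas it permutes the columns of \<open>g\<close> only up to
   scalars.\<close>
 have E: "u (g $ i $ k * gi $ k $ j) = g $ i $ perm u k * gi $ perm u k $ j" if s: "u : abs_galois" for u i j k
 proof -
  have nth: "el h $ i $ j = (SUM m:UNIV. g $ i $ m * h m * gi $ m $ j)" for h
   unfolding el_def matrix_matrix_mult_def[of "g ** _"] by (simp add: mult_dg)
  let ?h = "%k m. if m = k then to_ac \<pi> else 1"
  have d: "el (?h k) $ i $ j - el (%_. 1) $ i $ j = (to_ac \<pi> - 1) * (g $ i $ k * gi $ k $ j)" for k
  proof -
   have "el (?h k) $ i $ j - el (%_. 1) $ i $ j = (SUM m:UNIV. if m = k then (to_ac \<pi> - 1) * (g $ i $ k * gi $ k $ j) else 0)"
    unfolding nth sum_subtractf[symmetric] by (intro sum.cong) (auto simp: algebra_simps)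
   then show ?thesis by simp
  qed
  have pk: "perm (ginv u) m = k \<longleftrightarrow> m = perm u k" for m using perm_ginv[OF s] by metis
  have "map_matrix u (el (?h k)) = el (?h (perm u k))" "map_matrix u (el (%_. 1)) = el (%_. 1)"
   using pi(1) by (subst map_el[OF s]; simp add: pk if_distrib[of u] autsD(6)[OF s] s cong: if_cong)+
  then have "u (el (?h k) $ i $ j - el (%_. 1) $ i $ j) = el (?h (perm u k)) $ i $ j - el (%_. 1) $ i $ j"
   unfolding autsD(8)[OF s] nth_map_matrix[of u, symmetric] by (simp only:)
  then have "(to_ac \<pi> - 1) * u (g $ i $ k * gi $ k $ j) = (to_ac \<pi> - 1) * (g $ i $ perm u k * gi $ perm u k $ j)"
   unfolding d by (simp only: autsD(3,6,8)[OF s] auts_to_ac[OF s])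
  then show ?thesis using pi_ne(2) by (simp only: mult_left_cancel right_minus_eq simp_thms)
 qed
 have col: "EX i. g $ i $ k ~= 0" and row: "EX j. gi $ k $ j ~= 0" for k
  using arg_cong[OF gg(2), of "%A. A $ k $ k"] unfolding matrix_matrix_mult_def mat_def
  by (simp, metis (no_types, lifting) mult_not_zero sum.neutral zero_neq_one)+
 define k1 :: 'n where "k1 = undefined"
 obtain j where j: "gi $ k1 $ j ~= 0" using row by blast
 have nz: "gi $ k $ j ~= 0" for k
 proof -
  obtain u where s: "u : abs_galois" "perm u k1 = k" using elliptic_transitive[OF el] by blast
  obtain i where "g $ i $ k1 ~= 0" using col by blast
  then have "u (g $ i $ k1 * gi $ k1 $ j) ~= 0" using j by (simp add: autsD(12)[OF s(1)])
  then show ?thesis unfolding E[OF s(1)] s(2) by simp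
 qed
 \<comment> \<open>With this scaling the new k-th column is the j-th column of the k-th projection;
   no scalar vanishes, because Galois is transitive on the coordinates.\<close>
 define c where "c = (%k. gi $ k $ j)"
 define c' where "c' = (%k. inverse (c k))"
 have cc: "c k * c' k = 1" for k using nz by (simp add: c'_def c_def)
 let ?g = "g ** dg c"
 have "?g ** (dg c' ** gi) = g ** (dg c ** dg c') ** gi" by (simp add: matrix_mul_assoc)
 then have "?g ** (dg c' ** gi) = mat 1" by (simp add: dg_dg cc dg_const gg)
 then have inv: "matrix_inv ?g = dg c' ** gi" "invertible ?g" by (rule matrix_inv_eq)+
 have same: "?g ** d ** matrix_inv ?g = g ** d ** gi" if d: "ALL i j. i ~= j --> d $ i $ j = 0" for d
 proof -
  have "dg c ** d ** dg c' = d"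
  proof (simp only: vec_eq_iff mult_dg dg_mult, intro allI)
   show "c i * d $ i $ j * c' j = d $ i $ j" for i j using d cc[of j] by (cases "i = j") (auto simp: mult_ac)
  qed
  then have "g ** d ** gi = g ** (dg c ** d ** dg c') ** gi" by simp
  then show ?thesis unfolding inv(1) by (simp add: matrix_mul_assoc)
 qed
 have "torus v S ?g"
 proof
  show "invertible ?g" by (rule inv(2))
  show "separable_element (?g $ i $ k)" for i k unfolding mult_dg c_def by (intro sep_closed(5) sep_g sep_gi)
  show "S = {?g ** d ** matrix_inv ?g |d. invertible d & (ALL i j. i ~= j --> d $ i $ j = 0)}"
   unfolding S_eq using same by (intro Collect_cong ex_cong1) auto
  show "map_matrix u ` S = S" if "u : abs_galois" for u using stable[OF that] .
 qed
 moreover have "EX l. ALL i. u (?g $ i $ k) = ?g $ i $ l" if "u : abs_galois" for u k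
  using E[OF that] by (intro exI[of _ "perm u k"]) (simp add: mult_dg c_def)
 ultimately show ?thesis by blast
qed

end

text \<open>The condition \<open>normal\<close> says that Galois permutes the columns themselves,
  not just the lines which they span.\<close>

locale torus_frame = torus v S g
 for v :: "'f::field => int" and S :: "('f alg_closure ^'n ^'n) set" and g :: "'f alg_closure ^'n ^'n" +
 assumes transitive: "EX s:abs_galois. perm s k = l"
  and normal: "s : abs_galois ==> EX l. ALL i. s (g $ i $ k) = g $ i $ l"
begin

lemma col_nz: "EX i. g $ i $ k ~= 0"
proof (rule ccontr)
 assume "\<nexists>i. g $ i $ k ~= 0"
 then have "(gi ** g) $ k $ k = 0" by (simp add: matrix_matrix_mult_def)
 then show False by (simp add: gg mat_def)
qed

lemma galois_g: assumes s: "u : abs_galois" shows "u (g $ i $ k) = g $ i $ perm u k"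
proof -
 obtain l where l: "!!i. u (g $ i $ k) = g $ i $ l" using normal[OF s] by blast
 obtain i0 where i0: "g $ i0 $ l ~= 0" using col_nz by blast
 have "perm u k = l"
 proof (rule perm_unique[OF s])
  fix t assume t: "t : S"
  have e: "(SUM m:UNIV. t $ i0 $ m * g $ m $ k) = g $ i0 $ k * co k t" if "t : S" for t k
  proof -
   have "t ** g = g ** dg (%k. co k t)" using el_co[OF that] unfolding el_def by (metis gg(4))
   then have "(t ** g) $ i0 $ k = g $ i0 $ k * co k t" by (simp only: mult_dg)
   then show ?thesis by (simp add: matrix_matrix_mult_def)
  qed
  have "g $ i0 $ l * co l (map_matrix u t) = u (SUM m:UNIV. t $ i0 $ m * g $ m $ k)"
   unfolding e[OF map_S[OF s t], symmetric] by (simp add: auts_sum[OF s] autsD(3)[OF s] l)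
  also have "... = g $ i0 $ l * u (co k t)" unfolding e[OF t] by (simp add: autsD(3)[OF s] l)
  finally show "co l (map_matrix u t) = u (co k t)" using i0 by simp
 qed
 then show ?thesis using l by simp
qed

lemma galois_gi: assumes s: "u : abs_galois" shows "u (gi $ k $ j) = gi $ perm u k $ j"
proof -
 have "map_matrix u g = g ** pm (perm u)"
  by (simp add: vec_eq_iff galois_g[OF s] matrix_matrix_mult_def pm_def if_distrib[of "%x. _ * x"] cong: if_cong)
 moreover have "g ** pm (perm u) ** (pm (perm (ginv u)) ** gi) = g ** (pm (perm u) ** pm (perm (ginv u))) ** gi"
  by (simp add: matrix_mul_assoc)
 then have "g ** pm (perm u) ** (pm (perm (ginv u)) ** gi) = mat 1"
  using s by (simp add: pm_pm o_def pm_id gg)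
 ultimately have "map_matrix u gi = pm (perm (ginv u)) ** gi"
  unfolding map_matrix_inv(1)[OF s g] by (simp add: matrix_inv_eq(1))
 then have "u (gi $ k $ j) = (pm (perm (ginv u)) ** gi) $ k $ j" by (metis nth_map_matrix)
 also have "... = (SUM m:UNIV. (if m = perm u k then gi $ m $ j else 0))"
 proof -
  have "k = perm (ginv u) m \<longleftrightarrow> m = perm u k" for m using perm_ginv[OF s] by metis
  then show ?thesis by (simp add: matrix_matrix_mult_def pm_def if_distrib[of "%x. x * _"] cong: if_cong)
 qed
 finally show ?thesis by simp
qed

text \<open>Each entry is a sum over all coordinates whose terms are permuted by Galois once
  \<open>w\<close> commutes with Galois. So an equivariant permutation has a representative with
  entries in F.\<close>

lemma pm_rational:
 assumes w: "!!s k. s : abs_galois ==> w (perm s k) = perm s (w k)" shows "cj (pm w) $ i $ j : base_field"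
proof (rule separable_fixed[OF ifield_base])
 have e: "cj (pm w) $ i $ j = (SUM k:UNIV. g $ i $ w k * gi $ k $ j)"
  by (simp add: cj_def matrix_matrix_mult_def pm_def if_distrib[of "%x. _ * x"] cong: if_cong)
 show "separable_element (cj (pm w) $ i $ j)" unfolding e using sep_g sep_gi by (intro sep_closed(11) sep_closed(5))
 show "s (cj (pm w) $ i $ j) = cj (pm w) $ i $ j" if s: "s : abs_galois" for s
 proof -
  have "s (cj (pm w) $ i $ j) = (SUM k:UNIV. g $ i $ w (perm s k) * gi $ perm s k $ j)"
   unfolding e auts_sum[OF s] autsD(3)[OF s] galois_g[OF s] galois_gi[OF s] w[OF s] ..
  also have "... = (SUM k:UNIV. g $ i $ w k * gi $ k $ j)"
   by (rule sum.reindex_bij_betw[OF perm(1)[OF s]])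
  finally show ?thesis using e by simp
 qed
qed

text \<open>A row of the frame that distinguishes \<open>k\<close> from \<open>l\<close> is itself
  the coordinate vector of a rational point: Galois permutes its entries exactly, and transitivity
  makes all of them nonzero.\<close>

lemma co_distinct_rational:
 assumes "!!s. s : rational_points base_field S ==> co k s = co l s" shows "k = l"
proof (rule ccontr)
 assume kl: "k ~= l"
 have "EX i. g $ i $ k ~= g $ i $ l"
 proof (rule ccontr)
  assume "\<nexists>i. g $ i $ k ~= g $ i $ l"
  then have "(gi ** g) $ k $ k = (gi ** g) $ k $ l" by (simp add: matrix_matrix_mult_def)
  then show False using kl by (simp add: gg mat_def)
 qed
 then obtain i where i: "g $ i $ k ~= g $ i $ l" by blast
 then obtain m where m: "g $ i $ m ~= 0" by metis
 have "g $ i $ m' ~= 0" for m'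
 proof -
  obtain u where s: "u : abs_galois" "perm u m = m'" using transitive by blast
  then show ?thesis using m galois_g[OF s(1), of i m] autsD(12)[OF s(1)] by metis
 qed
 then have "el (%m. g $ i $ m) : rational_points base_field S"
  using sep_g galois_g by (intro el_rational ifield_base)
 then show False using assms i by fastforce
qed

end

context torus_frame
begin

lemma co_add: "co k (A + B) = co k A + co k B"
 by (simp add: co_def matrix_matrix_mult_def sum.distrib distrib_left distrib_right)

text \<open>An arbitrary coordinate composed with \<open>\<iota>\<close> is an embedding of
  \<open>K\<close> over F, hence the restriction of an automorphism \<open>s\<close>. Moving the
  coordinate by the inverse of \<open>s\<close> turns the embedding into the identity.\<close>

lemma identified_coordinate:
 assumes K: "intermediate_field K" and id: "identifies \<iota> K S"
 shows "EX k0. ALL x:K. co k0 (\<iota> x) = x"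
proof -
 have i: "\<iota> (x + y) = \<iota> x + \<iota> y" "\<iota> (x * y) = \<iota> x ** \<iota> y" if "x : K" "y : K" for x y
  using id that by (auto simp: identifies_def)
 have mat: "\<iota> (to_ac c) = mat (to_ac c)" for c using id by (auto simp: identifies_def)
 have rat: "\<iota> x : rational_points base_field S" if "x : K - {0}" for x using id that unfolding identifies_def by blast
 have c: "co k (\<iota> (to_ac c)) = to_ac c" for k c unfolding mat mat_el by simp
 have 0: "co k (\<iota> 0) = 0" for k using c[of k 0] by simp
 fix k :: 'n
 have hom: "hom_graph {(x, co k (\<iota> x)) |x. x : K}" unfolding hom_graph_def
 proof (intro conjI allI impI)
  show "(to_ac d, to_ac d) : {(x, co k (\<iota> x)) |x. x : K}" for d using c ifieldD(1)[OF K] by auto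
  show "b = 0" if "(0, b) : {(x, co k (\<iota> x)) |x. x : K}" for b using that 0 by auto
  fix a b x y assume "(a, b) : {(x, co k (\<iota> x)) |x. x : K}" "(x, y) : {(x, co k (\<iota> x)) |x. x : K}"
  then have m: "a : K" "b = co k (\<iota> a)" "x : K" "y = co k (\<iota> x)" by auto
  have "co k (\<iota> (a - x)) + co k (\<iota> x) = co k (\<iota> a)"
   unfolding co_add[symmetric] i(1)[OF ifieldD(4)[OF K m(1,3)] m(3), symmetric] by simp
  then have "b - y = co k (\<iota> (a - x))" unfolding m(2,4) by (simp add: diff_eq_eq)
  then show "(a - x, b - y) : {(x, co k (\<iota> x)) |x. x : K}" using ifieldD(4)[OF K m(1,3)] by blast
  have "co k (\<iota> (a * x)) = b * y"
  proof (cases "a = 0 | x = 0")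
   case False
   then show ?thesis using m i(2) co_mult[OF co_rational(1)[OF rat] co_rational(1)[OF rat]] by simp
  qed (use m 0 in auto)
  then show "(a * x, b * y) : {(x, co k (\<iota> x)) |x. x : K}" using ifieldD(5)[OF K m(1,3)] by force
 qed
 have "EX s:abs_galois. ALL x:K. co k (\<iota> x) = s x"
 proof (rule hom_graph_extends[OF hom])
  fix s assume s: "s : abs_galois" "!!x y. (x, y) : {(x, co k (\<iota> x)) |x. x : K} ==> s x = y"
  have "co k (\<iota> x) = s x" if "x : K" for x using s(2)[of x "co k (\<iota> x)"] that by simp
  then show ?thesis using s(1) by blast
 qed
 then obtain s where s: "s : abs_galois" "ALL x:K. co k (\<iota> x) = s x" by (rule bexE)
 have gs: "ginv s : abs_galois" using auts_inv[OF s(1)] .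
 have "co (perm (ginv s) k) (\<iota> x) = x" if x: "x : K" for x
 proof (cases "x = 0")
  case False
  have "co k (\<iota> x) = s x" using s(2) x by blast
  then show ?thesis using co_rational(3)[OF rat gs gs, of x k] False x ginv_simps(2)[OF s(1)] by simp
 qed (use 0 in simp)
 then show ?thesis by blast
qed

text \<open>If the orbit of \<open>k\<close> under \<open>\<sigma>\<close> stays in one class, the sum of the roots \<open>c\<^sub>m / c\<^bsub>\<sigma>m\<^esub>\<close> for \<open>m\<close> in the
  orbit vanishes, although \<open>\<sigma>\<close> permutes them; conversely a functional that separates the inertia orbits works.\<close>

lemma positive_iff:
 assumes e: "equivp eqr" and inv: "!!s k l. s : inertia v ==> eqr k l ==> eqr (perm s k) (perm s l)"
 shows "inertia_preserves_positive_system v S (rel_roots eqr) \<longleftrightarrow> (ALL s:inertia v. ALL k. eqr k (perm s k) --> perm s k = k)"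
proof
 assume "inertia_preserves_positive_system v S (rel_roots eqr)"
 then obtain P where P0: "positive_system S (rel_roots eqr) P" "ALL s:inertia v. galois_act S s ` P = P"
  unfolding inertia_preserves_positive_system_def by blast
 obtain l where l0: "(ALL \<eta>:characters S. ALL \<psi>:characters S. l (char_mult S \<eta> \<psi>) = l \<eta> + (l \<psi> :: real)) &
  (ALL \<alpha>:rel_roots eqr. l \<alpha> ~= 0) & P = {\<alpha> : rel_roots eqr. l \<alpha> > 0}" using P0(1) unfolding positive_system_def by (rule exE)
 note l = conjunct1[OF l0, rule_format] conjunct1[OF conjunct2[OF l0], rule_format]
  and P = conjunct2[OF conjunct2[OF l0]] P0(2)[rule_format]
 have add: "l (rt a c) = l (rt a b) + l (rt b c)" for a b c
 proof -
  have "char_mult S (rt a b) (rt b c) = rt a c"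
   unfolding char_mult_def rt_def by (rule restrict_ext) (simp add: co_nz)
  then show ?thesis using l(1)[OF rt_char rt_char] by metis
 qed
 have r0: "l (rt a a) = 0" for a using add[of a a a] by simp
 have pos: False if s: "s : inertia v" and k: "eqr a b" "b = perm s a | a = perm s b" "l (rt a b) > 0" for s a b
 proof -
  let ?p = "perm s"
  have sa: "s : abs_galois" using s aut_groupD(1)[OF aut_group_inertia] by blast
  have "a ~= b" using k(3) r0[of a] by auto
  then have P0: "rt a b : P" using k unfolding P(1) rel_roots_def by blast
  have Pi: "rt ((?p ^^ i) a) ((?p ^^ i) b) : P" for i
  proof (induction i)
   case (Suc i)
   then show ?case using P(2)[OF s] galois_rt[OF sa, of "(?p ^^ i) a" "(?p ^^ i) b"] by force
  qed (use P0 in simp)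
  have step: "l (rt ((?p ^^ i) a) ((?p ^^ i) b)) > 0" for i using Pi unfolding P(1) by blast
  have fin: "EX n>0. (?p ^^ n) c = c" for c
  proof -
   have "~ inj (%i. (?p ^^ i) c)" using finite_imageD[of "%i. (?p ^^ i) c" UNIV] by auto
   then obtain i i' where "i < i'" "(?p ^^ i) c = (?p ^^ i') c" unfolding inj_on_def by (metis linorder_neqE_nat)
   moreover from this have "(?p ^^ i) ((?p ^^ (i' - i)) c) = (?p ^^ i) c"
    using funpow_add[of i "i' - i" ?p] by (simp add: o_def fun_eq_iff)
   ultimately show ?thesis using injD[OF inj_fn[OF bij_is_inj[OF perm(1)[OF sa]]], of i] by (intro exI[of _ "i' - i"]) auto
  qed
  show False using k(2)
  proof
   assume b: "b = ?p a"
   have pa: "(?p ^^ i) b = (?p ^^ Suc i) a" for i by (simp add: b funpow_swap1)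
   have "0 < l (rt a ((?p ^^ Suc i) a))" for i
   proof (induction i)
    case (Suc i) then show ?case using add[of a "(?p ^^ Suc (Suc i)) a" "(?p ^^ Suc i) a"] step[of "Suc i"] unfolding pa by simp
   qed (use step[of 0] b in simp)
   moreover obtain n where "0 < n" "(?p ^^ n) a = a" using fin by blast
   ultimately show False using r0[of a] by (metis Suc_pred less_irrefl)
  next
   assume a: "a = ?p b"
   have pa: "(?p ^^ i) a = (?p ^^ Suc i) b" for i by (simp add: a funpow_swap1)
   have "0 < l (rt ((?p ^^ Suc i) b) b)" for i
   proof (induction i)
    case (Suc i) then show ?case using add[of "(?p ^^ Suc (Suc i)) b" b "(?p ^^ Suc i) b"] step[of "Suc i"] unfolding pa by simp
   qed (use step[of 0] a in simp)
   moreover obtain n where "0 < n" "(?p ^^ n) b = b" using fin by blast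
   ultimately show False using r0[of b] by (metis Suc_pred less_irrefl)
  qed
 qed
 show "ALL s:inertia v. ALL k. eqr k (perm s k) --> perm s k = k"
 proof (intro ballI allI impI, rule ccontr)
  fix s k assume s: "s : inertia v" "eqr k (perm s k)" "perm s k ~= k"
  then have "rt k (perm s k) : rel_roots eqr" unfolding rel_roots_def by (intro CollectI exI[of _ k] exI[of _ "perm s k"]) simp
  then have "l (rt k (perm s k)) ~= 0" by (rule l(2))
  moreover have "l (rt k (perm s k)) + l (rt (perm s k) k) = 0" using add[of k k "perm s k"] r0 by simp
  ultimately have "l (rt k (perm s k)) > 0 | l (rt (perm s k) k) > 0" by linarith
  then show False using pos[OF s(1,2)] pos[OF s(1) equivp_symp[OF e s(2)]] by blast
 qed
next
 assume triv: "ALL s:inertia v. ALL k. eqr k (perm s k) --> perm s k = k"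
 have ia: "s : abs_galois" if "s : inertia v" for s using that aut_groupD(1)[OF aut_group_inertia] by blast
 \<comment> \<open>An arbitrary numbering of the subsets gives different inertia orbits different
   integers, and it is constant along each orbit.\<close>
 obtain f :: "'n set => nat" where f: "inj f" using finite_imp_inj_to_nat_seg[of "UNIV :: 'n set set"] by auto
 define orb where "orb = (%k. (%s. perm s k) ` inertia v)"
 have orb_refl: "k : orb k" for k unfolding orb_def using aut_groupD(2)[OF aut_group_inertia] perm_id[of k] by (metis image_eqI)
 have sub: "orb (perm s k) <= orb k" if s: "s : inertia v" for s k
 proof
  fix m assume "m : orb (perm s k)"
  then obtain w where t: "w : inertia v" "m = perm w (perm s k)" by (auto simp: orb_def)
  show "m : orb k" unfolding t(2) perm_comp[OF ia[OF t(1)] ia[OF s], symmetric] orb_def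
   by (intro imageI aut_groupD(4)[OF aut_group_inertia t(1) s])
 qed
 have orb: "orb (perm s k) = orb k" if s: "s : inertia v" for s k
  using sub[OF s, of k] sub[OF aut_groupD(3)[OF aut_group_inertia s], of "perm s k"] perm_ginv(1)[OF ia[OF s]] by simp
 define a where "a = (%k. int (f (orb k)))"
 \<comment> \<open>The functional is the valuation of a character at a single torus point, which
   makes additivity automatic; on the root \<open>rt k m\<close> it is the difference of the two
   orbit numbers.\<close>
 define t where "t = el (%k. to_ac \<pi> powi a k)"
 define l where "l = (%\<eta> :: 'f alg_closure ^'n ^'n => 'f alg_closure. - log 2 (nrm (\<eta> t)))"
 have tS: "t : S" unfolding t_def using pi_powi(1) by (intro el_S) blast
 have lrt: "l (rt k m) = a k - a m" for k m
  unfolding l_def rt_S[OF tS] by (simp add: t_def nrm_mult nrm_inverse pi_powi(2) powi_2 log_mult log_inverse)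
 have as: "a (perm s k) = a k" if "s : inertia v" for s k using orb[OF that] by (simp add: a_def)
 have l0: "l \<alpha> ~= 0" if "\<alpha> : rel_roots eqr" for \<alpha>
 proof -
  obtain k m where km: "\<alpha> = rt k m" "k ~= m" "eqr k m" using \<open>\<alpha> : rel_roots eqr\<close> by (auto simp: rel_roots_def)
  have "a k ~= a m"
  proof
   assume "a k = a m"
   then have "orb k = orb m" using f by (simp add: a_def inj_eq)
   then have "m : orb k" using orb_refl by simp
   then obtain s where s: "s : inertia v" "m = perm s k" by (auto simp: orb_def)
   then have "perm s k = k" using triv km(3) by blast
   then show False using s(2) km(2) by simp
  qed
  then show ?thesis using lrt km(1) by simp
 qed
 let ?P = "{\<alpha> : rel_roots eqr. l \<alpha> > 0}"
 have stab: "galois_act S s \<alpha> : ?P" if sa: "s : inertia v" "\<alpha> : ?P" for s \<alpha>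
 proof -
  obtain k m where km: "\<alpha> = rt k m" "k ~= m" "eqr k m" "l \<alpha> > 0" using sa(2) by (auto simp: rel_roots_def)
  have "perm s k ~= perm s m" using km(2) bij_is_inj[OF perm(1)[OF ia[OF sa(1)]]] by (simp add: inj_eq)
  moreover have "eqr (perm s k) (perm s m)" using inv[OF sa(1) km(3)] .
  ultimately have "rt (perm s k) (perm s m) : rel_roots eqr" unfolding rel_roots_def by blast
  then show ?thesis using km(4) as[OF sa(1)] unfolding km(1) galois_rt[OF ia[OF sa(1)]] by (simp add: lrt)
 qed
 have "galois_act S s ` ?P = ?P" if s: "s : inertia v" for s
 proof (intro antisym subsetI)
  fix \<alpha> assume al: "\<alpha> : ?P"
  then obtain k m where km: "\<alpha> = rt k m" by (auto simp: rel_roots_def)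
  have "\<alpha> = galois_act S s (galois_act S (ginv s) \<alpha>)"
   unfolding km galois_rt[OF ia[OF s]] galois_rt[OF ia[OF aut_groupD(3)[OF aut_group_inertia s]]] using perm_ginv(2)[OF ia[OF s]] by simp
  then show "\<alpha> : galois_act S s ` ?P" using stab[OF aut_groupD(3)[OF aut_group_inertia s] al] by blast
 qed (use stab[OF s] in blast)
 moreover have "l (char_mult S \<eta> \<psi>) = l \<eta> + l \<psi>" if "\<eta> : characters S" "\<psi> : characters S" for \<eta> \<psi>
 proof -
  have "nrm (\<eta> t) > 0" "nrm (\<psi> t) > 0" using that tS by (auto simp: characters_def)
  then show ?thesis using tS by (simp add: l_def char_mult_def nrm_mult log_mult)
 qed
 ultimately show "inertia_preserves_positive_system v S (rel_roots eqr)"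
  unfolding inertia_preserves_positive_system_def positive_system_def using l0
  by (intro exI[of _ ?P] conjI exI[of _ l] ballI refl) blast+
qed

end

text \<open>The index \<open>k0\<close> belongs to the identity embedding of \<open>K\<close>. Its
  stabilizer is the group of automorphisms over \<open>K\<close> (\<open>stab\<close>), so with
  transitivity every coordinate is an embedding of \<open>K\<close>.\<close>

locale torus_field = torus_frame v S g
 for v :: "'f::field => int" and S :: "('f alg_closure ^'n ^'n) set" and g :: "'f alg_closure ^'n ^'n" +
 fixes K :: "'f alg_closure set" and \<iota> :: "'f alg_closure => 'f alg_closure ^'n ^'n" and k0 :: 'n
 assumes K: "intermediate_field K" and ident: "identifies \<iota> K S" and k0: "x : K ==> co k0 (\<iota> x) = x"
begin

lemma iota_rat: "x : K - {0} ==> \<iota> x : rational_points base_field S"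
 using ident unfolding identifies_def by blast

lemma iota_S: "x : K - {0} ==> \<iota> x : S" using co_rational(1)[OF iota_rat] .

lemma rat_co: assumes "s : rational_points base_field S" shows "co k0 s : K - {0}" "\<iota> (co k0 s) = s"
 "inv_into (K - {0}) \<iota> s = co k0 s"
proof -
 obtain x where x: "x : K - {0}" "s = \<iota> x" using ident assms unfolding identifies_def by blast
 then show "co k0 s : K - {0}" "\<iota> (co k0 s) = s" using k0 by auto
 have "inj_on \<iota> (K - {0})" using k0 by (metis DiffD1 inj_onI)
 then show "inv_into (K - {0}) \<iota> s = co k0 s" using x k0 by simp
qed

lemma sep_K: "x : K ==> separable_element x"
 using co_rational(2)[OF iota_rat, of x k0] separable_to_ac sep_closed(2) k0[of x] by (cases "x = 0") auto

lemma co_iota: "t : abs_galois ==> x : K - {0} ==> co (perm t k0) (\<iota> x) = t x"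
 using co_rational(3)[OF iota_rat, of x t k0] k0 by simp

lemma stab: assumes s: "s : abs_galois" shows "perm s k0 = k0 \<longleftrightarrow> s : field_auts K"
proof
 assume p: "perm s k0 = k0"
 have "s x = x" if "x : K" for x
  using co_iota[OF s, of x] that k0[of x] autsD(5)[OF s] unfolding p by (cases "x = 0") auto
 then show "s : field_auts K" using s unfolding field_auts_def by blast
next
 assume K': "s : field_auts K"
 show "perm s k0 = k0"
 proof (rule co_distinct_rational)
  fix t assume t: "t : rational_points base_field S"
  then show "co (perm s k0) t = co k0 t" using co_rational(3)[OF t s s, of k0] autsD(4)[OF K'] rat_co(1)[OF t] by simp
 qed
qed

lemma splits_K: "intermediate_field E ==> splits_over S E ==> K <= E"
proof
 fix x assume E: "intermediate_field E" "splits_over S E" and x: "x : K"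
 show "x : E"
 proof (rule separable_fixed[OF E(1) sep_K[OF x]])
  fix s assume s: "s : field_auts E"
  then have "s : field_auts K" using splits_iff[OF E(1)] E(2) stab[OF auts_abs[OF E(1) s]] by blast
  then show "s x = x" using x autsD(4) by blast
 qed
qed

lemma splits_closure:
 assumes E: "intermediate_field E" "!!t x. t : abs_galois ==> x : K ==> t x : E" shows "splits_over S E"
 unfolding splits_iff[OF E(1)]
proof (intro ballI allI)
 fix u k assume s: "u : field_auts E"
 have sa: "u : abs_galois" using auts_abs[OF E(1) s] .
 obtain t where t: "t : abs_galois" "perm t k0 = k" using transitive by blast
 let ?r = "ginv t o (u o t)"
 have r: "?r : abs_galois" using auts_comp auts_inv sa t(1) by blast
 have "?r x = x" if "x : K" for x using autsD(4)[OF s] E(2)[OF t(1) that] ginv_simps(2)[OF t(1)] by simp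
 then have "?r : field_auts K" using r unfolding field_auts_def by blast
 then have "perm ?r k0 = k0" using stab[OF r] by blast
 then have "perm t (perm (ginv t) (perm u k)) = perm t k0"
  using perm_comp[OF auts_inv[OF t(1)] auts_comp[OF sa t(1)]] perm_comp[OF sa t(1)] t(2) by simp
 then show "perm u k = k" using perm_ginv(2)[OF t(1)] t(2) by simp
qed

lemma tame_closure_field:
 assumes "tame_exp K j"
 shows "EX A. finite A & (ALL x:A. separable_element x) & (ALL t:abs_galois. t ` A <= A) & K <= gen_field base_field A &
  tame_exp (gen_field base_field A) (card (restrictions (inertia v) (gen_field base_field A))) &
  galois_extension (gen_field base_field A)"
proof (rule galois_closure_exists[OF tame_expD(1)[OF assms]])
 fix A assume A: "finite A" "!!x. x : A ==> separable_element x" "!!t. t : abs_galois ==> t ` A <= A"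
  "K <= gen_field base_field A" "A <= {s x |s x. s : abs_galois & x : K}"
 show ?thesis
  using A(1-4) tame_closure[OF assms sep_K A(1-3,5)] gen_field_galois[OF A(1-3)] by (intro exI[of _ A] conjI ballI) blast+
qed (rule sep_K)

text \<open>Write \<open>x = \<zeta> x\<^sub>1\<close> with a root of unity \<open>\<zeta>\<close>. Inertia fixes the \<open>m\<close>-th roots of the conjugates of \<open>\<zeta>\<close>, and
  \<open>x\<^sub>1\<close> is close to an \<open>m\<close>-th power, where \<open>m\<close> is the order of the inertia group, prime to \<open>p\<close>.\<close>

lemma iwahori_dense:
 assumes tame: "tame_exp K j" and r: "0 < r" and x: "x : K" "nrm x = 1"
 shows "EX y:K - {0}. \<iota> y : iwahori v S & nrm (x / y - 1) <= r"
proof -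
 obtain A where A: "finite A" "ALL x:A. separable_element x" "ALL q:abs_galois. q ` A <= A" "K <= gen_field base_field A"
  "tame_exp (gen_field base_field A) (card (restrictions (inertia v) (gen_field base_field A)))"
  using tame_closure_field[OF tame] by (elim exE conjE)
 define m where "m = card (restrictions (inertia v) (gen_field base_field A))"
 have m: "0 < m" "~ p dvd m" using A(5) by (auto simp: m_def tame_exp_def)
 obtain \<zeta> where z: "\<zeta> : mu Int K" "nrm (x - \<zeta>) < 1" using teichmueller_mem[OF K x] by blast
 have z0: "\<zeta> ~= 0" using nrm_mu[of \<zeta>] z(1) by auto
 obtain n where n: "0 < n" "~ p dvd n" "\<zeta> ^ n = 1" using z(1) by (auto simp: mu_def)
 have nm: "0 < n * m" "~ p dvd n * m" using n m prime_p by (auto simp: prime_dvd_mult_iff)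
 \<comment> \<open>The added roots of unity include the m-th roots of all conjugates of
   \<open>\<zeta>\<close>. Inertia fixes them, so the enlarged field has the same inertia group
   order \<open>m\<close>.\<close>
 let ?B = "A Un mu_n (n * m)"
 define E where "E = gen_field base_field ?B"
 have B: "finite ?B" "!!x. x : ?B ==> separable_element x" "!!q. q : abs_galois ==> q ` ?B <= ?B"
  using A(1-3) finite_mu_n[OF nm(1)] mu_n_subset[OF nm] separable_mu mu_n_galois by blast+
 have E: "galois_extension E" unfolding E_def by (rule gen_field_galois[OF B])
 have sub: "gen_field base_field A <= E"
  unfolding E_def by (intro gen_field_least ifield_gen gen_field_subset) (use gen_field_subset(2)[of ?B base_field] in blast)
 have muE: "mu_n (n * m) <= E" unfolding E_def using gen_field_subset(2)[of ?B base_field] by blast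
 have KE: "q x : E" if "q : abs_galois" "x : K" for q x using galoisD(5)[OF E that(1)] A(4) sub that(2) by blast
 have sp: "splits_over S E" using galoisD(2)[OF E] KE by (rule splits_closure)
 have ia: "s : abs_galois" if "s : inertia v" for s using that aut_groupD(1)[OF aut_group_inertia] by blast
 have card: "card (restrictions (inertia v) E) = m"
 proof -
  have "bij_betw (%q. restrict q (gen_field base_field A)) (restrictions (inertia v) E) (restrictions (inertia v) (gen_field base_field A))"
  proof (rule bij_betw_imageI)
   show "inj_on (%q. restrict q (gen_field base_field A)) (restrictions (inertia v) E)"
   proof (rule inj_onI)
    fix q q' assume t: "q : restrictions (inertia v) E" "q' : restrictions (inertia v) E"
     "restrict q (gen_field base_field A) = restrict q' (gen_field base_field A)"
    obtain s s' where s: "s : inertia v" "q = restrict s E" "s' : inertia v" "q' = restrict s' E" using t(1,2) by (auto elim!: restrictionsE)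
    have "s y = s' y" if "y : ?B" for y
     using that
    proof
     assume "y : A"
     then have "y : gen_field base_field A" using gen_field_subset(2) by blast
     then show ?thesis using t(3) s(2,4) sub by (auto simp: restrict_eq)
    qed (use s mu_n_subset[OF nm] in \<open>auto simp: inertia_iff\<close>)
    then have "s y = s' y" if "y : E" for y using field_auts_eq_gen_field[OF ia[OF s(1)] ia[OF s(3)]] that unfolding E_def by blast
    then show "q = q'" unfolding s restrict_eq by blast
   qed
   show "(%q. restrict q (gen_field base_field A)) ` restrictions (inertia v) E = restrictions (inertia v) (gen_field base_field A)"
    unfolding restrictions_def image_image using sub by (intro image_cong refl) (auto simp: restrict_def fun_eq_iff)
  qed
  then show ?thesis unfolding m_def by (rule bij_betw_same_card)
 qed
 define x1 where "x1 = x / \<zeta>"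
 have x1: "x1 : K - {0}" "nrm (x1 - 1) < 1" "nrm x1 = 1" "x = \<zeta> * x1"
 proof -
  have "x1 - 1 = (x - \<zeta>) / \<zeta>" using z0 by (simp add: x1_def field_simps)
  then show n1: "nrm (x1 - 1) < 1" using z nrm_mu by (simp add: nrm_divide)
  show "nrm x1 = 1" by (rule nrm_principal[OF n1])
  then show "x1 : K - {0}" using x(1) z(1) ifieldD(9)[OF K] by (auto simp: x1_def)
  show "x = \<zeta> * x1" using z0 by (simp add: x1_def)
 qed
 obtain k where k: "nrm (x1 ^ p ^ k - 1) < min r (1 / 2)" using power_p_principal[OF x1(2), of "min r (1 / 2)"] r by auto
 \<comment> \<open>With \<open>a * m = 1 + b * p ^ k\<close>, the m-th power
   \<open>x1 ^ (a * m)\<close> is \<open>x1\<close> times a power of \<open>x1 ^ p ^ k\<close>, and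
   the latter is close to 1.\<close>
 obtain a b where ab: "a * m = 1 + b * p ^ k"
 proof -
  have "coprime m (p ^ k)" using prime_coprime_p[OF m(2)] by (simp add: coprime_commute)
  then obtain a0 where "[m * a0 = Suc 0] (mod p ^ k)" using cong_solve_coprime_nat by blast
  then have "[m * (a0 + p ^ k) = 1] (mod p ^ k)" by (simp add: cong_def distrib_left)
  moreover have "0 < p ^ k" using p_gt_1 by simp
  then have "1 <= m * (a0 + p ^ k)" using m(1) by (simp add: Suc_le_eq)
  ultimately have "EX b. m * (a0 + p ^ k) = b * p ^ k + 1" using cong_le_nat[of 1 "m * (a0 + p ^ k)" "p ^ k"] cong_sym by (metis mult.commute)
  then show thesis using that by (metis add.commute mult.commute)
 qed
 define y where "y = \<zeta> * x1 ^ (a * m)"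
 have yK: "y : K - {0}" unfolding y_def using z z0 x1(1) ifieldD(5,10)[OF K] by simp
 have near: "nrm (x / y - 1) <= r"
 proof -
  have pb: "nrm ((x1 ^ p ^ k) ^ b - 1) <= min r (1 / 2)"
   using principal_prod[of "min r (1 / 2)" "{..<b}" "%_. x1 ^ p ^ k"] k r by simp
  have "x / y = inverse ((x1 ^ p ^ k) ^ b)"
   unfolding y_def ab x1(4) using z0 x1(1) by (simp add: power_add field_simps flip: power_mult)
  then show ?thesis using principal_div(2)[OF pb pb] by simp
 qed
 define root where "root = (%z :: 'f alg_closure. SOME w. w ^ m = z)"
 have rt: "root z ^ m = z" for z unfolding root_def using nth_root_exists[OF m(1), of z] by (rule someI_ex)
 \<comment> \<open>The coordinates of an m-th root of \<open>\<iota> y\<close>, chosen equivariant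
   under inertia. All inertia conjugates of \<open>el h\<close> therefore coincide, and its norm is
   its m-th power.\<close>
 define h where "h = (%k. root (co k (\<iota> \<zeta>)) * co k (\<iota> x1) ^ a)"
 have zK: "\<zeta> : K - {0}" using z z0 by blast
 have co: "EX q:abs_galois. ALL x:K - {0}. co k (\<iota> x) = q x" for k
  using transitive[of k0 k] co_iota by blast
 have rtE: "root (co k (\<iota> \<zeta>)) : mu_n (n * m)" for k
 proof -
  obtain q where t: "q : abs_galois" "co k (\<iota> \<zeta>) = q \<zeta>" using co zK by blast
  have "q \<zeta> ^ n = 1" using n(3) autsD(6,11)[OF t(1)] by metis
  then show ?thesis unfolding mu_n_def t(2) mem_Collect_eq mult.commute[of n] power_mult rt .
 qed
 have hE: "h k : E" "nrm (h k) = 1" "h k ~= 0" for k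
 proof -
  obtain q where t: "q : abs_galois" "co k (\<iota> x1) = q x1" using co x1(1) by blast
  show "h k : E" unfolding h_def t(2) using rtE muE KE[OF t(1)] x1(1) ifieldD(5,10)[OF galoisD(2)[OF E]] by blast
  show "nrm (h k) = 1" unfolding h_def t(2) using nrm_mu rtE mu_n_subset[OF nm] t(1) x1(3) by (simp add: nrm_mult nrm_power subset_iff)
  then show "h k ~= 0" by auto
 qed
 have hS: "ALL k. h k ~= 0" using hE(3) by blast
 have fix_h: "s (h k) = h (perm s k)" if s: "s : inertia v" for s k
 proof -
  note sa = ia[OF s]
  have zs: "co (perm s k) (\<iota> \<zeta>) = co k (\<iota> \<zeta>)"
  proof -
   obtain q where t: "q : abs_galois" "co k (\<iota> \<zeta>) = q \<zeta>" using co zK by blast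
   have "s (q \<zeta>) = q \<zeta>" using s z(1) mu_closed(5)[OF t(1)] unfolding inertia_iff by blast
   then show ?thesis using co_rational(3)[OF iota_rat[OF zK] sa sa, of k] t(2) by simp
  qed
  have "s (root (co k (\<iota> \<zeta>))) = root (co k (\<iota> \<zeta>))" using s rtE[of k] mu_n_subset[OF nm] unfolding inertia_iff by blast
  then show ?thesis unfolding h_def zs using co_rational(3)[OF iota_rat[OF x1(1)] sa sa, of k] by (simp add: autsD(3,11)[OF sa])
 qed
 have elE: "el h : rational_points E S"
 proof (rule el_rational)
  show "s (h k) = h (perm s k)" if "s : field_auts E" for s k
   using that autsD(4)[OF that hE(1)] splits_iff[OF galoisD(2)[OF E]] sp by simp
 qed (use hE galoisD[OF E] in blast)+
 have map: "map_matrix q (el h) = el h" if t: "q : restrictions (inertia v) E" for q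
 proof -
  obtain s where s: "s : inertia v" "q = restrict s E" using t by (rule restrictionsE)
  have "map_matrix q (el h) = map_matrix s (el h)" using elE s(2) by (simp add: rational_points_def vec_eq_iff)
  also have "... = el h" unfolding map_el[OF ia[OF s(1)] hS] fix_h[OF s(1)] using perm_ginv(2)[OF ia[OF s(1)]] by simp
  finally show ?thesis .
 qed
 have fin: "finite (restrictions (inertia v) E)" using finite_restrictions[OF galoisD(1)[OF E] aut_groupD(5)[OF aut_group_inertia]] .
 note T = torus_norm_co[OF fin, of "el h"]
 have "torus_norm S (restrictions (inertia v) E) (el h) = \<iota> y"
 proof (rule S_eqI)
  show "torus_norm S (restrictions (inertia v) E) (el h) : S" using T(1) map el_S[OF hS] by simp
  show "\<iota> y : S" using iota_S[OF yK] .
  fix k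
  obtain q where t: "q : abs_galois" "ALL x:K - {0}. co k (\<iota> x) = q x" using co[of k] by (rule bexE)
  have "co k (torus_norm S (restrictions (inertia v) E) (el h)) = h k ^ m" using T(2) map el_S[OF hS] by (simp add: card)
  also have "... = q \<zeta> * q x1 ^ (a * m)" unfolding h_def power_mult_distrib rt power_mult using t(2) zK x1(1) by simp
  also have "... = co k (\<iota> y)" using t(2) yK by (simp add: y_def autsD(3,11)[OF t(1)])
  finally show "co k (torus_norm S (restrictions (inertia v) E) (el h)) = co k (\<iota> y)" .
 qed
 moreover have "\<eta> (el h) : unit_integers v" if et: "\<eta> : characters S" for \<eta>
 proof -
  obtain a where a: "\<eta> = monoc a" using char_monoc[OF et] by (rule exE)
  have "nrm (h k powi i) = 1" for k i using hE(2) by (simp add: power_int_def nrm_power nrm_inverse)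
  then show ?thesis unfolding a unit_integers_iff monoc_S[OF el_S[OF hS]] nrm_prod by simp
 qed
 ultimately have "\<iota> y : iwahori v S" unfolding iwahori_def using iota_rat[OF yK] E sp elE by (auto intro!: exI[of _ E] bexI[of _ "el h"])
 then show ?thesis using yK near by blast
qed

end

section \<open>Regular pairs and admissible pairs\<close>

context torus_field
begin

abbreviation torus_char :: "('f alg_closure => complex) => 'f alg_closure ^'n ^'n => complex" where
 "torus_char \<theta> \<equiv> \<theta> o inv_into (K - {0}) \<iota>"

text \<open>The norm from \<open>E\<close> to \<open>K\<close> after an automorphism that carries
  the coordinate \<open>k\<close> to \<open>k0\<close>. By \<open>NX_eq\<close> the choice of the
  automorphism does not matter.\<close>

definition NX :: "'f alg_closure set => 'n => 'f alg_closure => 'f alg_closure" where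
 "NX E k x = field_norm K E ((SOME s. s : abs_galois & perm s k = k0) x)"

text \<open>Two coordinates are related when the corresponding conjugates of \<open>\<theta>\<close>
  composed with the norm agree on principal units; \<open>R0plus_eq\<close> identifies the resulting
  roots with \<open>R0plus\<close>.\<close>

definition eqr :: "'f alg_closure set => ('f alg_closure => complex) => 'n => 'n => bool" where
 "eqr E \<theta> k l \<longleftrightarrow> (ALL x:principal_units v E. \<theta> (NX E k x) = \<theta> (NX E l x))"

lemma equivp_eqr: "equivp (eqr E \<theta>)"
 by (intro equivpI reflpI sympI transpI) (auto simp: eqr_def)

lemma perm_eq_on_K:
 assumes s: "s : abs_galois" "t : abs_galois" and eq: "!!x. x : K ==> s x = t x" shows "perm s k0 = perm t k0"
proof -
 have r: "ginv t o s : abs_galois" using auts_comp auts_inv s by blast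
 have "ginv t o s : field_auts K" using r eq ginv_simps(2)[OF s(2)] unfolding field_auts_def by simp
 then have "perm (ginv t) (perm s k0) = k0" using stab[OF r] perm_comp[OF auts_inv[OF s(2)] s(1)] by simp
 then show ?thesis using perm_ginv(2)[OF s(2)] by metis
qed

text \<open>The coordinate \<open>perm r k0\<close> is the embedding of \<open>K\<close> given by
  \<open>r\<close>. If automorphisms over \<open>K\<close> fix this coordinate, they fix
  \<open>r x\<close>.\<close>

lemma normalizes_K:
 assumes r: "r : abs_galois" "!!\<gamma>. \<gamma> : field_auts K ==> perm \<gamma> (perm r k0) = perm r k0" and x: "x : K" shows "r x : K"
proof (rule separable_fixed[OF K separable_conjugate[OF sep_K[OF x] r(1)]])
 fix \<gamma> assume g: "\<gamma> : field_auts K"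
 have ga: "\<gamma> : abs_galois" using auts_abs[OF K g] .
 show "\<gamma> (r x) = r x"
 proof (cases "x = 0")
  case False
  then have x: "x : K - {0}" using x by simp
  have "\<gamma> (r x) = co (perm \<gamma> (perm r k0)) (\<iota> x)"
   using co_iota[OF auts_comp[OF ga r(1)] x] perm_comp[OF ga r(1)] by simp
  then show ?thesis unfolding r(2)[OF g] co_iota[OF r(1) x] .
 qed (simp add: autsD(5)[OF r(1)] autsD(5)[OF ga])
qed

lemma smooth_principal: assumes "smooth_character v (M - {0}) \<theta>" shows "smooth_character v (principal_units v M) \<theta>"
proof -
 have "principal_units v M <= M - {0}" by (auto simp: principal_iff)
 then have sub: "x : M - {0}" if "x : principal_units v M" for x using that by blast
 show ?thesis
 proof (rule smooth_radius[OF assms])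
  fix m assume m: "0 < m" "!!x. x : M - {0} ==> nrm (x - 1) <= m ==> \<theta> x = 1"
  show ?thesis
  proof (rule smooth_characterI[OF _ _ m(1)])
   fix x y assume xy: "x : principal_units v M" "y : principal_units v M"
   show "\<theta> (x * y) = \<theta> x * \<theta> y" using assms sub[OF xy(1)] sub[OF xy(2)] unfolding smooth_character_def by blast
  qed (use assms sub m(2) in \<open>auto simp: smooth_character_def\<close>)
 qed
qed

section \<open>A fixed tame Galois splitting field\<close>

context
 fixes E j \<theta>
 assumes E: "galois_extension E" "tame_exp E j" "splits_over S E" and \<theta>: "smooth_character v (K - {0}) \<theta>"
begin

lemma E_field: "intermediate_field E" using galoisD(2)[OF E(1)] .

lemma KE: "K <= E" using splits_K[OF E_field E(3)] .

lemma tg: "intermediate_field L ==> L <= E ==> tame_galois L E"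
 unfolding tame_galois_def using E(2) galoisD(3,4)[OF E(1)] auts_abs by blast

lemmas tgK = tg[OF K KE]

lemma tame_K: "tame_exp K j" using tame_exp_subset[OF E(2) K KE] .

lemma unr_iff: "intermediate_field L ==> L <= K ==>
  unramified v L K \<longleftrightarrow> (ALL s:inertia v. s : field_auts L --> (ALL x:K. s x = x))"
 by (rule unramified_iff[OF tame_K sep_K])

text \<open>Two automorphisms carrying \<open>k\<close> to \<open>k0\<close> differ by one over
  \<open>K\<close>, under which the norm to \<open>K\<close> is invariant.\<close>

lemma NX_eq:
 assumes s: "s : abs_galois" "perm s k = k0" and x: "x : E" shows "NX E k x = field_norm K E (s x)"
proof -
 define t where "t = (SOME s. s : abs_galois & perm s k = k0)"
 have t: "t : abs_galois" "perm t k = k0"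
  using someI_ex[of "%s. s : abs_galois & perm s k = k0"] s unfolding t_def by blast+
 let ?g = "t o ginv s"
 have ga: "?g : abs_galois" using auts_comp auts_inv s(1) t(1) by blast
 have "perm ?g k0 = k0" unfolding perm_comp[OF t(1) auts_inv[OF s(1)]] using perm_ginv(1)[OF s(1), of k] s(2) t(2) by simp
 then have g: "?g : field_auts K" using stab[OF ga] by blast
 have "field_norm K E (?g (s x)) = field_norm K E (s x)"
  using field_norm_conj[OF K g galoisD(4)[OF E(1) ga] galoisD(5)[OF E(1) s(1) x]] .
 then show ?thesis unfolding NX_def t_def[symmetric] using ginv_simps(2)[OF s(1)] by simp
qed

lemma NX_K: "x : E - {0} ==> NX E k x : K - {0}"
proof -
 assume x: "x : E - {0}"
 obtain s where s: "s : abs_galois" "perm s k = k0" using transitive by blast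
 have "s x : E" "s x ~= 0" using x galoisD(5)[OF E(1) s(1)] autsD(12)[OF s(1)] by auto
 then show ?thesis using tame_galoisD(8)[OF tgK] field_norm_eq_0[OF K galoisD(1)[OF E(1)]] NX_eq[OF s] x by simp
qed

lemma NX_galois: assumes t: "t : abs_galois" and x: "x : E" shows "NX E (perm t k) (t x) = NX E k x"
proof -
 obtain s where s: "s : abs_galois" "perm s (perm t k) = k0" using transitive by blast
 show ?thesis using NX_eq[OF s galoisD(5)[OF E(1) t x]] NX_eq[OF auts_comp[OF s(1) t] _ x, of k] perm_comp[OF s(1) t] s(2) by simp
qed

lemma NX_k0: "x : E ==> NX E k0 x = field_norm K E x"
 using NX_eq[OF id_auts perm_id] by simp

lemma principal_galois: "t : abs_galois ==> x : principal_units v E ==> t x : principal_units v E"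
 using galoisD(5)[OF E(1)] nrm_galois[of t "x - 1"]
 by (auto simp: principal_iff autsD(6,8) simp del: nrm_galois)

lemma eqr_galois: assumes t: "t : abs_galois" and e: "eqr E \<theta> k l" shows "eqr E \<theta> (perm t k) (perm t l)"
 unfolding eqr_def
proof
 fix x assume "x : principal_units v E"
 then have y: "ginv t x : principal_units v E" by (rule principal_galois[OF auts_inv[OF t]])
 then have "ginv t x : E" by (simp add: principal_iff)
 then show "\<theta> (NX E (perm t k) x) = \<theta> (NX E (perm t l) x)"
  using NX_galois[OF t, of "ginv t x"] e y unfolding eqr_def ginv_simps(1)[OF t] by simp
qed

lemma eqr_k0:
 assumes s: "s : abs_galois"
 shows "eqr E \<theta> k0 (perm s k0) \<longleftrightarrow> (ALL x:principal_units v E. \<theta> (field_norm K E (s x)) = \<theta> (field_norm K E x))"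
proof -
 have e: "NX E k0 (s x) = field_norm K E (s x)" "NX E (perm s k0) (s x) = field_norm K E x" if "x : principal_units v E" for x
  using that NX_k0 NX_galois[OF s] principal_galois[OF s that] by (auto simp: principal_iff)
 have "EX y:principal_units v E. x = s y" if "x : principal_units v E" for x
  using principal_galois[OF auts_inv[OF s] that] ginv_simps(1)[OF s] by metis
 then show ?thesis unfolding eqr_def using e principal_galois[OF s] by metis
qed

text \<open>The \<open>k0\<close>-coordinate of the conjugate of the coroot point under
  \<open>u\<close> is \<open>u x\<close> if \<open>u\<close> carries \<open>k\<close> to
  \<open>k0\<close>, its inverse if \<open>u\<close> carries \<open>l\<close> to \<open>k0\<close>,
  and 1 otherwise. The product over the embeddings that carry \<open>k\<close> to \<open>k0\<close>
  is the norm of a conjugate of \<open>x\<close>.\<close>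

lemma torus_norm_coroot:
 assumes kl: "k ~= l" and x: "x : principal_units v E"
 defines "T \<equiv> torus_norm S (restrictions abs_galois E) (coroot S (rt k l) x)"
 shows "T : rational_points base_field S" "co k0 T = NX E k x * inverse (NX E l x)"
proof -
 let ?R = "restrictions abs_galois E" and ?s = "el (cw k l x)"
 let ?C = "%k. restrictions {u : abs_galois. perm u k = k0} E"
 note B = aut_group_auts[OF ifield_base]
 have xE: "x : E" "x ~= 0" using x nrm_principal by (auto simp: principal_iff)
 have cw: "ALL m. cw k l x m ~= 0" "cw k l x m : E" for m using xE ifieldD(3,6)[OF E_field] by (auto simp: cw_def)
 have sE: "?s : rational_points E S"
 proof (rule el_rational)
  show "u (cw k l x m) = cw k l x (perm u m)" if "u : field_auts E" for u m
   using autsD(4)[OF that cw(2)] E(3) splits_iff[OF E_field] that by simp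
 qed (use cw galoisD(3)[OF E(1)] E_field in blast)+
 have mm: "map_matrix (restrict u E) ?s = map_matrix u ?s" for u using sE by (simp add: rational_points_def vec_eq_iff)
 have fin: "finite ?R" using finite_restrictions[OF galoisD(1)[OF E(1)]] by blast
 have inS: "map_matrix t ?s : S" if "t : ?R" for t
  using that map_S el_S[OF cw(1)] by (auto elim!: restrictionsE simp: mm)
 have T: "T : S" "co m T = (PROD t:?R. co m (map_matrix t ?s))" for m
  unfolding T_def coroot_rt[OF kl xE(2)] using torus_norm_co[OF fin inS] by auto
 have "el (%m. co m T) : rational_points base_field S"
 proof (rule el_rational[OF co_nz[OF T(1)] _ ifield_base])
  have "separable_element (co m (map_matrix t ?s))" if tR: "t : ?R" for t m
  proof -
   obtain u where s: "u : abs_galois" "t = restrict u E" using tR by (rule restrictionsE)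
   show ?thesis unfolding s(2) mm co_map[OF s(1) el_S[OF cw(1)]] co_el
    by (intro separable_conjugate[OF _ s(1)] galoisD(3)[OF E(1) cw(2)])
  qed
  then show "separable_element (co m T)" for m unfolding T(2) by (rule sep_closed(12))
  fix u :: "'f alg_closure => 'f alg_closure" and m assume s: "u : abs_galois"
  have "u (co m T) = (PROD t:?R. co (perm u m) (map_matrix (restrict (u o t) E) ?s))"
   unfolding T(2) auts_prod[OF s]
  proof (intro prod.cong refl)
   fix t assume t: "t : ?R"
   have "map_matrix (restrict (u o t) E) ?s = map_matrix u (map_matrix t ?s)" by (simp add: mm map_matrix_comp)
   then show "u (co m (map_matrix t ?s)) = co (perm u m) (map_matrix (restrict (u o t) E) ?s)" using perm(2)[OF s inS[OF t]] by simp
  qed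
  also have "... = co (perm u m) T" unfolding T(2) by (rule prod.reindex_bij_betw[OF restrictions_left[OF B s]])
  finally show "u (co m T) = co (perm u m) T" .
 qed
 then show "T : rational_points base_field S" unfolding el_co[OF T(1)] .
 have C_iff: "restrict u E : ?C m \<longleftrightarrow> perm u m = k0" if s: "u : abs_galois" for u m
 proof
  assume "restrict u E : ?C m"
  then obtain u' where s': "u' : abs_galois" "perm u' m = k0" "ALL x:E. u x = u' x" by (auto elim!: restrictionsE simp: restrict_eq)
  have "ginv u' o u : field_auts E"
   using auts_comp[OF auts_inv[OF s'(1)] s] s'(3) ginv_simps(2)[OF s'(1)] unfolding field_auts_def by simp
  then have "perm (ginv u') (perm u m) = m" using E(3) splits_iff[OF E_field] perm_comp[OF auts_inv[OF s'(1)] s] by simp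
  then show "perm u m = k0" using perm_ginv(2)[OF s'(1)] s'(2) by metis
 qed (use s in \<open>auto intro: restrictionsI\<close>)
 have NXC: "(PROD t:?C m. t x) = NX E m x" for m
 proof -
  obtain u where s: "u : abs_galois" "perm u m = k0" using transitive by blast
  have sx: "u y : E" if "y : E" for y using galoisD(5)[OF E(1) s(1) that] .
  have "bij_betw (%\<gamma>. restrict (\<gamma> o u) E) (restrictions (field_auts K) E) (?C m)"
  proof (rule bij_betw_imageI)
   have im: "y : u ` E" if "y : E" for y using galoisD(4)[OF E(1) s(1)] that by simp
   show "inj_on (%\<gamma>. restrict (\<gamma> o u) E) (restrictions (field_auts K) E)"
   proof (rule inj_onI)
    fix \<gamma> \<gamma>' assume g: "\<gamma> : restrictions (field_auts K) E" "\<gamma>' : restrictions (field_auts K) E"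
     and eq: "restrict (\<gamma> o u) E = restrict (\<gamma>' o u) E"
    have "\<gamma> y = \<gamma>' y" if "y : E" for y using im[OF that] eq unfolding restrict_eq by auto
    then show "\<gamma> = \<gamma>'" using g by (auto elim!: restrictionsE simp: restrict_eq)
   qed
   show "(%\<gamma>. restrict (\<gamma> o u) E) ` restrictions (field_auts K) E = ?C m"
   proof (intro antisym subsetI)
    fix t assume "t : (%\<gamma>. restrict (\<gamma> o u) E) ` restrictions (field_auts K) E"
    then obtain r where r: "r : field_auts K" "t = restrict (r o u) E" using sx by (auto elim!: restrictionsE simp: restrict_eq)
    have ra: "r : abs_galois" using auts_abs[OF K r(1)] .
    have "perm (r o u) m = k0" unfolding perm_comp[OF ra s(1)] s(2) using stab[OF ra] r(1) by blast
    then show "t : ?C m" unfolding r(2) using auts_comp[OF ra s(1)] by (intro restrictionsI) simp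
   next
    fix t assume "t : ?C m"
    then obtain r where r: "r : abs_galois" "perm r m = k0" "t = restrict r E" by (auto elim!: restrictionsE)
    let ?g = "r o ginv u"
    have ga: "?g : abs_galois" using auts_comp auts_inv s(1) r(1) by blast
    have "perm ?g k0 = k0" unfolding perm_comp[OF r(1) auts_inv[OF s(1)]] using perm_ginv(1)[OF s(1), of m] s(2) r(2) by simp
    then have "?g : field_auts K" using stab[OF ga] by blast
    moreover have "t = restrict (restrict ?g E o u) E"
     unfolding r(3) restrict_eq using sx ginv_simps(2)[OF s(1)] by simp
    ultimately show "t : (%\<gamma>. restrict (\<gamma> o u) E) ` restrictions (field_auts K) E" using restrictionsI by blast
   qed
  qed
  from prod.reindex_bij_betw[OF this, of "%t. t x"] show ?thesis
   unfolding NX_eq[OF s xE(1)] field_norm_def using xE(1) by simp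
 qed
 have sub: "?R Int ?C m = ?C m" for m by (auto elim!: restrictionsE intro: restrictionsI)
 have "co k0 (map_matrix t ?s) = (if t : ?C k then t x else 1) * (if t : ?C l then inverse (t x) else 1)" if tR: "t : ?R" for t
 proof -
  obtain u where s: "u : abs_galois" "t = restrict u E" using tR by (rule restrictionsE)
  have "perm (ginv u) k0 = m \<longleftrightarrow> perm u m = k0" for m using perm_ginv[OF s(1)] by metis
  moreover have "perm u k ~= perm u l" using kl bij_is_inj[OF perm(1)[OF s(1)]] by (simp add: inj_eq)
  ultimately show ?thesis unfolding s(2) mm co_map[OF s(1) el_S[OF cw(1)]] co_el C_iff[OF s(1)]
   using xE(1) kl by (auto simp: cw_def autsD(6,9)[OF s(1)])
 qed
 then have "co k0 T = (PROD t:?R. if t : ?C k then t x else 1) * (PROD t:?R. if t : ?C l then inverse (t x) else 1)"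
  unfolding T(2) prod.distrib[symmetric] by (intro prod.cong refl)
 also have "... = (PROD t:?C k. t x) * (PROD t:?C l. inverse (t x))"
  unfolding prod.inter_restrict[OF fin, symmetric] sub ..
 also have "(PROD t:?C l. inverse (t x)) = inverse (PROD t:?C l. t x)" using prod_inversef[of "%t. t x" "?C l"] by (simp add: o_def)
 finally show "co k0 T = NX E k x * inverse (NX E l x)" unfolding NXC .
qed

lemma R0plus_eq: "R0plus v S (torus_char \<theta>) E = rel_roots (eqr E \<theta>)"
proof -
 have mult: "\<theta> (a * b) = \<theta> a * \<theta> b" if "a : K - {0}" "b : K - {0}" for a b using \<theta> that by (auto simp: smooth_character_def)
 have nz: "\<theta> a ~= 0" if "a : K - {0}" for a using \<theta> that by (auto simp: smooth_character_def)
 have key: "torus_char \<theta> (torus_norm S (restrictions abs_galois E) (coroot S (rt k l) x)) = 1 \<longleftrightarrow> \<theta> (NX E k x) = \<theta> (NX E l x)"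
  if "k ~= l" "x : principal_units v E" for k l x
 proof -
  have "x : E - {0}" using that(2) nrm_principal by (auto simp: principal_iff)
  then have N: "NX E k x : K - {0}" "NX E l x : K - {0}" by (rule NX_K)+
  then have q: "NX E k x * inverse (NX E l x) : K - {0}" using ifieldD(5,6)[OF K] by simp
  have "NX E k x * inverse (NX E l x) * NX E l x = NX E k x" using N(2) by (simp add: mult.assoc)
  then have "\<theta> (NX E k x * inverse (NX E l x)) * \<theta> (NX E l x) = \<theta> (NX E k x)" using mult[OF q N(2)] by (simp only:)
  then show ?thesis using nz[OF N(2)] rat_co(3)[OF torus_norm_coroot(1)[OF that]] torus_norm_coroot(2)[OF that] by auto
 qed
 show ?thesis unfolding R0plus_def roots_eq rel_roots_def eqr_def using key by (auto 0 3)
qed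

text \<open>The group \<open>H\<close> of the overview: automorphisms that keep \<open>k0\<close> in
  its class.\<close>

definition HE :: "('f alg_closure => 'f alg_closure) set" where
 "HE = {s : abs_galois. eqr E \<theta> k0 (perm s k0)}"

text \<open>As inertia is normal and Galois transitive, conjugation moves the criterion of
  \<open>positive_iff\<close> at any coordinate to the coordinate \<open>k0\<close>.\<close>

lemma pos_iff: "inertia_preserves_positive_system v S (rel_roots (eqr E \<theta>)) \<longleftrightarrow> (ALL s:inertia v. s : HE --> s : field_auts K)"
proof -
 have ia: "s : abs_galois" if "s : inertia v" for s using that aut_groupD(1)[OF aut_group_inertia] by blast
 have *: "perm s k = k" if h: "ALL s:inertia v. s : HE --> s : field_auts K" and s: "s : inertia v" "eqr E \<theta> k (perm s k)" for s k
 proof -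
  obtain t where t: "t : abs_galois" "perm t k0 = k" using transitive by blast
  let ?r = "ginv t o s o t"
  have r: "?r : inertia v" by (rule inertia_normal[OF s(1) t(1)])
  have pr: "perm ?r k0 = perm (ginv t) (perm s k)"
   using perm_comp[OF auts_comp[OF auts_inv[OF t(1)] ia[OF s(1)]] t(1)] perm_comp[OF auts_inv[OF t(1)] ia[OF s(1)]] t(2) by simp
  have "perm (ginv t) k = k0" using perm_ginv(1)[OF t(1), of k0] t(2) by simp
  then have "eqr E \<theta> k0 (perm ?r k0)" using eqr_galois[OF auts_inv[OF t(1)] s(2)] pr by simp
  then have "perm ?r k0 = k0" using h r ia[OF r] stab unfolding HE_def by blast
  then show ?thesis using pr perm_ginv(2)[OF t(1)] t(2) by metis
 qed
 have pi: "inertia_preserves_positive_system v S (rel_roots (eqr E \<theta>)) \<longleftrightarrow> (ALL s:inertia v. ALL k. eqr E \<theta> k (perm s k) --> perm s k = k)"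
  by (rule positive_iff[OF equivp_eqr]) (rule eqr_galois[OF ia])
 show ?thesis unfolding pi
 proof (intro iffI ballI impI)
  fix s assume "ALL s:inertia v. ALL k. eqr E \<theta> k (perm s k) --> perm s k = k" "s : inertia v" "s : HE"
  then show "s : field_auts K" using stab[of s] by (simp add: HE_def)
 qed (use * in blast)
qed

text \<open>By transitivity of norms, \<open>\<theta>\<close> after the norm to \<open>K\<close>
  factors through the norm from \<open>E\<close> to \<open>L\<close>, which is invariant under
  automorphisms over \<open>L\<close>.\<close>

lemma norm_factor_HE:
 assumes L: "intermediate_field L" "L <= K" and f: "!!x. x : principal_units v K ==> \<theta> x = \<theta>L (field_norm L K x)"
 shows "field_auts L <= HE"
proof
 fix s assume s: "s : field_auts L"
 have sa: "s : abs_galois" using auts_abs[OF L(1) s] .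
 have "\<theta> (field_norm K E x) = \<theta>L (field_norm L E x)" if x: "x : principal_units v E" for x
 proof -
  have xE: "x : E" "nrm (x - 1) < 1" using x by (auto simp: principal_iff)
  have "field_norm K E x : principal_units v K" using tame_galoisD(8)[OF tgK xE(1)]
   field_norm_near(1)[OF galoisD(1)[OF E(1)] K nrm_nonneg xE(2,1) order_refl] xE(2) by (simp add: principal_iff)
  then show ?thesis using f field_norm_trans[OF L K KE galoisD(1)[OF E(1)] xE(1) galoisD(3)[OF E(1) xE(1)]] by simp
 qed
 moreover have "field_norm L E (s x) = field_norm L E x" if "x : E" for x
  by (rule field_norm_conj[OF L(1) s galoisD(4)[OF E(1) sa] that])
 ultimately have "ALL x:principal_units v E. \<theta> (field_norm K E (s x)) = \<theta> (field_norm K E x)"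
  using principal_galois[OF sa] by (auto simp: principal_iff)
 then show "s : HE" unfolding HE_def using eqr_k0[OF sa] sa by blast
qed

text \<open>Conjugation by \<open>n\<close> permutes the coordinates by \<open>w\<close>. As
  \<open>w\<close> commutes with Galois, rational points stay rational even if \<open>n\<close> is
  only rational modulo \<open>S\<close>, and on the \<open>k0\<close>-coordinate the effect is
  \<open>\<phi>\<close>.\<close>

lemma conj_rational:
 assumes n: "!!s. s : S ==> n ** s ** matrix_inv n : S" "!!s k. s : S ==> co (w k) (n ** s ** matrix_inv n) = co k s"
  and w: "bij w" "!!u k. u : abs_galois ==> w (perm u k) = perm u (w k)" and s: "s : rational_points base_field S"
  and m: "\<phi> : abs_galois" "w (perm \<phi> k0) = k0"
 shows "torus_char \<theta> (n ** s ** matrix_inv n) = \<theta> (\<phi> (co k0 s))"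
proof -
 let ?t = "n ** s ** matrix_inv n"
 have sS: "s : S" using co_rational(1)[OF s] .
 have co: "co k ?t = co (ginv w k) s" for k using n(2)[OF sS, of "ginv w k"] w(1) by (simp add: bij_def surj_f_inv_f)
 have gw: "ginv w (perm u k) = perm u (ginv w k)" if "u : abs_galois" for u k
  using w(2)[OF that, of "ginv w k"] w(1) by (metis bij_def bij_inv_eq_iff surj_f_inv_f)
 have "el (%k. co k ?t) : rational_points base_field S"
 proof (rule el_rational[OF co_nz[OF n(1)[OF sS]] _ ifield_base])
  show "separable_element (co k ?t)" for k unfolding co using separable_to_ac by (intro co_rational(2)[OF s]) auto
  show "u (co k ?t) = co (perm u k) ?t" if "u : abs_galois" for u k unfolding co gw[OF that] using co_rational(3)[OF s that that] .
 qed
 then have t: "?t : rational_points base_field S" unfolding el_co[OF n(1)[OF sS]] .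
 have "co k0 ?t = co (perm \<phi> k0) s" using n(2)[OF sS, of "perm \<phi> k0"] m(2) by simp
 also have "... = \<phi> (co k0 s)" using co_rational(3)[OF s m(1) m(1)] by simp
 finally show "torus_char \<theta> ?t = \<theta> (\<phi> (co k0 s))" using rat_co(3)[OF t] by simp
qed

text \<open>Condition (ii) is the inertia criterion applied to the automorphisms over
  \<open>L\<close>. A factorization as in (i) restricts to one as in (ii), so \<open>K\<close> is
  unramified and hence normal over \<open>L\<close>. A nontrivial automorphism of \<open>K\<close>
  over \<open>L\<close> would then give a rational Weyl element stabilizing
  \<open>\<theta>\<close>.\<close>

theorem regular_imp_admissible:
 assumes pos: "inertia_preserves_positive_system v S (rel_roots (eqr E \<theta>))"
  and stabil: "trivial_rational_stabilizer v S (torus_char \<theta>) (G0 (eqr E \<theta>))"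
 shows "admissible_pair v (ext_degree K) K \<theta>"
proof -
 have unr: "unramified v L K" if L: "intermediate_field L" "L <= K" and f: "!!x. x : principal_units v K ==> \<theta> x = \<theta>L (field_norm L K x)" for L \<theta>L
 proof -
  have "field_auts L <= HE" by (rule norm_factor_HE[OF L f])
  then show ?thesis unfolding unr_iff[OF L] using pos autsD(4) unfolding pos_iff by blast
 qed
 have eqK: "L = K" if L: "intermediate_field L" "L <= K" and f: "!!x. x : K - {0} ==> \<theta> x = \<theta>L (field_norm L K x)" for L \<theta>L
 proof (rule ccontr)
  assume "L ~= K"
  then obtain x where x: "x : K" "x ~: L" using L(2) by blast
  have f': "\<theta> x = \<theta>L (field_norm L K x)" if "x : principal_units v K" for x
   using f[of x] that nrm_principal[of x] by (cases "x = 0") (auto simp: principal_iff)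
  have un: "unramified v L K" by (rule unr[OF L f'])
  have u: "q x = x" if "q : inertia v" "q : field_auts L" "x : K" for q x
   using un that unfolding unr_iff[OF L] by blast
  obtain q where s: "q : field_auts L" "q x ~= x" using separable_fixed[OF L(1) sep_K[OF x(1)]] x(2) by blast
  have sa: "q : abs_galois" using auts_abs[OF L(1) s(1)] .
  have gs: "ginv q : field_auts L" by (rule auts_inv[OF s(1)])
  have nK: "r y : K" if "r : field_auts L" "y : K" for r y by (rule inertia_trivial_normal[OF K sep_K L _ that]) (assumption, rule u)
  have fixg: "perm \<gamma> (perm q k0) = perm q k0" if "\<gamma> : field_auts K" for \<gamma>
   using perm_eq_on_K[OF auts_comp[OF auts_abs[OF K that] sa] sa] autsD(4)[OF that nK[OF s(1)]]
    perm_comp[OF auts_abs[OF K that] sa] by simp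
  \<comment> \<open>Right translation by \<open>q\<close> on the coordinates, sending
    \<open>perm t k0\<close> to \<open>perm t (perm q k0)\<close>. It is well defined because
    \<open>perm q k0\<close> is fixed by the automorphisms over \<open>K\<close>, and it commutes
    with the left action of Galois.\<close>
  define w where "w = (%k. perm (SOME t. t : abs_galois & perm t k0 = k) (perm q k0))"
  have w: "w (perm t k0) = perm t (perm q k0)" if t: "t : abs_galois" for t
  proof -
   define r where "r = (SOME r. r : abs_galois & perm r k0 = perm t k0)"
   have r: "r : abs_galois" "perm r k0 = perm t k0"
    using someI_ex[of "%r. r : abs_galois & perm r k0 = perm t k0"] t unfolding r_def by blast+
   let ?g = "ginv r o t"
   have ga: "?g : abs_galois" using auts_comp auts_inv r(1) t by blast
   have "perm ?g k0 = k0" using perm_comp[OF auts_inv[OF r(1)] t] r perm_ginv(1)[OF r(1), of k0] by simp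
   then have "perm ?g (perm q k0) = perm q k0" using stab[OF ga] fixg by blast
   then have "perm (ginv r) (perm t (perm q k0)) = perm q k0" using perm_comp[OF auts_inv[OF r(1)] t] by simp
   then show ?thesis unfolding w_def r_def[symmetric] using perm_ginv(2)[OF r(1)] by metis
  qed
  have wc: "w (perm r k) = perm r (w k)" if r: "r : abs_galois" for r k
  proof -
   obtain t where t: "t : abs_galois" "perm t k0 = k" using transitive by blast
   have "w (perm r (perm t k0)) = perm r (w (perm t k0))"
    using w[OF auts_comp[OF r t(1)]] w[OF t(1)] perm_comp[OF r t(1)] by simp
   then show ?thesis using t(2) by simp
  qed
  have "surj w" unfolding surj_def using transitive[of "w k0"] wc by metis
  then have bw: "bij w" using finite_UNIV_surj_inj[of w] by (simp add: bij_def)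
  have eqw: "eqr E \<theta> k (w k)" for k
  proof -
   obtain t where t: "t : abs_galois" "perm t k0 = k" using transitive by blast
   have "eqr E \<theta> k0 (perm q k0)" using subsetD[OF norm_factor_HE[OF L f'] s(1)] unfolding HE_def by blast
   then show ?thesis using eqr_galois[OF t(1)] w[OF t(1)] t(2) by metis
  qed
  let ?n = "cj (pm w)"
  have nn: "?n : normalizer_in S (G0 (eqr E \<theta>))" by (rule pm_normalizer[OF equivp_eqr bw eqw])
  have rat: "?n : rational_points base_field (normalizer_in S (G0 (eqr E \<theta>)))" using nn pm_rational[OF wc] by (simp add: rational_points_def)
  have c1: "?n ** s ** matrix_inv ?n : S" "co (w k) (?n ** s ** matrix_inv ?n) = co k s" if sS: "s : S" for s k
  proof -
   obtain h where h: "ALL k. h k ~= 0" "s = el h" using sS by (rule S_cases)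
   show "?n ** s ** matrix_inv ?n : S" "co (w k) (?n ** s ** matrix_inv ?n) = co k s"
    unfolding h(2) pm_conj(2)[OF bw] using h(1) bij_is_inj[OF bw] by (auto intro!: el_S)
  qed
  have ks: "w (perm (ginv q) k0) = k0" using w[OF auts_inv[OF sa]] sa by simp
  have im: "ginv q ` K = K"
  proof (intro antisym subsetI)
   fix y assume "y : K"
   then have "ginv q (q y) : ginv q ` K" using nK[OF s(1)] by blast
   then show "y : ginv q ` K" using ginv_simps(2)[OF sa] by simp
  qed (use nK[OF gs] in blast)
  have "fixes_on_iwahori v S (torus_char \<theta>) ?n" unfolding fixes_on_iwahori_def
  proof
   fix s assume "s : iwahori v S"
   then have sr: "s : rational_points base_field S" by (simp add: iwahori_def)
   have y: "co k0 s : K - {0}" using rat_co(1)[OF sr] .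
   have "ginv q (co k0 s) : K - {0}" using y nK[OF gs] autsD(12)[OF auts_inv[OF sa]] by simp
   then have "\<theta> (ginv q (co k0 s)) = \<theta> (co k0 s)" using f y field_norm_conj[OF L(1) gs im] by simp
   moreover have "torus_char \<theta> (?n ** s ** matrix_inv ?n) = \<theta> (ginv q (co k0 s))"
    by (rule conj_rational[OF c1 bw wc sr auts_inv[OF sa] ks])
   ultimately show "torus_char \<theta> (?n ** s ** matrix_inv ?n) = torus_char \<theta> s"
    using rat_co(3)[OF sr] by simp
  qed
  then have "?n : S" using stabil rat unfolding trivial_rational_stabilizer_def by blast
  then obtain h where "?n = el h" by (rule S_cases)
  then have "pm w = dg h" by (metis cj_uc(2) uc_el)
  then have "pm w $ w k0 $ k0 = dg h $ w k0 $ k0" by simp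
  then have "w k0 = k0" by (simp add: pm_def dg_def split: if_splits)
  then have "perm q k0 = k0" using w[OF id_auts] by simp
  then show False using stab[OF sa] autsD(4) x(1) s(2) by blast
 qed
 show ?thesis unfolding admissible_pair_def
 proof (intro conjI allI impI)
  show "tamely_ramified v K" using tame_K tame_iff by blast
  show "smooth_character v (K - {0}) \<theta>" by (rule \<theta>)
  fix L assume L: "intermediate_field L" "L <= K"
  show "L = K" if ex: "EX \<theta>L. smooth_character v (L - {0}) \<theta>L & (ALL x:K - {0}. \<theta> x = \<theta>L (field_norm L K x))"
  proof -
   obtain \<theta>L where "ALL x:K - {0}. \<theta> x = \<theta>L (field_norm L K x)" using ex by blast
   then show ?thesis by (intro eqK[OF L, of \<theta>L]) blast
  qed
  show "unramified v L K" if ex: "EX \<theta>L. smooth_character v (principal_units v L) \<theta>L & (ALL x:principal_units v K. \<theta> x = \<theta>L (field_norm L K x))"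
  proof -
   obtain \<theta>L where "ALL x:principal_units v K. \<theta> x = \<theta>L (field_norm L K x)" using ex by blast
   then show ?thesis by (intro unr[OF L, of \<theta>L]) blast
  qed
 qed simp
qed

theorem admissible_imp_extra:
 assumes adm: "admissible_pair v N K \<theta>"
 shows "inertia_preserves_positive_system v S (rel_roots (eqr E \<theta>))"
  "trivial_weyl_stabilizer v S (torus_char \<theta>) (G0 (eqr E \<theta>))"
proof -
 note e = equivp_eqr[of E \<theta>]
 have Ha: "q : abs_galois" if "q : HE" for q using that by (simp add: HE_def)
 have KH: "field_auts K <= HE"
  unfolding HE_def using stab auts_abs[OF K] equivp_reflp[OF e] by (metis (mono_tags, lifting) mem_Collect_eq subsetI)
 have autH: "aut_group HE" unfolding aut_group_def
 proof (intro conjI ballI)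
  show "id : HE" using KH id_auts by blast
  fix q assume s: "q : HE"
  have es: "eqr E \<theta> k0 (perm q k0)" using s by (simp add: HE_def)
  have "eqr E \<theta> (perm (ginv q) k0) k0" using eqr_galois[OF auts_inv[OF Ha[OF s]] es] Ha[OF s] by simp
  then show "ginv q : HE" unfolding HE_def using auts_inv[OF Ha[OF s]] equivp_symp[OF e] by blast
  fix \<tau> assume t: "\<tau> : HE"
  then have "eqr E \<theta> (perm q k0) (perm q (perm \<tau> k0))" by (intro eqr_galois Ha s) (simp add: HE_def)
  then show "q o \<tau> : HE" unfolding HE_def
   using es equivp_transp[OF e] perm_comp[OF Ha[OF s] Ha[OF t]] auts_comp[OF Ha[OF s] Ha[OF t]] by (metis (mono_tags, lifting) mem_Collect_eq)
 qed (auto simp: HE_def)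
 \<comment> \<open>The fixed field of the group \<open>HE\<close>; it lies in \<open>K\<close>
   because the automorphisms over \<open>K\<close> belong to \<open>HE\<close>.\<close>
 define L where "L = {x : K. ALL h:HE. h x = x}"
 have L: "intermediate_field L" "L <= K"
 proof -
  show "intermediate_field L" unfolding L_def
  proof (rule ifieldI)
   show "base_field <= {x : K. ALL h:HE. h x = x}" using ifieldD(1)[OF K] Ha by auto
  qed (auto simp: ifieldD(4,5)[OF K] autsD(3,8)[OF Ha])
 qed (auto simp: L_def)
 \<comment> \<open>An automorphism over \<open>L\<close> agrees on \<open>E\<close> with an element
   of \<open>HE\<close> by Artin's theorem, and membership in \<open>HE\<close> depends only on the
   action on \<open>K\<close>.\<close>
 have LH: "field_auts L <= HE"
 proof
  fix t assume t: "t : field_auts L"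
  have ta: "t : abs_galois" using auts_abs[OF L(1) t] .
  have fx: "t x = x" if x: "x : E" "!!h. h : HE ==> h x = x" for x
  proof -
   have "x : K" using separable_fixed[OF K galoisD(3)[OF E(1) x(1)]] x(2) KH by blast
   then show ?thesis using autsD(4)[OF t] x(2) by (simp add: L_def)
  qed
  have "EX h:HE. ALL x:E. t x = h x"
   by (rule artin[OF autH galoisD(1)[OF E(1)] galoisD(4)[OF E(1) Ha] ta fx]) auto
  then obtain h where h: "h : HE" "ALL x:E. t x = h x" by blast
  then have "perm t k0 = perm h k0" using KE by (intro perm_eq_on_K ta Ha) auto
  then show "t : HE" using h(1) ta by (simp add: HE_def)
 qed
 have unr: "unramified v L K"
 proof -
  have "EX \<theta>L. smooth_character v (principal_units v L) \<theta>L & (ALL x:principal_units v K. \<theta> x = \<theta>L (field_norm L K x))"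
  proof (rule invariant_character_descends[OF tg[OF L(1)] tgK L(2) smooth_principal[OF \<theta>]])
   show "L <= E" using L(2) KE by blast
   fix q x assume "q : field_auts L" "x : principal_units v E"
   then show "\<theta> (field_norm K E (q x)) = \<theta> (field_norm K E x)" using LH eqr_k0[OF Ha] unfolding HE_def by blast
  qed
  then show ?thesis using adm L unfolding admissible_pair_def by blast
 qed
 have triv: "q x = x" if "q : inertia v" "q : field_auts L" "x : K" for q x
  using unr that unfolding unr_iff[OF L] by blast
 have HL: "HE <= field_auts L" using Ha unfolding L_def field_auts_def by blast
 show "inertia_preserves_positive_system v S (rel_roots (eqr E \<theta>))"
  unfolding pos_iff using triv HL Ha unfolding field_auts_def by blast
 show "trivial_weyl_stabilizer v S (torus_char \<theta>) (G0 (eqr E \<theta>))"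
  unfolding trivial_weyl_stabilizer_def
 proof (intro ballI impI)
  fix n assume n: "n : normalizer_in S (G0 (eqr E \<theta>))" and rat: "ALL q:abs_galois. matrix_inv n ** map_matrix q n : S"
   and fixI: "fixes_on_iwahori v S (torus_char \<theta>) n"
  have ni: "invertible n" using G0_block[OF e] n by (auto simp: normalizer_in_def)
  obtain w where w0: "bij w & (ALL k. eqr E \<theta> (w k) k) & (ALL s:S. n ** s ** matrix_inv n : S & (ALL k. co (w k) (n ** s ** matrix_inv n) = co k s)) &
   ((ALL k. w k = k) --> n : S)" using normalizer_perm[OF e n] by (rule exE)
  have bw: "bij w" and ew: "eqr E \<theta> (w k) k" and nS: "s : S ==> n ** s ** matrix_inv n : S"
   and nc: "s : S ==> co (w k) (n ** s ** matrix_inv n) = co k s" and wS: "(ALL k. w k = k) ==> n : S" for s k using w0 by auto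
  \<comment> \<open>Applying \<open>q\<close> to \<open>n\<close> changes it by a factor
    \<open>u\<close> in the torus, which commutes with the torus, so conjugation by \<open>n\<close>
    and its permutation commute with Galois.\<close>
  have wc: "w (perm q k) = perm q (w k)" if sa: "q : abs_galois" for q k
  proof (rule co_distinct)
   define u where "u = matrix_inv n ** map_matrix q n"
   have u: "u : S" using rat sa by (simp add: u_def)
   have un: "map_matrix q n = n ** u" unfolding u_def by (simp add: matrix_mul_assoc matrix_inv[OF ni])
   have ui: "u ** matrix_inv u = mat 1" using matrix_inv(1)[OF S_inv(3)[OF u]] .
   have "n ** u ** (matrix_inv u ** matrix_inv n) = n ** (u ** matrix_inv u) ** matrix_inv n" by (simp add: matrix_mul_assoc)
   then have "n ** u ** (matrix_inv u ** matrix_inv n) = mat 1" by (simp add: ui matrix_inv[OF ni])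
   then have inv: "matrix_inv (n ** u) = matrix_inv u ** matrix_inv n" by (rule matrix_inv_eq(1))
   fix t assume "t : S"
   then obtain t' where t': "t' : S" "t = map_matrix q t'" using stable[OF sa] by blast
   obtain s where s: "s : S" "t' = n ** s ** matrix_inv n" using n t'(1) unfolding normalizer_in_def by blast
   have ms: "map_matrix q s : S" using map_S[OF sa s(1)] .
   have "u ** map_matrix q s ** matrix_inv u = map_matrix q s"
    using u ms S_inv(1)[OF u] co_nz[OF u] by (intro S_eqI) (auto simp: S_mult co_mult S_inv(2))
   moreover have "t = n ** (u ** map_matrix q s ** matrix_inv u) ** matrix_inv n"
    unfolding t'(2) s(2) map_matrix_mult[OF sa] map_matrix_inv(1)[OF sa ni] un inv by (simp add: matrix_mul_assoc)
   ultimately have t: "t = n ** map_matrix q s ** matrix_inv n" by simp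
   have "co (w (perm q k)) t = q (co k s)" unfolding t nc[OF ms] using perm(2)[OF sa s(1)] .
   also have "... = q (co (w k) t')" unfolding s(2) nc[OF s(1)] ..
   also have "... = co (perm q (w k)) t" unfolding t'(2) perm(2)[OF sa t'(1)] ..
   finally show "co (w (perm q k)) t = co (perm q (w k)) t" .
  qed
  \<comment> \<open>The automorphism of \<open>K\<close> that conjugation by \<open>n\<close>
    induces on the \<open>k0\<close>-coordinate.\<close>
  obtain \<phi> where p: "\<phi> : abs_galois" "perm \<phi> k0 = ginv w k0" using transitive by blast
  have wp: "w (perm \<phi> k0) = k0" unfolding p(2) using bw by (simp add: bij_def surj_f_inv_f)
  have wk0: "w k0 = perm (ginv \<phi>) k0" using wc[OF auts_inv[OF p(1)], of "perm \<phi> k0"] wp p(1) by simp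
  have fixg: "perm \<gamma> (perm \<phi> k0) = perm \<phi> k0" "perm \<gamma> (perm (ginv \<phi>) k0) = perm (ginv \<phi>) k0" if g: "\<gamma> : field_auts K" for \<gamma>
  proof -
   have ga: "\<gamma> : abs_galois" and gk: "perm \<gamma> k0 = k0" using auts_abs[OF K g] stab g by auto
   have "w (perm \<gamma> (perm \<phi> k0)) = w (perm \<phi> k0)" using wc[OF ga] wp gk by simp
   then show "perm \<gamma> (perm \<phi> k0) = perm \<phi> k0" using bij_is_inj[OF bw] by (simp add: inj_eq)
   show "perm \<gamma> (perm (ginv \<phi>) k0) = perm (ginv \<phi>) k0" using wc[OF ga, of k0] unfolding wk0 gk by simp
  qed
  have pK: "\<phi> x : K" "ginv \<phi> x : K" if "x : K" for x
   using normalizes_K[OF p(1) fixg(1) that] normalizes_K[OF auts_inv[OF p(1)] fixg(2) that] by auto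
  have im: "\<phi> ` K = K"
  proof (intro antisym subsetI)
   fix y assume "y : K"
   then have "\<phi> (ginv \<phi> y) : \<phi> ` K" using pK(2) by blast
   then show "y : \<phi> ` K" using ginv_simps(1)[OF p(1)] by simp
  qed (use pK(1) in blast)
  have "eqr E \<theta> k0 (perm \<phi> k0)" using ew[of "perm \<phi> k0"] wp by simp
  then have pH: "\<phi> : HE" using p(1) by (simp add: HE_def)
  have mult: "\<theta> (a * b) = \<theta> a * \<theta> b" if "a : K - {0}" "b : K - {0}" for a b using \<theta> that by (auto simp: smooth_character_def)
  have K0: "\<phi> x : K - {0}" if "x : K - {0}" for x using that pK(1) autsD(12)[OF p(1)] by simp
  \<comment> \<open>A unit differs from an Iwahori point by a factor so close to 1 that
    \<open>\<theta>\<close> is trivial on it; \<open>\<phi>\<close> is an isometry, so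
    \<open>\<theta>\<close> is trivial on its image as well.\<close>
  have inv: "\<theta> (\<phi> x) = \<theta> x" if x: "x : K" "nrm x = 1" for x
  proof -
   obtain r where r: "0 < r" "r < 1" "!!x. x : K - {0} ==> nrm (x - 1) <= r ==> \<theta> x = 1"
    by (rule smooth_radius[OF \<theta>]) blast
   obtain y where y: "y : K - {0}" "\<iota> y : iwahori v S" "nrm (x / y - 1) <= r" using iwahori_dense[OF tame_K r(1) x] by blast
   have "torus_char \<theta> (n ** \<iota> y ** matrix_inv n) = torus_char \<theta> (\<iota> y)"
    using fixI y(2) unfolding fixes_on_iwahori_def by blast
   moreover have "torus_char \<theta> (n ** \<iota> y ** matrix_inv n) = \<theta> (\<phi> (co k0 (\<iota> y)))"
    by (rule conj_rational[OF nS nc bw wc iota_rat[OF y(1)] p(1) wp])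
   ultimately have ty: "\<theta> (\<phi> y) = \<theta> y" using rat_co(3)[OF iota_rat[OF y(1)]] k0 y(1) by simp
   have x0: "x ~= 0" using x(2) by auto
   have q: "x / y : K - {0}" using x0 x(1) y(1) ifieldD(9)[OF K] by simp
   have xy: "x = y * (x / y)" using y(1) by simp
   have "nrm (\<phi> (x / y) - 1) = nrm (x / y - 1)" using nrm_galois[OF p(1), of "x / y - 1"] by (simp only: autsD(6,8)[OF p(1)])
   then have "\<theta> (\<phi> (x / y)) = 1" "\<theta> (x / y) = 1" using r(3) K0[OF q] q y(3) by auto
   moreover have "\<phi> x = \<phi> y * \<phi> (x / y)" by (subst xy) (simp only: autsD(3)[OF p(1)])
   ultimately show ?thesis using mult[OF K0[OF y(1)] K0[OF q]] mult[OF y(1) q] ty xy by simp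
  qed
  \<comment> \<open>The fixed field of the single automorphism \<open>\<phi>\<close>, over which
    \<open>K\<close> is cyclic. It contains \<open>L\<close>, so \<open>K\<close> is unramified over
    it.\<close>
  define L' where "L' = {x : K. \<phi> x = x}"
  have L': "intermediate_field L'" "L' <= K"
  proof -
   show "intermediate_field L'" unfolding L'_def
   proof (rule ifieldI)
    show "base_field <= {x : K. \<phi> x = x}" using ifieldD(1)[OF K] p(1) by auto
   qed (auto simp: ifieldD(4,5)[OF K] autsD(3,8)[OF p(1)])
  qed (auto simp: L'_def)
  have "L <= L'" using pH by (auto simp: L_def L'_def)
  then have unr': "unramified v L' K" unfolding unr_iff[OF L'] using triv auts_mono by blast
  have pL: "\<phi> : field_auts L'" using p(1) unfolding field_auts_def L'_def by blast
  have fL: "x : L'" if "x : K" "\<phi> x = x" for x using that by (simp add: L'_def)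
  have "EX \<theta>L. smooth_character v (L' - {0}) \<theta>L & (ALL x:K - {0}. \<theta> x = \<theta>L (field_norm L' K x))"
   by (rule invariant_character_is_norm[OF tame_K sep_K L' unr' pL im fL \<theta> inv])
  then have "L' = K" using adm L' unfolding admissible_pair_def by blast
  then have "\<phi> : field_auts K" using pL by simp
  then have "w k0 = k0" using stab[OF p(1)] wp by simp
  then have "w k = k" for k using transitive[of k0 k] wc by metis
  then show "n : S" using wS by blast
 qed
qed

lemma weyl_imp_rational:
 assumes "trivial_weyl_stabilizer v S (torus_char \<theta>) (G0 (eqr E \<theta>))"
 shows "trivial_rational_stabilizer v S (torus_char \<theta>) (G0 (eqr E \<theta>))"
 unfolding trivial_rational_stabilizer_def
proof (intro ballI impI)
 fix n assume n: "n : rational_points base_field (normalizer_in S (G0 (eqr E \<theta>)))"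
  and f: "fixes_on_iwahori v S (torus_char \<theta>) n"
 have nn: "n : normalizer_in S (G0 (eqr E \<theta>))" using n by (simp add: rational_points_def)
 have ni: "invertible n" using G0_block[OF equivp_eqr] nn by (auto simp: normalizer_in_def)
 have "matrix_inv n ** map_matrix s n : S" if s: "s : abs_galois" for s
 proof -
  have "map_matrix s n = n" using n autsD(4)[OF s] by (simp add: rational_points_def vec_eq_iff)
  then show ?thesis using matrix_inv(2)[OF ni] el_S[of "%_. 1"] by (simp add: mat_el)
 qed
 then show "n : S" using assms nn f unfolding trivial_weyl_stabilizer_def by blast
qed

end

lemma smooth_torus:
 assumes \<theta>: "smooth_character v (K - {0}) \<theta>" shows "smooth_torus_character v S (torus_char \<theta>)"
proof -
 let ?t = "torus_char \<theta>"
 have t: "?t s = \<theta> (co k0 s)" if "s : rational_points base_field S" for s using rat_co(3)[OF that] by simp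
 have th: "\<theta> a ~= 0" "\<theta> (a * b) = \<theta> a * \<theta> b" if "a : K - {0}" "b : K - {0}" for a b using \<theta> that by (auto simp: smooth_character_def)
 obtain m where m: "0 < m" "m < 1" "!!x. x : K - {0} ==> nrm (x - 1) <= m ==> \<theta> x = 1"
  by (rule smooth_radius[OF \<theta>]) blast
 \<comment> \<open>Bounds the coefficients of the linear form \<open>co k0\<close> in the matrix
   entries; it turns a bound on the entries of \<open>s - mat 1\<close> into one on the field
   element \<open>co k0 s - 1\<close>.\<close>
 define C where "C = 1 + (SUM i:UNIV. SUM j:UNIV. nrm (gi $ k0 $ i * g $ j $ k0))"
 have C0: "0 < C" unfolding C_def by (intro add_pos_nonneg sum_nonneg) auto
 have C: "nrm (gi $ k0 $ i * g $ j $ k0) <= C" for i j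
 proof -
  have "nrm (gi $ k0 $ i * g $ j $ k0) <= (SUM j:UNIV. nrm (gi $ k0 $ i * g $ j $ k0))" by (rule member_le_sum) auto
  also have "... <= (SUM i:UNIV. SUM j:UNIV. nrm (gi $ k0 $ i * g $ j $ k0))" by (rule member_le_sum) (auto intro: sum_nonneg)
  finally show ?thesis by (simp add: C_def)
 qed
 obtain n where n: "(1 / 2 :: real) ^ n < m / C" using real_arch_pow_inv[of "m / C" "1 / 2"] m(1) C0 by auto
 have "?t s = 1" if s: "s : rational_points base_field S" and near: "ALL i j. (s - mat 1) $ i $ j / to_ac (\<pi> ^ n) : integers v" for s
 proof -
  have d: "nrm ((s - mat 1) $ i $ j) <= m / C" for i j
  proof -
   have "nrm ((s - mat 1) $ i $ j) <= (1 / 2) ^ n"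
    using near pi(1) av_pi unfolding integers_iff nrm_divide nrm_to_ac by (simp add: av_power divide_le_eq)
   then show ?thesis using n by linarith
  qed
  have "co k0 (s - mat 1) + co k0 (mat 1) = co k0 s" unfolding co_add[symmetric] by simp
  then have "co k0 s - 1 = co k0 (s - mat 1)" by (simp add: mat_el[of 1] diff_eq_eq)
  also have "... = (SUM j:UNIV. SUM i:UNIV. gi $ k0 $ i * g $ j $ k0 * (s - mat 1) $ i $ j)"
   by (simp add: co_def matrix_matrix_mult_def sum_distrib_right sum_distrib_left mult_ac)
  also have "nrm ... <= m"
  proof (intro nrm_sum_le)
   fix i j
   have "nrm (gi $ k0 $ i * g $ j $ k0) * nrm ((s - mat 1) $ i $ j) <= C * (m / C)" using C d C0 by (intro mult_mono) auto
   then show "nrm (gi $ k0 $ i * g $ j $ k0 * (s - mat 1) $ i $ j) <= m" using C0 by (simp add: nrm_mult)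
  qed (use m in auto)
  finally show ?thesis unfolding t[OF s] using m(3) rat_co(1)[OF s] by blast
 qed
 moreover have "to_ac (\<pi> ^ n) ~= (0 :: 'f alg_closure)" "\<pi> ^ n ~= 0" using pi(1) by auto
 moreover have "?t (s ** u) = ?t s * ?t u" if "s : rational_points base_field S" "u : rational_points base_field S" for s u
 proof -
  have "s ** u : rational_points base_field S"
   using that by (auto simp: rational_points_def S_mult intro!: matrix_mult_mem[OF ifield_base])
  then show ?thesis using t that th(2)[OF rat_co(1) rat_co(1)] co_mult[OF co_rational(1) co_rational(1)] by metis
 qed
 moreover have "?t s ~= 0" if "s : rational_points base_field S" for s using t[OF that] th(1) rat_co(1)[OF that] by metis
 ultimately show ?thesis unfolding smooth_torus_character_def by blast
qed

lemma closure_split: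
 assumes "tame_exp K j" obtains E i where "galois_extension E" "tame_exp E i" "splits_over S E"
proof -
 obtain A where A: "K <= gen_field base_field A"
  "tame_exp (gen_field base_field A) (card (restrictions (inertia v) (gen_field base_field A)))" "galois_extension (gen_field base_field A)"
  using tame_closure_field[OF assms] by (elim exE conjE)
 have "splits_over S (gen_field base_field A)"
  using galoisD(2,5)[OF A(3)] A(1) by (intro splits_closure) auto
 then show ?thesis using that A by blast
qed

text \<open>Admissibility is deduced from one splitting field, the Galois closure of
  \<open>K\<close>, which is tame because \<open>K\<close> lies in the given tame splitting field.
  The converse has to treat every tame Galois splitting field, which is why \<open>E\<close> is
  arbitrary in the preceding lemmas.\<close>

theorem equivalence:
 assumes \<theta>: "smooth_character v (K - {0}) \<theta>" and T: "maximal_torus S" "elliptic S"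
 defines "\<theta>' \<equiv> torus_char \<theta>"
 shows "tame_elliptic_extra_regular v S \<theta>' ==> tame_elliptic_regular v S \<theta>'"
  "tame_elliptic_regular v S \<theta>' ==> admissible_pair v (ext_degree K) K \<theta>"
  "admissible_pair v (ext_degree K) K \<theta> ==> tame_elliptic_extra_regular v S \<theta>'"
proof -
 have w: "trivial_rational_stabilizer v S \<theta>' (subgroup_of_roots S (R0plus v S \<theta>' E))"
  if tr: "tamely_ramified v E" "galois_extension E" "splits_over S E"
   "trivial_weyl_stabilizer v S \<theta>' (subgroup_of_roots S (R0plus v S \<theta>' E))" for E
 proof -
  obtain j where j: "tame_exp E j" using tr(1) unfolding tame_iff by (rule exE)
  show ?thesis using weyl_imp_rational[OF tr(2) j tr(3) \<theta>] R0plus_eq[OF tr(2) j tr(3) \<theta>] tr(4) unfolding \<theta>'_def by simp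
 qed
 show "tame_elliptic_extra_regular v S \<theta>' ==> tame_elliptic_regular v S \<theta>'"
  unfolding tame_elliptic_extra_regular_def tame_elliptic_regular_def using w by blast
 show "admissible_pair v (ext_degree K) K \<theta>" if reg: "tame_elliptic_regular v S \<theta>'"
 proof -
  obtain E0 j0 where E0: "tame_exp E0 j0" "splits_over S E0" using reg unfolding tame_elliptic_regular_def tame_iff by blast
  have tK: "tame_exp K j0" using tame_exp_subset[OF E0(1) K splits_K[OF tame_expD(2)[OF E0(1)] E0(2)]] .
  obtain E j where E: "galois_extension E" "tame_exp E j" "splits_over S E" by (rule closure_split[OF tK])
  have "tamely_ramified v E" using E(2) tame_iff by blast
  then have "inertia_preserves_positive_system v S (R0plus v S \<theta>' E) & trivial_rational_stabilizer v S \<theta>' (subgroup_of_roots S (R0plus v S \<theta>' E))"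
   using reg E unfolding tame_elliptic_regular_def by blast
  then show ?thesis using regular_imp_admissible[OF E \<theta>] unfolding \<theta>'_def R0plus_eq[OF E \<theta>] by blast
 qed
 show "tame_elliptic_extra_regular v S \<theta>'" if adm: "admissible_pair v (ext_degree K) K \<theta>"
 proof -
  obtain j0 where tK: "tame_exp K j0" using adm unfolding admissible_pair_def tame_iff by blast
  obtain E j where E: "galois_extension E" "tame_exp E j" "splits_over S E" by (rule closure_split[OF tK])
  have 1: "EX E. tamely_ramified v E & splits_over S E" using E tame_iff by blast
  have 2: "inertia_preserves_positive_system v S (R0plus v S \<theta>' E) & trivial_weyl_stabilizer v S \<theta>' (subgroup_of_roots S (R0plus v S \<theta>' E))"
   if E: "tamely_ramified v E" "galois_extension E" "splits_over S E" for E
  proof -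
   obtain j where j: "tame_exp E j" using E(1) unfolding tame_iff by (rule exE)
   show ?thesis using admissible_imp_extra[OF E(2) j E(3) \<theta> adm] unfolding \<theta>'_def R0plus_eq[OF E(2) j E(3) \<theta>] by blast
  qed
  show ?thesis unfolding tame_elliptic_extra_regular_def using T 1 2 smooth_torus[OF \<theta>] unfolding \<theta>'_def by blast
 qed
qed

end

theorem lemma3p6p8:
  fixes v :: "'f::field \<Rightarrow> int"
    and S :: "('f alg_closure ^'n ^'n) set"
    and K :: "'f alg_closure set"
    and \<iota> :: "'f alg_closure \<Rightarrow> 'f alg_closure ^'n ^'n"
    and \<theta> :: "'f alg_closure \<Rightarrow> complex"
  assumes "nonarch_local_field v" and "odd (residue_char v)"
    and "maximal_torus S" and "elliptic S"
    and "intermediate_field K" and "ext_degree K = CARD('n)"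
    and "identifies \<iota> K S"
    and "smooth_character v (K - {0}) \<theta>"
  shows "(tame_elliptic_extra_regular v S (\<theta> \<circ> inv_into (K - {0}) \<iota>) \<longleftrightarrow>
            tame_elliptic_regular v S (\<theta> \<circ> inv_into (K - {0}) \<iota>)) \<and>
         (tame_elliptic_regular v S (\<theta> \<circ> inv_into (K - {0}) \<iota>) \<longleftrightarrow>
            admissible_pair v CARD('n) K \<theta>)"
proof -
 obtain g :: "'f alg_closure ^'n ^'n" where g: "invertible g" "ALL i j. separable_element (g $ i $ j)"
  "S = {g ** d ** matrix_inv g |d. invertible d & (ALL i j. i ~= j --> d $ i $ j = 0)}"
  using assms(3) unfolding maximal_torus_def by (elim conjE exE)
 have stable: "ALL \<sigma>:abs_galois. map_matrix \<sigma> ` S = S" using assms(3) unfolding maximal_torus_def by (elim conjE)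
 interpret local_field v by unfold_locales (rule assms(1))
 have "torus v S g"
 proof (intro torus.intro torus_axioms.intro)
  show "local_field v" by (rule local_field_axioms)
  show "separable_element (g $ i $ k)" for i k using g(2) by blast
  show "map_matrix \<sigma> ` S = S" if "\<sigma> : abs_galois" for \<sigma> using stable that by blast
 qed (rule g)+
 then obtain g' where g': "torus v S g'" "ALL \<sigma>:abs_galois. ALL k. EX l. ALL i. \<sigma> (g' $ i $ k) = g' $ i $ l"
  using torus.normalized_frame[OF _ assms(4)] by blast
 interpret torus v S g' by (rule g'(1))
 have fr: "torus_frame v S g'" using elliptic_transitive[OF assms(4)] g'(2) by unfold_locales blast+
 interpret torus_frame v S g' by (rule fr)
 obtain k0 where k0: "ALL x:K. co k0 (\<iota> x) = x" using identified_coordinate[OF assms(5,7)] by (rule exE)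
 have tf: "torus_field v S g' K \<iota> k0" using assms(5,7) k0 by unfold_locales blast+
 show ?thesis
  using torus_field.equivalence[OF tf assms(8,3,4)] unfolding assms(6) by blast
qed

end
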